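(* Let $(\mathsf{A},\circledast)$ be a complemented category with a generator $X$ and let $M$ be a finitely generated $\mathsf{A}$-module over a ring $\mathbf{k}$. Write $M_n=M_{X^n}$. Assume that the following hold. (1) The category of $\mathsf{A}$-modules over $\mathbf{k}$ is locally Noetherian. (2) For all $k\ge0$, the map $\mathrm{H}_k(\operatorname{Aut}_{\mathsf{A}}(X^n);\mathbf{k})\to\mathrm{H}_k(\operatorname{Aut}_{\mathsf{A}}(X^{n+1});\mathbf{k})$ induced by the homomorphism $\operatorname{Aut}_{\mathsf{A}}(X^n)\to\operatorname{Aut}_{\mathsf{A}}(X^{n+1})$, $f\mapsto f\circledast\mathrm{id}_X$, is an isomorphism for all sufficiently large $n$. Then for each $k\ge0$, the map $$\mathrm{H}_k(\operatorname{Aut}_{\mathsf{A}}(X^n);M_n)\longrightarrow\mathrm{H}_k(\operatorname{Aut}_{\mathsf{A}}(X^{n+1});M_{n+1})$$ is an isomorphism for all sufficiently large $n$.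
   Context: All rings are commutative with $1$. Complemented categories. A complemented category with generator is a symmetric monoidal category $(\mathsf{A},\circledast)$, with identity object $\mathbf{1}$, satisfying: (i) every morphism is a monomorphism (so for a morphism $f:V\to V'$ one may speak of the subobject $f(V)$ of $V'$); (ii) $\mathbf{1}$ is initial; hence for objects $V,V'$ there are canonical morphisms $V\cong V\circledast\mathbf{1}\to V\circledast V'$ and $V'\cong\mathbf{1}\circledast V'\to V\circledast V'$; (iii) for all $V,V',W$ the map $\operatorname{Hom}(V\circledast V',W)\to\operatorname{Hom}(V,W)\times\operatorname{Hom}(V',W)$ given by composing with the canonical morphisms is injective; (iv) every subobject $C$ of an object $V$ has a unique complement, that is, a unique subobject $D$ of $V$ such that there is an isomorphism $C\circledast D\to V$ whose compositions with the canonical morphisms $C\to C\circledast D$ and $D\to C\circledast D$ are the inclusions; (v) the canonical map from the wreath product $\mathfrak{S}_p\wr\operatorname{Aut}(X)$ to $\operatorname{Aut}(X^p)$ is injective for all $p$, where $X^p$ is the $p$-fold $\circledast$-power; (vi) $X$ is a generator: every object $V$ is isomorphic to $X^i$ for a unique $i\ge 0$. Modules. An $\mathsf{A}$-module over $\mathbf{k}$ is a functor $M$ from $\mathsf{A}$ to $\mathbf{k}$-modules; submodules are defined pointwise. $M$ is finitely generated if there are finitely many objects $V_i$ and elements $x_i\in M_{V_i}$ such that the smallest submodule of $M$ containing all $x_i$ is $M$. The category of $\mathsf{A}$-modules over $\mathbf{k}$ is locally Noetherian if every submodule of a finitely generated $\mathsf{A}$-module over $\mathbf{k}$ is finitely generated.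 The map in the conclusion is induced by the homomorphism $f\mapsto f\circledast\mathrm{id}_X$ together with the map $M_n\to M_{n+1}$ induced by the canonical morphism $X^n\to X^n\circledast X=X^{n+1}$. *)

theory Defs
  imports Complex_Main "HOL-Combinatorics.Permutations" "HOL-Algebra.AbelCoset" "HOL-Algebra.Module"
begin

section \<open>Symmetric monoidal categories\<close>

text \<open>
  The associator is \<open>Assoc U V W : (U \<box> V) \<box> W \<rightarrow> U \<box> (V \<box> W)\<close>, the unitors are
  \<open>Lunit V : Unit \<box> V \<rightarrow> V\<close> and \<open>Runit V : V \<box> Unit \<rightarrow> V\<close>, and the symmetry is
  \<open>Braid V W : V \<box> W \<rightarrow> W \<box> V\<close>.  Composition \<open>g \<bullet> f\<close> is ``\<open>g\<close> after \<open>f\<close>''.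
\<close>

record ('o, 'a) smcat =
  Ob :: "'o set"
  Arr :: "'a set"
  Dom :: "'a \<Rightarrow> 'o"
  Cod :: "'a \<Rightarrow> 'o"
  Id :: "'o \<Rightarrow> 'a"
  Comp :: "'a \<Rightarrow> 'a \<Rightarrow> 'a"  (infixl \<open>\<bullet>\<index>\<close> 70)
  TOb :: "'o \<Rightarrow> 'o \<Rightarrow> 'o"  (infixl \<open>\<box>\<index>\<close> 75)
  TArr :: "'a \<Rightarrow> 'a \<Rightarrow> 'a"  (infixl \<open>\<star>\<index>\<close> 75)
  Unit :: "'o"
  Assoc :: "'o \<Rightarrow> 'o \<Rightarrow> 'o \<Rightarrow> 'a"
  Lunit :: "'o \<Rightarrow> 'a"
  Runit :: "'o \<Rightarrow> 'a"
  Braid :: "'o \<Rightarrow> 'o \<Rightarrow> 'a"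

definition Homs :: "('o, 'a) smcat \<Rightarrow> 'o \<Rightarrow> 'o \<Rightarrow> 'a set"
  where "Homs A V W = {f \<in> Arr A. Dom A f = V \<and> Cod A f = W}"

definition inverse_arrs :: "('o, 'a) smcat \<Rightarrow> 'a \<Rightarrow> 'a \<Rightarrow> bool"
  where "inverse_arrs A f g \<longleftrightarrow>
    f \<in> Arr A \<and> g \<in> Homs A (Cod A f) (Dom A f) \<and>
    g \<bullet>\<^bsub>A\<^esub> f = Id A (Dom A f) \<and> f \<bullet>\<^bsub>A\<^esub> g = Id A (Cod A f)"

definition iso_arr :: "('o, 'a) smcat \<Rightarrow> 'a \<Rightarrow> bool"
  where "iso_arr A f \<longleftrightarrow> (\<exists>g. inverse_arrs A f g)"

definition inv_arr :: "('o, 'a) smcat \<Rightarrow> 'a \<Rightarrow> 'a"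
  where "inv_arr A f = (THE g. inverse_arrs A f g)"

definition isomorphic_obs :: "('o, 'a) smcat \<Rightarrow> 'o \<Rightarrow> 'o \<Rightarrow> bool"
  where "isomorphic_obs A V W \<longleftrightarrow> (\<exists>f \<in> Homs A V W. iso_arr A f)"

definition monic :: "('o, 'a) smcat \<Rightarrow> 'a \<Rightarrow> bool"
  where "monic A f \<longleftrightarrow> f \<in> Arr A \<and>
    (\<forall>U g h. g \<in> Homs A U (Dom A f) \<longrightarrow> h \<in> Homs A U (Dom A f) \<longrightarrow>
       f \<bullet>\<^bsub>A\<^esub> g = f \<bullet>\<^bsub>A\<^esub> h \<longrightarrow> g = h)"

text \<open>The automorphism group as a group in the sense of \<open>HOL-Algebra\<close>.\<close>

definition AutG :: "('o, 'a) smcat \<Rightarrow> 'o \<Rightarrow> 'a monoid"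
  where "AutG A V = \<lparr>carrier = {f \<in> Homs A V V. iso_arr A f}, mult = Comp A, one = Id A V\<rparr>"

locale cat =
  fixes A :: "('o, 'a) smcat" (structure)
  assumes Dom_Ob: "f \<in> Arr A \<Longrightarrow> Dom A f \<in> Ob A"
    and Cod_Ob: "f \<in> Arr A \<Longrightarrow> Cod A f \<in> Ob A"
    and Id_Homs: "V \<in> Ob A \<Longrightarrow> Id A V \<in> Homs A V V"
    and Comp_Homs: "\<lbrakk>f \<in> Homs A U V; g \<in> Homs A V W\<rbrakk> \<Longrightarrow> g \<bullet> f \<in> Homs A U W"
    and Comp_Id: "f \<in> Homs A U V \<Longrightarrow> f \<bullet> Id A U = f"
    and Id_Comp: "f \<in> Homs A U V \<Longrightarrow> Id A V \<bullet> f = f"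
    and Comp_assoc: "\<lbrakk>f \<in> Homs A T U; g \<in> Homs A U V; h \<in> Homs A V W\<rbrakk>
      \<Longrightarrow> (h \<bullet> g) \<bullet> f = h \<bullet> (g \<bullet> f)"

locale symmetric_monoidal_cat = cat +
  assumes Unit_Ob: "Unit A \<in> Ob A"
    and TOb_Ob: "\<lbrakk>V \<in> Ob A; W \<in> Ob A\<rbrakk> \<Longrightarrow> V \<box> W \<in> Ob A"
    and TArr_Homs: "\<lbrakk>f \<in> Homs A V V'; g \<in> Homs A W W'\<rbrakk> \<Longrightarrow> f \<star> g \<in> Homs A (V \<box> W) (V' \<box> W')"
    and TArr_Id: "\<lbrakk>V \<in> Ob A; W \<in> Ob A\<rbrakk> \<Longrightarrow> Id A V \<star> Id A W = Id A (V \<box> W)"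
    and TArr_Comp:
      "\<lbrakk>f \<in> Homs A U V; f' \<in> Homs A V W; g \<in> Homs A U' V'; g' \<in> Homs A V' W'\<rbrakk>
        \<Longrightarrow> (f' \<bullet> f) \<star> (g' \<bullet> g) = (f' \<star> g') \<bullet> (f \<star> g)"
    and Assoc_iso: "\<lbrakk>U \<in> Ob A; V \<in> Ob A; W \<in> Ob A\<rbrakk>
      \<Longrightarrow> Assoc A U V W \<in> Homs A ((U \<box> V) \<box> W) (U \<box> (V \<box> W)) \<and> iso_arr A (Assoc A U V W)"
    and Lunit_iso: "V \<in> Ob A \<Longrightarrow> Lunit A V \<in> Homs A (Unit A \<box> V) V \<and> iso_arr A (Lunit A V)"
    and Runit_iso: "V \<in> Ob A \<Longrightarrow> Runit A V \<in> Homs A (V \<box> Unit A) V \<and> iso_arr A (Runit A V)"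
    and Braid_Homs: "\<lbrakk>V \<in> Ob A; W \<in> Ob A\<rbrakk> \<Longrightarrow> Braid A V W \<in> Homs A (V \<box> W) (W \<box> V)"
    and Assoc_natural:
      "\<lbrakk>f \<in> Homs A U U'; g \<in> Homs A V V'; h \<in> Homs A W W'\<rbrakk>
        \<Longrightarrow> Assoc A U' V' W' \<bullet> ((f \<star> g) \<star> h) = (f \<star> (g \<star> h)) \<bullet> Assoc A U V W"
    and Lunit_natural: "f \<in> Homs A V W \<Longrightarrow> Lunit A W \<bullet> (Id A (Unit A) \<star> f) = f \<bullet> Lunit A V"
    and Runit_natural: "f \<in> Homs A V W \<Longrightarrow> Runit A W \<bullet> (f \<star> Id A (Unit A)) = f \<bullet> Runit A V"
    and Braid_natural: "\<lbrakk>f \<in> Homs A V V'; g \<in> Homs A W W'\<rbrakk>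
        \<Longrightarrow> Braid A V' W' \<bullet> (f \<star> g) = (g \<star> f) \<bullet> Braid A V W"
    and pentagon:
      "\<lbrakk>T \<in> Ob A; U \<in> Ob A; V \<in> Ob A; W \<in> Ob A\<rbrakk>
        \<Longrightarrow> Assoc A T U (V \<box> W) \<bullet> Assoc A (T \<box> U) V W =
          (Id A T \<star> Assoc A U V W) \<bullet> Assoc A T (U \<box> V) W \<bullet> (Assoc A T U V \<star> Id A W)"
    and triangle:
      "\<lbrakk>V \<in> Ob A; W \<in> Ob A\<rbrakk>
        \<Longrightarrow> (Id A V \<star> Lunit A W) \<bullet> Assoc A V (Unit A) W = Runit A V \<star> Id A W"
    and hexagon:
      "\<lbrakk>U \<in> Ob A; V \<in> Ob A; W \<in> Ob A\<rbrakk>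
        \<Longrightarrow> Assoc A V W U \<bullet> Braid A U (V \<box> W) \<bullet> Assoc A U V W =
          (Id A V \<star> Braid A U W) \<bullet> Assoc A V U W \<bullet> (Braid A U V \<star> Id A W)"
    and Braid_Braid: "\<lbrakk>V \<in> Ob A; W \<in> Ob A\<rbrakk> \<Longrightarrow> Braid A W V \<bullet> Braid A V W = Id A (V \<box> W)"


section \<open>Complemented categories with generator\<close>

definition init_arr :: "('o, 'a) smcat \<Rightarrow> 'o \<Rightarrow> 'a"
  where "init_arr A V = (THE f. f \<in> Homs A (Unit A) V)"

definition inl_arr :: "('o, 'a) smcat \<Rightarrow> 'o \<Rightarrow> 'o \<Rightarrow> 'a"
  where "inl_arr A V V' = (Id A V \<star>\<^bsub>A\<^esub> init_arr A V') \<bullet>\<^bsub>A\<^esub> inv_arr A (Runit A V)"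

definition inr_arr :: "('o, 'a) smcat \<Rightarrow> 'o \<Rightarrow> 'o \<Rightarrow> 'a"
  where "inr_arr A V V' = (init_arr A V \<star>\<^bsub>A\<^esub> Id A V') \<bullet>\<^bsub>A\<^esub> inv_arr A (Lunit A V')"

text \<open>
  A subobject of \<open>V\<close> is represented by a monomorphism with codomain \<open>V\<close>; two of them represent
  the same subobject iff they satisfy \<open>same_subobject\<close>.
\<close>

definition same_subobject :: "('o, 'a) smcat \<Rightarrow> 'a \<Rightarrow> 'a \<Rightarrow> bool"
  where "same_subobject A i j \<longleftrightarrow>
    (\<exists>h \<in> Homs A (Dom A i) (Dom A j). iso_arr A h \<and> j \<bullet>\<^bsub>A\<^esub> h = i)"

definition is_complement :: "('o, 'a) smcat \<Rightarrow> 'a \<Rightarrow> 'a \<Rightarrow> bool"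
  where "is_complement A i j \<longleftrightarrow>
    (\<exists>e \<in> Homs A (Dom A i \<box>\<^bsub>A\<^esub> Dom A j) (Cod A i). iso_arr A e \<and>
       e \<bullet>\<^bsub>A\<^esub> inl_arr A (Dom A i) (Dom A j) = i \<and>
       e \<bullet>\<^bsub>A\<^esub> inr_arr A (Dom A i) (Dom A j) = j)"

primrec xpow :: "('o, 'a) smcat \<Rightarrow> 'o \<Rightarrow> nat \<Rightarrow> 'o"
  where "xpow A X 0 = Unit A"
  | "xpow A X (Suc n) = xpow A X n \<box>\<^bsub>A\<^esub> X"

primrec tensor_arrs :: "('o, 'a) smcat \<Rightarrow> nat \<Rightarrow> (nat \<Rightarrow> 'a) \<Rightarrow> 'a"
  where "tensor_arrs A 0 f = Id A (Unit A)"
  | "tensor_arrs A (Suc p) f = tensor_arrs A p f \<star>\<^bsub>A\<^esub> f p"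

text \<open>
  The factors of \<open>X\<^sup>p\<close> are numbered \<open>0, \<dots>, p - 1\<close>.  \<open>swap_last\<close> interchanges the last two
  factors of \<open>X\<^sup>p\<^sup>+\<^sup>2\<close>.  For \<open>j \<le> p\<close>, \<open>move_last A X p j\<close> is the automorphism of \<open>X\<^sup>p\<^sup>+\<^sup>1\<close> that moves
  the last factor to position \<open>j\<close> and shifts the factors \<open>j, \<dots>, p - 1\<close> up by one.
  For a permutation \<open>\<sigma>\<close> of \<open>{..<p}\<close>, \<open>perm_arr A X p \<sigma>\<close> is the automorphism of \<open>X\<^sup>p\<close> that moves
  the factor \<open>i\<close> to position \<open>\<sigma> i\<close>: the first \<open>p\<close> factors of \<open>X\<^sup>p\<^sup>+\<^sup>1\<close> are first brought into
  the relative order prescribed by \<open>\<sigma>\<close>, then the last one is moved to its place.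
\<close>

definition swap_last :: "('o, 'a) smcat \<Rightarrow> 'o \<Rightarrow> nat \<Rightarrow> 'a"
  where "swap_last A X p =
    inv_arr A (Assoc A (xpow A X p) X X) \<bullet>\<^bsub>A\<^esub> (Id A (xpow A X p) \<star>\<^bsub>A\<^esub> Braid A X X) \<bullet>\<^bsub>A\<^esub>
    Assoc A (xpow A X p) X X"

primrec move_last :: "('o, 'a) smcat \<Rightarrow> 'o \<Rightarrow> nat \<Rightarrow> nat \<Rightarrow> 'a"
  where "move_last A X 0 j = Id A (xpow A X 1)"
  | "move_last A X (Suc p) j =
      (if p < j then Id A (xpow A X (Suc (Suc p)))
       else (move_last A X p j \<star>\<^bsub>A\<^esub> Id A X) \<bullet>\<^bsub>A\<^esub> swap_last A X p)"

primrec perm_arr :: "('o, 'a) smcat \<Rightarrow> 'o \<Rightarrow> nat \<Rightarrow> (nat \<Rightarrow> nat) \<Rightarrow> 'a"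
  where "perm_arr A X 0 \<sigma> = Id A (Unit A)"
  | "perm_arr A X (Suc p) \<sigma> =
      move_last A X p (\<sigma> p) \<bullet>\<^bsub>A\<^esub>
      (perm_arr A X p (\<lambda>i. if \<sigma> p < \<sigma> i then \<sigma> i - 1 else \<sigma> i) \<star>\<^bsub>A\<^esub> Id A X)"

text \<open>
  The canonical map from the wreath product; its underlying set is
  \<open>S\<^sub>p \<times> Aut(X)\<^sup>p\<close>.
\<close>

definition wreath_arr :: "('o, 'a) smcat \<Rightarrow> 'o \<Rightarrow> nat \<Rightarrow> (nat \<Rightarrow> nat) \<times> (nat \<Rightarrow> 'a) \<Rightarrow> 'a"
  where "wreath_arr A X p = (\<lambda>(\<sigma>, f). perm_arr A X p \<sigma> \<bullet>\<^bsub>A\<^esub> tensor_arrs A p f)"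

locale complemented_cat = symmetric_monoidal_cat A for A :: "('o, 'a) smcat" (structure) +
  fixes X :: 'o
  assumes all_monic: "f \<in> Arr A \<Longrightarrow> monic A f"
    and Unit_initial: "V \<in> Ob A \<Longrightarrow> \<exists>!f. f \<in> Homs A (Unit A) V"
    and jointly_epic: "\<lbrakk>V \<in> Ob A; V' \<in> Ob A; W \<in> Ob A\<rbrakk>
      \<Longrightarrow> inj_on (\<lambda>f. (f \<bullet> inl_arr A V V', f \<bullet> inr_arr A V V')) (Homs A (V \<box> V') W)"
    and complement_exists: "\<lbrakk>monic A i; Cod A i = V\<rbrakk>
      \<Longrightarrow> \<exists>j. monic A j \<and> Cod A j = V \<and> is_complement A i j"
    and complement_unique:
      "\<lbrakk>monic A i; Cod A i = V; monic A j; Cod A j = V; monic A j'; Cod A j' = V;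
        is_complement A i j; is_complement A i j'\<rbrakk> \<Longrightarrow> same_subobject A j j'"
    and wreath_inj:
      "inj_on (wreath_arr A X p) ({\<sigma>. \<sigma> permutes {..<p}} \<times> ({..<p} \<rightarrow>\<^sub>E carrier (AutG A X)))"
    and X_Ob: "X \<in> Ob A"
    and generator: "V \<in> Ob A \<Longrightarrow> \<exists>!i. isomorphic_obs A V (xpow A X i)"


section \<open>Modules over a category\<close>

definition linear_map ::
    "('k, 'r) ring_scheme \<Rightarrow> ('k, 'm) module \<Rightarrow> ('k, 'n) module \<Rightarrow> ('m \<Rightarrow> 'n) \<Rightarrow> bool"
  where "linear_map K M N h \<longleftrightarrow>
    h \<in> carrier M \<rightarrow> carrier N \<and>
    (\<forall>x \<in> carrier M. \<forall>y \<in> carrier M. h (x \<oplus>\<^bsub>M\<^esub> y) = h x \<oplus>\<^bsub>N\<^esub> h y) \<and>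
    (\<forall>a \<in> carrier K. \<forall>x \<in> carrier M. h (a \<odot>\<^bsub>M\<^esub> x) = a \<odot>\<^bsub>N\<^esub> h x)"

definition module_iso ::
    "('k, 'r) ring_scheme \<Rightarrow> ('k, 'm) module \<Rightarrow> ('k, 'n) module \<Rightarrow> ('m \<Rightarrow> 'n) \<Rightarrow> bool"
  where "module_iso K M N h \<longleftrightarrow> linear_map K M N h \<and> bij_betw h (carrier M) (carrier N)"

record ('o, 'a, 'k, 'm) amod =
  fib :: "'o \<Rightarrow> ('k, 'm) module"
  mor :: "'a \<Rightarrow> 'm \<Rightarrow> 'm"

definition A_module ::
    "('o, 'a) smcat \<Rightarrow> ('k, 'r) ring_scheme \<Rightarrow> ('o, 'a, 'k, 'm) amod \<Rightarrow> bool"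
  where "A_module A K M \<longleftrightarrow>
    (\<forall>V \<in> Ob A. module K (fib M V)) \<and>
    (\<forall>f \<in> Arr A. linear_map K (fib M (Dom A f)) (fib M (Cod A f)) (mor M f)) \<and>
    (\<forall>V \<in> Ob A. \<forall>x \<in> carrier (fib M V). mor M (Id A V) x = x) \<and>
    (\<forall>U V W. \<forall>f \<in> Homs A U V. \<forall>g \<in> Homs A V W. \<forall>x \<in> carrier (fib M U).
       mor M (g \<bullet>\<^bsub>A\<^esub> f) x = mor M g (mor M f x))"

definition A_submodule ::
    "('o, 'a) smcat \<Rightarrow> ('k, 'r) ring_scheme \<Rightarrow> ('o, 'a, 'k, 'm) amod \<Rightarrow> ('o \<Rightarrow> 'm set) \<Rightarrow> bool"
  where "A_submodule A K M N \<longleftrightarrow>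
    (\<forall>V \<in> Ob A. submodule (N V) K (fib M V)) \<and>
    (\<forall>f \<in> Arr A. mor M f ` N (Dom A f) \<subseteq> N (Cod A f))"

definition restrict_amod ::
    "('o, 'a, 'k, 'm) amod \<Rightarrow> ('o \<Rightarrow> 'm set) \<Rightarrow> ('o, 'a, 'k, 'm) amod"
  where "restrict_amod M N = M\<lparr>fib := (\<lambda>V. (fib M V)\<lparr>carrier := N V\<rparr>)\<rparr>"

definition generated_submodule ::
    "('o, 'a) smcat \<Rightarrow> ('k, 'r) ring_scheme \<Rightarrow> ('o, 'a, 'k, 'm) amod \<Rightarrow> ('o \<times> 'm) set \<Rightarrow> 'o \<Rightarrow> 'm set"
  where "generated_submodule A K M S V =
    \<Inter>{N V |N. A_submodule A K M N \<and> (\<forall>(U, x) \<in> S. x \<in> N U)}"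

definition finitely_generated ::
    "('o, 'a) smcat \<Rightarrow> ('k, 'r) ring_scheme \<Rightarrow> ('o, 'a, 'k, 'm) amod \<Rightarrow> bool"
  where "finitely_generated A K M \<longleftrightarrow>
    (\<exists>S. finite S \<and> S \<subseteq> (SIGMA V:Ob A. carrier (fib M V)) \<and>
       (\<forall>V \<in> Ob A. generated_submodule A K M S V = carrier (fib M V)))"

text \<open>
  HOL cannot quantify over types inside a formula, so the modules in \<open>locally_noetherian\<close> take
  their elements from one fixed type.  Every finitely generated module is isomorphic to one of
  these: send an element to the set of all formal combinations
  \<open>a\<^sub>1 f\<^sub>1 x\<^sub>i\<^sub>1 + \<dots> + a\<^sub>r f\<^sub>r x\<^sub>i\<^sub>r\<close> of the generators that represent it, each written as the list of
  triples \<open>(i, f, a)\<close>.  Lemma \<open>locally_noetherianD\<close> below makes the property available for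
  modules with elements in an arbitrary type.
\<close>

definition locally_noetherian :: "('o, 'a) smcat \<Rightarrow> ('k, 'r) ring_scheme \<Rightarrow> bool"
  where "locally_noetherian A K \<longleftrightarrow>
    (\<forall>(M :: ('o, 'a, 'k, (nat \<times> 'a \<times> 'k) list set) amod) N.
       A_module A K M \<longrightarrow> finitely_generated A K M \<longrightarrow> A_submodule A K M N \<longrightarrow>
       finitely_generated A K (restrict_amod M N))"


subsection \<open>Independence of the type of the elements\<close>

lemma linear_map_zero:
  assumes M: "module K M" and N: "module K N" and h: "linear_map K M N h"
  shows "h \<zero>\<^bsub>M\<^esub> = \<zero>\<^bsub>N\<^esub>"
proof -
  interpret M: module K M by (rule M)
  interpret N: module K N by (rule N)
  have c: "h \<zero>\<^bsub>M\<^esub> \<in> carrier N" using h by (auto simp: linear_map_def)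
  have "h (\<zero>\<^bsub>M\<^esub> \<oplus>\<^bsub>M\<^esub> \<zero>\<^bsub>M\<^esub>) = h \<zero>\<^bsub>M\<^esub> \<oplus>\<^bsub>N\<^esub> h \<zero>\<^bsub>M\<^esub>"
    using h by (auto simp: linear_map_def simp del: M.l_zero M.r_zero)
  then show ?thesis using c by (metis M.l_zero M.zero_closed N.add.l_cancel_one')
qed

lemma linear_map_minus:
  assumes M: "module K M" and N: "module K N" and h: "linear_map K M N h" and x: "x \<in> carrier M"
  shows "h (\<ominus>\<^bsub>M\<^esub> x) = \<ominus>\<^bsub>N\<^esub> h x"
proof -
  interpret M: module K M by (rule M)
  interpret N: module K N by (rule N)
  have c: "h x \<in> carrier N" "h (\<ominus>\<^bsub>M\<^esub> x) \<in> carrier N"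
    using h x by (auto simp: linear_map_def)
  have "h (\<ominus>\<^bsub>M\<^esub> x \<oplus>\<^bsub>M\<^esub> x) = h (\<ominus>\<^bsub>M\<^esub> x) \<oplus>\<^bsub>N\<^esub> h x"
    using h x M.a_inv_closed[OF x] unfolding linear_map_def by blast
  then have "h (\<ominus>\<^bsub>M\<^esub> x) \<oplus>\<^bsub>N\<^esub> h x = \<zero>\<^bsub>N\<^esub>"
    using linear_map_zero[OF M N h] M.l_neg[OF x] by simp
  then show ?thesis using c by (metis N.minus_equality)
qed

lemma A_module_restrict:
  assumes M: "A_module A K M" and N: "A_submodule A K M N"
    and cat: "cat A"
  shows "A_module A K (restrict_amod M N)"
proof -
  have C: "\<And>f. f \<in> Arr A \<Longrightarrow> Dom A f \<in> Ob A \<and> Cod A f \<in> Ob A"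
    using cat.Dom_Ob[OF cat] cat.Cod_Ob[OF cat] by blast
  have sub: "submodule (N V) K (fib M V)" if "V \<in> Ob A" for V
    using N that by (auto simp: A_submodule_def)
  have NS: "N V \<subseteq> carrier (fib M V)" if "V \<in> Ob A" for V
    using sub[OF that] by (simp add: submodule_def subgroup_def)
  have "module K ((fib M V)\<lparr>carrier := N V\<rparr>)" if "V \<in> Ob A" for V
    using submodule.submodule_is_module[OF sub[OF that]] M that by (auto simp: A_module_def)
  moreover have "linear_map K ((fib M (Dom A f))\<lparr>carrier := N (Dom A f)\<rparr>)
      ((fib M (Cod A f))\<lparr>carrier := N (Cod A f)\<rparr>) (mor M f)" if f: "f \<in> Arr A" for f
  proof -
    have l: "linear_map K (fib M (Dom A f)) (fib M (Cod A f)) (mor M f)"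
      using M f by (auto simp: A_module_def)
    have s: "N (Dom A f) \<subseteq> carrier (fib M (Dom A f))" using C[OF f] NS by blast
    have t: "mor M f ` N (Dom A f) \<subseteq> N (Cod A f)" using N f by (auto simp: A_submodule_def)
    show ?thesis using l s t unfolding linear_map_def by (auto simp: subset_iff)
  qed
  moreover have "mor M (Id A V) x = x" if "V \<in> Ob A" "x \<in> N V" for V x
    using M that NS[of V] unfolding A_module_def by blast
  moreover have "mor M (g \<bullet>\<^bsub>A\<^esub> f) x = mor M g (mor M f x)"
    if "f \<in> Homs A U V" "g \<in> Homs A V W" "x \<in> N U" for U V W f g x
  proof -
    have "U \<in> Ob A" using that(1) C by (auto simp: Homs_def)
    then have "x \<in> carrier (fib M U)" using NS that(3) by blast
    then show ?thesis using M that unfolding A_module_def by blast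
  qed
  ultimately show ?thesis unfolding A_module_def restrict_amod_def by simp
qed

text \<open>A quotient of a finitely generated module is finitely generated.\<close>

lemma finitely_generated_surj:
  fixes P :: "('o, 'a, 'k, 'm) amod" and Q :: "('o, 'a, 'k, 'n) amod"
  assumes cat: "cat A"
    and P: "A_module A K P" and Q: "A_module A K Q"
    and h: "\<And>V. V \<in> Ob A \<Longrightarrow> linear_map K (fib P V) (fib Q V) (h V)"
    and surj: "\<And>V. V \<in> Ob A \<Longrightarrow> h V ` carrier (fib P V) = carrier (fib Q V)"
    and nat: "\<And>f x. \<lbrakk>f \<in> Arr A; x \<in> carrier (fib P (Dom A f))\<rbrakk>
      \<Longrightarrow> h (Cod A f) (mor P f x) = mor Q f (h (Dom A f) x)"
    and fg: "finitely_generated A K P"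
  shows "finitely_generated A K Q"
proof -
  have C: "\<And>f. f \<in> Arr A \<Longrightarrow> Dom A f \<in> Ob A \<and> Cod A f \<in> Ob A"
    using cat.Dom_Ob[OF cat] cat.Cod_Ob[OF cat] by blast
  obtain S where S: "finite S" "S \<subseteq> (SIGMA V:Ob A. carrier (fib P V))"
    "\<And>V. V \<in> Ob A \<Longrightarrow> generated_submodule A K P S V = carrier (fib P V)"
    using fg unfolding finitely_generated_def by metis
  define T where "T = (\<lambda>(V, x). (V, h V x)) ` S"
  have mP: "module K (fib P V)" and mQ: "module K (fib Q V)" if "V \<in> Ob A" for V
    using P Q that by (auto simp: A_module_def)
  have 1: "T \<subseteq> (SIGMA V:Ob A. carrier (fib Q V))"
  proof
    fix y assume "y \<in> T"
    then obtain V x where Vx: "(V, x) \<in> S" "y = (V, h V x)" by (auto simp: T_def)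
    then have "V \<in> Ob A" "x \<in> carrier (fib P V)" using S(2) by auto
    then show "y \<in> (SIGMA V:Ob A. carrier (fib Q V))" using surj[of V] Vx(2) by auto
  qed
  have 2: "carrier (fib Q V) \<subseteq> N V"
    if N: "A_submodule A K Q N" and TN: "\<forall>(U, x) \<in> T. x \<in> N U" and V: "V \<in> Ob A" for N V
  proof -
    define N' where "N' = (\<lambda>V. {x \<in> carrier (fib P V). h V x \<in> N V})"
    have sub: "submodule (N' V) K (fib P V)" if V: "V \<in> Ob A" for V
    proof -
      interpret p: module K "fib P V" by (rule mP[OF V])
      interpret q: module K "fib Q V" by (rule mQ[OF V])
      have NV: "submodule (N V) K (fib Q V)" using N V by (auto simp: A_submodule_def)
      note E = q.submoduleE[OF NV]
      have z: "\<zero>\<^bsub>fib Q V\<^esub> \<in> N V"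
        using NV by (auto simp: submodule_def dest: subgroup.one_closed)
      show ?thesis
      proof (rule p.submoduleI)
        show "N' V \<subseteq> carrier (fib P V)" by (auto simp: N'_def)
        show "\<zero>\<^bsub>fib P V\<^esub> \<in> N' V"
          using z linear_map_zero[OF mP[OF V] mQ[OF V] h[OF V]] by (simp add: N'_def)
        show "\<ominus>\<^bsub>fib P V\<^esub> a \<in> N' V" if "a \<in> N' V" for a
          using that linear_map_minus[OF mP[OF V] mQ[OF V] h[OF V]] E(3) by (simp add: N'_def)
        show "a \<oplus>\<^bsub>fib P V\<^esub> b \<in> N' V" if "a \<in> N' V" "b \<in> N' V" for a b
          using that h[OF V] E(5) by (simp add: N'_def linear_map_def)
        show "a \<odot>\<^bsub>fib P V\<^esub> x \<in> N' V" if "a \<in> carrier K" "x \<in> N' V" for a x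
          using that h[OF V] E(4) by (simp add: N'_def linear_map_def)
      qed
    qed
    have st: "mor P f ` N' (Dom A f) \<subseteq> N' (Cod A f)" if f: "f \<in> Arr A" for f
    proof
      fix y assume "y \<in> mor P f ` N' (Dom A f)"
      then obtain x where x: "y = mor P f x" "x \<in> carrier (fib P (Dom A f))"
        "h (Dom A f) x \<in> N (Dom A f)" by (auto simp: N'_def)
      have l: "linear_map K (fib P (Dom A f)) (fib P (Cod A f)) (mor P f)"
        using P f by (auto simp: A_module_def)
      have "mor Q f (h (Dom A f) x) \<in> N (Cod A f)"
        using N f x(3) by (auto simp: A_submodule_def)
      then show "y \<in> N' (Cod A f)"
        using nat[OF f x(2)] l x unfolding N'_def linear_map_def by auto
    qed
    have "A_submodule A K P N'" using sub st by (auto simp: A_submodule_def)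
    moreover have "\<forall>(U, x) \<in> S. x \<in> N' U"
    proof clarify
      fix U x assume Ux: "(U, x) \<in> S"
      then have "x \<in> carrier (fib P U)" using S(2) by auto
      moreover have "(U, h U x) \<in> T" using Ux by (force simp: T_def)
      ultimately show "x \<in> N' U" using TN by (auto simp: N'_def)
    qed
    ultimately have "generated_submodule A K P S V \<subseteq> N' V"
      unfolding generated_submodule_def by blast
    then have "carrier (fib P V) \<subseteq> N' V" using S(3)[OF V] by simp
    then have "h V ` carrier (fib P V) \<subseteq> N V" by (auto simp: N'_def)
    then show ?thesis using surj[OF V] by simp
  qed
  have 3: "A_submodule A K Q (\<lambda>V. carrier (fib Q V))"
  proof -
    have "submodule (carrier (fib Q V)) K (fib Q V)" if "V \<in> Ob A" for V
      using module.carrier_is_submodule[OF mQ[OF that]] .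
    moreover have "mor Q f ` carrier (fib Q (Dom A f)) \<subseteq> carrier (fib Q (Cod A f))"
      if "f \<in> Arr A" for f
      using Q that by (auto simp: A_module_def linear_map_def)
    ultimately show ?thesis by (auto simp: A_submodule_def)
  qed
  have "generated_submodule A K Q T V = carrier (fib Q V)" if V: "V \<in> Ob A" for V
  proof
    have "\<forall>(U, x) \<in> T. x \<in> carrier (fib Q U)" using 1 by auto
    then show "generated_submodule A K Q T V \<subseteq> carrier (fib Q V)"
      using 3 unfolding generated_submodule_def by blast
    show "carrier (fib Q V) \<subseteq> generated_submodule A K Q T V"
      using 2 V unfolding generated_submodule_def by blast
  qed
  moreover have "finite T" using S(1) by (simp add: T_def)
  ultimately show ?thesis using 1 unfolding finitely_generated_def by blast
qed

definition transport_module :: "('m \<Rightarrow> 'n) \<Rightarrow> ('k, 'm) module \<Rightarrow> ('k, 'n) module"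
  where "transport_module j M =
    (let i = inv_into (carrier M) j in
     \<lparr>carrier = j ` carrier M, mult = undefined, one = undefined, zero = j \<zero>\<^bsub>M\<^esub>,
      add = (\<lambda>u v. j (i u \<oplus>\<^bsub>M\<^esub> i v)), smult = (\<lambda>a u. j (a \<odot>\<^bsub>M\<^esub> i u))\<rparr>)"

lemma transport_module:
  assumes M: "module K M" and j: "inj_on j (carrier M)"
  shows "module K (transport_module j M)"
    and "linear_map K M (transport_module j M) j"
    and "linear_map K (transport_module j M) M (inv_into (carrier M) j)"
proof -
  interpret M: module K M by (rule M)
  have ij: "inv_into (carrier M) j (j x) = x" if "x \<in> carrier M" for x
    using j that by simp
  show "module K (transport_module j M)"
  proof (rule moduleI)
    show "cring K" by (rule M.R.is_cring)
    show "abelian_group (transport_module j M)"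
    proof (rule abelian_groupI)
      fix x assume "x \<in> carrier (transport_module j M)"
      then obtain y where y: "y \<in> carrier M" "x = j y" by (auto simp: transport_module_def Let_def)
      show "\<exists>z \<in> carrier (transport_module j M).
          z \<oplus>\<^bsub>transport_module j M\<^esub> x = \<zero>\<^bsub>transport_module j M\<^esub>"
        using y by (intro bexI[of _ "j (\<ominus>\<^bsub>M\<^esub> y)"])
          (auto simp: transport_module_def Let_def ij M.l_neg)
    qed (auto simp: transport_module_def Let_def ij M.add.m_ac)
  qed (auto simp: transport_module_def Let_def ij M.smult_l_distr M.smult_r_distr M.smult_assoc1)
  show "linear_map K M (transport_module j M) j"
    by (auto simp: linear_map_def transport_module_def Let_def ij)
  show "linear_map K (transport_module j M) M (inv_into (carrier M) j)"
    by (auto simp: linear_map_def transport_module_def Let_def ij)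
qed

text \<open>Replacing the elements of the fibre over \<open>V\<close> along an injection \<open>j V\<close>.\<close>

lemma finitely_generated_restrict_transport:
  fixes M :: "('o, 'a, 'k, 'm) amod" and j :: "'o \<Rightarrow> 'm \<Rightarrow> 'n"
  assumes cat: "cat A"
    and M: "A_module A K M" and fg: "finitely_generated A K M" and N: "A_submodule A K M N"
    and j: "\<And>V. V \<in> Ob A \<Longrightarrow> inj_on (j V) (carrier (fib M V))"
    and noeth: "\<And>(M' :: ('o, 'a, 'k, 'n) amod) N'. \<lbrakk>A_module A K M'; finitely_generated A K M';
       A_submodule A K M' N'\<rbrakk> \<Longrightarrow> finitely_generated A K (restrict_amod M' N')"
  shows "finitely_generated A K (restrict_amod M N)"
proof -
  have C: "\<And>f. f \<in> Arr A \<Longrightarrow> Dom A f \<in> Ob A \<and> Cod A f \<in> Ob A"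
    using cat.Dom_Ob[OF cat] cat.Cod_Ob[OF cat] by blast
  define i where "i = (\<lambda>V. inv_into (carrier (fib M V)) (j V))"
  define T where "T = \<lparr>fib = (\<lambda>V. transport_module (j V) (fib M V)),
     mor = (\<lambda>f u. j (Cod A f) (mor M f (i (Dom A f) u)))\<rparr>"
  define L where "L = (\<lambda>V. j V ` N V)"
  have mM: "module K (fib M V)" if "V \<in> Ob A" for V using M that by (auto simp: A_module_def)
  have lin: "linear_map K (fib M (Dom A f)) (fib M (Cod A f)) (mor M f)" if "f \<in> Arr A" for f
    using M that by (auto simp: A_module_def)
  have mc: "mor M f x \<in> carrier (fib M (Cod A f))"
    if "f \<in> Arr A" "x \<in> carrier (fib M (Dom A f))" for f x
    using lin[OF that(1)] that(2) by (auto simp: linear_map_def)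
  have ij: "i V (j V x) = x" if "V \<in> Ob A" "x \<in> carrier (fib M V)" for V x
    using j that by (simp add: i_def)
  have fT: "fib T V = transport_module (j V) (fib M V)" for V by (simp add: T_def)
  have cT: "carrier (fib T V) = j V ` carrier (fib M V)" for V
    by (simp add: T_def transport_module_def Let_def)
  have mT: "module K (fib T V)" and jl: "linear_map K (fib M V) (fib T V) (j V)"
    and il: "linear_map K (fib T V) (fib M V) (i V)" if "V \<in> Ob A" for V
    unfolding fT i_def using transport_module[OF mM[OF that] j[OF that]] by auto
  have jn: "j (Cod A f) (mor M f x) = mor T f (j (Dom A f) x)"
    if "f \<in> Arr A" "x \<in> carrier (fib M (Dom A f))" for f x
    using C that by (simp add: T_def ij)
  have lT: "linear_map K (fib T (Dom A f)) (fib T (Cod A f)) (mor T f)" if f: "f \<in> Arr A" for f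
  proof -
    have "mor T f = j (Cod A f) \<circ> mor M f \<circ> i (Dom A f)" by (auto simp: T_def)
    then show ?thesis
      using il[of "Dom A f"] lin[OF f] jl[of "Cod A f"] C[OF f] unfolding linear_map_def
      by (simp add: Pi_iff)
  qed
  have AT: "A_module A K T"
    unfolding A_module_def
  proof (intro conjI ballI allI)
    fix V x assume V: "V \<in> Ob A" and "x \<in> carrier (fib T V)"
    then obtain y where y: "y \<in> carrier (fib M V)" "x = j V y" by (auto simp: cT)
    have "mor M (Id A V) y = y" using M V y by (auto simp: A_module_def)
    moreover have "Dom A (Id A V) = V" "Cod A (Id A V) = V"
      using cat.Id_Homs[OF cat V] by (auto simp: Homs_def)
    ultimately show "mor T (Id A V) x = x" using y V by (simp add: T_def ij)
  next
    fix U V W f g x assume f: "f \<in> Homs A U V" and g: "g \<in> Homs A V W"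
      and "x \<in> carrier (fib T U)"
    then obtain y where y: "y \<in> carrier (fib M U)" "x = j U y" by (auto simp: cT)
    have d: "f \<in> Arr A" "g \<in> Arr A" "Dom A f = U" "Cod A f = V" "Dom A g = V" "Cod A g = W"
      using f g by (auto simp: Homs_def)
    have gf: "g \<bullet>\<^bsub>A\<^esub> f \<in> Homs A U W" using cat.Comp_Homs[OF cat f g] .
    have ob: "U \<in> Ob A" "V \<in> Ob A" "W \<in> Ob A" using C d by blast+
    have "mor M f y \<in> carrier (fib M V)" using mc[of f y] d y by simp
    moreover have "mor M (g \<bullet>\<^bsub>A\<^esub> f) y = mor M g (mor M f y)"
      using M f g y unfolding A_module_def by blast
    ultimately show "mor T (g \<bullet>\<^bsub>A\<^esub> f) x = mor T g (mor T f x)"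
      using gf y d ob by (simp add: T_def ij Homs_def)
  qed (use mT lT in auto)
  have NS: "N V \<subseteq> carrier (fib M V)" if "V \<in> Ob A" for V
    using N that module.submoduleE(1)[OF mM[OF that]] by (auto simp: A_submodule_def)
  have fgT: "finitely_generated A K T"
    by (rule finitely_generated_surj[OF cat M AT jl _ jn fg]) (auto simp: cT)
  have sL: "submodule (L V) K (fib T V)" if V: "V \<in> Ob A" for V
  proof -
    interpret m: module K "fib M V" by (rule mM[OF V])
    interpret t: module K "fib T V" by (rule mT[OF V])
    have NV: "submodule (N V) K (fib M V)" using N V by (auto simp: A_submodule_def)
    note E = m.submoduleE[OF NV]
    have z: "\<zero>\<^bsub>fib M V\<^esub> \<in> N V" using NV by (auto simp: submodule_def dest: subgroup.one_closed)
    note l = jl[OF V, unfolded linear_map_def]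
    show ?thesis
    proof (rule t.submoduleI)
      show "L V \<subseteq> carrier (fib T V)" using E(1) by (auto simp: L_def cT)
      show "\<zero>\<^bsub>fib T V\<^esub> \<in> L V"
        using z linear_map_zero[OF mM[OF V] mT[OF V] jl[OF V]] by (metis L_def imageI)
      show "\<ominus>\<^bsub>fib T V\<^esub> a \<in> L V" if a: "a \<in> L V" for a
      proof -
        obtain x where x: "x \<in> N V" "a = j V x" using a by (auto simp: L_def)
        have "\<ominus>\<^bsub>fib T V\<^esub> a = j V (\<ominus>\<^bsub>fib M V\<^esub> x)"
          using linear_map_minus[OF mM[OF V] mT[OF V] jl[OF V]] x E(1) by auto
        then show ?thesis using E(3)[OF x(1)] by (simp add: L_def)
      qed
      show "a \<oplus>\<^bsub>fib T V\<^esub> b \<in> L V" if ab: "a \<in> L V" "b \<in> L V" for a b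
      proof -
        obtain x y where x: "x \<in> N V" "a = j V x" "y \<in> N V" "b = j V y"
          using ab by (auto simp: L_def)
        have "a \<oplus>\<^bsub>fib T V\<^esub> b = j V (x \<oplus>\<^bsub>fib M V\<^esub> y)" using l x subsetD[OF E(1) x(1)] subsetD[OF E(1) x(3)] by simp
        then show ?thesis using E(5) x by (simp add: L_def)
      qed
      show "a \<odot>\<^bsub>fib T V\<^esub> b \<in> L V" if a: "a \<in> carrier K" and b: "b \<in> L V" for a b
      proof -
        obtain x where x: "x \<in> N V" "b = j V x" using b by (auto simp: L_def)
        have "a \<odot>\<^bsub>fib T V\<^esub> b = j V (a \<odot>\<^bsub>fib M V\<^esub> x)" using l x subsetD[OF E(1) x(1)] a by simp
        then show ?thesis using E(4) x a by (simp add: L_def)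
      qed
    qed
  qed
  have AL: "A_submodule A K T L"
    unfolding A_submodule_def
  proof (intro conjI ballI)
    fix f assume f: "f \<in> Arr A"
    show "mor T f ` L (Dom A f) \<subseteq> L (Cod A f)"
    proof
      fix y assume "y \<in> mor T f ` L (Dom A f)"
      then obtain x where x: "x \<in> N (Dom A f)" "y = mor T f (j (Dom A f) x)"
        by (auto simp: L_def)
      have "y = j (Cod A f) (mor M f x)"
        using jn[OF f subsetD[OF NS x(1)]] x(2) C[OF f] by simp
      moreover have "mor M f x \<in> N (Cod A f)" using N f x by (auto simp: A_submodule_def)
      ultimately show "y \<in> L (Cod A f)" by (simp add: L_def)
    qed
  qed (use sL in auto)
  have fgL: "finitely_generated A K (restrict_amod T L)" by (rule noeth[OF AT fgT AL])
  have iL: "i V ` L V = N V" if V: "V \<in> Ob A" for V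
    using ij[OF V] NS[OF V] by (force simp: L_def)
  have LS: "L V \<subseteq> carrier (fib T V)" if V: "V \<in> Ob A" for V
    using NS[OF V] by (auto simp: L_def cT)
  show ?thesis
  proof (rule finitely_generated_surj[OF cat _ _ _ _ _ fgL, where h = i])
    show "A_module A K (restrict_amod T L)" by (rule A_module_restrict[OF AT AL cat])
    show "A_module A K (restrict_amod M N)" by (rule A_module_restrict[OF M N cat])
    fix V assume V: "V \<in> Ob A"
    show "linear_map K (fib (restrict_amod T L) V) (fib (restrict_amod M N) V) (i V)"
      using il[OF V] iL[OF V] LS[OF V] unfolding linear_map_def restrict_amod_def
      by (auto simp: subset_iff)
    show "i V ` carrier (fib (restrict_amod T L) V) = carrier (fib (restrict_amod M N) V)"
      using iL[OF V] by (simp add: restrict_amod_def)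
  next
    fix f x assume f: "f \<in> Arr A" and "x \<in> carrier (fib (restrict_amod T L) (Dom A f))"
    then have x: "x \<in> carrier (fib T (Dom A f))" using LS C[OF f] by (auto simp: restrict_amod_def)
    then obtain y where y: "y \<in> carrier (fib M (Dom A f))" "x = j (Dom A f) y" by (auto simp: cT)
    show "i (Cod A f) (mor (restrict_amod T L) f x) = mor (restrict_amod M N) f (i (Dom A f) x)"
      using y mc[OF f y(1)] C[OF f] by (simp add: restrict_amod_def T_def ij)
  qed
qed

lemma locally_noetherianD:
  fixes M :: "('o, 'a, 'k, 'm) amod"
  assumes cat: "cat A" and noeth: "locally_noetherian A K"
    and M: "A_module A K M" and fg: "finitely_generated A K M" and N: "A_submodule A K M N"
  shows "finitely_generated A K (restrict_amod M N)"
proof -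
  have C: "\<And>f. f \<in> Arr A \<Longrightarrow> Dom A f \<in> Ob A \<and> Cod A f \<in> Ob A"
    using cat.Dom_Ob[OF cat] cat.Cod_Ob[OF cat] by blast
  obtain S where S: "finite S" "S \<subseteq> (SIGMA V:Ob A. carrier (fib M V))"
    "\<And>V. V \<in> Ob A \<Longrightarrow> generated_submodule A K M S V = carrier (fib M V)"
    using fg unfolding finitely_generated_def by metis
  obtain g where g: "set g = S" using finite_list[OF S(1)] by blast
  define ok where "ok = (\<lambda>V (l :: (nat \<times> 'a \<times> 'k) list). \<forall>(i, f, a) \<in> set l.
    i < length g \<and> f \<in> Homs A (fst (g ! i)) V \<and> a \<in> carrier K)"
  define val where "val = (\<lambda>V l. foldr (\<lambda>(i, f, a) y.
    (a \<odot>\<^bsub>fib M V\<^esub> mor M f (snd (g ! i))) \<oplus>\<^bsub>fib M V\<^esub> y) l \<zero>\<^bsub>fib M V\<^esub>)"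
  have val_Nil: "val V [] = \<zero>\<^bsub>fib M V\<^esub>" for V by (simp add: val_def)
  have val_Cons: "val V ((i, f, a) # l) =
      (a \<odot>\<^bsub>fib M V\<^esub> mor M f (snd (g ! i))) \<oplus>\<^bsub>fib M V\<^esub> val V l" for V i f a l
    by (simp add: val_def)
  have mM: "module K (fib M V)" if "V \<in> Ob A" for V using M that by (auto simp: A_module_def)
  have gen: "fst (g ! i) \<in> Ob A" "snd (g ! i) \<in> carrier (fib M (fst (g ! i)))"
    if "i < length g" for i
    using subsetD[OF S(2), of "g ! i"] g nth_mem[OF that] by (cases "g ! i"; simp)+
  have lin: "linear_map K (fib M U) (fib M V) (mor M f)" if "f \<in> Homs A U V" for f U V
    using M that by (auto simp: A_module_def Homs_def)
  have mc: "mor M f x \<in> carrier (fib M V)"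
    if "f \<in> Homs A U V" "x \<in> carrier (fib M U)" for f U V x
    using lin[OF that(1)] that(2) by (auto simp: linear_map_def)
  have ok_Cons: "ok V ((i, f, a) # l) \<longleftrightarrow>
      i < length g \<and> f \<in> Homs A (fst (g ! i)) V \<and> a \<in> carrier K \<and> ok V l" for V i f a l
    by (auto simp: ok_def)
  have ok_Nil: "ok V []" for V by (simp add: ok_def)
  have term_closed: "a \<odot>\<^bsub>fib M V\<^esub> mor M f (snd (g ! i)) \<in> carrier (fib M V)"
    if "V \<in> Ob A" "i < length g" "f \<in> Homs A (fst (g ! i)) V" "a \<in> carrier K" for V i f a
    using module.smult_closed[OF mM[OF that(1)] that(4)] mc[OF that(3) gen(2)[OF that(2)]] .
  have vc: "val V l \<in> carrier (fib M V)" if V: "V \<in> Ob A" and "ok V l" for V l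
    using that(2)
  proof (induction l)
    case Nil
    interpret m: module K "fib M V" by (rule mM[OF V])
    show ?case by (simp add: val_Nil)
  next
    case (Cons t l)
    interpret m: module K "fib M V" by (rule mM[OF V])
    obtain i f a where t: "t = (i, f, a)" by (cases t)
    show ?case using Cons term_closed[OF V] by (auto simp: t val_Cons ok_Cons)
  qed
  have app: "ok V (l @ l') \<and> val V (l @ l') = val V l \<oplus>\<^bsub>fib M V\<^esub> val V l'"
    if V: "V \<in> Ob A" and "ok V l" "ok V l'" for V l l'
    using that(2)
  proof (induction l)
    case Nil
    interpret m: module K "fib M V" by (rule mM[OF V])
    show ?case using vc[OF V that(3)] that(3) by (simp add: val_Nil)
  next
    case (Cons t l)
    interpret m: module K "fib M V" by (rule mM[OF V])
    obtain i f a where t: "t = (i, f, a)" by (cases t)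
    show ?case using Cons term_closed[OF V] vc[OF V] that(3)
      by (auto simp: t val_Cons ok_Cons m.a_assoc)
  qed
  have scal: "\<exists>l'. ok V l' \<and> val V l' = b \<odot>\<^bsub>fib M V\<^esub> val V l"
    if V: "V \<in> Ob A" and b: "b \<in> carrier K" and "ok V l" for V b l
    using that(3)
  proof (induction l)
    case Nil
    interpret m: module K "fib M V" by (rule mM[OF V])
    show ?case using ok_Nil b by (intro exI[of _ "[]"]) (simp add: val_Nil)
  next
    case (Cons t l)
    interpret m: module K "fib M V" by (rule mM[OF V])
    obtain i f a where t: "t = (i, f, a)" by (cases t)
    have o: "i < length g" "f \<in> Homs A (fst (g ! i)) V" "a \<in> carrier K" "ok V l"
      using Cons.prems by (auto simp: t ok_Cons)
    obtain l' where l': "ok V l'" "val V l' = b \<odot>\<^bsub>fib M V\<^esub> val V l" using Cons.IH o(4) by blast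
    show ?case
      using o l' b term_closed[OF V] mc[OF o(2) gen(2)[OF o(1)]] vc[OF V o(4)]
      by (intro exI[of _ "(i, f, b \<otimes>\<^bsub>K\<^esub> a) # l'"])
        (simp add: t val_Cons ok_Cons m.smult_r_distr m.smult_assoc1)
  qed
  have push: "\<exists>l'. ok V l' \<and> val V l' = mor M h (val U l)"
    if h: "h \<in> Homs A U V" and "ok U l" for U V h l
    using that(2)
  proof (induction l)
    case Nil
    have ob: "U \<in> Ob A" "V \<in> Ob A" using h C by (auto simp: Homs_def)
    show ?case using linear_map_zero[OF mM[OF ob(1)] mM[OF ob(2)] lin[OF h]] ok_Nil
      by (intro exI[of _ "[]"]) (simp add: val_Nil)
  next
    case (Cons t l)
    have ob: "U \<in> Ob A" "V \<in> Ob A" using h C by (auto simp: Homs_def)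
    obtain i f a where t: "t = (i, f, a)" by (cases t)
    have o: "i < length g" "f \<in> Homs A (fst (g ! i)) U" "a \<in> carrier K" "ok U l"
      using Cons.prems by (auto simp: t ok_Cons)
    obtain l' where l': "ok V l'" "val V l' = mor M h (val U l)" using Cons.IH o(4) by blast
    have 1: "mor M (h \<bullet>\<^bsub>A\<^esub> f) (snd (g ! i)) = mor M h (mor M f (snd (g ! i)))"
      using M o(2) h gen(2)[OF o(1)] unfolding A_module_def by blast
    have 2: "h \<bullet>\<^bsub>A\<^esub> f \<in> Homs A (fst (g ! i)) V" using cat.Comp_Homs[OF cat o(2) h] .
    show ?case
      using o l' 1 2 lin[OF h] term_closed[OF ob(1) o(1-3)] vc[OF ob(1) o(4)]
        mc[OF o(2) gen(2)[OF o(1)]]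
      by (intro exI[of _ "(i, h \<bullet>\<^bsub>A\<^esub> f, a) # l'"])
        (simp add: t val_Cons ok_Cons linear_map_def)
  qed
  define R where "R = (\<lambda>V. {val V l |l. ok V l})"
  have subR: "submodule (R V) K (fib M V)" if V: "V \<in> Ob A" for V
  proof -
    interpret m: module K "fib M V" by (rule mM[OF V])
    have sm: "b \<odot>\<^bsub>fib M V\<^esub> x \<in> R V" if b: "b \<in> carrier K" and x: "x \<in> R V" for b x
    proof -
      obtain l where l: "ok V l" "x = val V l" using x by (auto simp: R_def)
      obtain l' where "ok V l'" "val V l' = b \<odot>\<^bsub>fib M V\<^esub> val V l"
        using scal[OF V b l(1)] by blast
      then show ?thesis using l(2) unfolding R_def by (auto intro!: exI[of _ l'])
    qed
    have RS: "R V \<subseteq> carrier (fib M V)" using vc[OF V] by (auto simp: R_def)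
    show ?thesis
    proof (rule m.submoduleI)
      show "R V \<subseteq> carrier (fib M V)" by (rule RS)
      show "\<zero>\<^bsub>fib M V\<^esub> \<in> R V"
        unfolding R_def using ok_Nil val_Nil[of V] by (auto intro!: exI[of _ "[]"])
      show "a \<oplus>\<^bsub>fib M V\<^esub> b \<in> R V" if "a \<in> R V" "b \<in> R V" for a b
      proof -
        obtain l where l: "ok V l" "a = val V l" using \<open>a \<in> R V\<close> by (auto simp: R_def)
        obtain l' where l': "ok V l'" "b = val V l'" using \<open>b \<in> R V\<close> by (auto simp: R_def)
        have "ok V (l @ l')" "val V (l @ l') = a \<oplus>\<^bsub>fib M V\<^esub> b"
          using app[OF V l(1) l'(1)] l l' by auto
        then show ?thesis unfolding R_def by (auto intro!: exI[of _ "l @ l'"])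
      qed
      show "\<ominus>\<^bsub>fib M V\<^esub> a \<in> R V" if a: "a \<in> R V" for a
      proof -
        have ac: "a \<in> carrier (fib M V)" using a RS by blast
        have "\<ominus>\<^bsub>fib M V\<^esub> a = (\<ominus>\<^bsub>K\<^esub> \<one>\<^bsub>K\<^esub>) \<odot>\<^bsub>fib M V\<^esub> a"
          using m.smult_l_minus[OF m.R.one_closed ac] m.smult_one[OF ac] by simp
        then show ?thesis using sm[OF _ a] by simp
      qed
      show "a \<odot>\<^bsub>fib M V\<^esub> x \<in> R V" if "a \<in> carrier K" "x \<in> R V" for a x
        by (rule sm[OF that])
    qed
  qed
  have AR: "A_submodule A K M R"
    unfolding A_submodule_def
  proof (intro conjI ballI)
    fix f assume f: "f \<in> Arr A"
    then have fh: "f \<in> Homs A (Dom A f) (Cod A f)" by (simp add: Homs_def)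
    show "mor M f ` R (Dom A f) \<subseteq> R (Cod A f)"
    proof
      fix y assume "y \<in> mor M f ` R (Dom A f)"
      then obtain l where l: "ok (Dom A f) l" "y = mor M f (val (Dom A f) l)"
        by (auto simp: R_def)
      obtain l' where "ok (Cod A f) l'" "val (Cod A f) l' = y" using push[OF fh l(1)] l(2) by blast
      then show "y \<in> R (Cod A f)" unfolding R_def by blast
    qed
  qed (use subR in auto)
  have SR: "\<forall>(U, x) \<in> S. x \<in> R U"
  proof clarify
    fix U x assume Ux: "(U, x) \<in> S"
    then obtain i where i: "i < length g" "g ! i = (U, x)" using g by (metis in_set_conv_nth)
    have U: "U \<in> Ob A" and x: "x \<in> carrier (fib M U)" using Ux S(2) by auto
    interpret m: module K "fib M U" by (rule mM[OF U])
    have "mor M (Id A U) x = x" using M U x by (auto simp: A_module_def)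
    then have "val U [(i, Id A U, \<one>\<^bsub>K\<^esub>)] = x" using i x by (simp add: val_Cons val_Nil)
    moreover have "ok U [(i, Id A U, \<one>\<^bsub>K\<^esub>)]"
      using i cat.Id_Homs[OF cat U] by (simp add: ok_Cons ok_Nil)
    ultimately show "x \<in> R U" unfolding R_def by blast
  qed
  have cov: "\<exists>l. ok V l \<and> val V l = x" if "V \<in> Ob A" "x \<in> carrier (fib M V)" for V x
  proof -
    have "carrier (fib M V) \<subseteq> R V"
      using AR SR S(3)[OF that(1)] unfolding generated_submodule_def by blast
    then show ?thesis using that(2) unfolding R_def by blast
  qed
  define j where "j = (\<lambda>V x. {l. ok V l \<and> val V l = x})"
  have "inj_on (j V) (carrier (fib M V))" if V: "V \<in> Ob A" for V
  proof (rule inj_onI)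
    fix x y assume x: "x \<in> carrier (fib M V)" and e: "j V x = j V y"
    obtain l where l: "ok V l" "val V l = x" using cov[OF V x] by blast
    then have "l \<in> j V y" using e by (auto simp: j_def)
    then show "x = y" using l by (simp add: j_def)
  qed
  then show ?thesis
    by (rule finitely_generated_restrict_transport[OF cat M fg N])
      (use noeth in \<open>auto simp: locally_noetherian_def\<close>)
qed

section \<open>Group homology\<close>

text \<open>
  \<open>H\<^sub>n(G; M)\<close> for a left \<open>K[G]\<close>-module \<open>M\<close>, given by a \<open>K\<close>-module \<open>M\<close> and an action
  \<open>act :: 'g \<Rightarrow> 'm \<Rightarrow> 'm\<close>, is the homology of the (inhomogeneous) bar complex.  Its \<open>n\<close>-chains
  are the finite sums of \<open>[g\<^sub>1|\<dots>|g\<^sub>n] \<otimes> m\<close>, here finitely supported functions on lists of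
  length \<open>n\<close>, and
  \[ d([g_1|\ldots|g_n] \otimes m) = [g_2|\ldots|g_n] \otimes m
      + \sum_{0<i<n} (-1)^i [g_1|\ldots|g_i g_{i+1}|\ldots|g_n] \otimes m
      + (-1)^n [g_1|\ldots|g_{n-1}] \otimes g_n m. \]
\<close>

definition bar_chains ::
    "('g, 'b) monoid_scheme \<Rightarrow> ('k, 'm) module \<Rightarrow> nat \<Rightarrow> ('k, 'g list \<Rightarrow> 'm) module"
  where "bar_chains G M n =
    \<lparr>carrier = {c. (\<forall>gs. c gs \<in> carrier M) \<and> finite {gs. c gs \<noteq> \<zero>\<^bsub>M\<^esub>} \<and>
        (\<forall>gs. c gs \<noteq> \<zero>\<^bsub>M\<^esub> \<longrightarrow> length gs = n \<and> set gs \<subseteq> carrier G)},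
     mult = undefined, one = undefined,
     zero = (\<lambda>gs. \<zero>\<^bsub>M\<^esub>), add = (\<lambda>c d gs. c gs \<oplus>\<^bsub>M\<^esub> d gs),
     smult = (\<lambda>a c gs. a \<odot>\<^bsub>M\<^esub> c gs)\<rparr>"

definition bar_face :: "('g, 'b) monoid_scheme \<Rightarrow> nat \<Rightarrow> nat \<Rightarrow> 'g list \<Rightarrow> 'g list"
  where "bar_face G n i gs =
    (if i = 0 then tl gs else if i = n then butlast gs
     else take (i - 1) gs @ (gs ! (i - 1) \<otimes>\<^bsub>G\<^esub> gs ! i) # drop (i + 1) gs)"

definition bar_coeff ::
    "('k, 'm) module \<Rightarrow> ('g \<Rightarrow> 'm \<Rightarrow> 'm) \<Rightarrow> nat \<Rightarrow> nat \<Rightarrow> 'g list \<Rightarrow> 'm \<Rightarrow> 'm"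
  where "bar_coeff M act n i gs m =
    (let m' = (if i = n then act (last gs) m else m) in if even i then m' else \<ominus>\<^bsub>M\<^esub> m')"

text \<open>The differential from degree \<open>n > 0\<close> to degree \<open>n - 1\<close>.\<close>

definition bar_boundary ::
    "('g, 'b) monoid_scheme \<Rightarrow> ('k, 'm) module \<Rightarrow> ('g \<Rightarrow> 'm \<Rightarrow> 'm) \<Rightarrow> nat \<Rightarrow> ('g list \<Rightarrow> 'm) \<Rightarrow> 'g list \<Rightarrow> 'm"
  where "bar_boundary G M act n c hs =
    (\<Oplus>\<^bsub>M\<^esub>i \<in> {0..n}. \<Oplus>\<^bsub>M\<^esub>gs \<in> {gs. c gs \<noteq> \<zero>\<^bsub>M\<^esub> \<and> bar_face G n i gs = hs}.
       bar_coeff M act n i gs (c gs))"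

definition bar_cycles ::
    "('g, 'b) monoid_scheme \<Rightarrow> ('k, 'm) module \<Rightarrow> ('g \<Rightarrow> 'm \<Rightarrow> 'm) \<Rightarrow> nat \<Rightarrow> ('g list \<Rightarrow> 'm) set"
  where "bar_cycles G M act n =
    {c \<in> carrier (bar_chains G M n). n = 0 \<or> bar_boundary G M act n c = (\<lambda>_. \<zero>\<^bsub>M\<^esub>)}"

definition bar_boundaries ::
    "('g, 'b) monoid_scheme \<Rightarrow> ('k, 'm) module \<Rightarrow> ('g \<Rightarrow> 'm \<Rightarrow> 'm) \<Rightarrow> nat \<Rightarrow> ('g list \<Rightarrow> 'm) set"
  where "bar_boundaries G M act n =
    bar_boundary G M act (Suc n) ` carrier (bar_chains G M (Suc n))"

text \<open>
  The quotient of a module by a submodule; the components \<open>mult\<close> and \<open>one\<close> of the record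
  play no role for modules.
\<close>

definition quotient_module :: "('k, 'm) module \<Rightarrow> 'm set \<Rightarrow> ('k, 'm set) module"
  where "quotient_module M N =
    \<lparr>carrier = a_rcosets\<^bsub>M\<^esub> N, mult = undefined, one = undefined,
     zero = N, add = set_add M,
     smult = (\<lambda>a Y. \<Union>x \<in> Y. N +>\<^bsub>M\<^esub> (a \<odot>\<^bsub>M\<^esub> x))\<rparr>"

definition homology ::
    "('g, 'b) monoid_scheme \<Rightarrow> ('k, 'm) module \<Rightarrow> ('g \<Rightarrow> 'm \<Rightarrow> 'm) \<Rightarrow> nat \<Rightarrow> ('k, ('g list \<Rightarrow> 'm) set) module"
  where "homology G M act n =
    quotient_module ((bar_chains G M n)\<lparr>carrier := bar_cycles G M act n\<rparr>) (bar_boundaries G M act n)"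

text \<open>
  The map on homology induced by a group homomorphism \<open>\<phi> : G \<rightarrow> G'\<close> and a linear map
  \<open>\<psi> : M \<rightarrow> M'\<close> with \<open>\<psi> (g m) = \<phi> g (\<psi> m)\<close>; on chains it is
  \<open>[g\<^sub>1|\<dots>|g\<^sub>n] \<otimes> m \<mapsto> [\<phi> g\<^sub>1|\<dots>|\<phi> g\<^sub>n] \<otimes> \<psi> m\<close>.
\<close>

definition bar_map ::
    "('k, 'm) module \<Rightarrow> ('k, 'n) module \<Rightarrow> ('g \<Rightarrow> 'h) \<Rightarrow> ('m \<Rightarrow> 'n) \<Rightarrow> ('g list \<Rightarrow> 'm) \<Rightarrow> 'h list \<Rightarrow> 'n"
  where "bar_map M M' \<phi> \<psi> c hs =
    (\<Oplus>\<^bsub>M'\<^esub>gs \<in> {gs. c gs \<noteq> \<zero>\<^bsub>M\<^esub> \<and> map \<phi> gs = hs}. \<psi> (c gs))"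

definition homology_map ::
    "('k, 'm) module \<Rightarrow> ('h, 'b) monoid_scheme \<Rightarrow> ('k, 'n) module \<Rightarrow> ('h \<Rightarrow> 'n \<Rightarrow> 'n) \<Rightarrow>
     ('g \<Rightarrow> 'h) \<Rightarrow> ('m \<Rightarrow> 'n) \<Rightarrow> nat \<Rightarrow> ('g list \<Rightarrow> 'm) set \<Rightarrow> ('h list \<Rightarrow> 'n) set"
  where "homology_map M G' M' act' \<phi> \<psi> n Y =
    (\<Union>c \<in> Y. bar_boundaries G' M' act' n +>\<^bsub>bar_chains G' M' n\<^esub> bar_map M M' \<phi> \<psi> c)"


section \<open>The stabilization maps\<close>

definition regular_module :: "('k, 'r) ring_scheme \<Rightarrow> ('k, 'k) module"
  where "regular_module K =
    \<lparr>carrier = carrier K, mult = mult K, one = one K, zero = zero K, add = add K, smult = mult K\<rparr>"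

definition stab_hom :: "('o, 'a) smcat \<Rightarrow> 'o \<Rightarrow> 'a \<Rightarrow> 'a"
  where "stab_hom A X f = f \<star>\<^bsub>A\<^esub> Id A X"

text \<open>
  \<open>H\<^sub>q(Aut(X\<^sup>n); K)\<close> with trivial action and \<open>H\<^sub>q(Aut(X\<^sup>n); M\<^sub>n)\<close>, with their stabilization maps
  from \<open>n\<close> to \<open>n + 1\<close>.
\<close>

definition H_const ::
    "('o, 'a) smcat \<Rightarrow> 'o \<Rightarrow> ('k, 'r) ring_scheme \<Rightarrow> nat \<Rightarrow> nat \<Rightarrow> ('k, ('a list \<Rightarrow> 'k) set) module"
  where "H_const A X K q n = homology (AutG A (xpow A X n)) (regular_module K) (\<lambda>_ x. x) q"

definition stab_const ::
    "('o, 'a) smcat \<Rightarrow> 'o \<Rightarrow> ('k, 'r) ring_scheme \<Rightarrow> nat \<Rightarrow> nat \<Rightarrow> ('a list \<Rightarrow> 'k) set \<Rightarrow> ('a list \<Rightarrow> 'k) set"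
  where "stab_const A X K q n =
    homology_map (regular_module K)
      (AutG A (xpow A X (n + 1))) (regular_module K) (\<lambda>_ x. x) (stab_hom A X) (\<lambda>x. x) q"

definition H_twisted ::
    "('o, 'a) smcat \<Rightarrow> 'o \<Rightarrow> ('o, 'a, 'k, 'm) amod \<Rightarrow> nat \<Rightarrow> nat \<Rightarrow> ('k, ('a list \<Rightarrow> 'm) set) module"
  where "H_twisted A X M q n = homology (AutG A (xpow A X n)) (fib M (xpow A X n)) (mor M) q"

definition stab_twisted ::
    "('o, 'a) smcat \<Rightarrow> 'o \<Rightarrow> ('o, 'a, 'k, 'm) amod \<Rightarrow> nat \<Rightarrow> nat \<Rightarrow> ('a list \<Rightarrow> 'm) set \<Rightarrow> ('a list \<Rightarrow> 'm) set"
  where "stab_twisted A X M q n =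
    homology_map (fib M (xpow A X n))
      (AutG A (xpow A X (n + 1))) (fib M (xpow A X (n + 1))) (mor M)
      (stab_hom A X) (mor M (inl_arr A (xpow A X n) X)) q"

end

theory Submission
  imports Defs
begin

text \<open>
  The stabilization map on \<open>H\<^sub>q\<close> is induced by a map of bar complexes, and it is an isomorphism
  once two neighbouring homology groups of the mapping cone of that map vanish.  The proof is about
  the vanishing of the homology of these cones, in each degree separately and for all large \<open>n\<close>.  It
  is expressed without cones by \<open>rel_exact\<close>, and \<open>stab_exact\<close> is this property for the stabilization
  map with coefficients in a given module.

  A short exact sequence \<open>0 \<rightarrow> N \<rightarrow> P \<rightarrow> M \<rightarrow> 0\<close> of modules over the category gives a short exact
  sequence of cones.  Hence the cone of \<open>M\<close> is exact in degree \<open>q + 1\<close> as soon as that of \<open>P\<close> is exact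
  in degree \<open>q + 1\<close> and that of \<open>N\<close> in degree \<open>q\<close> (\<open>stab_exact_ses\<close>).  If \<open>M\<close> is finitely generated,
  there is such a sequence in which \<open>P\<close> is free on finitely many generators, and \<open>N\<close> is again finitely
  generated because the category of modules is locally Noetherian.  Induction on \<open>q\<close>
  (\<open>stable_step\<close>) therefore leaves only the modules that are free on finitely many generators, and
  the same sequences, now used to add one generator at a time, leave only the principal ones,
  whose value at \<open>W\<close> is the free \<open>K\<close>-module on \<open>Hom(V, W)\<close>.

  For a principal module one may think of \<open>V = X\<^sup>m\<close>.  The group \<open>Aut(X\<^sup>m\<^sup>+\<^sup>l)\<close> acts on
  \<open>Hom(X\<^sup>m, X\<^sup>m\<^sup>+\<^sup>l)\<close>, and the action is transitive: two subobjects isomorphic to \<open>X\<^sup>m\<close> have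
  complements of the same size, so an isomorphism between them extends to an automorphism
  (\<open>transitive_Homs\<close>).  The stabilizer of the canonical morphism is \<open>Aut(X\<^sup>l)\<close>, because an automorphism
  that fixes a subobject maps its complement to a complement, which is the same one by uniqueness
  (\<open>stabilizer\<close>).  Shapiro's lemma (\<open>shapiro\<close>) identifies the homology of \<open>Aut(X\<^sup>m\<^sup>+\<^sup>l)\<close> with coefficients
  in the principal module with the homology of \<open>Aut(X\<^sup>l)\<close> with constant coefficients.  The
  identifications for \<open>l\<close> and \<open>l + 1\<close> commute with the stabilization maps already on chains
  (\<open>base_arr_Suc\<close>, \<open>conj_arr_stab\<close>), so stability for constant coefficients carries over
  (\<open>principal_stable\<close>).
\<close>

section \<open>Linear maps and additive spans\<close>

context abelian_group begin

lemma diff_zero: "x \<in> carrier G \<Longrightarrow> x \<ominus> \<zero> = x"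
  by (simp add: minus_eq)

lemma diff_self: "x \<in> carrier G \<Longrightarrow> x \<ominus> x = \<zero>"
  by (simp add: minus_eq r_neg)

lemma diff_diff_cancel: "x \<in> carrier G \<Longrightarrow> y \<in> carrier G \<Longrightarrow> x \<ominus> (x \<ominus> y) = y"
  by (simp add: minus_eq minus_add r_neg1 r_neg2)

lemma diff_add_cancel: "x \<in> carrier G \<Longrightarrow> y \<in> carrier G \<Longrightarrow> x \<ominus> y \<oplus> y = x"
  by (simp add: minus_eq a_assoc l_neg)

lemma diff_eq_iff:
  "x \<in> carrier G \<Longrightarrow> y \<in> carrier G \<Longrightarrow> z \<in> carrier G \<Longrightarrow> x \<ominus> y = z \<longleftrightarrow> x = z \<oplus> y"
  by (metis add.inv_closed a_assoc diff_add_cancel l_neg r_neg minus_eq r_zero)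

lemma a_inv_zero: "\<ominus> \<zero> = \<zero>"
  by (rule minus_equality) simp_all

lemma diff_add_diff:
  "x \<in> carrier G \<Longrightarrow> y \<in> carrier G \<Longrightarrow> z \<in> carrier G \<Longrightarrow> w \<in> carrier G \<Longrightarrow>
    (x \<ominus> y) \<oplus> (z \<ominus> w) = (x \<oplus> z) \<ominus> (y \<oplus> w)"
  by (simp add: minus_eq minus_add a_ac)

end

lemma linear_map_closed: "linear_map K M N f \<Longrightarrow> x \<in> carrier M \<Longrightarrow> f x \<in> carrier N"
  by (auto simp: linear_map_def)

lemma linear_map_add:
  "linear_map K M N f \<Longrightarrow> x \<in> carrier M \<Longrightarrow> y \<in> carrier M \<Longrightarrow> f (x \<oplus>\<^bsub>M\<^esub> y) = f x \<oplus>\<^bsub>N\<^esub> f y"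
  by (auto simp: linear_map_def)

lemma linear_map_smult:
  "linear_map K M N f \<Longrightarrow> a \<in> carrier K \<Longrightarrow> x \<in> carrier M \<Longrightarrow> f (a \<odot>\<^bsub>M\<^esub> x) = a \<odot>\<^bsub>N\<^esub> f x"
  by (auto simp: linear_map_def)

lemma linear_map_diff:
  assumes "module K M" "module K N" "linear_map K M N f" "x \<in> carrier M" "y \<in> carrier M"
  shows "f (x \<ominus>\<^bsub>M\<^esub> y) = f x \<ominus>\<^bsub>N\<^esub> f y"
proof -
  interpret M: module K M by (rule assms)
  interpret N: module K N by (rule assms)
  show ?thesis
    using assms linear_map_minus[OF assms(1-3,5)] linear_map_add[OF assms(3,4)]
    by (simp add: a_minus_def)
qed

lemma linear_map_id: "linear_map K M M (\<lambda>x. x)"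
  by (auto simp: linear_map_def)

lemma linear_map_comp:
  "linear_map K M N f \<Longrightarrow> linear_map K N P g \<Longrightarrow> linear_map K M P (\<lambda>x. g (f x))"
  by (auto simp: linear_map_def Pi_iff)

lemma linear_map_const_zero: "module K N \<Longrightarrow> linear_map K M N (\<lambda>x. \<zero>\<^bsub>N\<^esub>)"
  by (auto simp: linear_map_def module.smult_r_null abelian_group.axioms(1)[OF module.axioms(2)]
      abelian_monoid.zero_closed abelian_monoid.l_zero)

lemma linear_map_sum:
  assumes "module K N" "linear_map K M N f" "linear_map K M N g"
  shows "linear_map K M N (\<lambda>x. f x \<oplus>\<^bsub>N\<^esub> g x)"
proof -
  interpret N: module K N by (rule assms)
  show ?thesis using assms(2,3)
    by (auto simp: linear_map_def N.smult_r_distr Pi_iff N.a_ac)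
qed

lemma linear_map_uminus:
  assumes "module K N" "linear_map K M N f"
  shows "linear_map K M N (\<lambda>x. \<ominus>\<^bsub>N\<^esub> f x)"
proof -
  interpret N: module K N by (rule assms)
  show ?thesis using assms(2)
    by (auto simp: linear_map_def N.smult_r_minus Pi_iff N.minus_add)
qed

lemma linear_map_difference:
  assumes "module K N" "linear_map K M N f" "linear_map K M N g"
  shows "linear_map K M N (\<lambda>x. f x \<ominus>\<^bsub>N\<^esub> g x)"
  using linear_map_sum[OF assms(1,2) linear_map_uminus[OF assms(1,3)]] by (simp add: a_minus_def)

lemma linear_map_scale:
  assumes "module K N" "a \<in> carrier K"
  shows "linear_map K N N (\<lambda>x. a \<odot>\<^bsub>N\<^esub> x)"
proof -
  interpret N: module K N by (rule assms)
  show ?thesis using assms(2)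
    by (auto simp: linear_map_def N.smult_r_distr simp flip: N.smult_assoc1 intro: arg_cong2[where f="smult N"] N.R.m_comm)
qed

lemma linear_map_cong:
  assumes "module K M" "linear_map K M N g" "\<And>x. x \<in> carrier M \<Longrightarrow> f x = g x"
  shows "linear_map K M N f"
proof -
  interpret M: module K M by (rule assms)
  show ?thesis using assms(2,3) by (simp add: linear_map_def Pi_iff)
qed

lemma linear_map_eval_scale:
  assumes "module K N" "x \<in> carrier N"
  shows "linear_map K (regular_module K) N (\<lambda>a. a \<odot>\<^bsub>N\<^esub> x)"
proof -
  interpret N: module K N by (rule assms)
  show ?thesis using assms(2)
    by (auto simp: linear_map_def regular_module_def N.smult_l_distr N.smult_assoc1)
qed

lemma linear_map_finsum:
  assumes "module K M" "module K N" "linear_map K M N h"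
    and "finite S" "\<And>i. i \<in> S \<Longrightarrow> f i \<in> carrier M"
  shows "h (\<Oplus>\<^bsub>M\<^esub>i \<in> S. f i) = (\<Oplus>\<^bsub>N\<^esub>i \<in> S. h (f i))"
proof -
  interpret M: module K M by (rule assms)
  interpret N: module K N by (rule assms)
  show ?thesis using assms(4,5)
  proof (induction S rule: finite_induct)
    case empty
    show ?case using linear_map_zero[OF assms(1-3)] by simp
  next
    case (insert i S)
    then have "f \<in> S \<rightarrow> carrier M" "(\<lambda>i. h (f i)) \<in> S \<rightarrow> carrier N"
      "f i \<in> carrier M" "h (f i) \<in> carrier N"
      using linear_map_closed[OF assms(3)] by auto
    then show ?case using insert linear_map_add[OF assms(3)] by simp
  qed
qed

lemma (in abelian_monoid) finsum_mono_neutral: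
  assumes "finite B" "A \<subseteq> B" "\<And>i. i \<in> B - A \<Longrightarrow> f i = \<zero>" "\<And>i. i \<in> A \<Longrightarrow> f i \<in> carrier G"
  shows "(\<Oplus>i \<in> A. f i) = (\<Oplus>i \<in> B. f i)"
proof -
  have "f i \<in> carrier G" if "i \<in> B" for i
    using assms that by (cases "i \<in> A") auto
  then show ?thesis
    by (intro add.finprod_mono_neutral_cong_left) (use assms in auto)
qed

lemma (in abelian_monoid) finsum_filter:
  assumes "finite A" "\<And>i. i \<in> A \<Longrightarrow> P i \<Longrightarrow> f i \<in> carrier G"
  shows "(\<Oplus>i \<in> {i \<in> A. P i}. f i) = (\<Oplus>i \<in> A. if P i then f i else \<zero>)"
proof -
  have "(\<Oplus>i \<in> {i \<in> A. P i}. f i) = (\<Oplus>i \<in> {i \<in> A. P i}. if P i then f i else \<zero>)"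
    by (rule finsum_cong') (use assms in auto)
  also have "\<dots> = (\<Oplus>i \<in> A. if P i then f i else \<zero>)"
    by (rule finsum_mono_neutral) (use assms in auto)
  finally show ?thesis .
qed

text \<open>
  Scalars are left out on purpose: the generating sets below are closed under multiplication by
  scalars, so that sums of generators are all that is needed to compare two linear maps or to locate
  the image of one.
\<close>

inductive_set addspan :: "('k, 'm) module \<Rightarrow> 'm set \<Rightarrow> 'm set" for N :: "('k, 'm) module" and Y
  where addspan_zero: "\<zero>\<^bsub>N\<^esub> \<in> addspan N Y"
  | addspan_add: "x \<in> Y \<Longrightarrow> y \<in> addspan N Y \<Longrightarrow> x \<oplus>\<^bsub>N\<^esub> y \<in> addspan N Y"

context
  fixes K :: "('k, 'r) ring_scheme" and M :: "('k, 'm) module"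
  assumes M: "module K M"
begin

interpretation module K M by (rule M)

lemma addspan_closed: "Y \<subseteq> carrier M \<Longrightarrow> x \<in> addspan M Y \<Longrightarrow> x \<in> carrier M"
  by (rotate_tac, induction rule: addspan.induct) auto

lemma addspan_base: "Y \<subseteq> carrier M \<Longrightarrow> x \<in> Y \<Longrightarrow> x \<in> addspan M Y"
  using addspan_add[OF _ addspan_zero, of x Y M] by auto

lemma addspan_plus:
  assumes Y: "Y \<subseteq> carrier M" and "x \<in> addspan M Y" and y: "y \<in> addspan M Y"
  shows "x \<oplus>\<^bsub>M\<^esub> y \<in> addspan M Y"
  using assms(2)
proof (induction rule: addspan.induct)
  case addspan_zero
  then show ?case using y addspan_closed[OF Y y] by simp
next
  case (addspan_add x z)
  then have "x \<oplus>\<^bsub>M\<^esub> z \<oplus>\<^bsub>M\<^esub> y = x \<oplus>\<^bsub>M\<^esub> (z \<oplus>\<^bsub>M\<^esub> y)"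
    using a_assoc addspan_closed[OF Y] y Y by blast
  then show ?case using addspan_add addspan.addspan_add by metis
qed

end

lemma addspan_map:
  assumes M: "module K M" and N: "module K N" and f: "linear_map K M N f"
    and Y: "Y \<subseteq> carrier M" and Z: "Z \<subseteq> carrier N"
    and YZ: "\<And>y. y \<in> Y \<Longrightarrow> f y \<in> addspan N Z"
    and x: "x \<in> addspan M Y"
  shows "f x \<in> addspan N Z"
  using x
proof (induction rule: addspan.induct)
  case addspan_zero
  then show ?case using linear_map_zero[OF M N f] addspan.addspan_zero by metis
next
  case (addspan_add x y)
  interpret M: module K M by (rule M)
  interpret N: module K N by (rule N)
  have "x \<in> carrier M" "y \<in> carrier M" using addspan_add addspan_closed[OF M Y] Y by auto
  then show ?case
    using linear_map_add[OF f] addspan_plus[OF N Z YZ addspan_add.IH] addspan_add by simp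
qed

lemma addspan_eq:
  assumes M: "module K M" and N: "module K N" and f: "linear_map K M N f" and g: "linear_map K M N g"
    and Y: "Y \<subseteq> carrier M"
    and eq: "\<And>y. y \<in> Y \<Longrightarrow> f y = g y"
    and x: "x \<in> addspan M Y"
  shows "f x = g x"
  using x
proof (induction rule: addspan.induct)
  case addspan_zero
  then show ?case using linear_map_zero[OF M N f] linear_map_zero[OF M N g] by metis
next
  case (addspan_add x y)
  interpret M: module K M by (rule M)
  have "x \<in> carrier M" "y \<in> carrier M" using addspan_add addspan_closed[OF M Y] Y by auto
  then show ?case
    using linear_map_add[OF f] linear_map_add[OF g] addspan_add eq by simp
qed

section \<open>Finitely supported functions\<close>

text \<open>
  The direct sum of copies of \<open>M\<close> indexed by \<open>I\<close>.  The index set enters only through the carrier, so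
  that the direct sums over different index sets, and the modules of cycles or the kernels inside them,
  share one addition.
\<close>

definition fsupp :: "'i set \<Rightarrow> ('k, 'm) module \<Rightarrow> ('k, 'i \<Rightarrow> 'm) module"
  where "fsupp I M =
    \<lparr>carrier = {c. (\<forall>i. c i \<in> carrier M) \<and> finite {i. c i \<noteq> \<zero>\<^bsub>M\<^esub>} \<and> (\<forall>i. c i \<noteq> \<zero>\<^bsub>M\<^esub> \<longrightarrow> i \<in> I)},
     mult = undefined, one = undefined,
     zero = (\<lambda>i. \<zero>\<^bsub>M\<^esub>), add = (\<lambda>c d i. c i \<oplus>\<^bsub>M\<^esub> d i), smult = (\<lambda>a c i. a \<odot>\<^bsub>M\<^esub> c i)\<rparr>"

definition single :: "('k, 'm) module \<Rightarrow> 'i \<Rightarrow> 'm \<Rightarrow> 'i \<Rightarrow> 'm"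
  where "single M i m = (\<lambda>j. if j = i then m else \<zero>\<^bsub>M\<^esub>)"

text \<open>The universal property of the direct sum: the map that is \<open>\<phi> i\<close> on the summand with index \<open>i\<close>.\<close>

definition lin_ext :: "('k, 'm) module \<Rightarrow> ('k, 'n) module \<Rightarrow> ('i \<Rightarrow> 'm \<Rightarrow> 'n) \<Rightarrow> ('i \<Rightarrow> 'm) \<Rightarrow> 'n"
  where "lin_ext M N \<phi> c = (\<Oplus>\<^bsub>N\<^esub>i \<in> {i. c i \<noteq> \<zero>\<^bsub>M\<^esub>}. \<phi> i (c i))"

lemma fsupp_simps [simp]:
  "\<zero>\<^bsub>fsupp I M\<^esub> = (\<lambda>i. \<zero>\<^bsub>M\<^esub>)"
  "c \<oplus>\<^bsub>fsupp I M\<^esub> d = (\<lambda>i. c i \<oplus>\<^bsub>M\<^esub> d i)"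
  "a \<odot>\<^bsub>fsupp I M\<^esub> c = (\<lambda>i. a \<odot>\<^bsub>M\<^esub> c i)"
  by (simp_all add: fsupp_def)

lemma in_fsupp:
  "c \<in> carrier (fsupp I M) \<longleftrightarrow>
    (\<forall>i. c i \<in> carrier M) \<and> finite {i. c i \<noteq> \<zero>\<^bsub>M\<^esub>} \<and> (\<forall>i. c i \<noteq> \<zero>\<^bsub>M\<^esub> \<longrightarrow> i \<in> I)"
  by (simp add: fsupp_def)

lemma fsupp_mono: "I \<subseteq> J \<Longrightarrow> carrier (fsupp I M) \<subseteq> carrier (fsupp J M)"
  by (auto simp: in_fsupp subset_iff)

lemma finite_support_image:
  assumes "finite {i. c i \<noteq> z}" "\<And>i. c i = z \<Longrightarrow> e i = z'"
  shows "finite {i. e i \<noteq> z'}"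
  by (rule finite_subset[OF _ assms(1)]) (use assms(2) in auto)

context
  fixes K :: "('k, 'r) ring_scheme" and M :: "('k, 'm) module"
  assumes M: "module K M"
begin

interpretation module K M by (rule M)

lemma fsupp_module: "module K (fsupp I M)"
proof (rule moduleI)
  show "cring K" by (rule R.is_cring)
  have fin: "finite {i. c i \<oplus>\<^bsub>M\<^esub> d i \<noteq> \<zero>\<^bsub>M\<^esub>}"
    if "finite {i. c i \<noteq> \<zero>\<^bsub>M\<^esub>}" "finite {i. d i \<noteq> \<zero>\<^bsub>M\<^esub>}" for c d :: "'i \<Rightarrow> 'm"
    by (rule finite_subset[OF _ finite_UnI[OF that]]) (auto intro: ccontr)
  show "abelian_group (fsupp I M)"
  proof (rule abelian_groupI)
    fix c assume c: "c \<in> carrier (fsupp I M)"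
    show "\<exists>d \<in> carrier (fsupp I M). d \<oplus>\<^bsub>fsupp I M\<^esub> c = \<zero>\<^bsub>fsupp I M\<^esub>"
    proof (rule bexI[of _ "\<lambda>i. \<ominus>\<^bsub>M\<^esub> c i"])
      show "(\<lambda>i. \<ominus>\<^bsub>M\<^esub> c i) \<in> carrier (fsupp I M)"
        using c by (auto simp: in_fsupp elim!: finite_support_image)
    qed (use c in \<open>auto simp: in_fsupp l_neg\<close>)
  next
    fix c d assume "c \<in> carrier (fsupp I M)" "d \<in> carrier (fsupp I M)"
    then show "c \<oplus>\<^bsub>fsupp I M\<^esub> d \<in> carrier (fsupp I M)"
      using fin by (auto simp: in_fsupp) (metis l_zero zero_closed)
  qed (auto simp: in_fsupp a_ac)
  show "a \<odot>\<^bsub>fsupp I M\<^esub> c \<in> carrier (fsupp I M)"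
    if "a \<in> carrier K" "c \<in> carrier (fsupp I M)" for a c
    using that by (auto simp: in_fsupp elim!: finite_support_image) (metis smult_r_null)
qed (auto simp: in_fsupp smult_l_distr smult_r_distr smult_assoc1)

lemma fsupp_minus: "c \<in> carrier (fsupp I M) \<Longrightarrow> \<ominus>\<^bsub>fsupp I M\<^esub> c = (\<lambda>i. \<ominus>\<^bsub>M\<^esub> c i)"
proof -
  assume c: "c \<in> carrier (fsupp I M)"
  interpret F: module K "fsupp I M" by (rule fsupp_module)
  have "(\<lambda>i. \<ominus>\<^bsub>M\<^esub> c i) \<in> carrier (fsupp I M)"
    using c by (auto simp: in_fsupp elim!: finite_support_image)
  moreover have "(\<lambda>i. \<ominus>\<^bsub>M\<^esub> c i) \<oplus>\<^bsub>fsupp I M\<^esub> c = \<zero>\<^bsub>fsupp I M\<^esub>"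
    using c by (auto simp: in_fsupp l_neg)
  ultimately show ?thesis using F.minus_equality c by blast
qed

lemma fsupp_diff:
  "c \<in> carrier (fsupp I M) \<Longrightarrow> d \<in> carrier (fsupp I M) \<Longrightarrow> c \<ominus>\<^bsub>fsupp I M\<^esub> d = (\<lambda>i. c i \<ominus>\<^bsub>M\<^esub> d i)"
  by (simp add: a_minus_def fsupp_minus)

lemma single_closed: "i \<in> I \<Longrightarrow> m \<in> carrier M \<Longrightarrow> single M i m \<in> carrier (fsupp I M)"
  by (auto simp: in_fsupp single_def)

lemma single_zero [simp]: "single M i \<zero>\<^bsub>M\<^esub> = (\<lambda>j. \<zero>\<^bsub>M\<^esub>)"
  by (auto simp: single_def)

lemma linear_map_single: "i \<in> I \<Longrightarrow> linear_map K M (fsupp I M) (single M i)"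
  using single_closed by (auto simp: linear_map_def) (auto simp: single_def)

lemma linear_map_eval: "linear_map K (fsupp I M) M (\<lambda>c. c i)"
  by (auto simp: linear_map_def in_fsupp)

text \<open>The points of the support are split off one at a time.\<close>

lemma fsupp_addspan:
  assumes "carrier M \<subseteq> addspan M Y" "Y \<subseteq> carrier M"
  shows "carrier (fsupp I M) = addspan (fsupp I M) {single M i y |i y. i \<in> I \<and> y \<in> Y}"
    (is "_ = addspan _ ?Z")
proof
  interpret F: module K "fsupp I M" by (rule fsupp_module)
  have Z: "?Z \<subseteq> carrier (fsupp I M)" using assms(2) by (clarsimp simp: single_closed subset_iff)
  then show "addspan (fsupp I M) ?Z \<subseteq> carrier (fsupp I M)"
    using addspan_closed[OF fsupp_module] by (intro subsetI)
  have "\<forall>c. c \<in> carrier (fsupp I M) \<longrightarrow> {i. c i \<noteq> \<zero>\<^bsub>M\<^esub>} = S \<longrightarrow> c \<in> addspan (fsupp I M) ?Z"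
    if "finite S" for S using that
  proof (induction S rule: finite_induct)
    case empty
    have "c = (\<lambda>i. \<zero>\<^bsub>M\<^esub>)" if "{i. c i \<noteq> \<zero>\<^bsub>M\<^esub>} = {}" for c :: "'i \<Rightarrow> 'm" using that by (intro ext) auto
    then show ?case using addspan_zero[of "fsupp I M" ?Z] by (simp only: fsupp_simps) blast
  next
    case (insert j S)
    show ?case
    proof (intro allI impI)
      fix c assume c: "c \<in> carrier (fsupp I M)" "{i. c i \<noteq> \<zero>\<^bsub>M\<^esub>} = insert j S"
      then have j: "j \<in> I" "c j \<in> carrier M" by (auto simp: in_fsupp)
      have "finite {i. (c(j := \<zero>\<^bsub>M\<^esub>)) i \<noteq> \<zero>\<^bsub>M\<^esub>}"
        by (rule finite_subset[of _ "{i. c i \<noteq> \<zero>\<^bsub>M\<^esub>}"]) (use c(1) in \<open>auto simp: in_fsupp\<close>)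
      then have "c(j := \<zero>\<^bsub>M\<^esub>) \<in> carrier (fsupp I M)"
        using c(1) by (simp add: in_fsupp)
      moreover have "{i. (c(j := \<zero>\<^bsub>M\<^esub>)) i \<noteq> \<zero>\<^bsub>M\<^esub>} = S" using c(2) insert(2) by auto
      ultimately have 1: "c(j := \<zero>\<^bsub>M\<^esub>) \<in> addspan (fsupp I M) ?Z"
        using insert.IH by (simp only:)
      have 2: "single M j (c j) \<in> addspan (fsupp I M) ?Z"
      proof (rule addspan_map[OF M fsupp_module linear_map_single[OF j(1)] assms(2) Z])
        show "single M j y \<in> addspan (fsupp I M) ?Z" if "y \<in> Y" for y
          by (rule addspan_base[OF fsupp_module Z]) (use that j(1) in blast)
        show "c j \<in> addspan M Y" using assms(1) j(2) by blast
      qed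
      have "c = single M j (c j) \<oplus>\<^bsub>fsupp I M\<^esub> c(j := \<zero>\<^bsub>M\<^esub>)"
        using c(1) by (intro ext) (simp add: single_def in_fsupp)
      then show "c \<in> addspan (fsupp I M) ?Z" using addspan_plus[OF fsupp_module Z 2 1] by (simp only:)
    qed
  qed
  then show "carrier (fsupp I M) \<subseteq> addspan (fsupp I M) ?Z" by (auto simp: in_fsupp)
qed

lemma carrier_addspan: "carrier M \<subseteq> addspan M (carrier M)"
  by (intro subsetI addspan_base[OF M] subset_refl)

end

lemma linear_map_eqI:
  assumes M: "module K M" and N: "module K N"
    and f: "linear_map K (fsupp I M) N f" and g: "linear_map K (fsupp I M) N g"
    and eq: "\<And>i m. i \<in> I \<Longrightarrow> m \<in> carrier M \<Longrightarrow> f (single M i m) = g (single M i m)"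
    and c: "c \<in> carrier (fsupp I M)"
  shows "f c = g c"
proof (rule addspan_eq[OF fsupp_module[OF M] N f g])
  show "c \<in> addspan (fsupp I M) {single M i y |i y. i \<in> I \<and> y \<in> carrier M}"
    using fsupp_addspan[OF M carrier_addspan[OF M] subset_refl] c by metis
  show "{single M i y |i y. i \<in> I \<and> y \<in> carrier M} \<subseteq> carrier (fsupp I M)"
    by (auto simp: single_closed[OF M])
qed (use eq in auto)

text \<open>Two layers of coefficients.\<close>

lemma linear_map_eqI2:
  assumes M: "module K M" and N: "module K N"
    and f: "linear_map K (fsupp I (fsupp J M)) N f" and g: "linear_map K (fsupp I (fsupp J M)) N g"
    and eq: "\<And>i j m. i \<in> I \<Longrightarrow> j \<in> J \<Longrightarrow> m \<in> carrier M \<Longrightarrow>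
      f (single (fsupp J M) i (single M j m)) = g (single (fsupp J M) i (single M j m))"
    and c: "c \<in> carrier (fsupp I (fsupp J M))"
  shows "f c = g c"
proof (rule linear_map_eqI[OF fsupp_module[OF M] N f g _ c])
  fix i m assume i: "i \<in> I" and m: "m \<in> carrier (fsupp J M)"
  note s = linear_map_single[OF fsupp_module[OF M] i, of J]
  show "f (single (fsupp J M) i m) = g (single (fsupp J M) i m)"
    by (rule linear_map_eqI[OF M N linear_map_comp[OF s f] linear_map_comp[OF s g] _ m])
      (use eq i in auto)
qed

text \<open>This lets the values of \<open>lin_ext\<close> at two functions be computed over a common index set.\<close>

lemma lin_ext_superset:
  assumes "module K M" "module K N" "\<And>i. i \<in> I \<Longrightarrow> linear_map K M N (\<phi> i)"
    and c: "c \<in> carrier (fsupp I M)" and S: "finite S" "{i. c i \<noteq> \<zero>\<^bsub>M\<^esub>} \<subseteq> S" "S \<subseteq> I"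
  shows "lin_ext M N \<phi> c = (\<Oplus>\<^bsub>N\<^esub>i \<in> S. \<phi> i (c i))"
proof -
  interpret N: module K N by (rule assms)
  show ?thesis
    unfolding lin_ext_def
  proof (rule N.finsum_mono_neutral[OF S(1,2)])
    show "\<phi> i (c i) = \<zero>\<^bsub>N\<^esub>" if "i \<in> S - {i. c i \<noteq> \<zero>\<^bsub>M\<^esub>}" for i
      using that linear_map_zero[OF assms(1,2) assms(3)[of i]] S by auto
    show "\<phi> i (c i) \<in> carrier N" if "i \<in> {i. c i \<noteq> \<zero>\<^bsub>M\<^esub>}" for i
      using that c linear_map_closed[OF assms(3)[of i]] by (auto simp: in_fsupp)
  qed
qed

lemma linear_map_lin_ext:
  assumes M: "module K M" and N: "module K N" and \<phi>: "\<And>i. i \<in> I \<Longrightarrow> linear_map K M N (\<phi> i)"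
  shows "linear_map K (fsupp I M) N (lin_ext M N \<phi>)"
proof -
  interpret M: module K M by (rule M)
  interpret N: module K N by (rule N)
  interpret F: module K "fsupp I M" by (rule fsupp_module[OF M])
  have cl: "\<phi> i (c i) \<in> carrier N" if "c \<in> carrier (fsupp I M)" "i \<in> I" for c i
    using that linear_map_closed[OF \<phi>[of i]] by (auto simp: in_fsupp)
  note sup = lin_ext_superset[OF M N \<phi>]
  show ?thesis
    unfolding linear_map_def
  proof (intro conjI ballI funcsetI)
    fix c assume c: "c \<in> carrier (fsupp I M)"
    show "lin_ext M N \<phi> c \<in> carrier N"
      unfolding lin_ext_def using c cl[OF c] by (intro N.finsum_closed) (auto simp: in_fsupp)
  next
    fix c e assume c: "c \<in> carrier (fsupp I M)" and e: "e \<in> carrier (fsupp I M)"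
    define S where "S = {i. c i \<noteq> \<zero>\<^bsub>M\<^esub>} \<union> {i. e i \<noteq> \<zero>\<^bsub>M\<^esub>}"
    have S: "finite S" "S \<subseteq> I" "{i. c i \<noteq> \<zero>\<^bsub>M\<^esub>} \<subseteq> S" "{i. e i \<noteq> \<zero>\<^bsub>M\<^esub>} \<subseteq> S"
      using c e by (auto simp: S_def in_fsupp)
    have S': "{i. (c \<oplus>\<^bsub>fsupp I M\<^esub> e) i \<noteq> \<zero>\<^bsub>M\<^esub>} \<subseteq> S" by (auto simp: S_def)
    have "lin_ext M N \<phi> (c \<oplus>\<^bsub>fsupp I M\<^esub> e) = (\<Oplus>\<^bsub>N\<^esub>i \<in> S. \<phi> i ((c \<oplus>\<^bsub>fsupp I M\<^esub> e) i))"
      by (rule sup[OF _ F.a_closed[OF c e] S(1) S' S(2)])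
    also have "\<dots> = (\<Oplus>\<^bsub>N\<^esub>i \<in> S. \<phi> i (c i) \<oplus>\<^bsub>N\<^esub> \<phi> i (e i))"
      by (rule N.finsum_cong')
        (use S(2) c e cl linear_map_add[OF \<phi>] in \<open>auto simp: in_fsupp subset_iff\<close>)
    also have "\<dots> = (\<Oplus>\<^bsub>N\<^esub>i \<in> S. \<phi> i (c i)) \<oplus>\<^bsub>N\<^esub> (\<Oplus>\<^bsub>N\<^esub>i \<in> S. \<phi> i (e i))"
      by (rule N.finsum_addf) (use S(2) cl c e in auto)
    also have "\<dots> = lin_ext M N \<phi> c \<oplus>\<^bsub>N\<^esub> lin_ext M N \<phi> e"
      using sup[OF _ c S(1,3,2)] sup[OF _ e S(1,4,2)] by simp
    finally show "lin_ext M N \<phi> (c \<oplus>\<^bsub>fsupp I M\<^esub> e) = lin_ext M N \<phi> c \<oplus>\<^bsub>N\<^esub> lin_ext M N \<phi> e" .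
  next
    fix a c assume a: "a \<in> carrier K" and c: "c \<in> carrier (fsupp I M)"
    have S: "finite {i. c i \<noteq> \<zero>\<^bsub>M\<^esub>}" "{i. c i \<noteq> \<zero>\<^bsub>M\<^esub>} \<subseteq> I"
      using c by (auto simp: in_fsupp)
    have "lin_ext M N \<phi> (a \<odot>\<^bsub>fsupp I M\<^esub> c) = (\<Oplus>\<^bsub>N\<^esub>i \<in> {i. c i \<noteq> \<zero>\<^bsub>M\<^esub>}. \<phi> i ((a \<odot>\<^bsub>fsupp I M\<^esub> c) i))"
      by (rule sup[OF _ F.smult_closed[OF a c] S(1) _ S(2)]) (use a in auto)
    also have "\<dots> = (\<Oplus>\<^bsub>N\<^esub>i \<in> {i. c i \<noteq> \<zero>\<^bsub>M\<^esub>}. a \<odot>\<^bsub>N\<^esub> \<phi> i (c i))"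
      by (rule N.finsum_cong')
        (use S(2) a c cl linear_map_smult[OF \<phi>] in \<open>auto simp: in_fsupp subset_iff\<close>)
    also have "\<dots> = a \<odot>\<^bsub>N\<^esub> lin_ext M N \<phi> c"
      unfolding lin_ext_def
      by (rule linear_map_finsum[OF N N linear_map_scale[OF N a] S(1), symmetric])
        (use cl[OF c] S(2) in auto)
    finally show "lin_ext M N \<phi> (a \<odot>\<^bsub>fsupp I M\<^esub> c) = a \<odot>\<^bsub>N\<^esub> lin_ext M N \<phi> c" .
  qed
qed

lemma lin_ext_single:
  assumes M: "module K M" and N: "module K N" and "linear_map K M N (\<phi> i)" "m \<in> carrier M"
  shows "lin_ext M N \<phi> (single M i m) = \<phi> i m"
proof -
  interpret M: module K M by (rule M)
  interpret N: module K N by (rule N)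
  have "lin_ext M N \<phi> (single M i m) = (\<Oplus>\<^bsub>N\<^esub>j \<in> {i}. \<phi> j (single M i m j))"
    by (rule lin_ext_superset[OF M N, of "{i}"])
      (use assms single_closed[OF M, of i "{i}" m] in \<open>auto simp: single_def\<close>)
  then show ?thesis using linear_map_closed[OF assms(3,4)] by (simp add: single_def)
qed

lemma lin_ext_eval:
  assumes M: "module K M" and N: "module K N"
    and \<phi>: "\<And>i. i \<in> I \<Longrightarrow> linear_map K M (fsupp J N) (\<phi> i)"
    and c: "c \<in> carrier (fsupp I M)"
  shows "lin_ext M (fsupp J N) \<phi> c j = (\<Oplus>\<^bsub>N\<^esub>i \<in> {i. c i \<noteq> \<zero>\<^bsub>M\<^esub>}. \<phi> i (c i) j)"
  unfolding lin_ext_def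
  by (rule linear_map_finsum[OF fsupp_module[OF N] N linear_map_eval[OF N]])
    (use c linear_map_closed[OF \<phi>] in \<open>auto simp: in_fsupp[of c]\<close>)

lemma linear_map_subset:
  "linear_map K (fsupp J M) N f \<Longrightarrow> I \<subseteq> J \<Longrightarrow> linear_map K (fsupp I M) N f"
  using fsupp_mono[of I J M] by (auto simp: linear_map_def subset_iff)

lemma module_regular:
  assumes "cring K"
  shows "module K (regular_module K)"
proof -
  interpret cring K by (rule assms)
  have "abelian_group (regular_module K)"
  proof (rule abelian_groupI)
    fix x assume "x \<in> carrier (regular_module K)"
    then show "\<exists>y \<in> carrier (regular_module K).
        y \<oplus>\<^bsub>regular_module K\<^esub> x = \<zero>\<^bsub>regular_module K\<^esub>"
      by (intro bexI[of _ "\<ominus>\<^bsub>K\<^esub> x"]) (auto simp: regular_module_def l_neg)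
  qed (simp_all add: regular_module_def a_ac)
  then show ?thesis
    by (intro moduleI assms) (simp_all add: regular_module_def l_distr r_distr m_assoc)
qed

lemma linear_map_supports:
  assumes M: "module K M" and N: "module K N"
    and f: "linear_map K (fsupp I M) (fsupp J N) f" and I': "I' \<subseteq> I" and J': "J' \<subseteq> J"
    and fs: "\<And>i m. i \<in> I' \<Longrightarrow> m \<in> carrier M \<Longrightarrow> f (single M i m) \<in> carrier (fsupp J' N)"
    and c: "c \<in> carrier (fsupp I' M)"
  shows "f c \<in> carrier (fsupp J' N)"
proof -
  interpret N': module K "fsupp J' N" by (rule fsupp_module[OF N])
  have Z: "{single M i y |i y. i \<in> I' \<and> y \<in> carrier M} \<subseteq> carrier (fsupp I' M)"
    by (auto simp: single_closed[OF M])
  have "c \<in> addspan (fsupp I' M) {single M i y |i y. i \<in> I' \<and> y \<in> carrier M}"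
    using fsupp_addspan[OF M carrier_addspan[OF M] subset_refl] c by metis
  then show ?thesis
  proof (induction rule: addspan.induct)
    case addspan_zero
    have "f \<zero>\<^bsub>fsupp I M\<^esub> = \<zero>\<^bsub>fsupp J N\<^esub>"
      by (rule linear_map_zero[OF fsupp_module[OF M] fsupp_module[OF N] f])
    then show ?case using N'.zero_closed by simp
  next
    case (addspan_add x y)
    have xy: "x \<in> carrier (fsupp I M)" "y \<in> carrier (fsupp I M)"
      using addspan_add Z addspan_closed[OF fsupp_module[OF M] Z] fsupp_mono[OF I'] by blast+
    have "f (x \<oplus>\<^bsub>fsupp I M\<^esub> y) = f x \<oplus>\<^bsub>fsupp J N\<^esub> f y"
      by (rule linear_map_add[OF f xy])
    moreover have "f x \<in> carrier (fsupp J' N)" using addspan_add.hyps(1) fs by blast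
    ultimately show ?case using N'.a_closed[OF _ addspan_add.IH] by simp
  qed
qed

section \<open>The bar complex\<close>

locale group_rep =
  fixes G :: "('g, 'b) monoid_scheme" and K :: "('k, 'r) ring_scheme"
    and M :: "('k, 'm) module" and act :: "'g \<Rightarrow> 'm \<Rightarrow> 'm"
  assumes grp: "group G" and mod: "module K M"
    and act_linear: "g \<in> carrier G \<Longrightarrow> linear_map K M M (act g)"
    and act_one: "m \<in> carrier M \<Longrightarrow> act \<one>\<^bsub>G\<^esub> m = m"
    and act_mult: "g \<in> carrier G \<Longrightarrow> h \<in> carrier G \<Longrightarrow> m \<in> carrier M \<Longrightarrow>
      act (g \<otimes>\<^bsub>G\<^esub> h) m = act g (act h m)"
begin

sublocale G: group G by (rule grp)
sublocale M: module K M by (rule mod)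

text \<open>
  The chains of all degrees together.  There is then one differential \<open>bd\<close>, and the degrees appear
  only when the support is restricted.
\<close>

definition Ch :: "('k, 'g list \<Rightarrow> 'm) module"
  where "Ch = fsupp (lists (carrier G)) M"

sublocale Ch: module K Ch unfolding Ch_def by (rule fsupp_module[OF mod])

text \<open>
  The differential is \<open>tail - inner\<close>.  Here \<open>tail\<close> is the face that drops the first entry, and \<open>inner\<close> is
  the alternating sum of the other faces, starting with a plus sign.  The latter is the differential of
  the bar resolution of \<open>M\<close>, on which the group acts by \<open>lmul\<close> and which is contracted by prepending the
  identity; it is determined, starting from zero on empty lists, by the rule \<open>inner (pre g c) = lmul g c - pre g (inner c)\<close>.  With this rule every
  identity between chains follows by induction on lists, without sums over faces.
\<close>

definition pre :: "'g \<Rightarrow> ('g list \<Rightarrow> 'm) \<Rightarrow> 'g list \<Rightarrow> 'm"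
  where "pre g = lin_ext M Ch (\<lambda>gs. single M (g # gs))"

definition lmul_cell :: "'g \<Rightarrow> 'g list \<Rightarrow> 'm \<Rightarrow> 'g list \<Rightarrow> 'm"
  where "lmul_cell g gs m =
    (case gs of [] \<Rightarrow> single M [] (act g m) | x # xs \<Rightarrow> single M ((g \<otimes>\<^bsub>G\<^esub> x) # xs) m)"

definition lmul :: "'g \<Rightarrow> ('g list \<Rightarrow> 'm) \<Rightarrow> 'g list \<Rightarrow> 'm"
  where "lmul g = lin_ext M Ch (lmul_cell g)"

definition tail :: "('g list \<Rightarrow> 'm) \<Rightarrow> 'g list \<Rightarrow> 'm"
  where "tail = lin_ext M Ch (\<lambda>gs m. case gs of [] \<Rightarrow> \<zero>\<^bsub>Ch\<^esub> | x # xs \<Rightarrow> single M xs m)"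

primrec inner_cell :: "'g list \<Rightarrow> 'm \<Rightarrow> 'g list \<Rightarrow> 'm"
  where "inner_cell [] m = \<zero>\<^bsub>Ch\<^esub>"
  | "inner_cell (g # gs) m = lmul_cell g gs m \<ominus>\<^bsub>Ch\<^esub> pre g (inner_cell gs m)"

definition inner :: "('g list \<Rightarrow> 'm) \<Rightarrow> 'g list \<Rightarrow> 'm"
  where "inner = lin_ext M Ch inner_cell"

definition bd :: "('g list \<Rightarrow> 'm) \<Rightarrow> 'g list \<Rightarrow> 'm"
  where "bd c = tail c \<ominus>\<^bsub>Ch\<^esub> inner c"

lemma single_Ch: "gs \<in> lists (carrier G) \<Longrightarrow> m \<in> carrier M \<Longrightarrow> single M gs m \<in> carrier Ch"
  unfolding Ch_def by (rule single_closed[OF mod])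

lemma single_linear: "gs \<in> lists (carrier G) \<Longrightarrow> linear_map K M Ch (single M gs)"
  unfolding Ch_def by (rule linear_map_single[OF mod])

lemma act_closed: "g \<in> carrier G \<Longrightarrow> m \<in> carrier M \<Longrightarrow> act g m \<in> carrier M"
  by (rule linear_map_closed[OF act_linear])

lemma Ch_eqI:
  assumes "module K N" "linear_map K Ch N f" "linear_map K Ch N f'"
    and "\<And>gs m. gs \<in> lists (carrier G) \<Longrightarrow> m \<in> carrier M \<Longrightarrow> f (single M gs m) = f' (single M gs m)"
    and "c \<in> carrier Ch"
  shows "f c = f' c"
proof (rule linear_map_eqI[where f=f and g=f' and c=c, OF mod assms(1)])
  show "linear_map K (fsupp (lists (carrier G)) M) N f" using assms(2) by (simp only: Ch_def)
  show "linear_map K (fsupp (lists (carrier G)) M) N f'" using assms(3) by (simp only: Ch_def)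
  show "c \<in> carrier (fsupp (lists (carrier G)) M)" using assms(5) by (simp only: Ch_def)
qed (rule assms(4))

lemma ext_linear:
  assumes "module K N" "\<And>gs. gs \<in> lists (carrier G) \<Longrightarrow> linear_map K M N (\<phi> gs)"
  shows "linear_map K Ch N (lin_ext M N \<phi>)"
  unfolding Ch_def by (rule linear_map_lin_ext[OF mod assms])

lemma ext_single:
  assumes "module K N" "\<And>gs. gs \<in> lists (carrier G) \<Longrightarrow> linear_map K M N (\<phi> gs)"
    and "gs \<in> lists (carrier G)" "m \<in> carrier M"
  shows "lin_ext M N \<phi> (single M gs m) = \<phi> gs m"
  by (rule lin_ext_single[where \<phi>=\<phi>, OF mod assms(1) assms(2)[OF assms(3)] assms(4)])

lemma pre_linear: "g \<in> carrier G \<Longrightarrow> linear_map K Ch Ch (pre g)"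
  unfolding pre_def by (rule ext_linear[OF Ch.module_axioms single_linear]) auto

lemma pre_single:
  "g \<in> carrier G \<Longrightarrow> gs \<in> lists (carrier G) \<Longrightarrow> m \<in> carrier M \<Longrightarrow>
    pre g (single M gs m) = single M (g # gs) m"
  unfolding pre_def by (rule ext_single[OF Ch.module_axioms single_linear]) auto

lemma lmul_cell_linear:
  "g \<in> carrier G \<Longrightarrow> gs \<in> lists (carrier G) \<Longrightarrow> linear_map K M Ch (lmul_cell g gs)"
  unfolding lmul_cell_def
  by (cases gs) (auto intro!: single_linear linear_map_comp[OF act_linear single_linear])

lemma lmul_linear: "g \<in> carrier G \<Longrightarrow> linear_map K Ch Ch (lmul g)"
  unfolding lmul_def by (rule ext_linear[OF Ch.module_axioms lmul_cell_linear])

lemma lmul_single: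
  "g \<in> carrier G \<Longrightarrow> gs \<in> lists (carrier G) \<Longrightarrow> m \<in> carrier M \<Longrightarrow>
    lmul g (single M gs m) = lmul_cell g gs m"
  unfolding lmul_def by (rule ext_single[OF Ch.module_axioms lmul_cell_linear])

lemma lmul_single_Nil:
  "g \<in> carrier G \<Longrightarrow> m \<in> carrier M \<Longrightarrow> lmul g (single M [] m) = single M [] (act g m)"
  by (simp add: lmul_single lmul_cell_def)

lemma lmul_single_Cons:
  "g \<in> carrier G \<Longrightarrow> x \<in> carrier G \<Longrightarrow> gs \<in> lists (carrier G) \<Longrightarrow> m \<in> carrier M \<Longrightarrow>
    lmul g (single M (x # gs) m) = single M ((g \<otimes>\<^bsub>G\<^esub> x) # gs) m"
  by (simp add: lmul_single lmul_cell_def)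

lemma tail_cell_linear:
  "gs \<in> lists (carrier G) \<Longrightarrow>
    linear_map K M Ch (\<lambda>m. case gs of [] \<Rightarrow> \<zero>\<^bsub>Ch\<^esub> | x # xs \<Rightarrow> single M xs m)"
  by (cases gs) (auto intro!: single_linear linear_map_const_zero[OF Ch.module_axioms])

lemma tail_linear: "linear_map K Ch Ch tail"
  unfolding tail_def by (rule ext_linear[OF Ch.module_axioms tail_cell_linear])

lemma tail_single:
  "gs \<in> lists (carrier G) \<Longrightarrow> m \<in> carrier M \<Longrightarrow>
    tail (single M gs m) = (case gs of [] \<Rightarrow> \<zero>\<^bsub>Ch\<^esub> | x # xs \<Rightarrow> single M xs m)"
  unfolding tail_def by (rule ext_single[OF Ch.module_axioms tail_cell_linear])

lemma inner_cell_linear: "gs \<in> lists (carrier G) \<Longrightarrow> linear_map K M Ch (inner_cell gs)"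
proof (induction gs)
  case Nil
  show ?case using linear_map_const_zero[OF Ch.module_axioms] by simp
next
  case (Cons g gs)
  then have g: "g \<in> carrier G" "gs \<in> lists (carrier G)" by auto
  show ?case
    using linear_map_difference[OF Ch.module_axioms lmul_cell_linear[OF g]
        linear_map_comp[OF Cons.IH[OF g(2)] pre_linear[OF g(1)]]] by simp
qed

lemma inner_linear: "linear_map K Ch Ch inner"
  unfolding inner_def by (rule ext_linear[OF Ch.module_axioms inner_cell_linear])

lemma inner_single:
  "gs \<in> lists (carrier G) \<Longrightarrow> m \<in> carrier M \<Longrightarrow> inner (single M gs m) = inner_cell gs m"
  unfolding inner_def by (rule ext_single[OF Ch.module_axioms inner_cell_linear])

lemma bd_linear: "linear_map K Ch Ch bd"
proof -
  have "bd = (\<lambda>c. tail c \<ominus>\<^bsub>Ch\<^esub> inner c)" by (auto simp: bd_def)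
  then show ?thesis
    using linear_map_difference[OF Ch.module_axioms tail_linear inner_linear] by simp
qed

lemmas pre_closed = linear_map_closed[OF pre_linear]
  and lmul_closed = linear_map_closed[OF lmul_linear]
  and tail_closed = linear_map_closed[OF tail_linear]
  and inner_closed = linear_map_closed[OF inner_linear]
  and bd_closed = linear_map_closed[OF bd_linear]

lemma tail_pre: "g \<in> carrier G \<Longrightarrow> c \<in> carrier Ch \<Longrightarrow> tail (pre g c) = c"
  by (rule Ch_eqI[OF Ch.module_axioms linear_map_comp[OF pre_linear tail_linear] linear_map_id])
    (simp_all add: pre_single tail_single)

lemma inner_pre:
  "g \<in> carrier G \<Longrightarrow> c \<in> carrier Ch \<Longrightarrow> inner (pre g c) = lmul g c \<ominus>\<^bsub>Ch\<^esub> pre g (inner c)"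
  by (rule Ch_eqI[OF Ch.module_axioms linear_map_comp[OF pre_linear inner_linear]
        linear_map_difference[OF Ch.module_axioms lmul_linear linear_map_comp[OF inner_linear pre_linear]]])
    (simp_all add: pre_single inner_single lmul_single)

lemma lmul_pre:
  "g \<in> carrier G \<Longrightarrow> h \<in> carrier G \<Longrightarrow> c \<in> carrier Ch \<Longrightarrow> lmul g (pre h c) = pre (g \<otimes>\<^bsub>G\<^esub> h) c"
  by (rule Ch_eqI[OF Ch.module_axioms linear_map_comp[OF pre_linear lmul_linear] pre_linear])
    (simp_all add: pre_single lmul_single lmul_cell_def)

lemma lmul_lmul:
  assumes g: "g \<in> carrier G" and h: "h \<in> carrier G" and c: "c \<in> carrier Ch"
  shows "lmul g (lmul h c) = lmul (g \<otimes>\<^bsub>G\<^esub> h) c"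
proof (rule Ch_eqI[OF Ch.module_axioms linear_map_comp[OF lmul_linear[OF h] lmul_linear[OF g]]
      lmul_linear[OF G.m_closed[OF g h]] _ c])
  fix gs m assume "gs \<in> lists (carrier G)" "m \<in> carrier M"
  then show "lmul g (lmul h (single M gs m)) = lmul (g \<otimes>\<^bsub>G\<^esub> h) (single M gs m)"
    using g h by (cases gs) (auto simp: lmul_single_Nil lmul_single_Cons act_closed act_mult G.m_assoc)
qed

lemma tail_lmul: "g \<in> carrier G \<Longrightarrow> c \<in> carrier Ch \<Longrightarrow> tail (lmul g c) = tail c"
proof (rule Ch_eqI[OF Ch.module_axioms linear_map_comp[OF lmul_linear tail_linear] tail_linear])
  fix gs m assume "g \<in> carrier G" "gs \<in> lists (carrier G)" "m \<in> carrier M"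
  then show "tail (lmul g (single M gs m)) = tail (single M gs m)"
    by (cases gs) (auto simp: lmul_single_Nil lmul_single_Cons tail_single act_closed)
qed auto

text \<open>Every cell is obtained from an empty one by prepending.\<close>

lemma cell_induct:
  assumes "gs \<in> lists (carrier G)" "m \<in> carrier M"
    and "P (single M [] m)"
    and "\<And>g c. g \<in> carrier G \<Longrightarrow> c \<in> carrier Ch \<Longrightarrow> P c \<Longrightarrow> P (pre g c)"
  shows "P (single M gs m)"
  using assms(1)
proof (induction gs)
  case Nil
  show ?case by (rule assms(3))
next
  case (Cons g gs)
  then have "P (pre g (single M gs m))" using assms(2,4) single_Ch by auto
  then show ?case using Cons assms(2) by (simp add: pre_single)
qed

lemma inner_Nil: "m \<in> carrier M \<Longrightarrow> inner (single M [] m) = \<zero>\<^bsub>Ch\<^esub>"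
  by (simp add: inner_single)

lemma tail_Nil: "m \<in> carrier M \<Longrightarrow> tail (single M [] m) = \<zero>\<^bsub>Ch\<^esub>"
  by (simp add: tail_single)

lemma inner_zero: "inner \<zero>\<^bsub>Ch\<^esub> = \<zero>\<^bsub>Ch\<^esub>"
  and bd_zero: "bd \<zero>\<^bsub>Ch\<^esub> = \<zero>\<^bsub>Ch\<^esub>"
  by (rule linear_map_zero[OF Ch.module_axioms Ch.module_axioms]; fact inner_linear bd_linear)+

lemma pre_zero: "g \<in> carrier G \<Longrightarrow> pre g \<zero>\<^bsub>Ch\<^esub> = \<zero>\<^bsub>Ch\<^esub>"
  and lmul_zero: "g \<in> carrier G \<Longrightarrow> lmul g \<zero>\<^bsub>Ch\<^esub> = \<zero>\<^bsub>Ch\<^esub>"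
  by (rule linear_map_zero[OF Ch.module_axioms Ch.module_axioms]; simp add: pre_linear lmul_linear)+

lemma inner_lmul:
  assumes g: "g \<in> carrier G" and c: "c \<in> carrier Ch"
  shows "inner (lmul g c) = lmul g (inner c)"
proof (rule Ch_eqI[OF Ch.module_axioms linear_map_comp[OF lmul_linear[OF g] inner_linear]
      linear_map_comp[OF inner_linear lmul_linear[OF g]] _ c])
  fix gs m assume gs: "gs \<in> lists (carrier G)" and m: "m \<in> carrier M"
  show "inner (lmul g (single M gs m)) = lmul g (inner (single M gs m))"
  proof (rule cell_induct[OF gs m])
    show "inner (lmul g (single M [] m)) = lmul g (inner (single M [] m))"
      using g m by (simp add: lmul_single_Nil act_closed inner_Nil lmul_zero del: fsupp_simps)
  next
    fix h c assume h: "h \<in> carrier G" and c: "c \<in> carrier Ch"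
    then show "inner (lmul g (pre h c)) = lmul g (inner (pre h c))"
      using g by (simp add: lmul_pre inner_pre lmul_lmul lmul_closed pre_closed inner_closed
          linear_map_diff[OF Ch.module_axioms Ch.module_axioms lmul_linear])
  qed
qed

text \<open>
  Applying \<open>inner\<close> to the rule for \<open>inner (pre h c)\<close> produces \<open>lmul h (inner c)\<close> twice, with opposite
  signs.
\<close>

lemma inner_inner:
  assumes c: "c \<in> carrier Ch" shows "inner (inner c) = \<zero>\<^bsub>Ch\<^esub>"
proof (rule Ch_eqI[OF Ch.module_axioms linear_map_comp[OF inner_linear inner_linear]
      linear_map_const_zero[OF Ch.module_axioms] _ c])
  fix gs m assume gs: "gs \<in> lists (carrier G)" and m: "m \<in> carrier M"
  show "inner (inner (single M gs m)) = \<zero>\<^bsub>Ch\<^esub>"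
  proof (rule cell_induct[OF gs m])
    show "inner (inner (single M [] m)) = \<zero>\<^bsub>Ch\<^esub>"
      using m by (simp only: inner_Nil inner_zero)
  next
    fix h c assume h: "h \<in> carrier G" and c: "c \<in> carrier Ch" and IH: "inner (inner c) = \<zero>\<^bsub>Ch\<^esub>"
    have "inner (inner (pre h c)) = inner (lmul h c) \<ominus>\<^bsub>Ch\<^esub> inner (pre h (inner c))"
      using h c by (simp add: inner_pre lmul_closed pre_closed inner_closed
          linear_map_diff[OF Ch.module_axioms Ch.module_axioms inner_linear])
    also have "inner (pre h (inner c)) = lmul h (inner c) \<ominus>\<^bsub>Ch\<^esub> pre h (inner (inner c))"
      using h c by (simp add: inner_pre inner_closed)
    also have "\<dots> = lmul h (inner c)"
      using h c IH by (simp only: pre_zero Ch.diff_zero lmul_closed inner_closed)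
    finally show "inner (inner (pre h c)) = \<zero>\<^bsub>Ch\<^esub>"
      using h c by (simp add: inner_lmul Ch.diff_self inner_closed lmul_closed del: fsupp_simps)
  qed
qed

text \<open>
  For \<open>pre g c\<close> the two parts of the differential are \<open>c\<close> and \<open>inner (pre g c)\<close>, and \<open>bd\<close> agrees on
  them: \<open>inner\<close> vanishes on the second one, and its \<open>tail\<close> is \<open>bd c\<close>.
\<close>

lemma bd_bd:
  assumes c: "c \<in> carrier Ch" shows "bd (bd c) = \<zero>\<^bsub>Ch\<^esub>"
proof (rule Ch_eqI[OF Ch.module_axioms linear_map_comp[OF bd_linear bd_linear]
      linear_map_const_zero[OF Ch.module_axioms] _ c])
  fix gs m assume gs: "gs \<in> lists (carrier G)" and m: "m \<in> carrier M"
  show "bd (bd (single M gs m)) = \<zero>\<^bsub>Ch\<^esub>"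
  proof (rule cell_induct[OF gs m])
    show "bd (bd (single M [] m)) = \<zero>\<^bsub>Ch\<^esub>"
      unfolding bd_def[of "single M [] m"]
      using m by (simp only: inner_Nil tail_Nil Ch.diff_zero[OF Ch.zero_closed] bd_zero)
  next
    fix g c assume g: "g \<in> carrier G" and c: "c \<in> carrier Ch"
    note cl = c g pre_closed lmul_closed inner_closed tail_closed
    have ti: "tail (inner (pre g c)) = tail c \<ominus>\<^bsub>Ch\<^esub> inner c"
      using cl by (simp add: inner_pre tail_lmul tail_pre
          linear_map_diff[OF Ch.module_axioms Ch.module_axioms tail_linear])
    have "bd (bd (pre g c)) = bd c \<ominus>\<^bsub>Ch\<^esub> bd (inner (pre g c))"
      using cl unfolding bd_def[of "pre g c"]
      by (simp add: tail_pre linear_map_diff[OF Ch.module_axioms Ch.module_axioms bd_linear])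
    also have "bd (inner (pre g c)) = bd c"
      unfolding bd_def ti using cl by (simp add: inner_inner Ch.diff_zero del: fsupp_simps)
    finally show "bd (bd (pre g c)) = \<zero>\<^bsub>Ch\<^esub>"
      using c by (simp only: Ch.diff_self bd_closed)
  qed
qed

subsection \<open>Degrees\<close>

text \<open>
  The degrees are shifted by one.  Then \<open>C 0\<close> is zero and \<open>bd\<close> maps \<open>C (Suc n)\<close> to \<open>C n\<close> for all \<open>n\<close>, which
  makes the augmentation by zero part of the complex: homology in degree \<open>q\<close> sits at \<open>C (Suc q)\<close>.
\<close>

definition deg :: "nat \<Rightarrow> 'g list set"
  where "deg n = {gs \<in> lists (carrier G). Suc (length gs) = n}"

definition C :: "nat \<Rightarrow> ('g list \<Rightarrow> 'm) set"
  where "C n = carrier (fsupp (deg n) M)"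

lemma deg_lists: "deg n \<subseteq> lists (carrier G)" by (auto simp: deg_def)

lemma C_Ch: "C n \<subseteq> carrier Ch"
  unfolding C_def Ch_def by (rule fsupp_mono[OF deg_lists])

lemma C_zero: "C 0 = {\<zero>\<^bsub>Ch\<^esub>}"
  by (auto simp: C_def deg_def in_fsupp Ch_def)

lemma Ch_ops: "\<zero>\<^bsub>Ch\<^esub> = \<zero>\<^bsub>fsupp (deg n) M\<^esub>" "x \<oplus>\<^bsub>Ch\<^esub> y = x \<oplus>\<^bsub>fsupp (deg n) M\<^esub> y"
  by (simp_all add: Ch_def)

lemma zero_C: "\<zero>\<^bsub>Ch\<^esub> \<in> C n"
  using module.axioms(2)[OF fsupp_module[OF mod]] abelian_group.axioms(1) abelian_monoid.zero_closed
  unfolding C_def Ch_ops(1)[of n] by blast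

lemma add_C: "x \<in> C n \<Longrightarrow> y \<in> C n \<Longrightarrow> x \<oplus>\<^bsub>Ch\<^esub> y \<in> C n"
proof -
  interpret D: module K "fsupp (deg n) M" by (rule fsupp_module[OF mod])
  show "x \<in> C n \<Longrightarrow> y \<in> C n \<Longrightarrow> x \<oplus>\<^bsub>Ch\<^esub> y \<in> C n"
    unfolding C_def Ch_ops(2)[of _ _ n] by (rule D.a_closed)
qed

lemma minus_C: "x \<in> C n \<Longrightarrow> \<ominus>\<^bsub>Ch\<^esub> x \<in> C n"
proof -
  assume x: "x \<in> C n"
  interpret D: module K "fsupp (deg n) M" by (rule fsupp_module[OF mod])
  have "\<ominus>\<^bsub>Ch\<^esub> x = \<ominus>\<^bsub>fsupp (deg n) M\<^esub> x"
    using x C_Ch[of n] fsupp_minus[OF mod, of x] unfolding C_def Ch_def by auto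
  then show ?thesis using x unfolding C_def by simp
qed

lemma diff_C: "x \<in> C n \<Longrightarrow> y \<in> C n \<Longrightarrow> x \<ominus>\<^bsub>Ch\<^esub> y \<in> C n"
  by (simp add: a_minus_def add_C minus_C)

lemma single_C: "gs \<in> lists (carrier G) \<Longrightarrow> m \<in> carrier M \<Longrightarrow> single M gs m \<in> C (Suc (length gs))"
  unfolding C_def by (rule single_closed[OF mod]) (auto simp: deg_def)

lemma C_map:
  assumes f: "linear_map K Ch Ch f"
    and fs: "\<And>gs m. gs \<in> deg n \<Longrightarrow> m \<in> carrier M \<Longrightarrow> f (single M gs m) \<in> C k"
    and c: "c \<in> C n"
  shows "f c \<in> C k"
  unfolding C_def
proof (rule linear_map_supports[where f=f and c=c, OF mod mod _ deg_lists deg_lists])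
  show "linear_map K (fsupp (lists (carrier G)) M) (fsupp (lists (carrier G)) M) f"
    using f by (simp only: Ch_def)
  show "f (single M gs m) \<in> carrier (fsupp (deg k) M)" if "gs \<in> deg n" "m \<in> carrier M" for gs m
    using fs[OF that] by (simp only: C_def)
  show "c \<in> carrier (fsupp (deg n) M)" using c by (simp only: C_def)
qed

lemma pre_C: "g \<in> carrier G \<Longrightarrow> c \<in> C n \<Longrightarrow> pre g c \<in> C (Suc n)"
proof (rule C_map[OF pre_linear])
  fix gs m assume a: "g \<in> carrier G" "gs \<in> deg n" "m \<in> carrier M"
  then show "pre g (single M gs m) \<in> C (Suc n)"
    using single_C[of "g # gs" m] by (simp add: deg_def pre_single)
qed

lemma lmul_cell_C:
  "g \<in> carrier G \<Longrightarrow> gs \<in> lists (carrier G) \<Longrightarrow> m \<in> carrier M \<Longrightarrow> lmul_cell g gs m \<in> C (Suc (length gs))"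
  using single_C[of "[]" "act g m"] single_C[of "(g \<otimes>\<^bsub>G\<^esub> hd gs) # tl gs" m]
  by (cases gs) (auto simp: lmul_cell_def act_closed)

lemma inner_cell_C:
  "gs \<in> lists (carrier G) \<Longrightarrow> m \<in> carrier M \<Longrightarrow> inner_cell gs m \<in> C (length gs)"
  by (induction gs) (auto simp: zero_C intro!: diff_C lmul_cell_C pre_C simp del: fsupp_simps)

lemma bd_C:
  assumes "c \<in> C (Suc n)" shows "bd c \<in> C n"
proof (rule C_map[OF bd_linear _ assms])
  fix gs m assume a: "gs \<in> deg (Suc n)" "m \<in> carrier M"
  then have "tail (single M gs m) \<in> C n"
    using single_C[of "tl gs" m] by (cases gs) (auto simp: deg_def tail_single zero_C simp del: fsupp_simps)
  moreover have "inner (single M gs m) \<in> C n"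
    using a inner_cell_C[of gs m] by (auto simp: deg_def inner_single)
  ultimately show "bd (single M gs m) \<in> C n" unfolding bd_def by (rule diff_C)
qed

lemma carrier_bar_chains: "carrier (bar_chains G M n) = C (Suc n)"
  by (simp add: bar_chains_def C_def fsupp_def deg_def lists_eq_set conj_commute)

end

context group_rep begin

text \<open>
  The differential of the bar complex is given by its values at lists.  To compare it with \<open>bd\<close>, the
  operator \<open>pre\<close> has to be evaluated at a list too.
\<close>

lemma pre_apply:
  assumes g: "g \<in> carrier G" and c: "c \<in> carrier Ch"
  shows "pre g c hs = (case hs of [] \<Rightarrow> \<zero>\<^bsub>M\<^esub> | x # xs \<Rightarrow> if x = g then c xs else \<zero>\<^bsub>M\<^esub>)"
proof -
  have ev: "linear_map K Ch M (\<lambda>c. c hs)" for hs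
    unfolding Ch_def by (rule linear_map_eval[OF mod])
  show ?thesis
  proof (rule Ch_eqI[OF mod, where f = "\<lambda>c. pre g c hs" and c = c])
    show "linear_map K Ch M (\<lambda>c. pre g c hs)"
      by (rule linear_map_comp[OF pre_linear[OF g] ev])
    show "linear_map K Ch M (\<lambda>c. case hs of [] \<Rightarrow> \<zero>\<^bsub>M\<^esub> | x # xs \<Rightarrow> if x = g then c xs else \<zero>\<^bsub>M\<^esub>)"
      by (cases hs; cases "hd hs = g") (auto intro: ev linear_map_const_zero[OF mod])
    show "pre g (single M gs m) hs =
        (case hs of [] \<Rightarrow> \<zero>\<^bsub>M\<^esub> | x # xs \<Rightarrow> if x = g then single M gs m xs else \<zero>\<^bsub>M\<^esub>)"
      if "gs \<in> lists (carrier G)" "m \<in> carrier M" for gs m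
      unfolding pre_single[OF g that] by (cases hs) (auto simp: single_def)
  qed (rule c)
qed

lemma Ch_apply: "c \<in> carrier Ch \<Longrightarrow> c hs \<in> carrier M"
  by (simp add: Ch_def in_fsupp)

lemma diff_apply: "c \<in> carrier Ch \<Longrightarrow> d \<in> carrier Ch \<Longrightarrow> (c \<ominus>\<^bsub>Ch\<^esub> d) hs = c hs \<ominus>\<^bsub>M\<^esub> d hs"
  by (simp add: Ch_def fsupp_diff[OF mod])

lemma inner_cell_closed: "gs \<in> lists (carrier G) \<Longrightarrow> m \<in> carrier M \<Longrightarrow> inner_cell gs m \<in> carrier Ch"
  by (rule linear_map_closed[OF inner_cell_linear])

lemma bar_coeff_linear:
  assumes "gs \<in> lists (carrier G)" "length gs = n" "0 < n"
  shows "linear_map K M M (bar_coeff M act n i gs)"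
proof -
  have l: "linear_map K M M (\<lambda>m. if i = n then act (last gs) m else m)"
    using assms act_linear[of "last gs"] last_in_set[of gs] linear_map_id by (cases "i = n") auto
  show ?thesis
    using l linear_map_uminus[OF mod l] unfolding bar_coeff_def[abs_def] Let_def
    by (cases "even i") simp_all
qed

text \<open>
  The face number \<open>i + 1\<close> of \<open>g # gs\<close> is \<open>g\<close> prepended to the face number \<open>i\<close> of \<open>gs\<close>, with the opposite
  sign; this is the second term of the rule for \<open>inner\<close>.  The face number 1 multiplies the first two
  entries, or lets \<open>g\<close> act on the coefficient if \<open>gs\<close> is empty, and this is the first term.
\<close>

lemma inner_faces:
  assumes "gs \<in> lists (carrier G)" "m \<in> carrier M" "gs \<noteq> []"
  shows "\<ominus>\<^bsub>M\<^esub> inner_cell gs m hs = (\<Oplus>\<^bsub>M\<^esub>i \<in> {1..length gs}.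
    if bar_face G (length gs) i gs = hs then bar_coeff M act (length gs) i gs m else \<zero>\<^bsub>M\<^esub>)"
  using assms
proof (induction gs arbitrary: hs)
  case (Cons g gs)
  then have g: "g \<in> carrier G" and gs: "gs \<in> lists (carrier G)" and m: "m \<in> carrier M" by auto
  show ?case
  proof (cases gs)
    case Nil
    have "inner_cell [g] m = single M [] (act g m)"
      using g m by (simp add: lmul_cell_def pre_zero Ch.diff_zero single_Ch act_closed del: fsupp_simps)
    then show ?thesis
      using Nil g m by (auto simp: single_def bar_face_def bar_coeff_def act_closed)
  next
    case (Cons x xs)
    define n where "n = length gs"
    have n: "0 < n" using Cons by (simp add: n_def)
    let ?t = "\<lambda>i. if bar_face G (Suc n) i (g # gs) = hs then bar_coeff M act (Suc n) i (g # gs) m else \<zero>\<^bsub>M\<^esub>"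
    let ?s = "\<lambda>hs i. if bar_face G n i gs = hs then bar_coeff M act n i gs m else \<zero>\<^bsub>M\<^esub>"
    have cl: "bar_coeff M act n i gs m \<in> carrier M" for i
      using linear_map_closed[OF bar_coeff_linear[OF gs] m] n n_def by simp
    have ti: "?t (Suc i) = (case hs of [] \<Rightarrow> \<zero>\<^bsub>M\<^esub> | y # ys \<Rightarrow> if y = g then \<ominus>\<^bsub>M\<^esub> ?s ys i else \<zero>\<^bsub>M\<^esub>)"
      if i: "i \<in> {1..n}" for i
    proof -
      have f: "bar_face G (Suc n) (Suc i) (g # gs) = g # bar_face G n i gs"
        using i n n_def by (auto simp: bar_face_def Cons take_Cons' nth_Cons')
      have "bar_coeff M act (Suc n) (Suc i) (g # gs) m = \<ominus>\<^bsub>M\<^esub> bar_coeff M act n i gs m"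
        using i n m g gs Cons act_closed[of "last gs" m] last_in_set[of gs]
        by (auto simp: bar_coeff_def Let_def)
      then show ?thesis unfolding f by (cases hs) (auto simp: M.a_inv_zero)
    qed
    have tc: "?t (Suc i) \<in> carrier M" if "i \<in> {1..n}" for i
      unfolding ti[OF that] using cl by (cases hs) auto
    have tc': "?t i \<in> carrier M" if i: "i \<in> Suc ` {1..n}" for i
    proof -
      obtain k where "i = Suc k" "k \<in> {1..n}" using i by blast
      then show ?thesis using tc[of k] by blast
    qed
    have t1: "?t 1 = \<ominus>\<^bsub>M\<^esub> lmul_cell g gs m hs"
      using n Cons m by (auto simp: bar_face_def bar_coeff_def lmul_cell_def single_def M.a_inv_zero)
    have lc: "lmul_cell g gs m \<in> carrier Ch"
      by (rule linear_map_closed[OF lmul_cell_linear[OF g gs] m])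
    have pc: "pre g (inner_cell gs m) \<in> carrier Ch"
      by (rule pre_closed[OF g inner_cell_closed[OF gs m]])
    have "(\<Oplus>\<^bsub>M\<^esub>i \<in> Suc ` {1..n}. ?t i) = (\<Oplus>\<^bsub>M\<^esub>i \<in> {1..n}. ?t (Suc i))"
      by (rule M.finsum_reindex[OF funcsetI[OF tc']]) auto
    also have "\<dots> = pre g (inner_cell gs m) hs"
    proof (cases "\<exists>ys. hs = g # ys")
      case True
      then obtain ys where ys: "hs = g # ys" by blast
      have "(\<Oplus>\<^bsub>M\<^esub>i \<in> {1..n}. ?t (Suc i)) = (\<Oplus>\<^bsub>M\<^esub>i \<in> {1..n}. \<ominus>\<^bsub>M\<^esub> ?s ys i)"
      proof (rule M.finsum_cong'[OF refl])
        show "?t (Suc i) = \<ominus>\<^bsub>M\<^esub> ?s ys i" if "i \<in> {1..n}" for i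
          by (rule trans[OF ti[OF that]]) (simp add: ys)
      qed (use cl in auto)
      also have "\<dots> = \<ominus>\<^bsub>M\<^esub> (\<Oplus>\<^bsub>M\<^esub>i \<in> {1..n}. ?s ys i)"
        by (rule linear_map_finsum[OF mod mod linear_map_uminus[OF mod linear_map_id], symmetric])
          (use cl in auto)
      also have "\<dots> = inner_cell gs m ys"
      proof -
        have "gs \<noteq> []" using \<open>gs = x # xs\<close> by simp
        note IH = Cons.IH[OF m this, of ys]
        show ?thesis
          unfolding n_def IH[symmetric]
          by (rule M.minus_minus[OF Ch_apply[OF inner_cell_closed[OF gs m]]])
      qed
      finally show ?thesis using ys by (simp add: pre_apply g inner_cell_closed gs m)
    next
      case False
      then have "(\<Oplus>\<^bsub>M\<^esub>i \<in> {1..n}. ?t (Suc i)) = (\<Oplus>\<^bsub>M\<^esub>i \<in> {1..n}. \<zero>\<^bsub>M\<^esub>)"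
      proof (intro M.finsum_cong'[OF refl])
        show "?t (Suc i) = \<zero>\<^bsub>M\<^esub>" if "i \<in> {1..n}" for i
          by (rule trans[OF ti[OF that]]) (use False in \<open>auto split: list.splits\<close>)
      qed auto
      then show ?thesis using False
        by (auto simp add: pre_apply g inner_cell_closed gs m split: list.splits)
    qed
    finally have S: "(\<Oplus>\<^bsub>M\<^esub>i \<in> Suc ` {1..n}. ?t i) = pre g (inner_cell gs m) hs" .
    have "{1..Suc n} = insert 1 (Suc ` {1..n})"
      by (auto simp: image_Suc_atLeastAtMost)
    then have "(\<Oplus>\<^bsub>M\<^esub>i \<in> {1..Suc n}. ?t i) = (\<Oplus>\<^bsub>M\<^esub>i \<in> insert 1 (Suc ` {1..n}). ?t i)" by simp
    also have "\<dots> = ?t 1 \<oplus>\<^bsub>M\<^esub> (\<Oplus>\<^bsub>M\<^esub>i \<in> Suc ` {1..n}. ?t i)"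
      proof (rule M.finsum_insert)
      show "?t 1 \<in> carrier M" unfolding t1 using Ch_apply[OF lc] by simp
    qed (use tc' in auto)
    also have "\<dots> = \<ominus>\<^bsub>M\<^esub> inner_cell (g # gs) m hs"
      unfolding S t1 using Ch_apply[OF lc] Ch_apply[OF pc]
      by (simp add: diff_apply lc pc M.minus_eq M.minus_add)
    finally have e: "(\<Oplus>\<^bsub>M\<^esub>i \<in> {1..Suc n}. ?t i) = \<ominus>\<^bsub>M\<^esub> inner_cell (g # gs) m hs" .
    have len: "length (g # gs) = Suc n" by (simp add: n_def)
    show ?thesis unfolding len by (rule e[symmetric])
  qed
qed simp

lemma bd_single_faces:
  assumes gs: "gs \<in> lists (carrier G)" "m \<in> carrier M" "gs \<noteq> []"
  shows "bd (single M gs m) hs = (\<Oplus>\<^bsub>M\<^esub>i \<in> {0..length gs}.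
    if bar_face G (length gs) i gs = hs then bar_coeff M act (length gs) i gs m else \<zero>\<^bsub>M\<^esub>)"
    (is "_ = (\<Oplus>\<^bsub>M\<^esub>i \<in> _. ?t i)")
proof -
  have cl: "?t i \<in> carrier M" for i
    using linear_map_closed[OF bar_coeff_linear[OF gs(1) refl] gs(2)] gs(3) by simp
  have tl: "tail (single M gs m) = single M (tl gs) m"
    using gs by (cases gs) (auto simp: tail_single)
  have tlc: "single M (tl gs) m \<in> carrier Ch"
    by (rule single_Ch) (use gs in \<open>cases gs; auto\<close>)+
  have t0: "?t 0 = single M (tl gs) m hs"
    using gs by (auto simp: bar_face_def bar_coeff_def single_def)
  have "(\<Oplus>\<^bsub>M\<^esub>i \<in> {0..length gs}. ?t i) = (\<Oplus>\<^bsub>M\<^esub>i \<in> insert 0 {1..length gs}. ?t i)"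
    by (rule arg_cong[where f = "finsum M ?t"]) auto
  also have "\<dots> = ?t 0 \<oplus>\<^bsub>M\<^esub> (\<Oplus>\<^bsub>M\<^esub>i \<in> {1..length gs}. ?t i)"
    by (rule M.finsum_insert) (use cl in auto)
  also have "\<dots> = single M (tl gs) m hs \<oplus>\<^bsub>M\<^esub> \<ominus>\<^bsub>M\<^esub> inner_cell gs m hs"
    unfolding t0 inner_faces[OF gs] ..
  also have "\<dots> = bd (single M gs m) hs"
    unfolding bd_def tl inner_single[OF gs(1,2)]
    by (simp only: diff_apply[OF tlc inner_cell_closed[OF gs(1,2)]] M.minus_eq)
  finally show ?thesis by simp
qed

lemma bar_boundary_eq_bd:
  assumes c: "c \<in> C (Suc n)" and n: "0 < n"
  shows "bar_boundary G M act n c = bd c"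
proof
  fix hs
  let ?\<phi> = "\<lambda>i gs m. if bar_face G n i gs = hs then bar_coeff M act n i gs m else \<zero>\<^bsub>M\<^esub>"
  let ?I = "deg (Suc n)"
  have I: "gs \<in> lists (carrier G)" "length gs = n" "gs \<noteq> []" if "gs \<in> ?I" for gs
    using that n by (auto simp: deg_def)
  have lin: "linear_map K M M (?\<phi> i gs)" if "gs \<in> ?I" for i gs
    using bar_coeff_linear[OF I(1,2)[OF that] n, of i] linear_map_const_zero[OF mod, of M]
    by (cases "bar_face G n i gs = hs") simp_all
  have ext: "linear_map K (fsupp ?I M) M (lin_ext M M (?\<phi> i))" for i
    by (rule linear_map_lin_ext[OF mod mod lin])
  have c': "c \<in> carrier (fsupp ?I M)" using c by (simp add: C_def)
  have supp: "finite {gs. c gs \<noteq> \<zero>\<^bsub>M\<^esub>}" "\<And>gs. c gs \<noteq> \<zero>\<^bsub>M\<^esub> \<Longrightarrow> gs \<in> ?I" "\<And>gs. c gs \<in> carrier M"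
    using c' by (auto simp: in_fsupp)
  have sumlin: "linear_map K (fsupp ?I M) M (\<lambda>c. \<Oplus>\<^bsub>M\<^esub>i \<in> S. lin_ext M M (?\<phi> i) c)" if "finite S" for S
    using that
  proof (induction S rule: finite_induct)
    case empty
    show ?case using linear_map_const_zero[OF mod] by simp
  next
    case (insert i S)
    have lc: "lin_ext M M (?\<phi> i) x \<in> carrier M" if "x \<in> carrier (fsupp ?I M)" for i x
      by (rule linear_map_closed[OF ext that])
    have "(\<Oplus>\<^bsub>M\<^esub>i \<in> insert i S. lin_ext M M (?\<phi> i) x) =
        lin_ext M M (?\<phi> i) x \<oplus>\<^bsub>M\<^esub> (\<Oplus>\<^bsub>M\<^esub>i \<in> S. lin_ext M M (?\<phi> i) x)"
      if "x \<in> carrier (fsupp ?I M)" for x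
      by (rule M.finsum_insert) (use insert lc[OF that] in auto)
    then show ?case
      by (rule linear_map_cong[OF fsupp_module[OF mod] linear_map_sum[OF mod ext[of i] insert.IH]])
  qed
  have "bar_boundary G M act n c hs = (\<Oplus>\<^bsub>M\<^esub>i \<in> {0..n}. lin_ext M M (?\<phi> i) c)"
    unfolding bar_boundary_def
  proof (rule M.finsum_cong')
    fix i
    have "(\<Oplus>\<^bsub>M\<^esub>gs \<in> {gs. c gs \<noteq> \<zero>\<^bsub>M\<^esub> \<and> bar_face G n i gs = hs}. bar_coeff M act n i gs (c gs)) =
        (\<Oplus>\<^bsub>M\<^esub>gs \<in> {gs \<in> {gs. c gs \<noteq> \<zero>\<^bsub>M\<^esub>}. bar_face G n i gs = hs}. bar_coeff M act n i gs (c gs))"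
      by simp
    also have "\<dots> = (\<Oplus>\<^bsub>M\<^esub>gs \<in> {gs. c gs \<noteq> \<zero>\<^bsub>M\<^esub>}. ?\<phi> i gs (c gs))"
    proof (rule M.finsum_filter[OF supp(1)])
      fix gs assume "gs \<in> {gs. c gs \<noteq> \<zero>\<^bsub>M\<^esub>}"
      then have "gs \<in> ?I" using supp(2) by simp
      then show "bar_coeff M act n i gs (c gs) \<in> carrier M"
        using linear_map_closed[OF bar_coeff_linear[OF I(1,2) n] supp(3)] by simp
    qed
    finally show "(\<Oplus>\<^bsub>M\<^esub>gs \<in> {gs. c gs \<noteq> \<zero>\<^bsub>M\<^esub> \<and> bar_face G n i gs = hs}. bar_coeff M act n i gs (c gs)) =
        lin_ext M M (?\<phi> i) c" unfolding lin_ext_def .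
  qed (use linear_map_closed[OF ext c'] in auto)
  also have "\<dots> = bd c hs"
  proof (rule linear_map_eqI[OF mod mod, where c = c and f = "\<lambda>c. \<Oplus>\<^bsub>M\<^esub>i \<in> {0..n}. lin_ext M M (?\<phi> i) c"
        and g = "\<lambda>c. bd c hs"])
    show "linear_map K (fsupp ?I M) M (\<lambda>c. \<Oplus>\<^bsub>M\<^esub>i \<in> {0..n}. lin_ext M M (?\<phi> i) c)"
      by (rule sumlin) simp
    have "linear_map K (fsupp (lists (carrier G)) M) M (\<lambda>c. bd c hs)"
      by (rule linear_map_comp[OF bd_linear[unfolded Ch_def] linear_map_eval[OF mod]])
    then show "linear_map K (fsupp ?I M) M (\<lambda>c. bd c hs)"
      by (rule linear_map_subset) (rule deg_lists)
    fix gs m assume gs: "gs \<in> ?I" and m: "m \<in> carrier M"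
    have le: "lin_ext M M (?\<phi> i) (single M gs m) = ?\<phi> i gs m" for i
      by (rule lin_ext_single[where \<phi> = "?\<phi> i", OF mod mod lin[OF gs] m])
    have "(\<Oplus>\<^bsub>M\<^esub>i \<in> {0..n}. lin_ext M M (?\<phi> i) (single M gs m)) = (\<Oplus>\<^bsub>M\<^esub>i \<in> {0..n}. ?\<phi> i gs m)"
      by (rule M.finsum_cong')
        (use le linear_map_closed[OF lin[OF gs] m] in auto)
    also have "\<dots> = bd (single M gs m) hs"
      using bd_single_faces[OF I(1)[OF gs] m I(3)[OF gs], of hs] unfolding I(2)[OF gs] by (rule sym)
    finally show "(\<Oplus>\<^bsub>M\<^esub>i \<in> {0..n}. lin_ext M M (?\<phi> i) (single M gs m)) = bd (single M gs m) hs" .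
  qed (rule c')
  finally show "bar_boundary G M act n c hs = bd c hs" .
qed

end

locale rep_map = R: group_rep G K M act + R': group_rep G' K M' act'
  for G :: "('g, 'b) monoid_scheme" and K :: "('k, 'r) ring_scheme"
    and M :: "('k, 'm) module" and act
    and G' :: "('h, 'c) monoid_scheme" and M' :: "('k, 'n) module" and act' +
  fixes \<phi> :: "'g \<Rightarrow> 'h" and \<psi> :: "'m \<Rightarrow> 'n"
  assumes hom: "\<phi> \<in> hom G G'" and lin: "linear_map K M M' \<psi>"
    and equi: "g \<in> carrier G \<Longrightarrow> m \<in> carrier M \<Longrightarrow> \<psi> (act g m) = act' (\<phi> g) (\<psi> m)"
begin

text \<open>
  The effect on chains of a group homomorphism together with a compatible map of coefficients.  It is a
  chain map because it commutes with the operators \<open>pre\<close> and \<open>lmul\<close> that determine the differential.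
\<close>

definition chmap :: "('g list \<Rightarrow> 'm) \<Rightarrow> 'h list \<Rightarrow> 'n"
  where "chmap = lin_ext M R'.Ch (\<lambda>gs m. single M' (map \<phi> gs) (\<psi> m))"

lemma hom_closed: "g \<in> carrier G \<Longrightarrow> \<phi> g \<in> carrier G'"
  using hom by (auto simp: hom_def)

lemma hom_mult: "g \<in> carrier G \<Longrightarrow> h \<in> carrier G \<Longrightarrow> \<phi> (g \<otimes>\<^bsub>G\<^esub> h) = \<phi> g \<otimes>\<^bsub>G'\<^esub> \<phi> h"
  using hom by (auto simp: hom_def)

lemma map_lists: "gs \<in> lists (carrier G) \<Longrightarrow> map \<phi> gs \<in> lists (carrier G')"
  using hom_closed by (auto simp: lists_eq_set)

lemma coeff_closed: "m \<in> carrier M \<Longrightarrow> \<psi> m \<in> carrier M'"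
  by (rule linear_map_closed[OF lin])

lemma chmap_cell_linear:
  "gs \<in> lists (carrier G) \<Longrightarrow> linear_map K M R'.Ch (\<lambda>m. single M' (map \<phi> gs) (\<psi> m))"
  by (rule linear_map_comp[OF lin R'.single_linear[OF map_lists]])

lemma chmap_linear: "linear_map K R.Ch R'.Ch chmap"
  unfolding chmap_def by (rule R.ext_linear[OF R'.Ch.module_axioms chmap_cell_linear])

lemmas chmap_closed = linear_map_closed[OF chmap_linear]

lemma chmap_single:
  "gs \<in> lists (carrier G) \<Longrightarrow> m \<in> carrier M \<Longrightarrow> chmap (single M gs m) = single M' (map \<phi> gs) (\<psi> m)"
  unfolding chmap_def by (rule R.ext_single[OF R'.Ch.module_axioms chmap_cell_linear])

lemma chmap_pre:
  assumes g: "g \<in> carrier G" and c: "c \<in> carrier R.Ch"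
  shows "chmap (R.pre g c) = R'.pre (\<phi> g) (chmap c)"
  by (rule R.Ch_eqI[OF R'.Ch.module_axioms linear_map_comp[OF R.pre_linear[OF g] chmap_linear]
        linear_map_comp[OF chmap_linear R'.pre_linear[OF hom_closed[OF g]]] _ c])
    (use g map_lists in \<open>simp add: R.pre_single R'.pre_single chmap_single coeff_closed hom_closed\<close>)

lemma chmap_lmul:
  assumes g: "g \<in> carrier G" and c: "c \<in> carrier R.Ch"
  shows "chmap (R.lmul g c) = R'.lmul (\<phi> g) (chmap c)"
proof (rule R.Ch_eqI[OF R'.Ch.module_axioms linear_map_comp[OF R.lmul_linear[OF g] chmap_linear]
        linear_map_comp[OF chmap_linear R'.lmul_linear[OF hom_closed[OF g]]] _ c])
  fix gs m assume "gs \<in> lists (carrier G)" "m \<in> carrier M"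
  then show "chmap (R.lmul g (single M gs m)) = R'.lmul (\<phi> g) (chmap (single M gs m))"
    using g map_lists[of "tl gs"]
    by (cases gs) (simp_all add: R.lmul_single_Nil R'.lmul_single_Nil R.lmul_single_Cons
        R'.lmul_single_Cons chmap_single coeff_closed hom_closed R.act_closed equi hom_mult)
qed

lemma chmap_zero: "chmap \<zero>\<^bsub>R.Ch\<^esub> = \<zero>\<^bsub>R'.Ch\<^esub>"
  by (rule linear_map_zero[OF R.Ch.module_axioms R'.Ch.module_axioms chmap_linear])

lemma chmap_tail:
  assumes c: "c \<in> carrier R.Ch"
  shows "chmap (R.tail c) = R'.tail (chmap c)"
proof (rule R.Ch_eqI[OF R'.Ch.module_axioms linear_map_comp[OF R.tail_linear chmap_linear]
        linear_map_comp[OF chmap_linear R'.tail_linear] _ c])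
  fix gs m assume "gs \<in> lists (carrier G)" "m \<in> carrier M"
  then show "chmap (R.tail (single M gs m)) = R'.tail (chmap (single M gs m))"
    using map_lists[of gs] chmap_zero
    by (cases gs) (simp_all add: R.tail_single R'.tail_single chmap_single coeff_closed hom_closed del: fsupp_simps)
qed

lemma chmap_inner:
  assumes c: "c \<in> carrier R.Ch"
  shows "chmap (R.inner c) = R'.inner (chmap c)"
proof (rule R.Ch_eqI[OF R'.Ch.module_axioms linear_map_comp[OF R.inner_linear chmap_linear]
        linear_map_comp[OF chmap_linear R'.inner_linear] _ c])
  fix gs m assume gs: "gs \<in> lists (carrier G)" and m: "m \<in> carrier M"
  show "chmap (R.inner (single M gs m)) = R'.inner (chmap (single M gs m))"
  proof (rule R.cell_induct[OF gs m])
    show "chmap (R.inner (single M [] m)) = R'.inner (chmap (single M [] m))"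
      using m by (simp add: R.inner_Nil R'.inner_Nil chmap_single coeff_closed chmap_zero del: fsupp_simps)
  next
    fix g c assume "g \<in> carrier G" "c \<in> carrier R.Ch" "chmap (R.inner c) = R'.inner (chmap c)"
    then show "chmap (R.inner (R.pre g c)) = R'.inner (chmap (R.pre g c))"
      by (simp add: R.inner_pre R'.inner_pre chmap_pre chmap_lmul chmap_closed R.inner_closed
          R.pre_closed R.lmul_closed hom_closed
          linear_map_diff[OF R.Ch.module_axioms R'.Ch.module_axioms chmap_linear])
  qed
qed

lemma chmap_bd: "c \<in> carrier R.Ch \<Longrightarrow> chmap (R.bd c) = R'.bd (chmap c)"
  by (simp add: R.bd_def R'.bd_def chmap_tail chmap_inner R.tail_closed R.inner_closed
      linear_map_diff[OF R.Ch.module_axioms R'.Ch.module_axioms chmap_linear])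

lemma chmap_C:
  assumes "c \<in> R.C n" shows "chmap c \<in> R'.C n"
  unfolding R'.C_def
proof (rule linear_map_supports[where f = chmap and c = c,
      OF R.mod R'.mod chmap_linear[unfolded R.Ch_def R'.Ch_def] R.deg_lists R'.deg_lists])
  show "c \<in> carrier (fsupp (R.deg n) M)" using assms by (simp add: R.C_def)
  fix gs m assume gs: "gs \<in> R.deg n" and m: "m \<in> carrier M"
  then show "chmap (single M gs m) \<in> carrier (fsupp (R'.deg n) M')"
    using R'.single_C[OF map_lists coeff_closed[OF m], of gs]
    by (auto simp: R.deg_def chmap_single R'.C_def)
qed

lemma bar_map_eq_chmap:
  assumes c: "c \<in> carrier R.Ch"
  shows "bar_map M M' \<phi> \<psi> c = chmap c"
proof
  fix hs
  have c': "c \<in> carrier (fsupp (lists (carrier G)) M)" using c by (simp add: R.Ch_def)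
  then have supp: "finite {gs. c gs \<noteq> \<zero>\<^bsub>M\<^esub>}" "\<And>gs. c gs \<in> carrier M" by (auto simp: in_fsupp)
  have "bar_map M M' \<phi> \<psi> c hs = (\<Oplus>\<^bsub>M'\<^esub>gs \<in> {gs \<in> {gs. c gs \<noteq> \<zero>\<^bsub>M\<^esub>}. map \<phi> gs = hs}. \<psi> (c gs))"
    by (simp add: bar_map_def)
  also have "\<dots> = (\<Oplus>\<^bsub>M'\<^esub>gs \<in> {gs. c gs \<noteq> \<zero>\<^bsub>M\<^esub>}. if map \<phi> gs = hs then \<psi> (c gs) else \<zero>\<^bsub>M'\<^esub>)"
    by (rule R'.M.finsum_filter[OF supp(1)]) (simp add: coeff_closed supp(2))
  also have "\<dots> = (\<Oplus>\<^bsub>M'\<^esub>gs \<in> {gs. c gs \<noteq> \<zero>\<^bsub>M\<^esub>}. single M' (map \<phi> gs) (\<psi> (c gs)) hs)"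
    by (rule R'.M.finsum_cong') (auto simp: single_def coeff_closed supp(2))
  also have "\<dots> = chmap c hs"
    unfolding chmap_def R'.Ch_def
    by (rule lin_ext_eval[OF R.mod R'.mod _ c', symmetric])
      (rule chmap_cell_linear[unfolded R'.Ch_def])
  finally show "bar_map M M' \<phi> \<psi> c hs = chmap c hs" .
qed

end

section \<open>Maps of chain complexes\<close>

text \<open>
  A complex is a family of subsets \<open>C n\<close> of one module \<open>T\<close> with a single differential.  The shift of
  degrees above accounts for \<open>C 0\<close> being zero.
\<close>

locale chain_cplx =
  fixes K :: "('k, 'r) ring_scheme" and T :: "('k, 'x) module" and C :: "nat \<Rightarrow> 'x set" and d :: "'x \<Rightarrow> 'x"
  assumes mod_total: "module K T"
    and C_total: "C n \<subseteq> carrier T"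
    and C_zero: "C 0 = {\<zero>\<^bsub>T\<^esub>}"
    and zero_C: "\<zero>\<^bsub>T\<^esub> \<in> C n"
    and add_C: "x \<in> C n \<Longrightarrow> y \<in> C n \<Longrightarrow> x \<oplus>\<^bsub>T\<^esub> y \<in> C n"
    and minus_C: "x \<in> C n \<Longrightarrow> \<ominus>\<^bsub>T\<^esub> x \<in> C n"
    and d_linear: "linear_map K T T d"
    and d_C: "x \<in> C (Suc n) \<Longrightarrow> d x \<in> C n"
    and d_d: "x \<in> carrier T \<Longrightarrow> d (d x) = \<zero>\<^bsub>T\<^esub>"
begin

sublocale T: module K T by (rule mod_total)

lemma C_carrier: "x \<in> C n \<Longrightarrow> x \<in> carrier T"
  using C_total by blast

lemma diff_C: "x \<in> C n \<Longrightarrow> y \<in> C n \<Longrightarrow> x \<ominus>\<^bsub>T\<^esub> y \<in> C n"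
  by (simp add: a_minus_def add_C minus_C)

lemmas d_closed = linear_map_closed[OF d_linear]
  and d_add = linear_map_add[OF d_linear]
  and d_diff = linear_map_diff[OF mod_total mod_total d_linear]
  and d_zero = linear_map_zero[OF mod_total mod_total d_linear]

text \<open>The homology class of a cycle, as a coset of the boundaries.\<close>

definition cls :: "nat \<Rightarrow> 'x \<Rightarrow> 'x set"
  where "cls n x = (\<lambda>b. d b \<oplus>\<^bsub>T\<^esub> x) ` C (Suc n)"

definition cycles :: "nat \<Rightarrow> 'x set"
  where "cycles n = {x \<in> C n. d x = \<zero>\<^bsub>T\<^esub>}"

lemma cls_self: "x \<in> C n \<Longrightarrow> x \<in> cls n x"
  unfolding cls_def using zero_C[of "Suc n"] C_carrier[of x n]
  by (auto intro!: image_eqI[of _ _ "\<zero>\<^bsub>T\<^esub>"] simp: d_zero)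

lemma cls_eqI:
  assumes "b \<in> C (Suc n)" "y \<in> C n"
  shows "cls n (d b \<oplus>\<^bsub>T\<^esub> y) = cls n y"
proof
  have c: "b \<in> carrier T" "y \<in> carrier T" "d b \<in> carrier T"
    using assms C_carrier d_closed by blast+
  show "cls n (d b \<oplus>\<^bsub>T\<^esub> y) \<subseteq> cls n y"
  proof
    fix z assume "z \<in> cls n (d b \<oplus>\<^bsub>T\<^esub> y)"
    then obtain e where e: "e \<in> C (Suc n)" "z = d e \<oplus>\<^bsub>T\<^esub> (d b \<oplus>\<^bsub>T\<^esub> y)" by (auto simp: cls_def)
    then have "z = d (e \<oplus>\<^bsub>T\<^esub> b) \<oplus>\<^bsub>T\<^esub> y"
      using c C_carrier[OF e(1)] by (simp add: d_add d_closed T.a_assoc)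
    then show "z \<in> cls n y" unfolding cls_def using add_C[OF e(1) assms(1)] by blast
  qed
  show "cls n y \<subseteq> cls n (d b \<oplus>\<^bsub>T\<^esub> y)"
  proof
    fix z assume "z \<in> cls n y"
    then obtain e where e: "e \<in> C (Suc n)" "z = d e \<oplus>\<^bsub>T\<^esub> y" by (auto simp: cls_def)
    then have "z = (d e \<ominus>\<^bsub>T\<^esub> d b) \<oplus>\<^bsub>T\<^esub> (d b \<oplus>\<^bsub>T\<^esub> y)"
      using c C_carrier[OF e(1)]  by (simp add: d_closed T.minus_eq T.a_assoc T.r_neg1)
    moreover have "d (e \<ominus>\<^bsub>T\<^esub> b) = d e \<ominus>\<^bsub>T\<^esub> d b" by (rule d_diff[OF C_carrier[OF e(1)] c(1)])
    ultimately have "z = d (e \<ominus>\<^bsub>T\<^esub> b) \<oplus>\<^bsub>T\<^esub> (d b \<oplus>\<^bsub>T\<^esub> y)" by simp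
    then show "z \<in> cls n (d b \<oplus>\<^bsub>T\<^esub> y)" unfolding cls_def using diff_C[OF e(1) assms(1)] by blast
  qed
qed

lemma cls_eqD:
  assumes "x \<in> C n" "cls n x = cls n y"
  shows "\<exists>b \<in> C (Suc n). x = d b \<oplus>\<^bsub>T\<^esub> y"
  using cls_self[OF assms(1)] assms(2) by (auto simp: cls_def)

end

text \<open>
  The pairs \<open>(x, y)\<close> with \<open>d x = 0\<close> and \<open>d' y = f x\<close> are, up to signs, the cycles of the mapping cone of
  \<open>f\<close>, and the conclusion says that such a pair is a boundary.  The long exact sequence of the cone
  becomes the equivalence of this property at \<open>n\<close> with surjectivity of \<open>f\<close> on homology at \<open>Suc n\<close> and
  injectivity at \<open>n\<close> (\<open>exact_hsurj\<close>, \<open>exact_hinj\<close>, \<open>exactI\<close>).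
\<close>

definition rel_exact ::
  "('k, 'x) module \<Rightarrow> (nat \<Rightarrow> 'x set) \<Rightarrow> ('x \<Rightarrow> 'x) \<Rightarrow> ('k, 'y) module \<Rightarrow> (nat \<Rightarrow> 'y set) \<Rightarrow> ('y \<Rightarrow> 'y) \<Rightarrow>
   ('x \<Rightarrow> 'y) \<Rightarrow> nat \<Rightarrow> bool"
  where "rel_exact T C d T' C' d' f n \<longleftrightarrow>
    (\<forall>x \<in> C n. \<forall>y \<in> C' (Suc n). d x = \<zero>\<^bsub>T\<^esub> \<longrightarrow> d' y = f x \<longrightarrow>
      (\<exists>x' \<in> C (Suc n). \<exists>y' \<in> C' (Suc (Suc n)). d x' = x \<and> y = f x' \<oplus>\<^bsub>T'\<^esub> d' y'))"

lemma rel_exactD: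
  assumes "rel_exact T C d T' C' d' f n" "x \<in> C n" "y \<in> C' (Suc n)" "d x = \<zero>\<^bsub>T\<^esub>" "d' y = f x"
  obtains x' y' where "x' \<in> C (Suc n)" "y' \<in> C' (Suc (Suc n))" "d x' = x" "y = f x' \<oplus>\<^bsub>T'\<^esub> d' y'"
  using assms unfolding rel_exact_def by blast

locale chain_map = C: chain_cplx K T C d + C': chain_cplx K T' C' d'
  for K :: "('k, 'r) ring_scheme" and T :: "('k, 'x) module" and C d
    and T' :: "('k, 'y) module" and C' d' +
  fixes f :: "'x \<Rightarrow> 'y"
  assumes f_linear: "linear_map K T T' f"
    and f_C: "x \<in> C n \<Longrightarrow> f x \<in> C' n"
    and f_d: "x \<in> carrier T \<Longrightarrow> f (d x) = d' (f x)"
begin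

lemmas f_closed = linear_map_closed[OF f_linear]
  and f_add = linear_map_add[OF f_linear]
  and f_diff = linear_map_diff[OF C.mod_total C'.mod_total f_linear]
  and f_zero = linear_map_zero[OF C.mod_total C'.mod_total f_linear]

definition hsurj :: "nat \<Rightarrow> bool"
  where "hsurj n \<longleftrightarrow> (\<forall>y \<in> C'.cycles n. \<exists>x \<in> C.cycles n. \<exists>b \<in> C' (Suc n). y = f x \<oplus>\<^bsub>T'\<^esub> d' b)"

definition hinj :: "nat \<Rightarrow> bool"
  where "hinj n \<longleftrightarrow> (\<forall>x \<in> C.cycles n. \<forall>y \<in> C' (Suc n). f x = d' y \<longrightarrow> (\<exists>x' \<in> C (Suc n). x = d x'))"

abbreviation exact :: "nat \<Rightarrow> bool"
  where "exact n \<equiv> rel_exact T C d T' C' d' f n"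

lemma exact_hsurj: assumes "exact n" shows "hsurj (Suc n)"
  unfolding hsurj_def
proof
  fix y assume "y \<in> C'.cycles (Suc n)"
  then have y: "y \<in> C' (Suc n)" "d' y = f \<zero>\<^bsub>T\<^esub>" by (auto simp: C'.cycles_def f_zero)
  obtain x' y' where "x' \<in> C (Suc n)" "y' \<in> C' (Suc (Suc n))" "d x' = \<zero>\<^bsub>T\<^esub>" "y = f x' \<oplus>\<^bsub>T'\<^esub> d' y'"
    using rel_exactD[OF assms C.zero_C y(1) C.d_zero y(2)] .
  then show "\<exists>x \<in> C.cycles (Suc n). \<exists>b \<in> C' (Suc (Suc n)). y = f x \<oplus>\<^bsub>T'\<^esub> d' b"
    by (auto simp: C.cycles_def)
qed

lemma exact_hinj: assumes "exact n" shows "hinj n"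
  unfolding hinj_def
proof (intro ballI impI)
  fix x y assume x: "x \<in> C.cycles n" and y: "y \<in> C' (Suc n)" "f x = d' y"
  obtain x' y' where "x' \<in> C (Suc n)" "y' \<in> C' (Suc (Suc n))" "d x' = x" "y = f x' \<oplus>\<^bsub>T'\<^esub> d' y'"
    using rel_exactD[OF assms, of x y] x y by (auto simp: C.cycles_def)
  then show "\<exists>x' \<in> C (Suc n). x = d x'" by blast
qed

lemma exactI: assumes s: "hsurj (Suc n)" and i: "hinj n" shows "exact n"
  unfolding rel_exact_def
proof (intro ballI impI)
  fix x y assume x: "x \<in> C n" and y: "y \<in> C' (Suc n)" and dx: "d x = \<zero>\<^bsub>T\<^esub>" and dy: "d' y = f x"
  obtain z where z: "z \<in> C (Suc n)" "x = d z"
    using i x y dx dy unfolding hinj_def C.cycles_def by (metis (mono_tags, lifting) mem_Collect_eq)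
  have c: "z \<in> carrier T" "y \<in> carrier T'" using z y C.C_carrier C'.C_carrier by blast+
  have "y \<ominus>\<^bsub>T'\<^esub> f z \<in> C'.cycles (Suc n)"
    using c z y dy C'.diff_C[OF y f_C[OF z(1)]]
    by (simp add: C'.cycles_def C'.d_diff f_closed f_d C'.T.diff_self C'.d_closed)
  then obtain w b where w: "w \<in> C.cycles (Suc n)" and b: "b \<in> C' (Suc (Suc n))"
    and yw: "y \<ominus>\<^bsub>T'\<^esub> f z = f w \<oplus>\<^bsub>T'\<^esub> d' b"
    using s unfolding hsurj_def by blast
  have c': "w \<in> carrier T" "b \<in> carrier T'" "d' b \<in> carrier T'"
    using w b C.C_carrier C'.C_carrier C'.d_closed by (auto simp: C.cycles_def)
  have "y = (f w \<oplus>\<^bsub>T'\<^esub> d' b) \<oplus>\<^bsub>T'\<^esub> f z"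
    using C'.T.diff_add_cancel[OF c(2) f_closed[OF c(1)]] yw by simp
  also have "\<dots> = f (z \<oplus>\<^bsub>T\<^esub> w) \<oplus>\<^bsub>T'\<^esub> d' b"
    using c c' by (simp add: f_add f_closed C'.T.a_ac)
  finally have "y = f (z \<oplus>\<^bsub>T\<^esub> w) \<oplus>\<^bsub>T'\<^esub> d' b" .
  moreover have "d (z \<oplus>\<^bsub>T\<^esub> w) = x"
    using w z c c' C.d_closed by (auto simp: C.d_add C.cycles_def)
  moreover have "z \<oplus>\<^bsub>T\<^esub> w \<in> C (Suc n)" using z w C.add_C by (auto simp: C.cycles_def)
  ultimately show "\<exists>x' \<in> C (Suc n). \<exists>y' \<in> C' (Suc (Suc n)). d x' = x \<and> y = f x' \<oplus>\<^bsub>T'\<^esub> d' y'"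
    using b by blast
qed

lemma hinj_0: "hinj 0"
  unfolding hinj_def
proof (intro ballI impI)
  fix x assume "x \<in> C.cycles 0"
  then have "x = d \<zero>\<^bsub>T\<^esub>" using C.C_zero C.d_zero by (auto simp: C.cycles_def)
  then show "\<exists>x' \<in> C (Suc 0). x = d x'" using C.zero_C by blast
qed

end

text \<open>
  If the maps \<open>\<alpha>\<close> and \<open>\<beta>\<close> of a commutative square \<open>f \<circ> \<alpha> = \<beta> \<circ> g\<close> induce isomorphisms on homology, then
  \<open>f\<close> is injective or surjective on homology wherever \<open>g\<close> is.
\<close>

locale square =
  g: chain_map K TA A dA TB B dB g + f: chain_map K TC C dC TD D dD f +
  \<alpha>: chain_map K TA A dA TC C dC \<alpha> + \<beta>: chain_map K TB B dB TD D dD \<beta>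
  for K :: "('k, 'r) ring_scheme" and TA :: "('k, 'x) module" and A dA and TB :: "('k, 'y) module" and B dB
    and TC :: "('k, 'v) module" and C dC and TD :: "('k, 'w) module" and D dD and g f \<alpha> \<beta> +
  assumes commutes: "x \<in> carrier TA \<Longrightarrow> f (\<alpha> x) = \<beta> (g x)"
begin

lemma hinj_transport:
  assumes "\<alpha>.hsurj n" "\<beta>.hinj n" "g.hinj n"
  shows "f.hinj n"
  unfolding f.hinj_def
proof (intro ballI impI)
  fix x y assume x: "x \<in> f.C.cycles n" and y: "y \<in> D (Suc n)" "f x = dD y"
  obtain a x1 where a: "a \<in> g.C.cycles n" and x1: "x1 \<in> C (Suc n)" and xa: "x = \<alpha> a \<oplus>\<^bsub>TC\<^esub> dC x1"
    using assms(1) x unfolding \<alpha>.hsurj_def by blast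
  have c: "a \<in> carrier TA" "x1 \<in> carrier TC" "y \<in> carrier TD" "dA a = \<zero>\<^bsub>TA\<^esub>" "a \<in> A n"
    "g a \<in> carrier TB" "\<alpha> a \<in> carrier TC" "dC x1 \<in> carrier TC" "f x1 \<in> carrier TD"
    using a x1 y g.C.C_carrier f.C.C_carrier f.C'.C_carrier g.f_closed \<alpha>.f_closed f.C.d_closed f.f_closed
    by (auto simp: g.C.cycles_def)
  have "\<beta> (g a) \<oplus>\<^bsub>TD\<^esub> dD (f x1) = dD y"
    using y(2) c unfolding xa by (simp add: f.f_add commutes f.f_d)
  then have "\<beta> (g a) = dD (y \<ominus>\<^bsub>TD\<^esub> f x1)"
    using c by (metis \<beta>.f_closed f.C'.T.diff_eq_iff f.C'.d_closed f.C'.d_diff)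
  moreover have "g a \<in> g.C'.cycles n"
    using c g.f_C[of a n] by (simp add: g.C'.cycles_def g.f_zero flip: g.f_d)
  moreover have "y \<ominus>\<^bsub>TD\<^esub> f x1 \<in> D (Suc n)" by (rule f.C'.diff_C[OF y(1) f.f_C[OF x1]])
  ultimately obtain b where "b \<in> B (Suc n)" "g a = dB b"
    using assms(2) unfolding \<beta>.hinj_def by blast
  then obtain a' where a': "a' \<in> A (Suc n)" "a = dA a'"
    using assms(3) a unfolding g.hinj_def by blast
  have "x = dC (\<alpha> a' \<oplus>\<^bsub>TC\<^esub> x1)"
    using c a' g.C.C_carrier[OF a'(1)] \<alpha>.f_closed unfolding xa by (simp add: f.C.d_add \<alpha>.f_d)
  then show "\<exists>x' \<in> C (Suc n). x = dC x'"
    using f.C.add_C[OF \<alpha>.f_C[OF a'(1)] x1] by blast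
qed

lemma hsurj_transport:
  assumes "\<beta>.hsurj n" "g.hsurj n"
  shows "f.hsurj n"
  unfolding f.hsurj_def
proof
  fix y assume y: "y \<in> f.C'.cycles n"
  obtain b y1 where b: "b \<in> g.C'.cycles n" and y1: "y1 \<in> D (Suc n)" and yb: "y = \<beta> b \<oplus>\<^bsub>TD\<^esub> dD y1"
    using assms(1) y unfolding \<beta>.hsurj_def by blast
  obtain a b1 where a: "a \<in> g.C.cycles n" and b1: "b1 \<in> B (Suc n)" and ba: "b = g a \<oplus>\<^bsub>TB\<^esub> dB b1"
    using assms(2) b unfolding g.hsurj_def by blast
  have c: "a \<in> carrier TA" "a \<in> A n" "dA a = \<zero>\<^bsub>TA\<^esub>" "b1 \<in> carrier TB" "y1 \<in> carrier TD"
    "dB b1 \<in> carrier TB" "dD y1 \<in> carrier TD" "g a \<in> carrier TB" "\<beta> (g a) \<in> carrier TD" "\<beta> b1 \<in> carrier TD"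
    "dD (\<beta> b1) \<in> carrier TD"
    using a b1 y1 g.C.C_carrier g.C'.C_carrier f.C'.C_carrier g.C'.d_closed f.C'.d_closed g.f_closed \<beta>.f_closed
    by (auto simp: g.C.cycles_def)
  have "y = f (\<alpha> a) \<oplus>\<^bsub>TD\<^esub> dD (\<beta> b1 \<oplus>\<^bsub>TD\<^esub> y1)"
    unfolding yb ba using c by (simp add: \<beta>.f_add \<beta>.f_d commutes f.C'.d_add f.C'.T.a_assoc)
  moreover have "\<alpha> a \<in> f.C.cycles n"
    using c \<alpha>.f_C[of a n] by (simp add: f.C.cycles_def \<alpha>.f_zero flip: \<alpha>.f_d)
  moreover have "\<beta> b1 \<oplus>\<^bsub>TD\<^esub> y1 \<in> D (Suc n)" by (rule f.C'.add_C[OF \<beta>.f_C[OF b1] y1])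
  ultimately show "\<exists>x \<in> f.C.cycles n. \<exists>b \<in> D (Suc n). y = f x \<oplus>\<^bsub>TD\<^esub> dD b" by blast
qed

end

text \<open>
  A surjection from a map \<open>fP\<close> of complexes onto a map \<open>fM\<close>, with kernel \<open>N \<rightarrow> N'\<close>.  The next lemmas are
  parts of the long exact sequence of the three mapping cones.
\<close>

locale chain_ses =
  P: chain_map K TP P dP TP' P' dP' fP + M: chain_map K TM M dM TM' M' dM' fM +
  \<pi>: chain_map K TP P dP TM M dM \<pi> + \<pi>': chain_map K TP' P' dP' TM' M' dM' \<pi>'
  for K :: "('k, 'r) ring_scheme" and TP :: "('k, 'x) module" and P dP and TP' :: "('k, 'y) module" and P' dP'
    and TM :: "('k, 'v) module" and M dM and TM' :: "('k, 'w) module" and M' dM' and fP fM \<pi> \<pi>' +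
  assumes commutes: "x \<in> carrier TP \<Longrightarrow> fM (\<pi> x) = \<pi>' (fP x)"
    and surj: "z \<in> M n \<Longrightarrow> \<exists>x \<in> P n. \<pi> x = z"
    and surj': "z' \<in> M' n \<Longrightarrow> \<exists>x \<in> P' n. \<pi>' x = z'"
begin

definition N where "N n = {x \<in> P n. \<pi> x = \<zero>\<^bsub>TM\<^esub>}"
definition N' where "N' n = {x \<in> P' n. \<pi>' x = \<zero>\<^bsub>TM'\<^esub>}"

abbreviation sub_exact :: "nat \<Rightarrow> bool"
  where "sub_exact n \<equiv> rel_exact TP N dP TP' N' dP' fP n"

lemma quotient_exact_0:
  assumes "P.exact 0" shows "M.exact 0"
  unfolding rel_exact_def
proof (intro ballI impI)
  fix x y assume x: "x \<in> M 0" and y: "y \<in> M' (Suc 0)"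
  have x0: "x = \<zero>\<^bsub>TM\<^esub>" using x M.C.C_zero by blast
  obtain y1 where y1: "y1 \<in> P' (Suc 0)" "\<pi>' y1 = y" using surj'[OF y] by blast
  have "dP' y1 = fP \<zero>\<^bsub>TP\<^esub>"
    using P.C'.d_C[OF y1(1)] P.C'.C_zero P.f_zero by auto
  then obtain x' y' where x': "x' \<in> P (Suc 0)" and y': "y' \<in> P' (Suc (Suc 0))" and d: "dP x' = \<zero>\<^bsub>TP\<^esub>"
    and e: "y1 = fP x' \<oplus>\<^bsub>TP'\<^esub> dP' y'"
    using rel_exactD[OF assms P.C.zero_C y1(1) P.C.d_zero] by blast
  have c: "x' \<in> carrier TP" "y' \<in> carrier TP'" "fP x' \<in> carrier TP'" "dP' y' \<in> carrier TP'"
    using x' y' P.C.C_carrier P.C'.C_carrier P.f_closed P.C'.d_closed by blast+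
  have "y = fM (\<pi> x') \<oplus>\<^bsub>TM'\<^esub> dM' (\<pi>' y')"
    unfolding y1(2)[symmetric] e using c by (simp add: \<pi>'.f_add commutes \<pi>'.f_d)
  moreover have "dM (\<pi> x') = x" using c d x0 by (simp add: \<pi>.f_zero flip: \<pi>.f_d)
  ultimately show "\<exists>x' \<in> M (Suc 0). \<exists>y' \<in> M' (Suc (Suc 0)). dM x' = x \<and> y = fM x' \<oplus>\<^bsub>TM'\<^esub> dM' y'"
    using \<pi>.f_C[OF x'] \<pi>'.f_C[OF y'] by blast
qed

text \<open>
  A cycle of the cone of \<open>fM\<close> is lifted to the cone of \<open>fP\<close>.  The boundary of the lift lies in the cone
  of the kernel, where it is again a cycle one degree lower and hence a boundary; this corrects the lift
  to a cycle, which bounds.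
\<close>

lemma quotient_exact_Suc:
  assumes P: "P.exact (Suc n)" and Nn: "sub_exact n"
  shows "M.exact (Suc n)"
  unfolding rel_exact_def
proof (intro ballI impI)
  fix x y assume x: "x \<in> M (Suc n)" and y: "y \<in> M' (Suc (Suc n))"
    and dx: "dM x = \<zero>\<^bsub>TM\<^esub>" and dy: "dM' y = fM x"
  obtain x1 where x1: "x1 \<in> P (Suc n)" "\<pi> x1 = x" using surj[OF x] by blast
  obtain y1 where y1: "y1 \<in> P' (Suc (Suc n))" "\<pi>' y1 = y" using surj'[OF y] by blast
  have c: "x1 \<in> carrier TP" "y1 \<in> carrier TP'" "dP x1 \<in> carrier TP" "dP' y1 \<in> carrier TP'"
    "fP x1 \<in> carrier TP'"
    using x1 y1 P.C.C_carrier P.C'.C_carrier P.C.d_closed P.C'.d_closed P.f_closed by blast+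
  \<comment> \<open>\<open>(u, v)\<close> is the boundary of the lift \<open>(x1, y1)\<close> in the cone.\<close>
  define u where "u = dP x1"
  define v where "v = fP x1 \<ominus>\<^bsub>TP'\<^esub> dP' y1"
  have u: "u \<in> N n"
    using P.C.d_C[OF x1(1)] c dx x1(2) by (simp add: u_def N_def \<pi>.f_d)
  have v: "v \<in> N' (Suc n)"
    using P.C'.diff_C[OF P.f_C[OF x1(1)] P.C'.d_C[OF y1(1)]] c dy x1(2) y1(2)
    by (simp add: v_def N'_def \<pi>'.f_diff \<pi>'.f_d M.f_closed M.C.C_carrier[OF x] M.C'.T.diff_self
        flip: commutes)
  have "dP u = \<zero>\<^bsub>TP\<^esub>" using c by (simp add: u_def P.C.d_d)
  moreover have "dP' v = fP u"
    using c by (simp add: v_def u_def P.C'.d_diff P.f_d P.C'.d_d P.C'.T.diff_zero P.C'.d_closed)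
  ultimately obtain u' v' where u': "u' \<in> N (Suc n)" "dP u' = u" and v': "v' \<in> N' (Suc (Suc n))"
    and ve: "v = fP u' \<oplus>\<^bsub>TP'\<^esub> dP' v'"
    using rel_exactD[OF Nn u v] by metis
  have u'P: "u' \<in> P (Suc n)" "\<pi> u' = \<zero>\<^bsub>TM\<^esub>" and v'P: "v' \<in> P' (Suc (Suc n))" "\<pi>' v' = \<zero>\<^bsub>TM'\<^esub>"
    using u' v' by (auto simp: N_def N'_def)
  have c': "u' \<in> carrier TP" "v' \<in> carrier TP'" "fP u' \<in> carrier TP'" "dP' v' \<in> carrier TP'"
    using u'P v'P P.C.C_carrier P.C'.C_carrier P.f_closed P.C'.d_closed by blast+
  \<comment> \<open>The corrected lift \<open>(x1 - u', y1 + v')\<close> is a cycle of the cone of \<open>fP\<close>.\<close>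
  have "dP (x1 \<ominus>\<^bsub>TP\<^esub> u') = \<zero>\<^bsub>TP\<^esub>"
    using c c' u'(2) by (simp add: P.C.d_diff u_def P.C.T.diff_self)
  moreover have "dP' (y1 \<oplus>\<^bsub>TP'\<^esub> v') = fP (x1 \<ominus>\<^bsub>TP\<^esub> u')"
  proof -
    have "fP x1 = v \<oplus>\<^bsub>TP'\<^esub> dP' y1"
      unfolding v_def using P.C'.T.diff_add_cancel[OF c(5,4)] by simp
    then have "fP x1 = (dP' y1 \<oplus>\<^bsub>TP'\<^esub> dP' v') \<oplus>\<^bsub>TP'\<^esub> fP u'"
      unfolding ve using c c' by (simp add: P.C'.T.a_ac)
    then have "fP x1 \<ominus>\<^bsub>TP'\<^esub> fP u' = dP' y1 \<oplus>\<^bsub>TP'\<^esub> dP' v'"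
      using c c' P.C'.T.diff_eq_iff by simp
    then show ?thesis using c c' by (simp add: P.f_diff P.C'.d_add)
  qed
  ultimately obtain x' y' where x': "x' \<in> P (Suc (Suc n))" "dP x' = x1 \<ominus>\<^bsub>TP\<^esub> u'"
    and y': "y' \<in> P' (Suc (Suc (Suc n)))" "y1 \<oplus>\<^bsub>TP'\<^esub> v' = fP x' \<oplus>\<^bsub>TP'\<^esub> dP' y'"
    using rel_exactD[OF P P.C.diff_C[OF x1(1) u'P(1)] P.C'.add_C[OF y1(1) v'P(1)]] by metis
  have c'': "x' \<in> carrier TP" "y' \<in> carrier TP'" "fP x' \<in> carrier TP'" "dP' y' \<in> carrier TP'"
    using x' y' P.C.C_carrier P.C'.C_carrier P.f_closed P.C'.d_closed by blast+
  have "dM (\<pi> x') = \<pi> (x1 \<ominus>\<^bsub>TP\<^esub> u')" using c'' x'(2) by (simp flip: \<pi>.f_d)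
  also have "\<dots> = x" using c c' x1(2) u'P(2) M.C.C_carrier[OF x] by (simp add: \<pi>.f_diff M.C.T.diff_zero)
  finally have "dM (\<pi> x') = x" .
  moreover have "y = fM (\<pi> x') \<oplus>\<^bsub>TM'\<^esub> dM' (\<pi>' y')"
  proof -
    have "y = \<pi>' (y1 \<oplus>\<^bsub>TP'\<^esub> v')"
      using c c' y1(2) v'P(2) M.C'.C_carrier[OF y] by (simp add: \<pi>'.f_add)
    then show ?thesis unfolding y'(2) using c'' by (simp add: \<pi>'.f_add commutes \<pi>'.f_d)
  qed
  ultimately show "\<exists>x' \<in> M (Suc (Suc n)). \<exists>y' \<in> M' (Suc (Suc (Suc n))). dM x' = x \<and> y = fM x' \<oplus>\<^bsub>TM'\<^esub> dM' y'"
    using \<pi>.f_C[OF x'(1)] \<pi>'.f_C[OF y'(1)] by blast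
qed

text \<open>
  The image of a cycle in the cone of \<open>fM\<close> bounds.  After the boundary of a lift is subtracted, the cycle
  lies in the cone of the kernel.
\<close>

lemma extension_exact:
  assumes Nn: "sub_exact n" and Mn: "M.exact n"
  shows "P.exact n"
  unfolding rel_exact_def
proof (intro ballI impI)
  fix x y assume x: "x \<in> P n" and y: "y \<in> P' (Suc n)"
    and dx: "dP x = \<zero>\<^bsub>TP\<^esub>" and dy: "dP' y = fP x"
  have c: "x \<in> carrier TP" "y \<in> carrier TP'" using x y P.C.C_carrier P.C'.C_carrier by blast+
  have 1: "dM (\<pi> x) = \<zero>\<^bsub>TM\<^esub>" using c dx by (simp add: \<pi>.f_zero flip: \<pi>.f_d)
  have 2: "dM' (\<pi>' y) = fM (\<pi> x)" using c dy by (simp add: commutes flip: \<pi>'.f_d)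
  obtain a b where a: "a \<in> M (Suc n)" "dM a = \<pi> x" and b: "b \<in> M' (Suc (Suc n))"
    and e: "\<pi>' y = fM a \<oplus>\<^bsub>TM'\<^esub> dM' b"
    using rel_exactD[OF Mn \<pi>.f_C[OF x] \<pi>'.f_C[OF y] 1 2] by blast
  obtain a1 where a1: "a1 \<in> P (Suc n)" "\<pi> a1 = a" using surj[OF a(1)] by blast
  obtain b1 where b1: "b1 \<in> P' (Suc (Suc n))" "\<pi>' b1 = b" using surj'[OF b] by blast
  have c': "a1 \<in> carrier TP" "b1 \<in> carrier TP'" "dP a1 \<in> carrier TP" "dP' b1 \<in> carrier TP'"
    "fP a1 \<in> carrier TP'" "fP x \<in> carrier TP'" "fP (dP a1) \<in> carrier TP'" "dP' (fP a1) \<in> carrier TP'"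
    using a1 b1 c P.C.C_carrier P.C'.C_carrier P.C.d_closed P.C'.d_closed P.f_closed by blast+
  define r where "r = fP a1 \<oplus>\<^bsub>TP'\<^esub> dP' b1"
  have rc: "r \<in> carrier TP'" "r \<in> P' (Suc n)"
    using c' P.C'.add_C[OF P.f_C[OF a1(1)] P.C'.d_C[OF b1(1)]] by (simp_all add: r_def)
  have pr: "\<pi>' r = \<pi>' y" unfolding r_def e using c' a1 b1 by (simp add: \<pi>'.f_add \<pi>'.f_d flip: commutes)
  have dr: "dP' r = fP (dP a1)"
    unfolding r_def using c' by (simp add: P.C'.d_add P.C'.d_d P.f_d)
  have u: "x \<ominus>\<^bsub>TP\<^esub> dP a1 \<in> N n"
    using c c' P.C.diff_C[OF x P.C.d_C[OF a1(1)]] a1(2) a(2)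
    by (simp add: N_def \<pi>.f_diff \<pi>.f_d M.C.T.diff_self \<pi>.f_closed)
  have v: "y \<ominus>\<^bsub>TP'\<^esub> r \<in> N' (Suc n)"
    using c rc P.C'.diff_C[OF y rc(2)] pr
    by (simp add: N'_def \<pi>'.f_diff M.C'.T.diff_self \<pi>'.f_closed)
  have 3: "dP (x \<ominus>\<^bsub>TP\<^esub> dP a1) = \<zero>\<^bsub>TP\<^esub>"
    using c c' dx by (simp add: P.C.d_diff P.C.d_d P.C.T.diff_zero)
  have 4: "dP' (y \<ominus>\<^bsub>TP'\<^esub> r) = fP (x \<ominus>\<^bsub>TP\<^esub> dP a1)"
    using c c' rc by (simp add: P.C'.d_diff P.f_diff dy dr)
  obtain x' y' where x': "x' \<in> N (Suc n)" "dP x' = x \<ominus>\<^bsub>TP\<^esub> dP a1"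
    and y': "y' \<in> N' (Suc (Suc n))" "y \<ominus>\<^bsub>TP'\<^esub> r = fP x' \<oplus>\<^bsub>TP'\<^esub> dP' y'"
    using rel_exactD[OF Nn u v 3 4] by metis
  have xy': "x' \<in> P (Suc n)" "y' \<in> P' (Suc (Suc n))" using x' y' by (auto simp: N_def N'_def)
  have c'': "x' \<in> carrier TP" "y' \<in> carrier TP'" "fP x' \<in> carrier TP'" "dP' y' \<in> carrier TP'"
    using xy' P.C.C_carrier P.C'.C_carrier P.f_closed P.C'.d_closed by blast+
  have "dP (x' \<oplus>\<^bsub>TP\<^esub> a1) = x"
    using c c' c'' x'(2) by (simp add: P.C.d_add P.C.T.diff_add_cancel)
  moreover have "y = fP (x' \<oplus>\<^bsub>TP\<^esub> a1) \<oplus>\<^bsub>TP'\<^esub> dP' (y' \<oplus>\<^bsub>TP'\<^esub> b1)"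
  proof -
    have "y = (fP x' \<oplus>\<^bsub>TP'\<^esub> dP' y') \<oplus>\<^bsub>TP'\<^esub> r"
      using P.C'.T.diff_add_cancel[OF c(2) rc(1)] y'(2) by simp
    then show ?thesis unfolding r_def using c c' c'' by (simp add: P.f_add P.C'.d_add P.C'.T.a_ac)
  qed
  ultimately show "\<exists>x' \<in> P (Suc n). \<exists>y' \<in> P' (Suc (Suc n)). dP x' = x \<and> y = fP x' \<oplus>\<^bsub>TP'\<^esub> dP' y'"
    using P.C.add_C[OF xy'(1) a1(1)] P.C'.add_C[OF xy'(2) b1(1)] by blast
qed

end

section \<open>Homology of the bar complex\<close>

context group_rep begin

lemma chain_cplx: "chain_cplx K Ch C bd"
proof
  show "linear_map K Ch Ch bd" by (rule bd_linear)
qed (use C_Ch in \<open>simp_all add: C_zero zero_C add_C minus_C bd_C bd_bd del: fsupp_simps\<close>)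

sublocale B: chain_cplx K Ch C bd by (rule chain_cplx)

lemma smult_C: "a \<in> carrier K \<Longrightarrow> x \<in> C n \<Longrightarrow> a \<odot>\<^bsub>Ch\<^esub> x \<in> C n"
proof -
  interpret D: module K "fsupp (deg n) M" by (rule fsupp_module[OF mod])
  show "a \<in> carrier K \<Longrightarrow> x \<in> C n \<Longrightarrow> a \<odot>\<^bsub>Ch\<^esub> x \<in> C n"
    using D.smult_closed[of a x] by (simp add: C_def Ch_def)
qed

lemma bar_cycles_eq: "bar_cycles G M act q = B.cycles (Suc q)"
proof -
  have "bd c = \<zero>\<^bsub>Ch\<^esub>" if "c \<in> C (Suc 0)" for c
    using bd_C[OF that] C_zero by blast
  moreover have "\<zero>\<^bsub>Ch\<^esub> = (\<lambda>_. \<zero>\<^bsub>M\<^esub>)" by (simp add: Ch_def)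
  ultimately show ?thesis
    unfolding bar_cycles_def B.cycles_def carrier_bar_chains using bar_boundary_eq_bd[of _ q]
    by (cases "q = 0") auto
qed

lemma bar_boundaries_eq: "bar_boundaries G M act q = bd ` C (Suc (Suc q))"
  unfolding bar_boundaries_def carrier_bar_chains using bar_boundary_eq_bd by (intro image_cong) auto

lemma bar_add: "x \<oplus>\<^bsub>bar_chains G M q\<^esub> y = x \<oplus>\<^bsub>Ch\<^esub> y"
  by (simp add: bar_chains_def Ch_def)

lemma coset_eq_cls:
  "a_r_coset (bar_chains G M q) (bar_boundaries G M act q) x = B.cls (Suc q) x"
  unfolding a_r_coset_def' B.cls_def bar_boundaries_eq bar_add by auto

lemma coset_eq_cls':
  "a_r_coset ((bar_chains G M q)\<lparr>carrier := Z\<rparr>) (bar_boundaries G M act q) x = B.cls (Suc q) x"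
  using coset_eq_cls[of q x] unfolding a_r_coset_def' by simp

lemma homology_carrier: "carrier (homology G M act q) = B.cls (Suc q) ` B.cycles (Suc q)"
  unfolding homology_def quotient_module_def A_RCOSETS_def' coset_eq_cls' bar_cycles_eq by auto

lemma cyclesD: "x \<in> B.cycles n \<Longrightarrow> x \<in> C n" "x \<in> B.cycles n \<Longrightarrow> x \<in> carrier Ch"
  using C_Ch by (auto simp: B.cycles_def)

lemma homology_add:
  assumes x: "x \<in> B.cycles (Suc q)" and y: "y \<in> B.cycles (Suc q)"
  shows "B.cls (Suc q) x \<oplus>\<^bsub>homology G M act q\<^esub> B.cls (Suc q) y = B.cls (Suc q) (x \<oplus>\<^bsub>Ch\<^esub> y)"
proof -
  have c: "x \<in> carrier Ch" "y \<in> carrier Ch" using x y cyclesD by auto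
  have "B.cls (Suc q) x \<oplus>\<^bsub>homology G M act q\<^esub> B.cls (Suc q) y =
      {u \<oplus>\<^bsub>Ch\<^esub> v |u v. u \<in> B.cls (Suc q) x \<and> v \<in> B.cls (Suc q) y}"
    by (auto simp: homology_def quotient_module_def set_add_def' bar_chains_def Ch_def)
  also have "\<dots> = B.cls (Suc q) (x \<oplus>\<^bsub>Ch\<^esub> y)"
  proof
    show "{u \<oplus>\<^bsub>Ch\<^esub> v |u v. u \<in> B.cls (Suc q) x \<and> v \<in> B.cls (Suc q) y} \<subseteq> B.cls (Suc q) (x \<oplus>\<^bsub>Ch\<^esub> y)"
    proof clarify
      fix u v assume "u \<in> B.cls (Suc q) x" "v \<in> B.cls (Suc q) y"
      then obtain b e where b: "b \<in> C (Suc (Suc q))" "u = bd b \<oplus>\<^bsub>Ch\<^esub> x"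
        and e: "e \<in> C (Suc (Suc q))" "v = bd e \<oplus>\<^bsub>Ch\<^esub> y" by (auto simp: B.cls_def)
      have "b \<in> carrier Ch" "e \<in> carrier Ch" using b e C_Ch by auto
      then have "u \<oplus>\<^bsub>Ch\<^esub> v = bd (b \<oplus>\<^bsub>Ch\<^esub> e) \<oplus>\<^bsub>Ch\<^esub> (x \<oplus>\<^bsub>Ch\<^esub> y)"
        using c unfolding b(2) e(2) by (simp add: B.d_add bd_closed Ch.a_ac)
      then show "u \<oplus>\<^bsub>Ch\<^esub> v \<in> B.cls (Suc q) (x \<oplus>\<^bsub>Ch\<^esub> y)"
        unfolding B.cls_def using add_C[OF b(1) e(1)] by blast
    qed
    show "B.cls (Suc q) (x \<oplus>\<^bsub>Ch\<^esub> y) \<subseteq> {u \<oplus>\<^bsub>Ch\<^esub> v |u v. u \<in> B.cls (Suc q) x \<and> v \<in> B.cls (Suc q) y}"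
    proof
      fix z assume "z \<in> B.cls (Suc q) (x \<oplus>\<^bsub>Ch\<^esub> y)"
      then obtain b where b: "b \<in> C (Suc (Suc q))" "z = bd b \<oplus>\<^bsub>Ch\<^esub> (x \<oplus>\<^bsub>Ch\<^esub> y)" by (auto simp: B.cls_def)
      then have "z = (bd b \<oplus>\<^bsub>Ch\<^esub> x) \<oplus>\<^bsub>Ch\<^esub> y"
        using c C_Ch bd_closed by (auto simp only: Ch.a_assoc subset_iff)
      moreover have "bd b \<oplus>\<^bsub>Ch\<^esub> x \<in> B.cls (Suc q) x" using b(1) by (auto simp: B.cls_def)
      moreover have "y \<in> B.cls (Suc q) y" using B.cls_self[OF cyclesD(1)[OF y]] .
      ultimately show "z \<in> {u \<oplus>\<^bsub>Ch\<^esub> v |u v. u \<in> B.cls (Suc q) x \<and> v \<in> B.cls (Suc q) y}" by blast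
    qed
  qed
  finally show ?thesis .
qed

lemma homology_smult:
  assumes a: "a \<in> carrier K" and x: "x \<in> B.cycles (Suc q)"
  shows "a \<odot>\<^bsub>homology G M act q\<^esub> B.cls (Suc q) x = B.cls (Suc q) (a \<odot>\<^bsub>Ch\<^esub> x)"
proof -
  have "a \<odot>\<^bsub>homology G M act q\<^esub> B.cls (Suc q) x =
      (\<Union>z \<in> B.cls (Suc q) x. B.cls (Suc q) (a \<odot>\<^bsub>bar_chains G M q\<^esub> z))"
    by (simp add: homology_def quotient_module_def coset_eq_cls')
  also have "\<dots> = (\<Union>z \<in> B.cls (Suc q) x. B.cls (Suc q) (a \<odot>\<^bsub>Ch\<^esub> x))"
  proof (rule SUP_cong[OF refl])
    fix z assume "z \<in> B.cls (Suc q) x"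
    then obtain b where b: "b \<in> C (Suc (Suc q))" "z = bd b \<oplus>\<^bsub>Ch\<^esub> x" by (auto simp: B.cls_def)
    have c: "b \<in> carrier Ch" using b(1) C_Ch by auto
    have "a \<odot>\<^bsub>bar_chains G M q\<^esub> z = a \<odot>\<^bsub>Ch\<^esub> z" by (simp add: bar_chains_def Ch_def)
    also have "\<dots> = bd (a \<odot>\<^bsub>Ch\<^esub> b) \<oplus>\<^bsub>Ch\<^esub> (a \<odot>\<^bsub>Ch\<^esub> x)"
      unfolding b(2) using a c cyclesD(2)[OF x]
      by (simp only: Ch.smult_r_distr bd_closed linear_map_smult[OF bd_linear])
    finally show "B.cls (Suc q) (a \<odot>\<^bsub>bar_chains G M q\<^esub> z) = B.cls (Suc q) (a \<odot>\<^bsub>Ch\<^esub> x)"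
      using B.cls_eqI[OF smult_C[OF a b(1)] smult_C[OF a cyclesD(1)[OF x]]] by simp
  qed
  also have "\<dots> = B.cls (Suc q) (a \<odot>\<^bsub>Ch\<^esub> x)" using B.cls_self[OF cyclesD(1)[OF x]] by auto
  finally show ?thesis .
qed

lemma cycles_add:
  assumes "x \<in> B.cycles n" "y \<in> B.cycles n" shows "x \<oplus>\<^bsub>Ch\<^esub> y \<in> B.cycles n"
proof -
  have "bd (x \<oplus>\<^bsub>Ch\<^esub> y) = \<zero>\<^bsub>Ch\<^esub> \<oplus>\<^bsub>Ch\<^esub> \<zero>\<^bsub>Ch\<^esub>"
    using assms B.d_add[OF cyclesD(2)[OF assms(1)] cyclesD(2)[OF assms(2)]]
    by (simp only: B.cycles_def mem_Collect_eq)
  then have "bd (x \<oplus>\<^bsub>Ch\<^esub> y) = \<zero>\<^bsub>Ch\<^esub>" by (simp only: Ch.r_zero[OF Ch.zero_closed])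
  then show ?thesis
    using add_C[OF cyclesD(1)[OF assms(1)] cyclesD(1)[OF assms(2)]] unfolding B.cycles_def by blast
qed

lemma cycles_smult:
  assumes "a \<in> carrier K" "x \<in> B.cycles n" shows "a \<odot>\<^bsub>Ch\<^esub> x \<in> B.cycles n"
proof -
  have "bd (a \<odot>\<^bsub>Ch\<^esub> x) = a \<odot>\<^bsub>Ch\<^esub> \<zero>\<^bsub>Ch\<^esub>"
    using assms linear_map_smult[OF bd_linear assms(1) cyclesD(2)[OF assms(2)]]
    by (simp only: B.cycles_def mem_Collect_eq)
  then have "bd (a \<odot>\<^bsub>Ch\<^esub> x) = \<zero>\<^bsub>Ch\<^esub>" by (simp only: Ch.smult_r_null[OF assms(1)])
  then show ?thesis
    using smult_C[OF assms(1) cyclesD(1)[OF assms(2)]] unfolding B.cycles_def by blast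
qed

end

context rep_map begin

lemma chain_map: "chain_map K R.Ch R.C R.bd R'.Ch R'.C R'.bd chmap"
proof
  show "linear_map K R.Ch R'.Ch chmap" by (rule chmap_linear)
qed (simp_all add: chmap_C chmap_bd)

sublocale F: chain_map K R.Ch R.C R.bd R'.Ch R'.C R'.bd chmap by (rule chain_map)

lemma chmap_cycles: "x \<in> R.B.cycles n \<Longrightarrow> chmap x \<in> R'.B.cycles n"
  using R.cyclesD[of x n]
  by (auto simp: R.B.cycles_def R'.B.cycles_def chmap_C F.f_zero simp flip: chmap_bd simp del: fsupp_simps)

lemma homology_map_cls:
  assumes x: "x \<in> R.B.cycles (Suc q)"
  shows "homology_map M G' M' act' \<phi> \<psi> q (R.B.cls (Suc q) x) = R'.B.cls (Suc q) (chmap x)"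
proof -
  have "homology_map M G' M' act' \<phi> \<psi> q (R.B.cls (Suc q) x) =
      (\<Union>c \<in> R.B.cls (Suc q) x. R'.B.cls (Suc q) (chmap x))"
    unfolding homology_map_def R'.coset_eq_cls
  proof (rule SUP_cong[OF refl])
    fix c assume "c \<in> R.B.cls (Suc q) x"
    then obtain b where b: "b \<in> R.C (Suc (Suc q))" "c = R.bd b \<oplus>\<^bsub>R.Ch\<^esub> x" by (auto simp: R.B.cls_def)
    have c: "b \<in> carrier R.Ch" "x \<in> carrier R.Ch" using b(1) R.C_Ch R.cyclesD(2)[OF x] by auto
    then have cc: "c \<in> carrier R.Ch" unfolding b(2) by (simp only: R.Ch.a_closed R.bd_closed)
    have "chmap c = R'.bd (chmap b) \<oplus>\<^bsub>R'.Ch\<^esub> chmap x"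
      unfolding b(2) using c by (simp only: F.f_add R.bd_closed chmap_bd)
    then show "R'.B.cls (Suc q) (bar_map M M' \<phi> \<psi> c) = R'.B.cls (Suc q) (chmap x)"
      unfolding bar_map_eq_chmap[OF cc]
      using R'.B.cls_eqI[OF chmap_C[OF b(1)] chmap_C[OF R.cyclesD(1)[OF x]]] by simp
  qed
  then show ?thesis using R.B.cls_self[OF R.cyclesD(1)[OF x]] by auto
qed

lemma homology_map_linear:
  "linear_map K (homology G M act q) (homology G' M' act' q) (homology_map M G' M' act' \<phi> \<psi> q)"
  unfolding linear_map_def
proof (intro conjI ballI funcsetI)
  fix X assume "X \<in> carrier (homology G M act q)"
  then obtain x where x: "x \<in> R.B.cycles (Suc q)" "X = R.B.cls (Suc q) x" by (auto simp: R.homology_carrier)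
  show "homology_map M G' M' act' \<phi> \<psi> q X \<in> carrier (homology G' M' act' q)"
    unfolding x(2) homology_map_cls[OF x(1)] R'.homology_carrier using chmap_cycles[OF x(1)] by blast
next
  fix X Y assume "X \<in> carrier (homology G M act q)" "Y \<in> carrier (homology G M act q)"
  then obtain x y where x: "x \<in> R.B.cycles (Suc q)" "X = R.B.cls (Suc q) x"
    and y: "y \<in> R.B.cycles (Suc q)" "Y = R.B.cls (Suc q) y" by (auto simp: R.homology_carrier)
  show "homology_map M G' M' act' \<phi> \<psi> q (X \<oplus>\<^bsub>homology G M act q\<^esub> Y) =
      homology_map M G' M' act' \<phi> \<psi> q X \<oplus>\<^bsub>homology G' M' act' q\<^esub> homology_map M G' M' act' \<phi> \<psi> q Y"
    unfolding x(2) y(2) R.homology_add[OF x(1) y(1)] homology_map_cls[OF x(1)] homology_map_cls[OF y(1)]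
      homology_map_cls[OF R.cycles_add[OF x(1) y(1)]]
      R'.homology_add[OF chmap_cycles[OF x(1)] chmap_cycles[OF y(1)]]
    using R.cyclesD(2)[OF x(1)] R.cyclesD(2)[OF y(1)] by (simp only: F.f_add)
next
  fix a X assume a: "a \<in> carrier K" and "X \<in> carrier (homology G M act q)"
  then obtain x where x: "x \<in> R.B.cycles (Suc q)" "X = R.B.cls (Suc q) x" by (auto simp: R.homology_carrier)
  show "homology_map M G' M' act' \<phi> \<psi> q (a \<odot>\<^bsub>homology G M act q\<^esub> X) =
      a \<odot>\<^bsub>homology G' M' act' q\<^esub> homology_map M G' M' act' \<phi> \<psi> q X"
    unfolding x(2) R.homology_smult[OF a x(1)] homology_map_cls[OF x(1)]
      homology_map_cls[OF R.cycles_smult[OF a x(1)]] R'.homology_smult[OF a chmap_cycles[OF x(1)]]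
    using linear_map_smult[OF chmap_linear a R.cyclesD(2)[OF x(1)]] by simp
qed

text \<open>
  This is where the cosets, unions and quotient modules in the definition of group homology are traded
  for statements about cycles and boundaries.
\<close>

theorem module_iso_iff:
  "module_iso K (homology G M act q) (homology G' M' act' q) (homology_map M G' M' act' \<phi> \<psi> q) \<longleftrightarrow>
    F.hsurj (Suc q) \<and> F.hinj (Suc q)"
proof -
  let ?h = "homology_map M G' M' act' \<phi> \<psi> q"
  let ?Z = "R.B.cycles (Suc q)" and ?Z' = "R'.B.cycles (Suc q)"
  have "F.hsurj (Suc q) \<longleftrightarrow> ?h ` carrier (homology G M act q) = carrier (homology G' M' act' q)"
  proof
    assume s: "F.hsurj (Suc q)"
    have "\<exists>X \<in> carrier (homology G M act q). ?h X = Y" if "Y \<in> carrier (homology G' M' act' q)" for Y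
    proof -
      obtain y where y: "y \<in> ?Z'" "Y = R'.B.cls (Suc q) y" using \<open>Y \<in> _\<close> by (auto simp: R'.homology_carrier)
      obtain x b where x: "x \<in> ?Z" and b: "b \<in> R'.C (Suc (Suc q))" and e: "y = chmap x \<oplus>\<^bsub>R'.Ch\<^esub> R'.bd b"
        using s y(1) unfolding F.hsurj_def by blast
      have c: "chmap x \<in> carrier R'.Ch" "b \<in> carrier R'.Ch"
        using R'.cyclesD(2)[OF chmap_cycles[OF x]] b R'.C_Ch by auto
      have "y = R'.bd b \<oplus>\<^bsub>R'.Ch\<^esub> chmap x" unfolding e using c by (simp only: R'.Ch.a_comm R'.bd_closed)
      then have "?h (R.B.cls (Suc q) x) = Y"
        unfolding y(2) homology_map_cls[OF x]
        using R'.B.cls_eqI[OF b R'.cyclesD(1)[OF chmap_cycles[OF x]]] by simp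
      then show ?thesis using x R.homology_carrier by blast
    qed
    then show "?h ` carrier (homology G M act q) = carrier (homology G' M' act' q)"
      using linear_map_closed[OF homology_map_linear] by blast
  next
    assume s: "?h ` carrier (homology G M act q) = carrier (homology G' M' act' q)"
    show "F.hsurj (Suc q)"
      unfolding F.hsurj_def
    proof
      fix y assume y: "y \<in> ?Z'"
      then have "R'.B.cls (Suc q) y \<in> ?h ` carrier (homology G M act q)"
        unfolding s R'.homology_carrier by blast
      then obtain x where x: "x \<in> ?Z" "R'.B.cls (Suc q) y = R'.B.cls (Suc q) (chmap x)"
        by (auto simp: R.homology_carrier homology_map_cls)
      obtain b where b: "b \<in> R'.C (Suc (Suc q))" "y = R'.bd b \<oplus>\<^bsub>R'.Ch\<^esub> chmap x"
        using R'.B.cls_eqD[OF R'.cyclesD(1)[OF y] x(2)] by blast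
      have c: "chmap x \<in> carrier R'.Ch" "b \<in> carrier R'.Ch"
        using R'.cyclesD(2)[OF chmap_cycles[OF x(1)]] b(1) R'.C_Ch by auto
      have "y = chmap x \<oplus>\<^bsub>R'.Ch\<^esub> R'.bd b" unfolding b(2) using c by (simp only: R'.Ch.a_comm R'.bd_closed)
      then show "\<exists>x \<in> ?Z. \<exists>b \<in> R'.C (Suc (Suc q)). y = chmap x \<oplus>\<^bsub>R'.Ch\<^esub> R'.bd b"
        using x(1) b(1) by blast
    qed
  qed
  moreover have "F.hinj (Suc q) \<longleftrightarrow> inj_on ?h (carrier (homology G M act q))"
  proof
    assume i: "F.hinj (Suc q)"
    show "inj_on ?h (carrier (homology G M act q))"
    proof (rule inj_onI)
      fix X Y assume "X \<in> carrier (homology G M act q)" "Y \<in> carrier (homology G M act q)"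
        and eq: "?h X = ?h Y"
      then obtain x y where x: "x \<in> ?Z" "X = R.B.cls (Suc q) x" and y: "y \<in> ?Z" "Y = R.B.cls (Suc q) y"
        by (auto simp: R.homology_carrier)
      have c: "x \<in> carrier R.Ch" "y \<in> carrier R.Ch" using R.cyclesD(2) x y by auto
      have "R'.B.cls (Suc q) (chmap x) = R'.B.cls (Suc q) (chmap y)"
        using eq by (simp only: x y homology_map_cls)
      then obtain b where b: "b \<in> R'.C (Suc (Suc q))" "chmap x = R'.bd b \<oplus>\<^bsub>R'.Ch\<^esub> chmap y"
        using R'.B.cls_eqD[OF R'.cyclesD(1)[OF chmap_cycles[OF x(1)]]] by blast
      have bc: "b \<in> carrier R'.Ch" using b(1) R'.C_Ch by auto
      have "chmap (x \<ominus>\<^bsub>R.Ch\<^esub> y) = R'.bd b"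
        unfolding F.f_diff[OF c]
        by (rule R'.Ch.diff_eq_iff[THEN iffD2, OF chmap_closed[OF c(1)] chmap_closed[OF c(2)] R'.bd_closed[OF bc] b(2)])
      moreover have "x \<ominus>\<^bsub>R.Ch\<^esub> y \<in> ?Z"
        using R.diff_C[OF R.cyclesD(1)[OF x(1)] R.cyclesD(1)[OF y(1)]] x(1) y(1) c
        by (simp add: R.B.cycles_def R.B.d_diff R.Ch.diff_zero del: fsupp_simps)
      ultimately obtain x' where x': "x' \<in> R.C (Suc (Suc q))" "x \<ominus>\<^bsub>R.Ch\<^esub> y = R.bd x'"
        using i b(1) unfolding F.hinj_def by blast
      then have "x = R.bd x' \<oplus>\<^bsub>R.Ch\<^esub> y" using R.Ch.diff_add_cancel[OF c] by simp
      then show "X = Y" unfolding x(2) y(2) using R.B.cls_eqI[OF x'(1) R.cyclesD(1)[OF y(1)]] by simp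
    qed
  next
    assume i: "inj_on ?h (carrier (homology G M act q))"
    show "F.hinj (Suc q)"
      unfolding F.hinj_def
    proof (intro ballI impI)
      fix x y assume x: "x \<in> ?Z" and y: "y \<in> R'.C (Suc (Suc q))" and e: "chmap x = R'.bd y"
      have zz: "\<zero>\<^bsub>R.Ch\<^esub> \<in> ?Z" by (simp only: R.B.cycles_def mem_Collect_eq R.zero_C R.B.d_zero simp_thms)
      have "R'.B.cls (Suc q) (chmap x) = R'.B.cls (Suc q) \<zero>\<^bsub>R'.Ch\<^esub>"
        using R'.B.cls_eqI[OF y R'.zero_C] y R'.C_Ch R'.bd_closed
        by (simp only: e R'.Ch.r_zero subset_iff)
      then have "?h (R.B.cls (Suc q) x) = ?h (R.B.cls (Suc q) \<zero>\<^bsub>R.Ch\<^esub>)"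
        by (simp only: homology_map_cls[OF x] homology_map_cls[OF zz] F.f_zero)
      then have "R.B.cls (Suc q) x = R.B.cls (Suc q) \<zero>\<^bsub>R.Ch\<^esub>"
        using inj_onD[OF i] x zz unfolding R.homology_carrier by blast
      then obtain b where b: "b \<in> R.C (Suc (Suc q))" "x = R.bd b \<oplus>\<^bsub>R.Ch\<^esub> \<zero>\<^bsub>R.Ch\<^esub>"
        using R.B.cls_eqD[OF R.cyclesD(1)[OF x]] by blast
      then have "x = R.bd b" using R.C_Ch R.bd_closed by (simp only: R.Ch.r_zero subset_iff)
      then show "\<exists>x' \<in> R.C (Suc (Suc q)). x = R.bd x'" using b(1) by blast
    qed
  qed
  ultimately show ?thesis
    unfolding module_iso_def bij_betw_def using homology_map_linear by blast
qed

end

section \<open>Shapiro's lemma for permutation modules\<close>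

text \<open>
  A group \<open>G\<close> acts transitively on \<open>S\<close>, and \<open>\<phi>\<close> identifies \<open>H\<close> with the stabilizer of \<open>s0\<close>.  The
  permutation module \<open>P\<close> is free on \<open>S\<close>.  The action \<open>actP\<close> on \<open>P\<close> is described by its effect on the basis
  rather than defined, since the action of a module over a category is given by a function that is also
  applied to arrows outside of the group.
\<close>

locale transitive_action =
  fixes G :: "('g, 'b) monoid_scheme" and H :: "('h, 'c) monoid_scheme" and K :: "('k, 'r) ring_scheme"
    and S :: "'s set" and \<sigma> :: "'g \<Rightarrow> 's \<Rightarrow> 's" and actP :: "'g \<Rightarrow> ('s \<Rightarrow> 'k) \<Rightarrow> 's \<Rightarrow> 'k"
    and s0 :: 's and \<phi> :: "'h \<Rightarrow> 'g"
  assumes grpG: "group G" and grpH: "group H" and cringK: "cring K"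
    and \<sigma>_closed: "g \<in> carrier G \<Longrightarrow> s \<in> S \<Longrightarrow> \<sigma> g s \<in> S"
    and \<sigma>_one: "s \<in> S \<Longrightarrow> \<sigma> \<one>\<^bsub>G\<^esub> s = s"
    and \<sigma>_mult: "g \<in> carrier G \<Longrightarrow> h \<in> carrier G \<Longrightarrow> s \<in> S \<Longrightarrow> \<sigma> (g \<otimes>\<^bsub>G\<^esub> h) s = \<sigma> g (\<sigma> h s)"
    and actP_linear: "g \<in> carrier G \<Longrightarrow>
      linear_map K (fsupp S (regular_module K)) (fsupp S (regular_module K)) (actP g)"
    and actP_single: "g \<in> carrier G \<Longrightarrow> s \<in> S \<Longrightarrow> a \<in> carrier (regular_module K) \<Longrightarrow>
      actP g (single (regular_module K) s a) = single (regular_module K) (\<sigma> g s) a"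
    and s0: "s0 \<in> S"
    and transitive: "s \<in> S \<Longrightarrow> \<exists>g \<in> carrier G. \<sigma> g s0 = s"
    and \<phi>_hom: "\<phi> \<in> hom H G" and \<phi>_inj: "inj_on \<phi> (carrier H)"
    and \<phi>_image: "\<phi> ` carrier H = {g \<in> carrier G. \<sigma> g s0 = s0}"
begin

abbreviation "k1 \<equiv> regular_module K"
abbreviation "P \<equiv> fsupp S k1"

lemma k1: "module K k1" by (rule module_regular[OF cringK])
lemma modP: "module K P" by (rule fsupp_module[OF k1])

lemma cell_linear: "s \<in> S \<Longrightarrow> linear_map K k1 P (single k1 s)"
  by (rule linear_map_single[OF k1])

lemma group_rep_P: "group_rep G K P actP"
proof (rule group_rep.intro)
  interpret G: group G by (rule grpG)
  show "group G" by (rule grpG)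
  show "module K P" by (rule modP)
  show "linear_map K P P (actP g)" if "g \<in> carrier G" for g by (rule actP_linear[OF that])
  show "actP \<one>\<^bsub>G\<^esub> m = m" if m: "m \<in> carrier P" for m
    by (rule linear_map_eqI[where f = "actP \<one>\<^bsub>G\<^esub>" and g = "\<lambda>m. m" and c = m,
          OF k1 modP actP_linear[OF G.one_closed] linear_map_id])
      (simp_all add: actP_single \<sigma>_one m)
  show "actP (g \<otimes>\<^bsub>G\<^esub> h) m = actP g (actP h m)"
    if g: "g \<in> carrier G" and h: "h \<in> carrier G" and m: "m \<in> carrier P" for g h m
    by (rule linear_map_eqI[where f = "actP (g \<otimes>\<^bsub>G\<^esub> h)" and g = "\<lambda>m. actP g (actP h m)" and c = m,
          OF k1 modP actP_linear[OF G.m_closed[OF g h]] linear_map_comp[OF actP_linear[OF h] actP_linear[OF g]]])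
      (simp_all add: actP_single \<sigma>_mult \<sigma>_closed g h m)
qed

lemma group_rep_k1: "group_rep H K k1 (\<lambda>_ x. x)"
  by (rule group_rep.intro) (simp_all add: grpH k1 linear_map_id)

lemma \<phi>_closed: "h \<in> carrier H \<Longrightarrow> \<phi> h \<in> carrier G"
  using \<phi>_hom by (auto simp: hom_def)

lemma \<phi>_fix: "h \<in> carrier H \<Longrightarrow> \<sigma> (\<phi> h) s0 = s0"
  using \<phi>_image by blast

lemma rep_map: "rep_map H K k1 (\<lambda>_ x. x) G P actP \<phi> (single k1 s0)"
proof (rule rep_map.intro[OF group_rep_k1 group_rep_P], unfold_locales)
  show "\<phi> \<in> hom H G" by (rule \<phi>_hom)
  show "linear_map K k1 P (single k1 s0)" by (rule cell_linear[OF s0])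
  show "single k1 s0 m = actP (\<phi> g) (single k1 s0 m)" if "g \<in> carrier H" "m \<in> carrier k1" for g m
    using that by (simp add: actP_single \<phi>_closed s0 \<phi>_fix)
qed

sublocale \<iota>: rep_map H K k1 "\<lambda>_ x. x" G P actP \<phi> "single k1 s0"
  by (rule rep_map)

abbreviation "T \<equiv> \<iota>.R'.Ch"
abbreviation "TH \<equiv> \<iota>.R.Ch"
abbreviation "L \<equiv> lists (carrier G)"

lemmas modT = \<iota>.R'.Ch.module_axioms and modTH = \<iota>.R.Ch.module_axioms

text \<open>The chains with coefficients in \<open>P\<close> are free on the pairs of a list and an element of \<open>S\<close>.\<close>

definition cell :: "'g list \<Rightarrow> 's \<Rightarrow> 'k \<Rightarrow> 'g list \<Rightarrow> 's \<Rightarrow> 'k"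
  where "cell gs s a = single P gs (single k1 s a)"

lemma cell_closed: "gs \<in> L \<Longrightarrow> s \<in> S \<Longrightarrow> a \<in> carrier k1 \<Longrightarrow> cell gs s a \<in> carrier T"
  unfolding cell_def by (rule \<iota>.R'.single_Ch) (simp_all add: single_closed[OF k1])

lemma cell_linear2: "gs \<in> L \<Longrightarrow> s \<in> S \<Longrightarrow> linear_map K k1 T (cell gs s)"
  unfolding cell_def[abs_def] by (rule linear_map_comp[OF cell_linear \<iota>.R'.single_linear])

definition ext2 :: "('k, 'x) module \<Rightarrow> ('g list \<Rightarrow> 's \<Rightarrow> 'k \<Rightarrow> 'x) \<Rightarrow> ('g list \<Rightarrow> 's \<Rightarrow> 'k) \<Rightarrow> 'x"
  where "ext2 N \<chi> = lin_ext P N (\<lambda>gs. lin_ext k1 N (\<chi> gs))"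

lemma ext2_linear:
  assumes N: "module K N" and \<chi>: "\<And>gs s. gs \<in> L \<Longrightarrow> s \<in> S \<Longrightarrow> linear_map K k1 N (\<chi> gs s)"
  shows "linear_map K T N (ext2 N \<chi>)"
  unfolding ext2_def
  by (rule \<iota>.R'.ext_linear[OF N]) (rule linear_map_lin_ext[OF k1 N \<chi>])

lemma ext2_cell:
  assumes N: "module K N" and \<chi>: "\<And>gs s. gs \<in> L \<Longrightarrow> s \<in> S \<Longrightarrow> linear_map K k1 N (\<chi> gs s)"
    and gs: "gs \<in> L" and s: "s \<in> S" and a: "a \<in> carrier k1"
  shows "ext2 N \<chi> (cell gs s a) = \<chi> gs s a"
proof -
  have "ext2 N \<chi> (cell gs s a) = lin_ext k1 N (\<chi> gs) (single k1 s a)"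
    unfolding ext2_def cell_def
    by (rule \<iota>.R'.ext_single[where \<phi> = "\<lambda>gs. lin_ext k1 N (\<chi> gs)", OF N _ gs single_closed[OF k1 s a]])
      (rule linear_map_lin_ext[OF k1 N \<chi>])
  also have "\<dots> = \<chi> gs s a"
    by (rule lin_ext_single[where \<phi> = "\<chi> gs" and i = s, OF k1 N \<chi>[OF gs s] a])
  finally show ?thesis .
qed

lemma T_eqI:
  assumes "module K N" "linear_map K T N f" "linear_map K T N f'"
    and "\<And>gs s a. gs \<in> L \<Longrightarrow> s \<in> S \<Longrightarrow> a \<in> carrier k1 \<Longrightarrow> f (cell gs s a) = f' (cell gs s a)"
    and "c \<in> carrier T"
  shows "f c = f' c"
proof (rule linear_map_eqI2[where f = f and g = f' and c = c, OF k1 assms(1)])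
  show "linear_map K (fsupp L P) N f" "linear_map K (fsupp L P) N f'"
    using assms(2,3) by (simp_all only: \<iota>.R'.Ch_def)
  show "c \<in> carrier (fsupp L P)" using assms(5) by (simp only: \<iota>.R'.Ch_def)
qed (use assms(4) in \<open>simp only: cell_def\<close>)

text \<open>
  A pair \<open>(gs, s)\<close> is a chain of composable arrows in the action groupoid that starts at \<open>s\<close>, and \<open>tgt\<close> is
  the object at which it ends.  Arrows of the groupoid are reduced to elements of \<open>H\<close> in a way that
  depends on their source.  So the effect of prepending \<open>g\<close> to a chain can be described only if all its
  terms end at the same object, and this is what \<open>over u\<close> records.
\<close>

primrec tgt :: "'g list \<Rightarrow> 's \<Rightarrow> 's"
  where "tgt [] s = s"
  | "tgt (g # gs) s = \<sigma> g (tgt gs s)"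

lemma tgt_closed: "gs \<in> L \<Longrightarrow> s \<in> S \<Longrightarrow> tgt gs s \<in> S"
  by (induction gs) (auto simp: \<sigma>_closed)

definition over :: "'s \<Rightarrow> ('g list \<Rightarrow> 's \<Rightarrow> 'k) set"
  where "over u = addspan T {cell gs s a |gs s a. gs \<in> L \<and> s \<in> S \<and> a \<in> carrier k1 \<and> tgt gs s = u}"

lemma over_cells: "{cell gs s a |gs s a. gs \<in> L \<and> s \<in> S \<and> a \<in> carrier k1 \<and> tgt gs s = u} \<subseteq> carrier T"
  using cell_closed by auto

lemma over_closed: "c \<in> over u \<Longrightarrow> c \<in> carrier T"
  unfolding over_def by (rule addspan_closed[OF modT over_cells])

lemma cell_over: "gs \<in> L \<Longrightarrow> s \<in> S \<Longrightarrow> a \<in> carrier k1 \<Longrightarrow> cell gs s a \<in> over (tgt gs s)"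
  unfolding over_def by (rule addspan_base[OF modT over_cells]) auto

lemma over_add: "x \<in> over u \<Longrightarrow> y \<in> over u \<Longrightarrow> x \<oplus>\<^bsub>T\<^esub> y \<in> over u"
  unfolding over_def by (rule addspan_plus[OF modT over_cells])

lemma over_map:
  assumes f: "linear_map K T T f"
    and "\<And>gs s a. gs \<in> L \<Longrightarrow> s \<in> S \<Longrightarrow> a \<in> carrier k1 \<Longrightarrow> tgt gs s = u \<Longrightarrow> f (cell gs s a) \<in> over v"
    and "c \<in> over u"
  shows "f c \<in> over v"
  unfolding over_def
  by (rule addspan_map[OF modT modT f over_cells[of u] over_cells])
    (use assms(2,3) in \<open>auto simp: over_def\<close>)

lemma over_eq:
  assumes N: "module K N" and f: "linear_map K T N f" and g: "linear_map K T N g"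
    and eq: "\<And>gs s a. gs \<in> L \<Longrightarrow> s \<in> S \<Longrightarrow> a \<in> carrier k1 \<Longrightarrow> tgt gs s = u \<Longrightarrow> f (cell gs s a) = g (cell gs s a)"
    and c: "c \<in> over u"
  shows "f c = g c"
  by (rule addspan_eq[where f = f and g = g, OF modT N f g over_cells[of u]])
    (use eq c in \<open>auto simp: over_def\<close>)

lemma over_minus: assumes "c \<in> over u" shows "\<ominus>\<^bsub>T\<^esub> c \<in> over u"
proof (rule over_map[OF linear_map_uminus[OF modT linear_map_id] _ assms])
  fix gs s a assume gs: "gs \<in> L" and s: "s \<in> S" and a: "a \<in> carrier k1" and t: "tgt gs s = u"
  have "\<ominus>\<^bsub>T\<^esub> cell gs s a = cell gs s (\<ominus>\<^bsub>k1\<^esub> a)"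
    by (rule linear_map_minus[OF k1 modT cell_linear2[OF gs s] a, symmetric])
  then show "\<ominus>\<^bsub>T\<^esub> cell gs s a \<in> over u"
    using cell_over[OF gs s \<iota>.R.M.a_inv_closed[OF a]] t by simp
qed

lemma over_diff: "x \<in> over u \<Longrightarrow> y \<in> over u \<Longrightarrow> x \<ominus>\<^bsub>T\<^esub> y \<in> over u"
  by (simp add: a_minus_def over_add over_minus del: fsupp_simps)

lemma pre_cell: "g \<in> carrier G \<Longrightarrow> gs \<in> L \<Longrightarrow> s \<in> S \<Longrightarrow> a \<in> carrier k1 \<Longrightarrow>
    \<iota>.R'.pre g (cell gs s a) = cell (g # gs) s a"
  unfolding cell_def by (rule \<iota>.R'.pre_single) (simp_all add: single_closed[OF k1])

lemma lmul_cell_Nil: "g \<in> carrier G \<Longrightarrow> s \<in> S \<Longrightarrow> a \<in> carrier k1 \<Longrightarrow>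
    \<iota>.R'.lmul g (cell [] s a) = cell [] (\<sigma> g s) a"
  unfolding cell_def by (simp add: \<iota>.R'.lmul_single_Nil single_closed[OF k1] actP_single)

lemma lmul_cell_Cons: "g \<in> carrier G \<Longrightarrow> x \<in> carrier G \<Longrightarrow> gs \<in> L \<Longrightarrow> s \<in> S \<Longrightarrow> a \<in> carrier k1 \<Longrightarrow>
    \<iota>.R'.lmul g (cell (x # gs) s a) = cell ((g \<otimes>\<^bsub>G\<^esub> x) # gs) s a"
  unfolding cell_def by (simp add: \<iota>.R'.lmul_single_Cons single_closed[OF k1])

lemma pre_over: "g \<in> carrier G \<Longrightarrow> c \<in> over u \<Longrightarrow> \<iota>.R'.pre g c \<in> over (\<sigma> g u)"
  by (rule over_map[OF \<iota>.R'.pre_linear])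
    (use cell_over[of "g # gs" for gs] in \<open>auto simp: pre_cell\<close>)

lemma lmul_over: "g \<in> carrier G \<Longrightarrow> c \<in> over u \<Longrightarrow> \<iota>.R'.lmul g c \<in> over (\<sigma> g u)"
proof (rule over_map[OF \<iota>.R'.lmul_linear])
  fix gs s a assume a: "g \<in> carrier G" "gs \<in> L" "s \<in> S" "a \<in> carrier k1" "tgt gs s = u"
  show "\<iota>.R'.lmul g (cell gs s a) \<in> over (\<sigma> g u)"
  proof (cases gs)
    case Nil
    then show ?thesis using a cell_over[of "[]" "\<sigma> g s" a] by (simp add: lmul_cell_Nil \<sigma>_closed)
  next
    case (Cons x xs)
    have x: "x \<in> carrier G" "xs \<in> L" using a Cons by auto
    show ?thesis
      using a x cell_over[of "(g \<otimes>\<^bsub>G\<^esub> x) # xs" s a] tgt_closed[OF x(2) a(3)]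
      by (auto simp: lmul_cell_Cons \<sigma>_mult Cons)
  qed
qed

lemma cell_induct:
  assumes gs: "gs \<in> L" and s: "s \<in> S" and a: "a \<in> carrier k1"
    and Nil: "\<And>s. s \<in> S \<Longrightarrow> Q (cell [] s a)"
    and Cons: "\<And>g gs. g \<in> carrier G \<Longrightarrow> gs \<in> L \<Longrightarrow> cell gs s a \<in> over (tgt gs s) \<Longrightarrow>
      Q (cell gs s a) \<Longrightarrow> Q (\<iota>.R'.pre g (cell gs s a))"
  shows "Q (cell gs s a)"
  using gs
proof (induct gs)
  case Nil
  show ?case by (rule assms(4)[OF s])
next
  case (Cons g gs)
  then have "Q (\<iota>.R'.pre g (cell gs s a))" using assms(5) cell_over[OF _ s a] by auto
  then show ?case using Cons s a by (simp add: pre_cell)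
qed

lemma inner_cell_Nil: "s \<in> S \<Longrightarrow> a \<in> carrier k1 \<Longrightarrow> \<iota>.R'.inner (cell [] s a) = \<zero>\<^bsub>T\<^esub>"
  and tail_cell_Nil: "s \<in> S \<Longrightarrow> a \<in> carrier k1 \<Longrightarrow> \<iota>.R'.tail (cell [] s a) = \<zero>\<^bsub>T\<^esub>"
  unfolding cell_def by (rule \<iota>.R'.inner_Nil \<iota>.R'.tail_Nil, rule single_closed[OF k1], assumption+)+

lemma zero_over: "\<zero>\<^bsub>T\<^esub> \<in> over u"
  unfolding over_def by (rule addspan_zero)

lemma inner_cell_over:
  assumes gs: "gs \<in> L" and s: "s \<in> S" and a: "a \<in> carrier k1"
  shows "\<iota>.R'.inner (cell gs s a) \<in> over (tgt gs s)"
  using gs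
proof (induct gs)
  case Nil
  show ?case using inner_cell_Nil[OF s a] zero_over by simp
next
  case (Cons g gs)
  then have g: "g \<in> carrier G" "gs \<in> L" by auto
  note c = cell_over[OF g(2) s a]
  have "\<iota>.R'.inner (cell (g # gs) s a) =
      \<iota>.R'.lmul g (cell gs s a) \<ominus>\<^bsub>T\<^esub> \<iota>.R'.pre g (\<iota>.R'.inner (cell gs s a))"
    unfolding pre_cell[OF g s a, symmetric] by (rule \<iota>.R'.inner_pre[OF g(1) over_closed[OF c]])
  moreover have "\<dots> \<in> over (\<sigma> g (tgt gs s))"
    by (rule over_diff[OF lmul_over[OF g(1) c] pre_over[OF g(1) Cons(3)]])
  ultimately show ?case by simp
qed

lemma inner_over: "c \<in> over u \<Longrightarrow> \<iota>.R'.inner c \<in> over u"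
  by (rule over_map[OF \<iota>.R'.inner_linear]) (use inner_cell_over in auto)

subsection \<open>The retraction\<close>

text \<open>
  The choice of an arrow \<open>tr s\<close> from \<open>s0\<close> to each object \<open>s\<close> retracts the action groupoid to the group \<open>H\<close>
  at \<open>s0\<close>: an arrow \<open>g\<close> from \<open>s\<close> to \<open>\<sigma> g s\<close> goes to the loop \<open>red g s\<close>.  Taking the identity for \<open>tr s0\<close>
  makes this a strict left inverse of the inclusion of \<open>H\<close>.
\<close>

definition tr :: "'s \<Rightarrow> 'g"
  where "tr s = (if s = s0 then \<one>\<^bsub>G\<^esub> else (SOME g. g \<in> carrier G \<and> \<sigma> g s0 = s))"

lemma tr: assumes "s \<in> S" shows "tr s \<in> carrier G" "\<sigma> (tr s) s0 = s"
proof -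
  have "\<exists>g. g \<in> carrier G \<and> \<sigma> g s0 = s" using transitive[OF assms] by blast
  from someI_ex[OF this] show "tr s \<in> carrier G" "\<sigma> (tr s) s0 = s"
    by (auto simp: tr_def \<sigma>_one s0)
qed

definition red :: "'g \<Rightarrow> 's \<Rightarrow> 'h"
  where "red g s = inv_into (carrier H) \<phi> (inv\<^bsub>G\<^esub> (tr (\<sigma> g s)) \<otimes>\<^bsub>G\<^esub> (g \<otimes>\<^bsub>G\<^esub> tr s))"

lemma red:
  assumes g: "g \<in> carrier G" and s: "s \<in> S"
  shows "red g s \<in> carrier H" "tr (\<sigma> g s) \<otimes>\<^bsub>G\<^esub> \<phi> (red g s) = g \<otimes>\<^bsub>G\<^esub> tr s"
proof -
  let ?x = "inv\<^bsub>G\<^esub> (tr (\<sigma> g s)) \<otimes>\<^bsub>G\<^esub> (g \<otimes>\<^bsub>G\<^esub> tr s)"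
  note t = tr[OF s] tr[OF \<sigma>_closed[OF g s]]
  have x: "?x \<in> carrier G" using t g by simp
  have "\<sigma> ?x s0 = \<sigma> (inv\<^bsub>G\<^esub> (tr (\<sigma> g s))) (\<sigma> (tr (\<sigma> g s)) s0)"
    using t g s0 by (simp add: \<sigma>_mult)
  also have "\<dots> = \<sigma> (inv\<^bsub>G\<^esub> (tr (\<sigma> g s)) \<otimes>\<^bsub>G\<^esub> tr (\<sigma> g s)) s0"
    using t s0 by (simp only: \<sigma>_mult \<iota>.R'.G.inv_closed)
  also have "\<dots> = s0" using t s0 by (simp add: \<sigma>_one)
  finally have "?x \<in> \<phi> ` carrier H" using x \<phi>_image by blast
  then have *: "red g s \<in> carrier H" "\<phi> (red g s) = ?x"
    unfolding red_def by (simp_all add: inv_into_into f_inv_into_f)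
  show "red g s \<in> carrier H" by (rule *)
  show "tr (\<sigma> g s) \<otimes>\<^bsub>G\<^esub> \<phi> (red g s) = g \<otimes>\<^bsub>G\<^esub> tr s"
    unfolding *(2) using t g by (simp add: \<iota>.R'.G.m_assoc[symmetric])
qed

lemma red_unique:
  assumes "g \<in> carrier G" "s \<in> S" "h \<in> carrier H" "tr (\<sigma> g s) \<otimes>\<^bsub>G\<^esub> \<phi> h = g \<otimes>\<^bsub>G\<^esub> tr s"
  shows "red g s = h"
proof -
  have "tr (\<sigma> g s) \<otimes>\<^bsub>G\<^esub> \<phi> (red g s) = tr (\<sigma> g s) \<otimes>\<^bsub>G\<^esub> \<phi> h" using red[OF assms(1,2)] assms(4) by simp
  then have "\<phi> (red g s) = \<phi> h"
    using \<iota>.R'.G.Units_l_cancel[OF _ \<phi>_closed[OF red(1)[OF assms(1,2)]]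
        \<phi>_closed[OF assms(3)], of "tr (\<sigma> g s)"] tr(1)[OF \<sigma>_closed[OF assms(1,2)]]
    by (simp add: \<iota>.R'.G.Units_eq)
  then show ?thesis using \<phi>_inj red(1)[OF assms(1,2)] assms(3) by (auto dest: inj_onD)
qed

text \<open>Reduction is a functor on the action groupoid.\<close>

lemma red_mult:
  assumes g: "g \<in> carrier G" and x: "x \<in> carrier G" and s: "s \<in> S"
  shows "red (g \<otimes>\<^bsub>G\<^esub> x) s = red g (\<sigma> x s) \<otimes>\<^bsub>H\<^esub> red x s"
proof (rule red_unique)
  note r = red[OF x s] red[OF g \<sigma>_closed[OF x s]]
  note t = tr[OF s] tr[OF \<sigma>_closed[OF x s]] tr[OF \<sigma>_closed[OF g \<sigma>_closed[OF x s]]]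
  show "g \<otimes>\<^bsub>G\<^esub> x \<in> carrier G" using g x by simp
  show "red g (\<sigma> x s) \<otimes>\<^bsub>H\<^esub> red x s \<in> carrier H" using r by simp
  have "tr (\<sigma> (g \<otimes>\<^bsub>G\<^esub> x) s) \<otimes>\<^bsub>G\<^esub> \<phi> (red g (\<sigma> x s) \<otimes>\<^bsub>H\<^esub> red x s) =
      (tr (\<sigma> g (\<sigma> x s)) \<otimes>\<^bsub>G\<^esub> \<phi> (red g (\<sigma> x s))) \<otimes>\<^bsub>G\<^esub> \<phi> (red x s)"
    unfolding \<sigma>_mult[OF g x s] hom_mult[OF \<phi>_hom r(3) r(1)]
    by (rule \<iota>.R'.G.m_assoc[OF t(5) \<phi>_closed[OF r(3)] \<phi>_closed[OF r(1)], symmetric])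
  also have "\<dots> = g \<otimes>\<^bsub>G\<^esub> (tr (\<sigma> x s) \<otimes>\<^bsub>G\<^esub> \<phi> (red x s))"
    unfolding r(4) using g r t \<phi>_closed by (simp add: \<iota>.R'.G.m_assoc)
  also have "\<dots> = (g \<otimes>\<^bsub>G\<^esub> x) \<otimes>\<^bsub>G\<^esub> tr s"
    unfolding r(2) using g x t by (simp add: \<iota>.R'.G.m_assoc)
  finally show "tr (\<sigma> (g \<otimes>\<^bsub>G\<^esub> x) s) \<otimes>\<^bsub>G\<^esub> \<phi> (red g (\<sigma> x s) \<otimes>\<^bsub>H\<^esub> red x s) = (g \<otimes>\<^bsub>G\<^esub> x) \<otimes>\<^bsub>G\<^esub> tr s" .
qed (rule s)

lemma red_\<phi>: "h \<in> carrier H \<Longrightarrow> red (\<phi> h) s0 = h"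
proof (rule red_unique)
  assume h: "h \<in> carrier H"
  show "tr (\<sigma> (\<phi> h) s0) \<otimes>\<^bsub>G\<^esub> \<phi> h = \<phi> h \<otimes>\<^bsub>G\<^esub> tr s0"
    using h by (simp add: \<phi>_fix tr_def \<phi>_closed)
qed (simp_all add: \<phi>_closed s0)

primrec redl :: "'g list \<Rightarrow> 's \<Rightarrow> 'h list"
  where "redl [] s = []"
  | "redl (g # gs) s = red g (tgt gs s) # redl gs s"

lemma redl_closed: "gs \<in> L \<Longrightarrow> s \<in> S \<Longrightarrow> redl gs s \<in> lists (carrier H)"
  by (induction gs) (auto simp: red tgt_closed)

lemma length_redl: "length (redl gs s) = length gs"
  by (induction gs) auto

lemma tgt_\<phi>: "hs \<in> lists (carrier H) \<Longrightarrow> tgt (map \<phi> hs) s0 = s0"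
  by (induction hs) (auto simp: \<phi>_fix)

lemma redl_\<phi>: "hs \<in> lists (carrier H) \<Longrightarrow> redl (map \<phi> hs) s0 = hs"
  by (induction hs) (auto simp: red_\<phi> tgt_\<phi>)

definition retr :: "('g list \<Rightarrow> 's \<Rightarrow> 'k) \<Rightarrow> 'h list \<Rightarrow> 'k"
  where "retr = ext2 TH (\<lambda>gs s. single k1 (redl gs s))"

lemma retr_linear: "linear_map K T TH retr"
  unfolding retr_def by (rule ext2_linear[OF modTH]) (rule \<iota>.R.single_linear[OF redl_closed])

lemma retr_cell: "gs \<in> L \<Longrightarrow> s \<in> S \<Longrightarrow> a \<in> carrier k1 \<Longrightarrow> retr (cell gs s a) = single k1 (redl gs s) a"
  unfolding retr_def
  by (rule ext2_cell[where \<chi> = "\<lambda>gs s. single k1 (redl gs s)", OF modTH]) (rule \<iota>.R.single_linear[OF redl_closed])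

lemmas retr_closed = linear_map_closed[OF retr_linear]

lemma retr_chmap: "c \<in> carrier TH \<Longrightarrow> retr (\<iota>.chmap c) = c"
proof (rule \<iota>.R.Ch_eqI[OF modTH linear_map_comp[OF \<iota>.chmap_linear retr_linear] linear_map_id])
  fix hs a assume hs: "hs \<in> lists (carrier H)" and a: "a \<in> carrier k1"
  have "\<iota>.chmap (single k1 hs a) = cell (map \<phi> hs) s0 a"
    unfolding cell_def by (rule \<iota>.chmap_single[OF hs a])
  then show "retr (\<iota>.chmap (single k1 hs a)) = single k1 hs a"
    using retr_cell[OF \<iota>.map_lists[OF hs] s0 a] redl_\<phi>[OF hs] by simp
qed

lemma retr_pre:
  assumes g: "g \<in> carrier G" and u: "u \<in> S" and c: "c \<in> over u"
  shows "retr (\<iota>.R'.pre g c) = \<iota>.R.pre (red g u) (retr c)"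
proof (rule over_eq[OF modTH linear_map_comp[OF \<iota>.R'.pre_linear[OF g] retr_linear]
        linear_map_comp[OF retr_linear \<iota>.R.pre_linear[OF red(1)[OF g u]]] _ c])
  fix gs s a assume gs: "gs \<in> L" and s: "s \<in> S" and a: "a \<in> carrier k1" and t: "tgt gs s = u"
  have "g # gs \<in> L" using g gs by simp
  from retr_cell[OF this s a] show "retr (\<iota>.R'.pre g (cell gs s a)) = \<iota>.R.pre (red g u) (retr (cell gs s a))"
    unfolding pre_cell[OF g gs s a] retr_cell[OF gs s a]
      \<iota>.R.pre_single[OF red(1)[OF g u] redl_closed[OF gs s] a] by (simp add: t)
qed

lemma retr_lmul:
  assumes g: "g \<in> carrier G" and u: "u \<in> S" and c: "c \<in> over u"
  shows "retr (\<iota>.R'.lmul g c) = \<iota>.R.lmul (red g u) (retr c)"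
proof (rule over_eq[OF modTH linear_map_comp[OF \<iota>.R'.lmul_linear[OF g] retr_linear]
        linear_map_comp[OF retr_linear \<iota>.R.lmul_linear[OF red(1)[OF g u]]] _ c])
  fix gs s a assume gs: "gs \<in> L" and s: "s \<in> S" and a: "a \<in> carrier k1" and t: "tgt gs s = u"
  show "retr (\<iota>.R'.lmul g (cell gs s a)) = \<iota>.R.lmul (red g u) (retr (cell gs s a))"
  proof (cases gs)
    case Nil
    then show ?thesis using g u s a
      by (simp add: lmul_cell_Nil retr_cell \<sigma>_closed \<iota>.R.lmul_single_Nil red)
  next
    case (Cons x xs)
    then have x: "x \<in> carrier G" "xs \<in> L" using gs by auto
      note t' = tgt_closed[OF x(2) s]
    have gx: "(g \<otimes>\<^bsub>G\<^esub> x) # xs \<in> L" using g x by simp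
    have "retr (\<iota>.R'.lmul g (cell gs s a)) = single k1 (redl ((g \<otimes>\<^bsub>G\<^esub> x) # xs) s) a"
      unfolding Cons lmul_cell_Cons[OF g x s a] by (rule retr_cell[OF gx s a])
    also have "\<dots> = single k1 ((red g u \<otimes>\<^bsub>H\<^esub> red x (tgt xs s)) # redl xs s) a"
      using red_mult[OF g x(1) t'] t Cons by simp
    also have "\<dots> = \<iota>.R.lmul (red g u) (single k1 (redl gs s) a)"
      using \<iota>.R.lmul_single_Cons[OF red(1)[OF g u] red(1)[OF x(1) t'] redl_closed[OF x(2) s] a] Cons by simp
    finally show ?thesis by (simp only: retr_cell[OF gs s a])
  qed
qed

lemma retr_zero: "retr \<zero>\<^bsub>T\<^esub> = \<zero>\<^bsub>TH\<^esub>"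
  by (rule linear_map_zero[OF modT modTH retr_linear])

text \<open>
  Reduction turns \<open>pre g\<close> and \<open>lmul g\<close> on chains over \<open>u\<close> into \<open>pre\<close> and \<open>lmul\<close> with \<open>red g u\<close>, so both
  sides satisfy the same recursion.
\<close>

lemma retr_inner: "c \<in> carrier T \<Longrightarrow> retr (\<iota>.R'.inner c) = \<iota>.R.inner (retr c)"
proof (rule T_eqI[OF modTH linear_map_comp[OF \<iota>.R'.inner_linear retr_linear]
      linear_map_comp[OF retr_linear \<iota>.R.inner_linear]])
  fix gs s a assume gs: "gs \<in> L" and s: "s \<in> S" and a: "a \<in> carrier k1"
  show "retr (\<iota>.R'.inner (cell gs s a)) = \<iota>.R.inner (retr (cell gs s a))"
  proof (rule cell_induct[OF gs s a])
    fix s assume s: "s \<in> S"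
    have "retr (cell [] s a) = single k1 [] a" using retr_cell[of "[]", OF _ s a] by simp
    then show "retr (\<iota>.R'.inner (cell [] s a)) = \<iota>.R.inner (retr (cell [] s a))"
      by (simp only: inner_cell_Nil[OF s a] retr_zero \<iota>.R.inner_Nil[OF a])
  next
    fix g gs assume g: "g \<in> carrier G" and gs: "gs \<in> L" and c: "cell gs s a \<in> over (tgt gs s)"
      and IH: "retr (\<iota>.R'.inner (cell gs s a)) = \<iota>.R.inner (retr (cell gs s a))"
    let ?c = "cell gs s a" and ?u = "tgt gs s"
    have u: "?u \<in> S" by (rule tgt_closed[OF gs s])
    note cc = over_closed[OF c]
    have "retr (\<iota>.R'.inner (\<iota>.R'.pre g ?c)) = retr (\<iota>.R'.lmul g ?c) \<ominus>\<^bsub>TH\<^esub> retr (\<iota>.R'.pre g (\<iota>.R'.inner ?c))"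
      unfolding \<iota>.R'.inner_pre[OF g cc]
      by (rule linear_map_diff[OF modT modTH retr_linear \<iota>.R'.lmul_closed[OF g cc]
            \<iota>.R'.pre_closed[OF g \<iota>.R'.inner_closed[OF cc]]])
    also have "\<dots> = \<iota>.R.inner (\<iota>.R.pre (red g ?u) (retr ?c))"
      unfolding retr_lmul[OF g u c] retr_pre[OF g u inner_over[OF c]] IH
      by (rule \<iota>.R.inner_pre[OF red(1)[OF g u] retr_closed[OF cc], symmetric])
    finally show "retr (\<iota>.R'.inner (\<iota>.R'.pre g ?c)) = \<iota>.R.inner (retr (\<iota>.R'.pre g ?c))"
      unfolding retr_pre[OF g u c] .
  qed
qed

lemma retr_tail: "c \<in> carrier T \<Longrightarrow> retr (\<iota>.R'.tail c) = \<iota>.R.tail (retr c)"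
proof (rule T_eqI[OF modTH linear_map_comp[OF \<iota>.R'.tail_linear retr_linear]
      linear_map_comp[OF retr_linear \<iota>.R.tail_linear]])
  fix gs s a assume gs: "gs \<in> L" and s: "s \<in> S" and a: "a \<in> carrier k1"
  show "retr (\<iota>.R'.tail (cell gs s a)) = \<iota>.R.tail (retr (cell gs s a))"
  proof (rule cell_induct[OF gs s a])
    fix s assume s: "s \<in> S"
    have "retr (cell [] s a) = single k1 [] a" using retr_cell[of "[]", OF _ s a] by simp
    then show "retr (\<iota>.R'.tail (cell [] s a)) = \<iota>.R.tail (retr (cell [] s a))"
      by (simp only: tail_cell_Nil[OF s a] retr_zero \<iota>.R.tail_Nil[OF a])
  next
    fix g gs assume g: "g \<in> carrier G" and gs: "gs \<in> L" and c: "cell gs s a \<in> over (tgt gs s)"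
    have u: "tgt gs s \<in> S" by (rule tgt_closed[OF gs s])
    show "retr (\<iota>.R'.tail (\<iota>.R'.pre g (cell gs s a))) = \<iota>.R.tail (retr (\<iota>.R'.pre g (cell gs s a)))"
      unfolding retr_pre[OF g u c] \<iota>.R'.tail_pre[OF g over_closed[OF c]]
      by (rule \<iota>.R.tail_pre[OF red(1)[OF g u] retr_closed[OF over_closed[OF c]], symmetric])
  qed
qed

lemma retr_bd: "c \<in> carrier T \<Longrightarrow> retr (\<iota>.R'.bd c) = \<iota>.R.bd (retr c)"
  unfolding \<iota>.R'.bd_def \<iota>.R.bd_def
  by (simp only: linear_map_diff[OF modT modTH retr_linear] \<iota>.R'.tail_closed \<iota>.R'.inner_closed retr_tail retr_inner)

lemma T_C_map:
  assumes N: "module K N" and f: "linear_map K (fsupp L P) (fsupp J N) f" and J': "J' \<subseteq> J"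
    and fs: "\<And>gs s a. gs \<in> \<iota>.R'.deg n \<Longrightarrow> s \<in> S \<Longrightarrow> a \<in> carrier k1 \<Longrightarrow> f (cell gs s a) \<in> carrier (fsupp J' N)"
    and c: "c \<in> \<iota>.R'.C n"
  shows "f c \<in> carrier (fsupp J' N)"
proof (rule linear_map_supports[where f = f and c = c, OF modP N f \<iota>.R'.deg_lists J'])
  show "c \<in> carrier (fsupp (\<iota>.R'.deg n) P)" using c by (simp only: \<iota>.R'.C_def)
  fix gs m assume gs: "gs \<in> \<iota>.R'.deg n" and m: "m \<in> carrier P"
  have l: "linear_map K P (fsupp J N) (\<lambda>m. f (single P gs m))"
    by (rule linear_map_comp[OF linear_map_single[OF modP] f]) (use gs \<iota>.R'.deg_lists in blast)
  show "f (single P gs m) \<in> carrier (fsupp J' N)"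
    by (rule linear_map_supports[where f = "\<lambda>m. f (single P gs m)" and c = m, OF k1 N l subset_refl J' _ m])
      (rule fs[OF gs, unfolded cell_def])
qed

lemma retr_C: "c \<in> \<iota>.R'.C n \<Longrightarrow> retr c \<in> \<iota>.R.C n"
  unfolding \<iota>.R.C_def
proof -
  assume c: "c \<in> \<iota>.R'.C n"
  show "retr c \<in> carrier (fsupp (\<iota>.R.deg n) k1)"
  proof (rule T_C_map[OF k1 retr_linear[unfolded \<iota>.R.Ch_def \<iota>.R'.Ch_def] \<iota>.R.deg_lists _ c])
    fix gs s a assume gs: "gs \<in> \<iota>.R'.deg n" and s: "s \<in> S" and a: "a \<in> carrier k1"
    then have "gs \<in> L" "Suc (length gs) = n" by (auto simp: \<iota>.R'.deg_def)
    then show "retr (cell gs s a) \<in> carrier (fsupp (\<iota>.R.deg n) k1)"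
      using \<iota>.R.single_C[OF redl_closed[OF _ s] a, of gs] s a
      by (simp add: retr_cell length_redl \<iota>.R.C_def)
  qed
qed

subsection \<open>The homotopy\<close>

text \<open>
  The arrows \<open>tr s\<close> form a natural isomorphism from the retraction, followed by the inclusion of \<open>H\<close>, to
  the identity of the action groupoid.  The corresponding simplicial homotopy is an alternating sum in
  which the term number \<open>j\<close> keeps the first \<open>j\<close> arrows, inserts a chosen arrow, and reduces the
  remaining ones.  It is written as \<open>h = q - \<kappa>\<close>: the term \<open>q\<close> reduces all arrows, and \<open>\<kappa>\<close> keeps the first
  arrow and applies \<open>h\<close> to the rest.
\<close>

abbreviation "F c \<equiv> \<iota>.chmap (retr c)"

lemma F_linear: "linear_map K T T (\<lambda>c. F c)"
  by (rule linear_map_comp[OF retr_linear \<iota>.chmap_linear])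

definition qcell :: "'g list \<Rightarrow> 's \<Rightarrow> 'k \<Rightarrow> 'g list \<Rightarrow> 's \<Rightarrow> 'k"
  where "qcell gs s a = cell (tr (tgt gs s) # map \<phi> (redl gs s)) s0 a"

primrec kcell :: "'g list \<Rightarrow> 's \<Rightarrow> 'k \<Rightarrow> 'g list \<Rightarrow> 's \<Rightarrow> 'k"
  where "kcell [] s a = \<zero>\<^bsub>T\<^esub>"
  | "kcell (g # gs) s a = \<iota>.R'.pre g (qcell gs s a \<ominus>\<^bsub>T\<^esub> kcell gs s a)"

definition "q = ext2 T qcell"
definition "\<kappa> = ext2 T kcell"
definition "h c = q c \<ominus>\<^bsub>T\<^esub> \<kappa> c"

lemma qlist: "gs \<in> L \<Longrightarrow> s \<in> S \<Longrightarrow> tr (tgt gs s) # map \<phi> (redl gs s) \<in> L"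
  using tr(1)[OF tgt_closed] \<iota>.map_lists[OF redl_closed] by simp

lemma qcell_linear: "gs \<in> L \<Longrightarrow> s \<in> S \<Longrightarrow> linear_map K k1 T (qcell gs s)"
  unfolding qcell_def[abs_def] by (rule cell_linear2[OF qlist s0])

lemma kcell_linear:
  assumes gs: "gs \<in> L" and s: "s \<in> S" shows "linear_map K k1 T (kcell gs s)"
  using gs
proof (induct gs)
  case Nil
  show ?case using linear_map_const_zero[OF modT] by simp
next
  case (Cons g gs)
  then have g: "g \<in> carrier G" "gs \<in> L" by auto
  show ?case
    using linear_map_comp[OF linear_map_difference[OF modT qcell_linear[OF g(2) s] Cons(3)]
        \<iota>.R'.pre_linear[OF g(1)]] by simp
qed

lemma q_linear: "linear_map K T T q" and \<kappa>_linear: "linear_map K T T \<kappa>"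
  unfolding q_def \<kappa>_def by (rule ext2_linear[OF modT], erule (1) qcell_linear kcell_linear)+

lemma h_linear: "linear_map K T T h"
proof -
  have "h = (\<lambda>c. q c \<ominus>\<^bsub>T\<^esub> \<kappa> c)" by (auto simp: h_def)
  then show ?thesis using linear_map_difference[OF modT q_linear \<kappa>_linear] by simp
qed

lemmas q_closed = linear_map_closed[OF q_linear]
  and \<kappa>_closed = linear_map_closed[OF \<kappa>_linear]
  and h_closed = linear_map_closed[OF h_linear]
  and F_closed = linear_map_closed[OF F_linear]

lemma q_cell: "gs \<in> L \<Longrightarrow> s \<in> S \<Longrightarrow> a \<in> carrier k1 \<Longrightarrow> q (cell gs s a) = qcell gs s a"
  unfolding q_def by (rule ext2_cell[where \<chi> = qcell, OF modT qcell_linear])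

lemma \<kappa>_cell: "gs \<in> L \<Longrightarrow> s \<in> S \<Longrightarrow> a \<in> carrier k1 \<Longrightarrow> \<kappa> (cell gs s a) = kcell gs s a"
  unfolding \<kappa>_def by (rule ext2_cell[where \<chi> = kcell, OF modT kcell_linear])

lemma F_cell: "gs \<in> L \<Longrightarrow> s \<in> S \<Longrightarrow> a \<in> carrier k1 \<Longrightarrow> F (cell gs s a) = cell (map \<phi> (redl gs s)) s0 a"
  unfolding cell_def[of "map \<phi> (redl gs s)"]
  by (simp only: retr_cell \<iota>.chmap_single[OF redl_closed])

lemma q_over:
  assumes u: "u \<in> S" and c: "c \<in> over u"
  shows "q c = \<iota>.R'.pre (tr u) (F c)"
proof (rule over_eq[OF modT q_linear linear_map_comp[OF F_linear \<iota>.R'.pre_linear[OF tr(1)[OF u]]] _ c])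
  fix gs s a assume gs: "gs \<in> L" and s: "s \<in> S" and a: "a \<in> carrier k1" and t: "tgt gs s = u"
  show "q (cell gs s a) = \<iota>.R'.pre (tr u) (F (cell gs s a))"
    unfolding q_cell[OF gs s a] F_cell[OF gs s a] qcell_def t
    by (rule pre_cell[OF tr(1)[OF u] \<iota>.map_lists[OF redl_closed[OF gs s]] s0 a, symmetric])
qed

lemma \<kappa>_pre:
  assumes g: "g \<in> carrier G" and c: "c \<in> carrier T"
  shows "\<kappa> (\<iota>.R'.pre g c) = \<iota>.R'.pre g (h c)"
proof (rule T_eqI[OF modT linear_map_comp[OF \<iota>.R'.pre_linear[OF g] \<kappa>_linear]
      linear_map_comp[OF h_linear \<iota>.R'.pre_linear[OF g]] _ c])
  fix gs s a assume gs: "gs \<in> L" and s: "s \<in> S" and a: "a \<in> carrier k1"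
  have "g # gs \<in> L" using g gs by simp
  then show "\<kappa> (\<iota>.R'.pre g (cell gs s a)) = \<iota>.R'.pre g (h (cell gs s a))"
    unfolding pre_cell[OF g gs s a] h_def q_cell[OF gs s a] \<kappa>_cell[OF gs s a]
    using \<kappa>_cell[OF _ s a] by simp
qed

lemma \<kappa>_Nil: "s \<in> S \<Longrightarrow> a \<in> carrier k1 \<Longrightarrow> \<kappa> (cell [] s a) = \<zero>\<^bsub>T\<^esub>"
  using \<kappa>_cell[of "[]" s a] by simp

text \<open>
  The first arrow is the only one that \<open>lmul\<close> changes, and \<open>\<kappa>\<close> keeps it while what it does to the other
  arrows does not depend on it.
\<close>

lemma \<kappa>_lmul:
  assumes g: "g \<in> carrier G" and c: "c \<in> carrier T"
  shows "\<kappa> (\<iota>.R'.lmul g c) = \<iota>.R'.lmul g (\<kappa> c)"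
proof (rule T_eqI[OF modT linear_map_comp[OF \<iota>.R'.lmul_linear[OF g] \<kappa>_linear]
      linear_map_comp[OF \<kappa>_linear \<iota>.R'.lmul_linear[OF g]] _ c])
  fix gs s a assume gs: "gs \<in> L" and s: "s \<in> S" and a: "a \<in> carrier k1"
  show "\<kappa> (\<iota>.R'.lmul g (cell gs s a)) = \<iota>.R'.lmul g (\<kappa> (cell gs s a))"
  proof (rule cell_induct[OF gs s a])
    fix s assume s: "s \<in> S"
    show "\<kappa> (\<iota>.R'.lmul g (cell [] s a)) = \<iota>.R'.lmul g (\<kappa> (cell [] s a))"
      by (simp only: lmul_cell_Nil[OF g s a] \<kappa>_Nil[OF \<sigma>_closed[OF g s] a] \<kappa>_Nil[OF s a] \<iota>.R'.lmul_zero[OF g])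
  next
    fix x gs assume x: "x \<in> carrier G" and c: "cell gs s a \<in> over (tgt gs s)"
    note cc = over_closed[OF c]
    show "\<kappa> (\<iota>.R'.lmul g (\<iota>.R'.pre x (cell gs s a))) = \<iota>.R'.lmul g (\<kappa> (\<iota>.R'.pre x (cell gs s a)))"
      unfolding \<iota>.R'.lmul_pre[OF g x cc] \<kappa>_pre[OF x cc] \<kappa>_pre[OF \<iota>.R'.G.m_closed[OF g x] cc]
      by (rule \<iota>.R'.lmul_pre[OF g x h_closed[OF cc], symmetric])
  qed
qed

lemma F_inner: "c \<in> carrier T \<Longrightarrow> F (\<iota>.R'.inner c) = \<iota>.R'.inner (F c)"
  by (simp only: retr_inner \<iota>.chmap_inner retr_closed)

lemma F_pre:
  assumes g: "g \<in> carrier G" and u: "u \<in> S" and c: "c \<in> over u"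
  shows "F (\<iota>.R'.pre g c) = \<iota>.R'.pre (\<phi> (red g u)) (F c)"
  unfolding retr_pre[OF g u c]
  by (rule \<iota>.chmap_pre[OF red(1)[OF g u] retr_closed[OF over_closed[OF c]]])

lemma q_homotopy:
  assumes u: "u \<in> S" and c: "c \<in> over u"
  shows "\<iota>.R'.inner (q c) \<oplus>\<^bsub>T\<^esub> q (\<iota>.R'.inner c) = \<iota>.R'.lmul (tr u) (F c)"
proof -
  note cc = over_closed[OF c]
  note Fc = F_closed[OF cc]
  have "\<iota>.R'.inner (q c) = \<iota>.R'.lmul (tr u) (F c) \<ominus>\<^bsub>T\<^esub> \<iota>.R'.pre (tr u) (\<iota>.R'.inner (F c))"
    unfolding q_over[OF u c] by (rule \<iota>.R'.inner_pre[OF tr(1)[OF u] Fc])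
  moreover have "q (\<iota>.R'.inner c) = \<iota>.R'.pre (tr u) (\<iota>.R'.inner (F c))"
    unfolding q_over[OF u inner_over[OF c]] F_inner[OF cc] ..
  ultimately show ?thesis
    using \<iota>.R'.Ch.diff_add_cancel[OF \<iota>.R'.lmul_closed[OF tr(1)[OF u] Fc]
        \<iota>.R'.pre_closed[OF tr(1)[OF u] \<iota>.R'.inner_closed[OF Fc]]] by simp
qed

text \<open>
  With respect to \<open>inner\<close>, the homotopy \<open>h\<close> is a contraction.  For a cell \<open>c = pre g b\<close>, the part \<open>q\<close>
  contributes \<open>lmul g (q b)\<close>.  By induction \<open>\<kappa>\<close> contributes \<open>lmul g (q b) - c\<close>, and the difference is \<open>c\<close>.
\<close>

lemma h_inner:
  assumes c: "c \<in> carrier T"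
  shows "\<iota>.R'.inner (h c) \<oplus>\<^bsub>T\<^esub> h (\<iota>.R'.inner c) = c"
proof (rule T_eqI[OF modT linear_map_sum[OF modT linear_map_comp[OF h_linear \<iota>.R'.inner_linear]
        linear_map_comp[OF \<iota>.R'.inner_linear h_linear]] linear_map_id _ c])
  fix gs s a assume gs: "gs \<in> L" and s: "s \<in> S" and a: "a \<in> carrier k1"
  show "\<iota>.R'.inner (h (cell gs s a)) \<oplus>\<^bsub>T\<^esub> h (\<iota>.R'.inner (cell gs s a)) = cell gs s a"
  proof (rule cell_induct[OF gs s a])
    fix s assume s: "s \<in> S"
    let ?c = "cell [] s a"
    have c: "?c \<in> over s" using cell_over[of "[]" s a] s a by simp
    note cc = over_closed[OF c]
    have hc: "h ?c = q ?c" unfolding h_def \<kappa>_Nil[OF s a] by (rule \<iota>.R'.Ch.diff_zero[OF q_closed[OF cc]])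
    have z: "h \<zero>\<^bsub>T\<^esub> = \<zero>\<^bsub>T\<^esub>" "q \<zero>\<^bsub>T\<^esub> = \<zero>\<^bsub>T\<^esub>"
      by (rule linear_map_zero[OF modT modT h_linear], rule linear_map_zero[OF modT modT q_linear])
    have "\<iota>.R'.lmul (tr s) (F ?c) = ?c"
      using F_cell[of "[]" s a] lmul_cell_Nil[OF tr(1)[OF s] s0 a] tr(2)[OF s] s a by simp
    then show "\<iota>.R'.inner (h ?c) \<oplus>\<^bsub>T\<^esub> h (\<iota>.R'.inner ?c) = ?c"
      using q_homotopy[OF s c] by (simp only: hc inner_cell_Nil[OF s a] z)
  next
    fix g gs assume g: "g \<in> carrier G" and gs: "gs \<in> L" and b: "cell gs s a \<in> over (tgt gs s)"
      and IH: "\<iota>.R'.inner (h (cell gs s a)) \<oplus>\<^bsub>T\<^esub> h (\<iota>.R'.inner (cell gs s a)) = cell gs s a"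
    define b where "b = cell gs s a"
    define u where "u = tgt gs s"
    define c where "c = \<iota>.R'.pre g b"
    have bu: "b \<in> over u" and IH: "\<iota>.R'.inner (h b) \<oplus>\<^bsub>T\<^esub> h (\<iota>.R'.inner b) = b"
      using b IH by (simp_all only: b_def u_def)
    have u: "u \<in> S" unfolding u_def by (rule tgt_closed[OF gs s])
    have gu: "\<sigma> g u \<in> S" by (rule \<sigma>_closed[OF g u])
    have cu: "c \<in> over (\<sigma> g u)" unfolding c_def by (rule pre_over[OF g bu])
    note bc = over_closed[OF bu] and cc = over_closed[OF cu]
    note cl = bc cc \<iota>.R'.inner_closed h_closed q_closed \<kappa>_closed \<iota>.R'.lmul_closed[OF g] \<iota>.R'.pre_closed[OF g]
    \<comment> \<open>By the choice of \<open>red\<close>, the reduced first arrow followed by \<open>tr (\<sigma> g u)\<close> is \<open>tr u\<close> followed by \<open>g\<close>.\<close>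
    have W: "\<iota>.R'.lmul (tr (\<sigma> g u)) (F c) = \<iota>.R'.lmul g (q b)"
      unfolding c_def F_pre[OF g u bu] q_over[OF u bu]
        \<iota>.R'.lmul_pre[OF tr(1)[OF gu] \<phi>_closed[OF red(1)[OF g u]] F_closed[OF bc]]
        \<iota>.R'.lmul_pre[OF g tr(1)[OF u] F_closed[OF bc]] red(2)[OF g u] ..
    have DK: "\<iota>.R'.inner (\<kappa> c) = \<iota>.R'.lmul g (h b) \<ominus>\<^bsub>T\<^esub> \<iota>.R'.pre g (\<iota>.R'.inner (h b))"
      unfolding c_def \<kappa>_pre[OF g bc] by (rule \<iota>.R'.inner_pre[OF g h_closed[OF bc]])
    have KD: "\<kappa> (\<iota>.R'.inner c) = \<iota>.R'.lmul g (\<kappa> b) \<ominus>\<^bsub>T\<^esub> \<iota>.R'.pre g (h (\<iota>.R'.inner b))"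
      unfolding c_def \<iota>.R'.inner_pre[OF g bc]
      by (simp only: linear_map_diff[OF modT modT \<kappa>_linear] cl \<kappa>_lmul[OF g] \<kappa>_pre[OF g])
    have hk: "h b \<oplus>\<^bsub>T\<^esub> \<kappa> b = q b"
      unfolding h_def by (rule \<iota>.R'.Ch.diff_add_cancel) (simp_all only: cl)
    have "\<iota>.R'.inner (\<kappa> c) \<oplus>\<^bsub>T\<^esub> \<kappa> (\<iota>.R'.inner c) =
        (\<iota>.R'.lmul g (h b) \<oplus>\<^bsub>T\<^esub> \<iota>.R'.lmul g (\<kappa> b)) \<ominus>\<^bsub>T\<^esub>
        (\<iota>.R'.pre g (\<iota>.R'.inner (h b)) \<oplus>\<^bsub>T\<^esub> \<iota>.R'.pre g (h (\<iota>.R'.inner b)))"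
      unfolding DK KD by (rule \<iota>.R'.Ch.diff_add_diff) (simp_all only: cl)
    also have "\<dots> = \<iota>.R'.lmul g (h b \<oplus>\<^bsub>T\<^esub> \<kappa> b) \<ominus>\<^bsub>T\<^esub> \<iota>.R'.pre g (\<iota>.R'.inner (h b) \<oplus>\<^bsub>T\<^esub> h (\<iota>.R'.inner b))"
      by (simp only: linear_map_add[OF \<iota>.R'.lmul_linear[OF g]] linear_map_add[OF \<iota>.R'.pre_linear[OF g]] cl)
    also have "\<dots> = \<iota>.R'.lmul g (q b) \<ominus>\<^bsub>T\<^esub> c" unfolding hk IH c_def ..
    finally have K: "\<iota>.R'.inner (\<kappa> c) \<oplus>\<^bsub>T\<^esub> \<kappa> (\<iota>.R'.inner c) = \<iota>.R'.lmul g (q b) \<ominus>\<^bsub>T\<^esub> c" .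
    have "\<iota>.R'.inner (h c) \<oplus>\<^bsub>T\<^esub> h (\<iota>.R'.inner c) =
        (\<iota>.R'.inner (q c) \<ominus>\<^bsub>T\<^esub> \<iota>.R'.inner (\<kappa> c)) \<oplus>\<^bsub>T\<^esub> (q (\<iota>.R'.inner c) \<ominus>\<^bsub>T\<^esub> \<kappa> (\<iota>.R'.inner c))"
      unfolding h_def by (simp only: linear_map_diff[OF modT modT \<iota>.R'.inner_linear] cl)
    also have "\<dots> = (\<iota>.R'.inner (q c) \<oplus>\<^bsub>T\<^esub> q (\<iota>.R'.inner c)) \<ominus>\<^bsub>T\<^esub> (\<iota>.R'.inner (\<kappa> c) \<oplus>\<^bsub>T\<^esub> \<kappa> (\<iota>.R'.inner c))"
      by (rule \<iota>.R'.Ch.diff_add_diff) (simp_all only: cl)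
    also have "\<dots> = \<iota>.R'.lmul g (q b) \<ominus>\<^bsub>T\<^esub> (\<iota>.R'.lmul g (q b) \<ominus>\<^bsub>T\<^esub> c)"
      unfolding q_homotopy[OF gu cu] W K ..
    also have "\<dots> = c" by (rule \<iota>.R'.Ch.diff_diff_cancel) (simp_all only: cl)
    finally show "\<iota>.R'.inner (h (\<iota>.R'.pre g (cell gs s a))) \<oplus>\<^bsub>T\<^esub> h (\<iota>.R'.inner (\<iota>.R'.pre g (cell gs s a))) =
        \<iota>.R'.pre g (cell gs s a)" unfolding c_def b_def .
  qed
qed

lemma q_tail:
  assumes "u \<in> S" "c \<in> over u" shows "\<iota>.R'.tail (q c) = F c"
  unfolding q_over[OF assms]
  by (rule \<iota>.R'.tail_pre[OF tr(1)[OF assms(1)] F_closed[OF over_closed[OF assms(2)]]])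

text \<open>
  The face that drops the chosen arrow from \<open>q c\<close> leaves the reduced chain, and the one that drops the
  first arrow from \<open>\<kappa> c\<close> leaves \<open>h\<close> of the tail.
\<close>

lemma h_tail:
  assumes c: "c \<in> carrier T"
  shows "\<iota>.R'.tail (h c) \<oplus>\<^bsub>T\<^esub> h (\<iota>.R'.tail c) = F c"
proof (rule T_eqI[OF modT linear_map_sum[OF modT linear_map_comp[OF h_linear \<iota>.R'.tail_linear]
        linear_map_comp[OF \<iota>.R'.tail_linear h_linear]] F_linear _ c])
  fix gs s a assume gs: "gs \<in> L" and s: "s \<in> S" and a: "a \<in> carrier k1"
  show "\<iota>.R'.tail (h (cell gs s a)) \<oplus>\<^bsub>T\<^esub> h (\<iota>.R'.tail (cell gs s a)) = F (cell gs s a)"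
  proof (rule cell_induct[OF gs s a])
    fix s assume s: "s \<in> S"
    let ?c = "cell [] s a"
    have c: "?c \<in> over s" using cell_over[of "[]" s a] s a by simp
    note cc = over_closed[OF c]
    have hc: "h ?c = q ?c" unfolding h_def \<kappa>_Nil[OF s a] by (rule \<iota>.R'.Ch.diff_zero[OF q_closed[OF cc]])
    have z: "h \<zero>\<^bsub>T\<^esub> = \<zero>\<^bsub>T\<^esub>" by (rule linear_map_zero[OF modT modT h_linear])
    show "\<iota>.R'.tail (h ?c) \<oplus>\<^bsub>T\<^esub> h (\<iota>.R'.tail ?c) = F ?c"
      unfolding hc tail_cell_Nil[OF s a] z q_tail[OF s c] by (rule \<iota>.R'.Ch.r_zero[OF F_closed[OF cc]])
  next
    fix g gs assume g: "g \<in> carrier G" and gs: "gs \<in> L" and b: "cell gs s a \<in> over (tgt gs s)"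
    let ?b = "cell gs s a" and ?c = "\<iota>.R'.pre g (cell gs s a)"
    have u: "\<sigma> g (tgt gs s) \<in> S" by (rule \<sigma>_closed[OF g tgt_closed[OF gs s]])
    note bc = over_closed[OF b]
    note c = pre_over[OF g b]
    note cc = over_closed[OF c]
    have "\<iota>.R'.tail (h ?c) = \<iota>.R'.tail (q ?c) \<ominus>\<^bsub>T\<^esub> \<iota>.R'.tail (\<kappa> ?c)"
      unfolding h_def by (rule linear_map_diff[OF modT modT \<iota>.R'.tail_linear q_closed[OF cc] \<kappa>_closed[OF cc]])
    also have "\<dots> = F ?c \<ominus>\<^bsub>T\<^esub> h ?b"
      unfolding q_tail[OF u c] \<kappa>_pre[OF g bc] \<iota>.R'.tail_pre[OF g h_closed[OF bc]] ..
    finally show "\<iota>.R'.tail (h ?c) \<oplus>\<^bsub>T\<^esub> h (\<iota>.R'.tail ?c) = F ?c"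
      unfolding \<iota>.R'.tail_pre[OF g bc]
      using \<iota>.R'.Ch.diff_add_cancel[OF F_closed[OF cc] h_closed[OF bc]] by simp
  qed
qed

lemma h_bd:
  assumes c: "c \<in> carrier T"
  shows "\<iota>.R'.bd (h c) \<oplus>\<^bsub>T\<^esub> h (\<iota>.R'.bd c) = F c \<ominus>\<^bsub>T\<^esub> c"
proof -
  note cl = c h_closed \<iota>.R'.tail_closed \<iota>.R'.inner_closed
  have "\<iota>.R'.bd (h c) \<oplus>\<^bsub>T\<^esub> h (\<iota>.R'.bd c) =
      (\<iota>.R'.tail (h c) \<ominus>\<^bsub>T\<^esub> \<iota>.R'.inner (h c)) \<oplus>\<^bsub>T\<^esub> (h (\<iota>.R'.tail c) \<ominus>\<^bsub>T\<^esub> h (\<iota>.R'.inner c))"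
    unfolding \<iota>.R'.bd_def by (simp only: linear_map_diff[OF modT modT h_linear] cl)
  also have "\<dots> = (\<iota>.R'.tail (h c) \<oplus>\<^bsub>T\<^esub> h (\<iota>.R'.tail c)) \<ominus>\<^bsub>T\<^esub> (\<iota>.R'.inner (h c) \<oplus>\<^bsub>T\<^esub> h (\<iota>.R'.inner c))"
    by (rule \<iota>.R'.Ch.diff_add_diff) (simp_all only: cl)
  also have "\<dots> = F c \<ominus>\<^bsub>T\<^esub> c" unfolding h_tail[OF c] h_inner[OF c] ..
  finally show ?thesis .
qed

lemma q_C:
  assumes "c \<in> \<iota>.R'.C n" shows "q c \<in> \<iota>.R'.C (Suc n)"
  unfolding \<iota>.R'.C_def
proof (rule T_C_map[OF modP q_linear[unfolded \<iota>.R'.Ch_def] \<iota>.R'.deg_lists _ assms])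
  fix gs s a assume "gs \<in> \<iota>.R'.deg n" and s: "s \<in> S" and a: "a \<in> carrier k1"
  then have gs: "gs \<in> L" "Suc (length gs) = n" by (auto simp: \<iota>.R'.deg_def)
  show "q (cell gs s a) \<in> carrier (fsupp (\<iota>.R'.deg (Suc n)) P)"
    unfolding q_cell[OF gs(1) s a] unfolding qcell_def cell_def
    by (rule single_closed[OF modP _ single_closed[OF k1 s0 a]])
      (use qlist[OF gs(1) s] gs(2) in \<open>simp add: \<iota>.R'.deg_def length_redl\<close>)
qed

lemma kcell_C:
  assumes "gs \<in> L" and s: "s \<in> S" and a: "a \<in> carrier k1"
  shows "kcell gs s a \<in> \<iota>.R'.C (Suc (Suc (length gs)))"
  using assms(1)
proof (induct gs)
  case Nil
  show ?case using \<iota>.R'.zero_C by simp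
next
  case (Cons g gs)
  then have g: "g \<in> carrier G" "gs \<in> L" by auto
  have "cell gs s a \<in> \<iota>.R'.C (Suc (length gs))"
    unfolding cell_def by (rule \<iota>.R'.single_C[OF g(2) single_closed[OF k1 s a]])
  then have "qcell gs s a \<in> \<iota>.R'.C (Suc (Suc (length gs)))"
    using q_C q_cell[OF g(2) s a] by metis
  then show ?case using \<iota>.R'.pre_C[OF g(1) \<iota>.R'.diff_C[OF _ Cons(3)]] by simp
qed

lemma h_C:
  assumes "c \<in> \<iota>.R'.C n" shows "h c \<in> \<iota>.R'.C (Suc n)"
proof -
  have "\<kappa> c \<in> carrier (fsupp (\<iota>.R'.deg (Suc n)) P)"
  proof (rule T_C_map[OF modP \<kappa>_linear[unfolded \<iota>.R'.Ch_def] \<iota>.R'.deg_lists _ assms])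
    fix gs s a assume "gs \<in> \<iota>.R'.deg n" and s: "s \<in> S" and a: "a \<in> carrier k1"
    then have gs: "gs \<in> L" "Suc (length gs) = n" by (auto simp: \<iota>.R'.deg_def)
    show "\<kappa> (cell gs s a) \<in> carrier (fsupp (\<iota>.R'.deg (Suc n)) P)"
      unfolding \<kappa>_cell[OF gs(1) s a] using kcell_C[OF gs(1) s a] gs(2) by (simp only: \<iota>.R'.C_def)
  qed
  then have "\<kappa> c \<in> \<iota>.R'.C (Suc n)" by (simp only: \<iota>.R'.C_def)
  then show ?thesis unfolding h_def by (rule \<iota>.R'.diff_C[OF q_C[OF assms]])
qed

text \<open>The inclusion of \<open>H\<close> has a retraction, and the other composite is homotopic to the identity.\<close>

theorem shapiro: "\<iota>.F.hsurj n" "\<iota>.F.hinj n"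
proof -
  show "\<iota>.F.hsurj n"
    unfolding \<iota>.F.hsurj_def
  proof
    fix y assume y: "y \<in> \<iota>.R'.B.cycles n"
    then have yC: "y \<in> \<iota>.R'.C n" "y \<in> carrier T" "\<iota>.R'.bd y = \<zero>\<^bsub>T\<^esub>"
      using \<iota>.R'.cyclesD[of y n] by (auto simp: \<iota>.R'.B.cycles_def)
    have hz: "h \<zero>\<^bsub>T\<^esub> = \<zero>\<^bsub>T\<^esub>" by (rule linear_map_zero[OF modT modT h_linear])
    note hc = h_closed[OF yC(2)]
    have "\<iota>.R'.bd (h y) = F y \<ominus>\<^bsub>T\<^esub> y"
      using h_bd[OF yC(2)] \<iota>.R'.Ch.r_zero[OF \<iota>.R'.bd_closed[OF hc]] by (simp only: yC(3) hz)
    then have "F y \<ominus>\<^bsub>T\<^esub> \<iota>.R'.bd (h y) = y"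
      using \<iota>.R'.Ch.diff_diff_cancel[OF F_closed[OF yC(2)] yC(2)] by (simp only:)
    then have e: "y = F y \<oplus>\<^bsub>T\<^esub> \<iota>.R'.bd (\<ominus>\<^bsub>T\<^esub> h y)"
      using linear_map_minus[OF modT modT \<iota>.R'.bd_linear hc] by (simp only: a_minus_def)
    have "\<iota>.R.bd (retr y) = \<zero>\<^bsub>TH\<^esub>"
      using retr_bd[OF yC(2)] by (simp only: yC(3) retr_zero)
    then have "retr y \<in> \<iota>.R.B.cycles n" using retr_C[OF yC(1)] unfolding \<iota>.R.B.cycles_def by blast
    then show "\<exists>x \<in> \<iota>.R.B.cycles n. \<exists>b \<in> \<iota>.R'.C (Suc n). y = \<iota>.chmap x \<oplus>\<^bsub>T\<^esub> \<iota>.R'.bd b"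
      using e \<iota>.R'.minus_C[OF h_C[OF yC(1)]] by blast
  qed
  show "\<iota>.F.hinj n"
    unfolding \<iota>.F.hinj_def
  proof (intro ballI impI)
    fix x y assume x: "x \<in> \<iota>.R.B.cycles n" and y: "y \<in> \<iota>.R'.C (Suc n)" and e: "\<iota>.chmap x = \<iota>.R'.bd y"
    have "y \<in> carrier T" using y \<iota>.R'.C_Ch by auto
    then have "x = \<iota>.R.bd (retr y)"
      using retr_chmap[OF \<iota>.R.cyclesD(2)[OF x]] retr_bd[of y] e by simp
    then show "\<exists>x' \<in> \<iota>.R.C (Suc n). x = \<iota>.R.bd x'" using retr_C[OF y] by blast
  qed
qed

end

section \<open>Complemented categories\<close>

lemma HomsD:
  "f \<in> Homs A V W \<Longrightarrow> f \<in> Arr A" "f \<in> Homs A V W \<Longrightarrow> Dom A f = V" "f \<in> Homs A V W \<Longrightarrow> Cod A f = W"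
  by (auto simp: Homs_def)

context cat begin

lemma Homs_Ob: "f \<in> Homs A V W \<Longrightarrow> V \<in> Ob A" "f \<in> Homs A V W \<Longrightarrow> W \<in> Ob A"
  using Dom_Ob Cod_Ob by (auto simp: Homs_def)

lemma inverse_arrs_unique:
  assumes "inverse_arrs A f g" "inverse_arrs A f g'" shows "g = g'"
proof -
  let ?V = "Dom A f" and ?W = "Cod A f"
  have f: "f \<in> Homs A ?V ?W" using assms by (simp add: inverse_arrs_def Homs_def)
  have g: "g \<in> Homs A ?W ?V" "g \<bullet> f = Id A ?V" and g': "g' \<in> Homs A ?W ?V" "f \<bullet> g' = Id A ?W"
    using assms by (auto simp: inverse_arrs_def)
  have "g = g \<bullet> (f \<bullet> g')" using Comp_Id[OF g(1)] g'(2) by simp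
  also have "\<dots> = (g \<bullet> f) \<bullet> g'" using Comp_assoc[OF g'(1) f g(1)] by simp
  also have "\<dots> = g'" using Id_Comp[OF g'(1)] g(2) by simp
  finally show ?thesis .
qed

lemma inv_arr:
  assumes "f \<in> Homs A V W" "iso_arr A f"
  shows "inv_arr A f \<in> Homs A W V" "inv_arr A f \<bullet> f = Id A V" "f \<bullet> inv_arr A f = Id A W"
    "iso_arr A (inv_arr A f)"
proof -
  obtain g where g: "inverse_arrs A f g" using assms(2) by (auto simp: iso_arr_def)
  have "inv_arr A f = g" unfolding inv_arr_def using g inverse_arrs_unique by blast
  then have i: "inverse_arrs A f (inv_arr A f)" using g by simp
  then show 1: "inv_arr A f \<in> Homs A W V" "inv_arr A f \<bullet> f = Id A V" "f \<bullet> inv_arr A f = Id A W"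
    using assms(1) by (auto simp: inverse_arrs_def Homs_def)
  have "inverse_arrs A (inv_arr A f) f"
    using 1 assms(1) by (auto simp: inverse_arrs_def Homs_def)
  then show "iso_arr A (inv_arr A f)" by (auto simp: iso_arr_def)
qed

lemma isoI:
  assumes "f \<in> Homs A V W" "g \<in> Homs A W V" "g \<bullet> f = Id A V" "f \<bullet> g = Id A W"
  shows "iso_arr A f"
  unfolding iso_arr_def inverse_arrs_def using assms by (intro exI[of _ g]) (auto simp: Homs_def)

lemma inv_comp_cancel:
  assumes "f \<in> Homs A V W" "iso_arr A f" "g \<in> Homs A U V"
  shows "inv_arr A f \<bullet> (f \<bullet> g) = g"
  using Comp_assoc[OF assms(3,1) inv_arr(1)[OF assms(1,2)]] inv_arr(2)[OF assms(1,2)] Id_Comp[OF assms(3)] by simp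

lemma comp_inv_cancel:
  assumes "f \<in> Homs A V W" "iso_arr A f" "g \<in> Homs A U W"
  shows "f \<bullet> (inv_arr A f \<bullet> g) = g"
  using Comp_assoc[OF assms(3) inv_arr(1)[OF assms(1,2)] assms(1)] inv_arr(3)[OF assms(1,2)] Id_Comp[OF assms(3)] by simp

lemma comp_inv_cancel':
  assumes "f \<in> Homs A V W" "iso_arr A f" "g \<in> Homs A V U"
  shows "(g \<bullet> inv_arr A f) \<bullet> f = g"
  using Comp_assoc[OF assms(1) inv_arr(1)[OF assms(1,2)] assms(3)] inv_arr(2)[OF assms(1,2)] Comp_Id[OF assms(3)] by simp

lemma comp_comp_inv_cancel:
  assumes "f \<in> Homs A V W" "iso_arr A f" "g \<in> Homs A W U"
  shows "(g \<bullet> f) \<bullet> inv_arr A f = g"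
  using Comp_assoc[OF inv_arr(1)[OF assms(1,2)] assms(1,3)] inv_arr(3)[OF assms(1,2)] Comp_Id[OF assms(3)] by simp

lemma iso_left_cancel:
  assumes "f \<in> Homs A V W" "iso_arr A f" "g \<in> Homs A U V" "h \<in> Homs A U V" "f \<bullet> g = f \<bullet> h"
  shows "g = h"
  using inv_comp_cancel[OF assms(1,2,3)] inv_comp_cancel[OF assms(1,2,4)] unfolding assms(5) by (rule box_equals[OF refl])

lemma iso_right_cancel:
  assumes "f \<in> Homs A V W" "iso_arr A f" "g \<in> Homs A W U" "h \<in> Homs A W U" "g \<bullet> f = h \<bullet> f"
  shows "g = h"
  using comp_comp_inv_cancel[OF assms(1,2,3)] comp_comp_inv_cancel[OF assms(1,2,4)] unfolding assms(5) by (rule box_equals[OF refl])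

lemma iso_Id: "V \<in> Ob A \<Longrightarrow> iso_arr A (Id A V)"
  using Id_Homs[of V] Comp_Id[of "Id A V" V V] by (intro isoI) auto

lemma iso_Comp:
  assumes f: "f \<in> Homs A U V" "iso_arr A f" and g: "g \<in> Homs A V W" "iso_arr A g"
  shows "iso_arr A (g \<bullet> f)"
proof (rule isoI)
  note f' = inv_arr[OF f] and g' = inv_arr[OF g]
  show "g \<bullet> f \<in> Homs A U W" by (rule Comp_Homs[OF f(1) g(1)])
  show "inv_arr A f \<bullet> inv_arr A g \<in> Homs A W U" by (rule Comp_Homs[OF g'(1) f'(1)])
  have "(inv_arr A f \<bullet> inv_arr A g) \<bullet> (g \<bullet> f) = inv_arr A f \<bullet> (inv_arr A g \<bullet> (g \<bullet> f))"
    by (rule Comp_assoc[OF Comp_Homs[OF f(1) g(1)] g'(1) f'(1)])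
  also have "\<dots> = Id A U" unfolding inv_comp_cancel[OF g f(1)] by (rule f'(2))
  finally show "(inv_arr A f \<bullet> inv_arr A g) \<bullet> (g \<bullet> f) = Id A U" .
  have "(g \<bullet> f) \<bullet> (inv_arr A f \<bullet> inv_arr A g) = g \<bullet> (f \<bullet> (inv_arr A f \<bullet> inv_arr A g))"
    by (rule Comp_assoc[OF Comp_Homs[OF g'(1) f'(1)] f(1) g(1)])
  also have "\<dots> = Id A W" unfolding comp_inv_cancel[OF f g'(1)] by (rule g'(3))
  finally show "(g \<bullet> f) \<bullet> (inv_arr A f \<bullet> inv_arr A g) = Id A W" .
qed

lemma AutG_carrier: "f \<in> carrier (AutG A V) \<longleftrightarrow> f \<in> Homs A V V \<and> iso_arr A f"
  by (simp add: AutG_def)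

lemma AutG_mult: "f \<otimes>\<^bsub>AutG A V\<^esub> g = f \<bullet> g"
  by (simp add: AutG_def)

lemma AutG_one: "\<one>\<^bsub>AutG A V\<^esub> = Id A V"
  by (simp add: AutG_def)

lemma AutG_group: assumes V: "V \<in> Ob A" shows "group (AutG A V)"
proof (rule groupI)
  show "\<one>\<^bsub>AutG A V\<^esub> \<in> carrier (AutG A V)"
    using Id_Homs[OF V] iso_Id[OF V] by (simp add: AutG_carrier AutG_one)
  fix f assume f: "f \<in> carrier (AutG A V)"
  show "\<one>\<^bsub>AutG A V\<^esub> \<otimes>\<^bsub>AutG A V\<^esub> f = f"
    using f Id_Comp[of f V V] by (simp add: AutG_carrier AutG_one AutG_mult)
  show "\<exists>g \<in> carrier (AutG A V). g \<otimes>\<^bsub>AutG A V\<^esub> f = \<one>\<^bsub>AutG A V\<^esub>"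
    using f inv_arr[of f V V] by (intro bexI[of _ "inv_arr A f"]) (auto simp: AutG_carrier AutG_one AutG_mult)
  fix g assume g: "g \<in> carrier (AutG A V)"
  show "f \<otimes>\<^bsub>AutG A V\<^esub> g \<in> carrier (AutG A V)"
    using f g Comp_Homs iso_Comp by (auto simp: AutG_carrier AutG_mult)
  fix h assume h: "h \<in> carrier (AutG A V)"
  show "f \<otimes>\<^bsub>AutG A V\<^esub> g \<otimes>\<^bsub>AutG A V\<^esub> h = f \<otimes>\<^bsub>AutG A V\<^esub> (g \<otimes>\<^bsub>AutG A V\<^esub> h)"
    using f g h Comp_assoc by (auto simp: AutG_carrier AutG_mult)
qed

lemma isomorphic_obs_sym: "isomorphic_obs A V W \<Longrightarrow> isomorphic_obs A W V"
  unfolding isomorphic_obs_def using inv_arr by blast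

lemma isomorphic_obs_trans: "isomorphic_obs A U V \<Longrightarrow> isomorphic_obs A V W \<Longrightarrow> isomorphic_obs A U W"
  unfolding isomorphic_obs_def using Comp_Homs iso_Comp by blast

end

context symmetric_monoidal_cat begin

lemma TArr_Comp_Id:
  "f \<in> Homs A U V \<Longrightarrow> g \<in> Homs A V V' \<Longrightarrow> W \<in> Ob A \<Longrightarrow>
    (g \<star> Id A W) \<bullet> (f \<star> Id A W) = (g \<bullet> f) \<star> Id A W"
  using TArr_Comp[of f U V g V' "Id A W" W W "Id A W" W] Id_Homs[of W] Id_Comp[of "Id A W" W W] by simp

lemma Id_TArr_Comp:
  "f \<in> Homs A U V \<Longrightarrow> g \<in> Homs A V V' \<Longrightarrow> W \<in> Ob A \<Longrightarrow>
    (Id A W \<star> g) \<bullet> (Id A W \<star> f) = Id A W \<star> (g \<bullet> f)"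
  using TArr_Comp[of "Id A W" W W "Id A W" W f U V g V'] Id_Homs[of W] Id_Comp[of "Id A W" W W] by simp

lemma iso_TArr:
  assumes f: "f \<in> Homs A V V'" "iso_arr A f" and g: "g \<in> Homs A W W'" "iso_arr A g"
  shows "iso_arr A (f \<star> g)"
proof (rule isoI)
  note f' = inv_arr[OF f] and g' = inv_arr[OF g]
  show "f \<star> g \<in> Homs A (V \<box> W) (V' \<box> W')" by (rule TArr_Homs[OF f(1) g(1)])
  show "inv_arr A f \<star> inv_arr A g \<in> Homs A (V' \<box> W') (V \<box> W)" by (rule TArr_Homs[OF f'(1) g'(1)])
  show "(inv_arr A f \<star> inv_arr A g) \<bullet> (f \<star> g) = Id A (V \<box> W)"
    using TArr_Comp[OF f(1) f'(1) g(1) g'(1)] f'(2) g'(2) TArr_Id[OF Homs_Ob(1)[OF f(1)] Homs_Ob(1)[OF g(1)]]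
    by simp
  show "(f \<star> g) \<bullet> (inv_arr A f \<star> inv_arr A g) = Id A (V' \<box> W')"
    using TArr_Comp[OF f'(1) f(1) g'(1) g(1)] f'(3) g'(3) TArr_Id[OF Homs_Ob(2)[OF f(1)] Homs_Ob(2)[OF g(1)]]
    by simp
qed

lemma isomorphic_obs_TOb:
  "isomorphic_obs A V V' \<Longrightarrow> isomorphic_obs A W W' \<Longrightarrow> isomorphic_obs A (V \<box> W) (V' \<box> W')"
  unfolding isomorphic_obs_def using TArr_Homs iso_TArr by blast

lemma stab_hom_hom:
  assumes V: "V \<in> Ob A" and W: "W \<in> Ob A"
  shows "stab_hom A W \<in> hom (AutG A V) (AutG A (V \<box> W))"
proof (rule homI)
  fix f assume f: "f \<in> carrier (AutG A V)"
  then show "stab_hom A W f \<in> carrier (AutG A (V \<box> W))"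
    using TArr_Homs[OF _ Id_Homs[OF W]] iso_TArr[OF _ _ Id_Homs[OF W] iso_Id[OF W]]
    by (auto simp: stab_hom_def AutG_carrier)
  fix g assume g: "g \<in> carrier (AutG A V)"
  show "stab_hom A W (f \<otimes>\<^bsub>AutG A V\<^esub> g) = stab_hom A W f \<otimes>\<^bsub>AutG A (V \<box> W)\<^esub> stab_hom A W g"
    using f g TArr_Comp_Id[of g V V f V W] W by (simp add: stab_hom_def AutG_carrier AutG_mult)
qed

end

context complemented_cat begin

lemma init_arr: "V \<in> Ob A \<Longrightarrow> init_arr A V \<in> Homs A (Unit A) V"
  unfolding init_arr_def by (rule theI') (rule Unit_initial)

lemma init_unique: "f \<in> Homs A (Unit A) V \<Longrightarrow> g \<in> Homs A (Unit A) V \<Longrightarrow> f = g"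
  using Unit_initial Homs_Ob(2) by blast

lemmas runit = Runit_iso[THEN conjunct1] Runit_iso[THEN conjunct2]
  and lunit = Lunit_iso[THEN conjunct1] Lunit_iso[THEN conjunct2]
  and assoc = Assoc_iso[THEN conjunct1] Assoc_iso[THEN conjunct2]

lemma inl_arr: assumes V: "V \<in> Ob A" and W: "W \<in> Ob A" shows "inl_arr A V W \<in> Homs A V (V \<box> W)"
  unfolding inl_arr_def
  by (rule Comp_Homs[OF inv_arr(1)[OF runit[OF V]] TArr_Homs[OF Id_Homs[OF V] init_arr[OF W]]])

lemma inr_arr: assumes V: "V \<in> Ob A" and W: "W \<in> Ob A" shows "inr_arr A V W \<in> Homs A W (V \<box> W)"
  unfolding inr_arr_def
  by (rule Comp_Homs[OF inv_arr(1)[OF lunit[OF W]] TArr_Homs[OF init_arr[OF V] Id_Homs[OF W]]])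

lemma inv_runit_natural:
  assumes f: "f \<in> Homs A V V'"
  shows "(f \<star> Id A (Unit A)) \<bullet> inv_arr A (Runit A V) = inv_arr A (Runit A V') \<bullet> f"
proof -
  note V = Homs_Ob[OF f]
  note r = runit[OF V(1)] and r' = runit[OF V(2)]
  have g: "f \<star> Id A (Unit A) \<in> Homs A (V \<box> Unit A) (V' \<box> Unit A)"
    by (rule TArr_Homs[OF f Id_Homs[OF Unit_Ob]])
  have "f \<star> Id A (Unit A) = inv_arr A (Runit A V') \<bullet> (f \<bullet> Runit A V)"
    using inv_comp_cancel[OF r' g] Runit_natural[OF f] by simp
  also have "\<dots> = (inv_arr A (Runit A V') \<bullet> f) \<bullet> Runit A V"
    using Comp_assoc[OF r(1) f inv_arr(1)[OF r']] by simp
  finally show ?thesis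
    using comp_comp_inv_cancel[OF r Comp_Homs[OF f inv_arr(1)[OF r']]] by simp
qed

lemma inv_lunit_natural:
  assumes f: "f \<in> Homs A V V'"
  shows "(Id A (Unit A) \<star> f) \<bullet> inv_arr A (Lunit A V) = inv_arr A (Lunit A V') \<bullet> f"
proof -
  note V = Homs_Ob[OF f]
  note r = lunit[OF V(1)] and r' = lunit[OF V(2)]
  have g: "Id A (Unit A) \<star> f \<in> Homs A (Unit A \<box> V) (Unit A \<box> V')"
    by (rule TArr_Homs[OF Id_Homs[OF Unit_Ob] f])
  have "Id A (Unit A) \<star> f = inv_arr A (Lunit A V') \<bullet> (f \<bullet> Lunit A V)"
    using inv_comp_cancel[OF r' g] Lunit_natural[OF f] by simp
  also have "\<dots> = (inv_arr A (Lunit A V') \<bullet> f) \<bullet> Lunit A V"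
    using Comp_assoc[OF r(1) f inv_arr(1)[OF r']] by simp
  finally show ?thesis
    using comp_comp_inv_cancel[OF r Comp_Homs[OF f inv_arr(1)[OF r']]] by simp
qed

lemma inl_natural:
  assumes f: "f \<in> Homs A V V'" and g: "g \<in> Homs A W W'"
  shows "(f \<star> g) \<bullet> inl_arr A V W = inl_arr A V' W' \<bullet> f"
proof -
  note V = Homs_Ob[OF f] and W = Homs_Ob[OF g]
  note iV = Id_Homs[OF V(1)] and iV' = Id_Homs[OF V(2)] and i1 = Id_Homs[OF Unit_Ob]
  note w = init_arr[OF W(1)] and w' = init_arr[OF W(2)]
  note r = inv_arr(1)[OF runit[OF V(1)]] and r' = inv_arr(1)[OF runit[OF V(2)]]
  have gw: "g \<bullet> init_arr A W = init_arr A W'" by (rule init_unique[OF Comp_Homs[OF w g] w'])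
  have "(f \<star> g) \<bullet> inl_arr A V W = ((f \<star> g) \<bullet> (Id A V \<star> init_arr A W)) \<bullet> inv_arr A (Runit A V)"
    unfolding inl_arr_def using Comp_assoc[OF r TArr_Homs[OF iV w] TArr_Homs[OF f g]] by simp
  also have "(f \<star> g) \<bullet> (Id A V \<star> init_arr A W) = (Id A V' \<star> init_arr A W') \<bullet> (f \<star> Id A (Unit A))"
    using TArr_Comp[OF iV f w g] TArr_Comp[OF f iV' i1 w'] Comp_Id[OF f] Id_Comp[OF f] gw Comp_Id[OF w'] by simp
  also have "\<dots> \<bullet> inv_arr A (Runit A V) = (Id A V' \<star> init_arr A W') \<bullet> (inv_arr A (Runit A V') \<bullet> f)"
    using Comp_assoc[OF r TArr_Homs[OF f i1] TArr_Homs[OF iV' w']] inv_runit_natural[OF f] by simp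
  also have "\<dots> = inl_arr A V' W' \<bullet> f"
    unfolding inl_arr_def using Comp_assoc[OF f r' TArr_Homs[OF iV' w']] by simp
  finally show ?thesis .
qed

lemma inr_natural:
  assumes f: "f \<in> Homs A V V'" and g: "g \<in> Homs A W W'"
  shows "(f \<star> g) \<bullet> inr_arr A V W = inr_arr A V' W' \<bullet> g"
proof -
  note V = Homs_Ob[OF f] and W = Homs_Ob[OF g]
  note iW = Id_Homs[OF W(1)] and iW' = Id_Homs[OF W(2)] and i1 = Id_Homs[OF Unit_Ob]
  note v = init_arr[OF V(1)] and v' = init_arr[OF V(2)]
  note r = inv_arr(1)[OF lunit[OF W(1)]] and r' = inv_arr(1)[OF lunit[OF W(2)]]
  have fv: "f \<bullet> init_arr A V = init_arr A V'" by (rule init_unique[OF Comp_Homs[OF v f] v'])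
  have "(f \<star> g) \<bullet> inr_arr A V W = ((f \<star> g) \<bullet> (init_arr A V \<star> Id A W)) \<bullet> inv_arr A (Lunit A W)"
    unfolding inr_arr_def using Comp_assoc[OF r TArr_Homs[OF v iW] TArr_Homs[OF f g]] by simp
  also have "(f \<star> g) \<bullet> (init_arr A V \<star> Id A W) = (init_arr A V' \<star> Id A W') \<bullet> (Id A (Unit A) \<star> g)"
    using TArr_Comp[OF v f iW g] TArr_Comp[OF i1 v' g iW'] Comp_Id[OF g] Id_Comp[OF g] fv Comp_Id[OF v'] by simp
  also have "\<dots> \<bullet> inv_arr A (Lunit A W) = (init_arr A V' \<star> Id A W') \<bullet> (inv_arr A (Lunit A W') \<bullet> g)"
    using Comp_assoc[OF r TArr_Homs[OF i1 g] TArr_Homs[OF v' iW']] inv_lunit_natural[OF g] by simp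
  also have "\<dots> = inr_arr A V' W' \<bullet> g"
    unfolding inr_arr_def using Comp_assoc[OF g r' TArr_Homs[OF v' iW']] by simp
  finally show ?thesis .
qed

lemma TOb_eqI:
  assumes V: "V \<in> Ob A" and W: "W \<in> Ob A" and f: "f \<in> Homs A (V \<box> W) U" and g: "g \<in> Homs A (V \<box> W) U"
    and "f \<bullet> inl_arr A V W = g \<bullet> inl_arr A V W" "f \<bullet> inr_arr A V W = g \<bullet> inr_arr A V W"
  shows "f = g"
  using inj_onD[OF jointly_epic[OF V W Homs_Ob(2)[OF f]] _ f g] assms(5,6) by simp

text \<open>
  Both sides insert a unit object on the right and map it to the other factors.  As the unit object is
  initial, only the unitors have to be compared, by the triangle identity and the equation
  \<open>Runit A U \<star> id = Runit A (U \<box> Unit A)\<close>, which is the naturality of \<open>Runit\<close> at \<open>Runit A U\<close>.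
\<close>

lemma assoc_inl_inl:
  assumes U: "U \<in> Ob A" and V: "V \<in> Ob A" and W: "W \<in> Ob A"
  shows "Assoc A U V W \<bullet> (inl_arr A (U \<box> V) W \<bullet> inl_arr A U V) = inl_arr A U (V \<box> W)"
proof -
  let ?one = "Unit A" and ?r = "\<lambda>V. inv_arr A (Runit A V)" and ?i = "init_arr A"
  note UV = TOb_Ob[OF U V] and VW = TOb_Ob[OF V W] and U1 = TOb_Ob[OF U Unit_Ob]
  note v = init_arr[OF V] and w = init_arr[OF W] and iU = Id_Homs[OF U] and i1 = Id_Homs[OF Unit_Ob]
  note rU = inv_arr(1)[OF runit[OF U]] and rU1 = inv_arr(1)[OF runit[OF U1]]
    and rUV = inv_arr(1)[OF runit[OF UV]]
  note a = Id_Homs[OF UV, THEN TArr_Homs, OF w]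
  note b = TArr_Homs[OF iU v]
  note l1 = lunit[OF Unit_Ob]
  note aU11 = assoc(1)[OF U Unit_Ob Unit_Ob]
  have 1: "inl_arr A (U \<box> V) W \<bullet> inl_arr A U V =
      ((Id A U \<star> ?i V) \<star> ?i W) \<bullet> (?r (U \<box> ?one) \<bullet> ?r U)"
  proof -
    have "inl_arr A (U \<box> V) W \<bullet> inl_arr A U V = (inl_arr A (U \<box> V) W \<bullet> (Id A U \<star> ?i V)) \<bullet> ?r U"
      unfolding inl_arr_def[of A U V] using Comp_assoc[OF rU b inl_arr[OF UV W]] by simp
    also have "inl_arr A (U \<box> V) W \<bullet> (Id A U \<star> ?i V) = ((Id A U \<star> ?i V) \<star> ?i W) \<bullet> ?r (U \<box> ?one)"
    proof -
      have "inl_arr A (U \<box> V) W \<bullet> (Id A U \<star> ?i V) = ((Id A U \<star> ?i V) \<star> ?i W) \<bullet> inl_arr A (U \<box> ?one) ?one"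
        using inl_natural[OF b w] by simp
      also have "inl_arr A (U \<box> ?one) ?one = ?r (U \<box> ?one)"
        unfolding inl_arr_def using init_unique[OF init_arr[OF Unit_Ob] i1] TArr_Id[OF U1 Unit_Ob] Id_Comp[OF rU1]
        by simp
      finally show ?thesis .
    qed
    finally show ?thesis using Comp_assoc[OF rU rU1 TArr_Homs[OF b w]] by simp
  qed
  have vw: "?i V \<star> ?i W = ?i (V \<box> W) \<bullet> Lunit A ?one"
  proof -
    have "(?i V \<star> ?i W) \<bullet> inv_arr A (Lunit A ?one) = ?i (V \<box> W)"
      by (rule init_unique[OF Comp_Homs[OF inv_arr(1)[OF l1] TArr_Homs[OF v w]] init_arr[OF VW]])
    then show ?thesis using comp_inv_cancel'[OF l1 TArr_Homs[OF v w]] by simp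
  qed
  have ru: "Runit A U \<star> Id A ?one = Runit A (U \<box> ?one)"
  proof (rule iso_left_cancel[OF runit[OF U]])
    show "Runit A U \<star> Id A ?one \<in> Homs A ((U \<box> ?one) \<box> ?one) (U \<box> ?one)"
      by (rule TArr_Homs[OF runit(1)[OF U] i1])
    show "Runit A (U \<box> ?one) \<in> Homs A ((U \<box> ?one) \<box> ?one) (U \<box> ?one)" by (rule runit(1)[OF U1])
    show "Runit A U \<bullet> (Runit A U \<star> Id A ?one) = Runit A U \<bullet> Runit A (U \<box> ?one)"
      by (rule Runit_natural[OF runit(1)[OF U]])
  qed
  let ?R = "?r (U \<box> ?one) \<bullet> ?r U"
  have R: "?R \<in> Homs A U ((U \<box> ?one) \<box> ?one)" by (rule Comp_Homs[OF rU rU1])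
  have vwH: "Id A U \<star> (?i V \<star> ?i W) \<in> Homs A (U \<box> (?one \<box> ?one)) (U \<box> (V \<box> W))"
    by (rule TArr_Homs[OF iU TArr_Homs[OF v w]])
  have "Assoc A U V W \<bullet> (inl_arr A (U \<box> V) W \<bullet> inl_arr A U V) =
      (Assoc A U V W \<bullet> ((Id A U \<star> ?i V) \<star> ?i W)) \<bullet> ?R"
    unfolding 1 using Comp_assoc[OF R TArr_Homs[OF b w] assoc(1)[OF U V W]] by simp
  also have "\<dots> = ((Id A U \<star> (?i V \<star> ?i W)) \<bullet> Assoc A U ?one ?one) \<bullet> ?R"
    using Assoc_natural[OF iU v w] by simp
  also have "Id A U \<star> (?i V \<star> ?i W) = (Id A U \<star> ?i (V \<box> W)) \<bullet> (Id A U \<star> Lunit A ?one)"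
    unfolding vw using Id_TArr_Comp[OF l1(1) init_arr[OF VW] U] by simp
  also have "\<dots> \<bullet> Assoc A U ?one ?one = (Id A U \<star> ?i (V \<box> W)) \<bullet> Runit A (U \<box> ?one)"
    using Comp_assoc[OF aU11 TArr_Homs[OF iU l1(1)] TArr_Homs[OF iU init_arr[OF VW]]]
      triangle[OF U Unit_Ob] ru by simp
  also have "\<dots> \<bullet> ?R = (Id A U \<star> ?i (V \<box> W)) \<bullet> (Runit A (U \<box> ?one) \<bullet> ?R)"
    by (rule Comp_assoc[OF R runit(1)[OF U1] TArr_Homs[OF iU init_arr[OF VW]]])
  also have "Runit A (U \<box> ?one) \<bullet> ?R = ?r U" by (rule comp_inv_cancel[OF runit[OF U1] rU])
  finally show ?thesis unfolding inl_arr_def[of A U "V \<box> W"] .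
qed

lemma xpow_Ob: "xpow A X n \<in> Ob A"
  by (induction n) (simp_all add: Unit_Ob TOb_Ob X_Ob)

subsection \<open>Automorphisms of \<open>X\<^sup>m\<^sup>+\<^sup>l\<close> and morphisms into it\<close>

text \<open>
  Both morphisms have complements, and these are isomorphic because every object determines its number
  of factors \<open>X\<close>.  An isomorphism between the complements, together with the identity of \<open>V\<close>, gives the
  automorphism.
\<close>

lemma transitive_Homs:
  assumes V: "isomorphic_obs A V (xpow A X m)"
    and f: "f \<in> Homs A V (xpow A X n)" and f': "f' \<in> Homs A V (xpow A X n)"
  shows "\<exists>g \<in> carrier (AutG A (xpow A X n)). g \<bullet> f = f'"
proof -
  have split: "\<exists>C e. C \<in> Ob A \<and> e \<in> Homs A (V \<box> C) (xpow A X n) \<and> iso_arr A e \<and> e \<bullet> inl_arr A V C = f"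
    if "f \<in> Homs A V (xpow A X n)" for f
  proof -
    have m: "monic A f" "Cod A f = xpow A X n" "Dom A f = V" using all_monic[OF HomsD(1)[OF that]] HomsD(2,3)[OF that] by auto
    obtain j where j: "monic A j" "is_complement A f j" using complement_exists[OF m(1,2)] by blast
    have "Dom A j \<in> Ob A" using j(1) Dom_Ob by (auto simp: monic_def)
    moreover obtain e where "e \<in> Homs A (V \<box> Dom A j) (xpow A X n)" "iso_arr A e"
      "e \<bullet> inl_arr A V (Dom A j) = f"
      using j(2) unfolding is_complement_def m(2,3) by blast
    ultimately show ?thesis by blast
  qed
  obtain C e where C: "C \<in> Ob A" and e: "e \<in> Homs A (V \<box> C) (xpow A X n)" "iso_arr A e"
    and ef: "e \<bullet> inl_arr A V C = f" using split[OF f] by blast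
  obtain C' e' where C': "C' \<in> Ob A" and e': "e' \<in> Homs A (V \<box> C') (xpow A X n)" "iso_arr A e'"
    and ef': "e' \<bullet> inl_arr A V C' = f'" using split[OF f'] by blast
  have add: "isomorphic_obs A (xpow A X m \<box> xpow A X c) (xpow A X (m + c))" for c
  proof (induction c)
    case 0
    show ?case using runit[OF xpow_Ob] unfolding isomorphic_obs_def by auto
  next
    case (Suc c)
    have "isomorphic_obs A ((xpow A X m \<box> xpow A X c) \<box> X) (xpow A X m \<box> (xpow A X c \<box> X))"
      unfolding isomorphic_obs_def using assoc[OF xpow_Ob xpow_Ob X_Ob] by blast
    moreover have "isomorphic_obs A ((xpow A X m \<box> xpow A X c) \<box> X) (xpow A X (m + c) \<box> X)"
    proof (rule isomorphic_obs_TOb[OF Suc])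
      show "isomorphic_obs A X X"
        unfolding isomorphic_obs_def using iso_Id[OF X_Ob] Id_Homs[OF X_Ob] by blast
    qed
    ultimately have "isomorphic_obs A (xpow A X m \<box> (xpow A X c \<box> X)) (xpow A X (m + c) \<box> X)"
      by (rule isomorphic_obs_trans[OF isomorphic_obs_sym])
    then show ?case by simp
  qed
  have size: "\<exists>c. isomorphic_obs A C (xpow A X c) \<and> m + c = n"
    if C: "C \<in> Ob A" and e: "e \<in> Homs A (V \<box> C) (xpow A X n)" "iso_arr A e" for C e
  proof -
    obtain c where c: "isomorphic_obs A C (xpow A X c)" using ex1_implies_ex[OF generator[OF C]] ..
    have "isomorphic_obs A (V \<box> C) (xpow A X (m + c))"
      by (rule isomorphic_obs_trans[OF isomorphic_obs_TOb[OF V c] add])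
    moreover have "isomorphic_obs A (V \<box> C) (xpow A X n)" using e unfolding isomorphic_obs_def by blast
    moreover note generator[OF Homs_Ob(1)[OF e(1)]]
    ultimately have "m + c = n" by (metis (no_types, lifting))
    then show ?thesis using c by blast
  qed
  obtain c where c: "isomorphic_obs A C (xpow A X c)" "m + c = n" using size[OF C e] by blast
  obtain c' where c': "isomorphic_obs A C' (xpow A X c')" "m + c' = n" using size[OF C' e'] by blast
  have "c' = c" using c(2) c'(2) by simp
  then have "isomorphic_obs A C C'"
    using c'(1) isomorphic_obs_trans[OF c(1) isomorphic_obs_sym[of C']] by simp
  then obtain \<theta> where \<theta>: "\<theta> \<in> Homs A C C'" "iso_arr A \<theta>" unfolding isomorphic_obs_def by blast
  note VO = Homs_Ob(1)[OF f]
  note iV = Id_Homs[OF VO] and ie = inv_arr[OF e]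
  have t: "Id A V \<star> \<theta> \<in> Homs A (V \<box> C) (V \<box> C')" "iso_arr A (Id A V \<star> \<theta>)"
    using TArr_Homs[OF iV \<theta>(1)] iso_TArr[OF iV iso_Id[OF VO] \<theta>] by auto
  let ?k = "e' \<bullet> (Id A V \<star> \<theta>)"
  have k: "?k \<in> Homs A (V \<box> C) (xpow A X n)" "iso_arr A ?k"
    using Comp_Homs[OF t(1) e'(1)] iso_Comp[OF t e'] by auto
  have g: "?k \<bullet> inv_arr A e \<in> carrier (AutG A (xpow A X n))"
    using Comp_Homs[OF ie(1) k(1)] iso_Comp[OF ie(1,4) k] by (simp add: AutG_carrier)
  have "(?k \<bullet> inv_arr A e) \<bullet> f = ?k \<bullet> (inv_arr A e \<bullet> (e \<bullet> inl_arr A V C))"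
    using Comp_assoc[OF f ie(1) k(1)] ef by simp
  also have "\<dots> = ?k \<bullet> inl_arr A V C" using inv_comp_cancel[OF e inl_arr[OF VO C]] by simp
  also have "\<dots> = e' \<bullet> ((Id A V \<star> \<theta>) \<bullet> inl_arr A V C)"
    by (rule Comp_assoc[OF inl_arr[OF VO C] t(1) e'(1)])
  also have "\<dots> = f'"
    using inl_natural[OF iV \<theta>(1)] Comp_Id[OF inl_arr[OF VO C']] ef' by simp
  finally show ?thesis using g by blast
qed

text \<open>
  The automorphism \<open>g\<close> maps the complement \<open>C\<close> of \<open>U\<close> to a complement of \<open>U\<close>, hence to the same
  subobject.  So \<open>g\<close> restricts to an automorphism of \<open>C\<close>, and \<open>g\<close> is determined by its restrictions to
  \<open>U\<close> and \<open>C\<close>.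
\<close>

lemma stabilizer:
  assumes U: "U \<in> Ob A" and C: "C \<in> Ob A" and e: "e \<in> Homs A (U \<box> C) W" "iso_arr A e"
    and g: "g \<in> carrier (AutG A W)" and fixed: "g \<bullet> (e \<bullet> inl_arr A U C) = e \<bullet> inl_arr A U C"
  shows "\<exists>f \<in> carrier (AutG A C). g = e \<bullet> (Id A U \<star> f) \<bullet> inv_arr A e"
proof -
  have g: "g \<in> Homs A W W" "iso_arr A g" using g by (auto simp: AutG_carrier)
  note l = inl_arr[OF U C] and r = inr_arr[OF U C]
  note i = Comp_Homs[OF l e(1)] and j = Comp_Homs[OF r e(1)]
  note ge = Comp_Homs[OF e(1) g(1)] iso_Comp[OF e g] and gj = Comp_Homs[OF j g(1)]
  have 1: "is_complement A (e \<bullet> inl_arr A U C) (e \<bullet> inr_arr A U C)"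
    unfolding is_complement_def HomsD(2,3)[OF i] HomsD(2)[OF j] using e by blast
  have "(g \<bullet> e) \<bullet> inl_arr A U C = e \<bullet> inl_arr A U C" using Comp_assoc[OF l e(1) g(1)] fixed by simp
  moreover have "(g \<bullet> e) \<bullet> inr_arr A U C = g \<bullet> (e \<bullet> inr_arr A U C)" by (rule Comp_assoc[OF r e(1) g(1)])
  ultimately have 2: "is_complement A (e \<bullet> inl_arr A U C) (g \<bullet> (e \<bullet> inr_arr A U C))"
    unfolding is_complement_def HomsD(2,3)[OF i] HomsD(2)[OF gj] using ge by blast
  have "same_subobject A (e \<bullet> inr_arr A U C) (g \<bullet> (e \<bullet> inr_arr A U C))"
    by (rule complement_unique[OF all_monic[OF HomsD(1)[OF i]] HomsD(3)[OF i] all_monic[OF HomsD(1)[OF j]]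
          HomsD(3)[OF j] all_monic[OF HomsD(1)[OF gj]] HomsD(3)[OF gj] 1 2])
  then obtain k where k: "k \<in> Homs A C C" "iso_arr A k"
    and kj: "(g \<bullet> (e \<bullet> inr_arr A U C)) \<bullet> k = e \<bullet> inr_arr A U C"
    unfolding same_subobject_def HomsD(2)[OF j] HomsD(2)[OF gj] by blast
  let ?f = "inv_arr A k"
  note f = inv_arr[OF k]
  note iU = Id_Homs[OF U] and tf = TArr_Homs[OF Id_Homs[OF U] f(1)]
  have gjf: "g \<bullet> (e \<bullet> inr_arr A U C) = (e \<bullet> inr_arr A U C) \<bullet> ?f"
    using comp_comp_inv_cancel[OF k gj] kj by simp
  have "g \<bullet> e = e \<bullet> (Id A U \<star> ?f)"
  proof (rule TOb_eqI[OF U C ge(1) Comp_Homs[OF tf e(1)]])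
    have "(e \<bullet> (Id A U \<star> ?f)) \<bullet> inl_arr A U C = e \<bullet> (inl_arr A U C \<bullet> Id A U)"
      using Comp_assoc[OF l tf e(1)] inl_natural[OF iU f(1)] by simp
    then show "(g \<bullet> e) \<bullet> inl_arr A U C = (e \<bullet> (Id A U \<star> ?f)) \<bullet> inl_arr A U C"
      using Comp_assoc[OF l e(1) g(1)] fixed Comp_Id[OF l] by simp
    have "(e \<bullet> (Id A U \<star> ?f)) \<bullet> inr_arr A U C = e \<bullet> (inr_arr A U C \<bullet> ?f)"
      using Comp_assoc[OF r tf e(1)] inr_natural[OF iU f(1)] by simp
    also have "\<dots> = (e \<bullet> inr_arr A U C) \<bullet> ?f" using Comp_assoc[OF f(1) r e(1)] by simp
    finally show "(g \<bullet> e) \<bullet> inr_arr A U C = (e \<bullet> (Id A U \<star> ?f)) \<bullet> inr_arr A U C"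
      using Comp_assoc[OF r e(1) g(1)] gjf by simp
  qed
  then have "g = e \<bullet> (Id A U \<star> ?f) \<bullet> inv_arr A e" using comp_comp_inv_cancel[OF e g(1)] by simp
  then show ?thesis using f by (auto simp: AutG_carrier)
qed

text \<open>
  The isomorphism \<open>X\<^sup>m \<box> X\<^sup>l \<rightarrow> X\<^sup>m\<^sup>+\<^sup>l\<close>.  The last factor is split off first, as in the definition of the
  powers; this makes it strictly compatible with adding a factor \<open>X\<close> on the right.
\<close>

primrec pow_sum :: "nat \<Rightarrow> nat \<Rightarrow> 'a"
  where "pow_sum m 0 = Runit A (xpow A X m)"
  | "pow_sum m (Suc l) = (pow_sum m l \<star> Id A X) \<bullet> inv_arr A (Assoc A (xpow A X m) (xpow A X l) X)"

lemma pow_sum: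
  "pow_sum m l \<in> Homs A (xpow A X m \<box> xpow A X l) (xpow A X (m + l)) \<and> iso_arr A (pow_sum m l)"
proof (induction l)
  case 0
  show ?case using runit[OF xpow_Ob] by simp
next
  case (Suc l)
  note s = conjunct1[OF Suc] conjunct2[OF Suc]
  note iX = Id_Homs[OF X_Ob] iso_Id[OF X_Ob]
  note a = inv_arr[OF assoc[OF xpow_Ob[of m] xpow_Ob[of l] X_Ob]]
  note t = TArr_Homs[OF s(1) iX(1)] iso_TArr[OF s iX]
  show ?case using Comp_Homs[OF a(1) t(1)] iso_Comp[OF a(1,4) t] by simp
qed

text \<open>
  The canonical morphism \<open>X\<^sup>m \<rightarrow> X\<^sup>m\<^sup>+\<^sup>l\<close>, and the embedding of \<open>Aut(X\<^sup>l)\<close> into \<open>Aut(X\<^sup>m\<^sup>+\<^sup>l)\<close> whose image is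
  the stabilizer of that morphism.
\<close>

definition base_arr :: "nat \<Rightarrow> nat \<Rightarrow> 'a"
  where "base_arr m l = pow_sum m l \<bullet> inl_arr A (xpow A X m) (xpow A X l)"

definition conj_arr :: "nat \<Rightarrow> nat \<Rightarrow> 'a \<Rightarrow> 'a"
  where "conj_arr m l f = pow_sum m l \<bullet> (Id A (xpow A X m) \<star> f) \<bullet> inv_arr A (pow_sum m l)"

lemma base_arr: "base_arr m l \<in> Homs A (xpow A X m) (xpow A X (m + l))"
  unfolding base_arr_def by (rule Comp_Homs[OF inl_arr[OF xpow_Ob xpow_Ob] conjunct1[OF pow_sum]])

lemma base_arr_Suc: "inl_arr A (xpow A X (m + l)) X \<bullet> base_arr m l = base_arr m (Suc l)"
proof -
  let ?M = "xpow A X m" and ?L = "xpow A X l"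
  note M = xpow_Ob[of m] and L = xpow_Ob[of l] and iX = Id_Homs[OF X_Ob]
  note s = pow_sum[of m l, THEN conjunct1] and l = inl_arr[OF M L]
  note MxL = TOb_Ob[OF M L]
  note a = assoc[OF M L X_Ob]
  note l2 = inl_arr[OF MxL X_Ob]
  have "inl_arr A (xpow A X (m + l)) X \<bullet> base_arr m l = (inl_arr A (xpow A X (m + l)) X \<bullet> pow_sum m l) \<bullet> inl_arr A ?M ?L"
    unfolding base_arr_def using Comp_assoc[OF l s inl_arr[OF xpow_Ob X_Ob]] by simp
  also have "\<dots> = ((pow_sum m l \<star> Id A X) \<bullet> inl_arr A (?M \<box> ?L) X) \<bullet> inl_arr A ?M ?L"
    using inl_natural[OF s iX] by simp
  also have "\<dots> = (pow_sum m l \<star> Id A X) \<bullet> (inl_arr A (?M \<box> ?L) X \<bullet> inl_arr A ?M ?L)"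
    by (rule Comp_assoc[OF l l2 TArr_Homs[OF s iX]])
  also have "inl_arr A (?M \<box> ?L) X \<bullet> inl_arr A ?M ?L = inv_arr A (Assoc A ?M ?L X) \<bullet> inl_arr A ?M (?L \<box> X)"
    using inv_comp_cancel[OF a Comp_Homs[OF l l2]] assoc_inl_inl[OF M L X_Ob] by simp
  also have "(pow_sum m l \<star> Id A X) \<bullet> \<dots> = base_arr m (Suc l)"
    unfolding base_arr_def
    using Comp_assoc[OF inl_arr[OF M TOb_Ob[OF L X_Ob]] inv_arr(1)[OF a] TArr_Homs[OF s iX]] by simp
  finally show ?thesis .
qed

lemma conj_arr:
  assumes "f \<in> carrier (AutG A (xpow A X l))"
  shows "conj_arr m l f \<in> Homs A (xpow A X (m + l)) (xpow A X (m + l))" "iso_arr A (conj_arr m l f)"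
    "conj_arr m l f \<bullet> pow_sum m l = pow_sum m l \<bullet> (Id A (xpow A X m) \<star> f)"
proof -
  have f: "f \<in> Homs A (xpow A X l) (xpow A X l)" "iso_arr A f" using assms by (auto simp: AutG_carrier)
  note s = conjunct1[OF pow_sum[of m l]] conjunct2[OF pow_sum[of m l]]
  note i = Id_Homs[OF xpow_Ob[of m]] iso_Id[OF xpow_Ob[of m]]
  note t = TArr_Homs[OF i(1) f(1)] iso_TArr[OF i f]
  note st = Comp_Homs[OF t(1) s(1)] iso_Comp[OF t s]
  note si = inv_arr[OF s]
  show "conj_arr m l f \<in> Homs A (xpow A X (m + l)) (xpow A X (m + l))" "iso_arr A (conj_arr m l f)"
    unfolding conj_arr_def using Comp_Homs[OF si(1) st(1)] iso_Comp[OF si(1,4) st] by auto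
  show "conj_arr m l f \<bullet> pow_sum m l = pow_sum m l \<bullet> (Id A (xpow A X m) \<star> f)"
    unfolding conj_arr_def by (rule comp_inv_cancel'[OF s st(1)])
qed

lemma conj_arr_hom: "conj_arr m l \<in> hom (AutG A (xpow A X l)) (AutG A (xpow A X (m + l)))"
proof (rule homI)
  fix f assume f: "f \<in> carrier (AutG A (xpow A X l))"
  show "conj_arr m l f \<in> carrier (AutG A (xpow A X (m + l)))"
    using conj_arr(1,2)[OF f] by (simp add: AutG_carrier)
  fix g assume g: "g \<in> carrier (AutG A (xpow A X l))"
  have fH: "f \<in> Homs A (xpow A X l) (xpow A X l)" and gH: "g \<in> Homs A (xpow A X l) (xpow A X l)"
    using f g by (auto simp: AutG_carrier)
  have fg: "f \<bullet> g \<in> carrier (AutG A (xpow A X l))"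
    using group.is_monoid[OF AutG_group[OF xpow_Ob[of l]]] monoid.m_closed f g by (metis AutG_mult)
  note s = conjunct1[OF pow_sum[of m l]] conjunct2[OF pow_sum[of m l]]
  note i = Id_Homs[OF xpow_Ob[of m]]
  note cf = conj_arr[OF f, where m = m] and cg = conj_arr[OF g, where m = m] and cfg = conj_arr[OF fg, where m = m]
  have "conj_arr m l (f \<bullet> g) = conj_arr m l f \<bullet> conj_arr m l g"
  proof (rule iso_right_cancel[OF s cfg(1) Comp_Homs[OF cg(1) cf(1)]])
    have "(conj_arr m l f \<bullet> conj_arr m l g) \<bullet> pow_sum m l = conj_arr m l f \<bullet> (pow_sum m l \<bullet> (Id A (xpow A X m) \<star> g))"
      using Comp_assoc[OF s(1) cg(1) cf(1)] cg(3) by simp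
    also have "\<dots> = (pow_sum m l \<bullet> (Id A (xpow A X m) \<star> f)) \<bullet> (Id A (xpow A X m) \<star> g)"
      using Comp_assoc[OF TArr_Homs[OF i gH] s(1) cf(1)] cf(3) by simp
    also have "\<dots> = pow_sum m l \<bullet> (Id A (xpow A X m) \<star> (f \<bullet> g))"
      using Comp_assoc[OF TArr_Homs[OF i gH] TArr_Homs[OF i fH] s(1)] Id_TArr_Comp[OF gH fH xpow_Ob] by simp
    finally show "conj_arr m l (f \<bullet> g) \<bullet> pow_sum m l = (conj_arr m l f \<bullet> conj_arr m l g) \<bullet> pow_sum m l"
      using cfg(3) by simp
  qed
  then show "conj_arr m l (f \<otimes>\<^bsub>AutG A (xpow A X l)\<^esub> g) =
      conj_arr m l f \<otimes>\<^bsub>AutG A (xpow A X (m + l))\<^esub> conj_arr m l g"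
    by (simp add: AutG_mult)
qed

lemma conj_arr_inj: "inj_on (conj_arr m l) (carrier (AutG A (xpow A X l)))"
proof (rule inj_onI)
  fix f g assume f: "f \<in> carrier (AutG A (xpow A X l))" and g: "g \<in> carrier (AutG A (xpow A X l))"
    and eq: "conj_arr m l f = conj_arr m l g"
  have fH: "f \<in> Homs A (xpow A X l) (xpow A X l)" and gH: "g \<in> Homs A (xpow A X l) (xpow A X l)"
    using f g by (auto simp: AutG_carrier)
  let ?M = "xpow A X m" and ?L = "xpow A X l"
  note s = conjunct1[OF pow_sum[of m l]] conjunct2[OF pow_sum[of m l]]
  note i = Id_Homs[OF xpow_Ob[of m]] and r = inr_arr[OF xpow_Ob[of m] xpow_Ob[of l]]
  have "Id A ?M \<star> f = Id A ?M \<star> g"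
    by (rule iso_left_cancel[OF s TArr_Homs[OF i fH] TArr_Homs[OF i gH]])
      (use conj_arr(3)[OF f, where m = m] conj_arr(3)[OF g, where m = m] eq in simp)
  then have e: "inr_arr A ?M ?L \<bullet> f = inr_arr A ?M ?L \<bullet> g"
    using inr_natural[OF i fH] inr_natural[OF i gH] by simp
  have "monic A (inr_arr A ?M ?L)" by (rule all_monic[OF HomsD(1)[OF r]])
  then show "f = g" unfolding monic_def HomsD(2)[OF r] using fH gH e by blast
qed

lemma conj_arr_base:
  assumes "f \<in> carrier (AutG A (xpow A X l))"
  shows "conj_arr m l f \<bullet> base_arr m l = base_arr m l"
proof -
  let ?M = "xpow A X m" and ?L = "xpow A X l"
  have f: "f \<in> Homs A ?L ?L" using assms by (auto simp: AutG_carrier)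
  note s = pow_sum[of m l, THEN conjunct1] and i = Id_Homs[OF xpow_Ob[of m]]
    and l = inl_arr[OF xpow_Ob[of m] xpow_Ob[of l]] and c = conj_arr[OF assms, where m = m]
  have "conj_arr m l f \<bullet> base_arr m l = (pow_sum m l \<bullet> (Id A ?M \<star> f)) \<bullet> inl_arr A ?M ?L"
    unfolding base_arr_def using Comp_assoc[OF l s c(1)] c(3) by simp
  also have "\<dots> = pow_sum m l \<bullet> (inl_arr A ?M ?L \<bullet> Id A ?M)"
    using Comp_assoc[OF l TArr_Homs[OF i f] s] inl_natural[OF i f] by simp
  finally show ?thesis unfolding base_arr_def Comp_Id[OF l] .
qed

lemma conj_arr_image:
  "conj_arr m l ` carrier (AutG A (xpow A X l)) =
    {g \<in> carrier (AutG A (xpow A X (m + l))). g \<bullet> base_arr m l = base_arr m l}"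
proof
  show "conj_arr m l ` carrier (AutG A (xpow A X l)) \<subseteq>
      {g \<in> carrier (AutG A (xpow A X (m + l))). g \<bullet> base_arr m l = base_arr m l}"
    using conj_arr(1,2) conj_arr_base by (auto simp: AutG_carrier)
  show "{g \<in> carrier (AutG A (xpow A X (m + l))). g \<bullet> base_arr m l = base_arr m l} \<subseteq>
      conj_arr m l ` carrier (AutG A (xpow A X l))"
  proof
    fix g assume "g \<in> {g \<in> carrier (AutG A (xpow A X (m + l))). g \<bullet> base_arr m l = base_arr m l}"
    then have g: "g \<in> carrier (AutG A (xpow A X (m + l)))" "g \<bullet> base_arr m l = base_arr m l" by auto
    obtain f where "f \<in> carrier (AutG A (xpow A X l))"
      "g = pow_sum m l \<bullet> (Id A (xpow A X m) \<star> f) \<bullet> inv_arr A (pow_sum m l)"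
      using stabilizer[OF xpow_Ob xpow_Ob pow_sum[THEN conjunct1] pow_sum[THEN conjunct2] g(1)] g(2)
      unfolding base_arr_def by blast
    then show "g \<in> conj_arr m l ` carrier (AutG A (xpow A X l))" unfolding conj_arr_def by blast
  qed
qed

text \<open>
  Naturality of the associator, since \<open>pow_sum m (Suc l)\<close> is \<open>pow_sum m l \<star> id\<close> after the inverse of an
  associator.
\<close>

lemma conj_arr_stab:
  assumes "f \<in> carrier (AutG A (xpow A X l))"
  shows "conj_arr m (Suc l) (stab_hom A X f) = stab_hom A X (conj_arr m l f)"
proof -
  let ?M = "xpow A X m" and ?L = "xpow A X l"
  have f: "f \<in> Homs A ?L ?L" using assms by (auto simp: AutG_carrier)
  note M = xpow_Ob[of m] and L = xpow_Ob[of l] and iX = Id_Homs[OF X_Ob] and i = Id_Homs[OF xpow_Ob[of m]]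
  note a = assoc[OF M L X_Ob] and ai = inv_arr[OF assoc[OF M L X_Ob]]
  note s = pow_sum[of m l, THEN conjunct1] and s' = pow_sum[of m "Suc l", THEN conjunct1] pow_sum[of m "Suc l", THEN conjunct2]
  note c = conj_arr[OF assms, where m = m]
  have sf: "stab_hom A X f \<in> carrier (AutG A (xpow A X (Suc l)))"
    using hom_in_carrier[OF stab_hom_hom[OF L X_Ob] assms] by simp
  note c' = conj_arr[OF sf, where m = m]
  note t1 = TArr_Homs[OF TArr_Homs[OF i f] iX] and t2 = TArr_Homs[OF i TArr_Homs[OF f iX]]
  have nat: "inv_arr A (Assoc A ?M ?L X) \<bullet> (Id A ?M \<star> (f \<star> Id A X)) = ((Id A ?M \<star> f) \<star> Id A X) \<bullet> inv_arr A (Assoc A ?M ?L X)"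
  proof -
    have "inv_arr A (Assoc A ?M ?L X) \<bullet> (Id A ?M \<star> (f \<star> Id A X)) =
        ((inv_arr A (Assoc A ?M ?L X) \<bullet> (Id A ?M \<star> (f \<star> Id A X))) \<bullet> Assoc A ?M ?L X) \<bullet> inv_arr A (Assoc A ?M ?L X)"
      using comp_comp_inv_cancel[OF a Comp_Homs[OF t2 ai(1)]] by simp
    also have "(inv_arr A (Assoc A ?M ?L X) \<bullet> (Id A ?M \<star> (f \<star> Id A X))) \<bullet> Assoc A ?M ?L X =
        inv_arr A (Assoc A ?M ?L X) \<bullet> (Assoc A ?M ?L X \<bullet> ((Id A ?M \<star> f) \<star> Id A X))"
      using Comp_assoc[OF a(1) t2 ai(1)] Assoc_natural[OF i f iX] by simp
    also have "\<dots> = (Id A ?M \<star> f) \<star> Id A X" by (rule inv_comp_cancel[OF a t1])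
    finally show ?thesis .
  qed
  have cH: "stab_hom A X (conj_arr m l f) \<in> Homs A (xpow A X (m + Suc l)) (xpow A X (m + Suc l))"
    unfolding stab_hom_def using TArr_Homs[OF c(1) iX] by simp
  show ?thesis
  proof (rule iso_right_cancel[OF s' c'(1) cH])
    let ?p = "pow_sum m l \<star> Id A X" and ?i = "inv_arr A (Assoc A ?M ?L X)"
    note p = TArr_Homs[OF s iX]
    note cX = TArr_Homs[OF c(1) iX]
    have "conj_arr m (Suc l) (stab_hom A X f) \<bullet> pow_sum m (Suc l) = (?p \<bullet> ?i) \<bullet> (Id A ?M \<star> (f \<star> Id A X))"
      using c'(3) by (simp add: stab_hom_def)
    also have "\<dots> = ?p \<bullet> (((Id A ?M \<star> f) \<star> Id A X) \<bullet> ?i)"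
      using Comp_assoc[OF t2 ai(1) p] nat by simp
    also have "\<dots> = (?p \<bullet> ((Id A ?M \<star> f) \<star> Id A X)) \<bullet> ?i"
      using Comp_assoc[OF ai(1) t1 p] by simp
    also have "?p \<bullet> ((Id A ?M \<star> f) \<star> Id A X) = (conj_arr m l f \<star> Id A X) \<bullet> ?p"
      using TArr_Comp_Id[OF TArr_Homs[OF i f] s X_Ob] TArr_Comp_Id[OF s c(1) X_Ob] c(3) by simp
    also have "\<dots> \<bullet> ?i = (conj_arr m l f \<star> Id A X) \<bullet> (?p \<bullet> ?i)"
      by (rule Comp_assoc[OF ai(1) p cX])
    finally show "conj_arr m (Suc l) (stab_hom A X f) \<bullet> pow_sum m (Suc l) =
        stab_hom A X (conj_arr m l f) \<bullet> pow_sum m (Suc l)"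
      by (simp add: stab_hom_def)
  qed
qed

end

section \<open>Squares and short exact sequences of coefficients\<close>

text \<open>Squares of compatible group homomorphisms and maps of coefficients.\<close>

locale rep_square =
  g: rep_map G1 K M1 a1 G2 M2 a2 \<phi>g \<psi>g + f: rep_map G3 K M3 a3 G4 M4 a4 \<phi>f \<psi>f +
  \<alpha>: rep_map G1 K M1 a1 G3 M3 a3 \<phi>\<alpha> \<psi>\<alpha> + \<beta>: rep_map G2 K M2 a2 G4 M4 a4 \<phi>\<beta> \<psi>\<beta>
  for G1 :: "('g1, 'b1) monoid_scheme" and K :: "('k, 'r) ring_scheme" and M1 :: "('k, 'm1) module" and a1
    and G2 :: "('g2, 'b2) monoid_scheme" and M2 :: "('k, 'm2) module" and a2 and \<phi>g \<psi>g
    and G3 :: "('g3, 'b3) monoid_scheme" and M3 :: "('k, 'm3) module" and a3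
    and G4 :: "('g4, 'b4) monoid_scheme" and M4 :: "('k, 'm4) module" and a4 and \<phi>f \<psi>f \<phi>\<alpha> \<psi>\<alpha> \<phi>\<beta> \<psi>\<beta> +
  assumes groups_commute: "x \<in> carrier G1 \<Longrightarrow> \<phi>f (\<phi>\<alpha> x) = \<phi>\<beta> (\<phi>g x)"
    and coeffs_commute: "m \<in> carrier M1 \<Longrightarrow> \<psi>f (\<psi>\<alpha> m) = \<psi>\<beta> (\<psi>g m)"
begin

lemma chmaps_commute:
  assumes c: "c \<in> carrier g.R.Ch"
  shows "f.chmap (\<alpha>.chmap c) = \<beta>.chmap (g.chmap c)"
proof (rule g.R.Ch_eqI[OF f.R'.Ch.module_axioms linear_map_comp[OF \<alpha>.chmap_linear f.chmap_linear]
      linear_map_comp[OF g.chmap_linear \<beta>.chmap_linear] _ c])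
  fix gs m assume gs: "gs \<in> lists (carrier G1)" and m: "m \<in> carrier M1"
  have "map \<phi>f (map \<phi>\<alpha> gs) = map \<phi>\<beta> (map \<phi>g gs)"
    using gs groups_commute by (auto simp: lists_eq_set)
  then show "f.chmap (\<alpha>.chmap (single M1 gs m)) = \<beta>.chmap (g.chmap (single M1 gs m))"
    by (simp only: \<alpha>.chmap_single[OF gs m] g.chmap_single[OF gs m]
        f.chmap_single[OF \<alpha>.map_lists[OF gs] \<alpha>.coeff_closed[OF m]]
        \<beta>.chmap_single[OF g.map_lists[OF gs] g.coeff_closed[OF m]] coeffs_commute[OF m])
qed

lemma square: "square K g.R.Ch g.R.C g.R.bd g.R'.Ch g.R'.C g.R'.bd f.R.Ch f.R.C f.R.bd f.R'.Ch f.R'.C f.R'.bd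
    g.chmap f.chmap \<alpha>.chmap \<beta>.chmap"
  by (intro square.intro square_axioms.intro g.chain_map f.chain_map \<alpha>.chain_map \<beta>.chain_map chmaps_commute)

sublocale Q: square K g.R.Ch g.R.C g.R.bd g.R'.Ch g.R'.C g.R'.bd f.R.Ch f.R.C f.R.bd f.R'.Ch f.R'.C f.R'.bd
    g.chmap f.chmap \<alpha>.chmap \<beta>.chmap
  by (rule square)

end

locale coeff_map = rep_map G K M act G M' act' "\<lambda>x. x" \<psi>
  for G :: "('g, 'b) monoid_scheme" and K :: "('k, 'r) ring_scheme" and M :: "('k, 'm) module" and act
    and M' :: "('k, 'n) module" and act' and \<psi>
begin

lemma chmap_apply:
  assumes c: "c \<in> carrier R.Ch"
  shows "chmap c gs = \<psi> (c gs)"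
proof (rule R.Ch_eqI[where f = "\<lambda>c. chmap c gs" and f' = "\<lambda>c. \<psi> (c gs)", OF R'.mod _ _ _ c])
  have ev: "linear_map K R.Ch M (\<lambda>c. c gs)" unfolding R.Ch_def by (rule linear_map_eval[OF R.mod])
  have ev': "linear_map K R'.Ch M' (\<lambda>c. c gs)" unfolding R'.Ch_def by (rule linear_map_eval[OF R'.mod])
  show "linear_map K R.Ch M' (\<lambda>c. chmap c gs)" by (rule linear_map_comp[OF chmap_linear ev'])
  show "linear_map K R.Ch M' (\<lambda>c. \<psi> (c gs))" by (rule linear_map_comp[OF ev lin])
  show "chmap (single M hs m) gs = \<psi> (single M hs m gs)" if "hs \<in> lists (carrier G)" "m \<in> carrier M" for hs m
    using chmap_single[OF that] linear_map_zero[OF R.mod R'.mod lin] by (simp add: single_def)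
qed

lemma chmap_surj:
  assumes s: "\<psi> ` carrier M = carrier M'" and z: "z \<in> R'.C n"
  shows "\<exists>x \<in> R.C n. chmap x = z"
proof -
  have z': "\<And>gs. z gs \<in> carrier M'" "finite {gs. z gs \<noteq> \<zero>\<^bsub>M'\<^esub>}" "\<And>gs. z gs \<noteq> \<zero>\<^bsub>M'\<^esub> \<Longrightarrow> gs \<in> R.deg n"
    using z by (auto simp: R'.C_def in_fsupp)
  \<comment> \<open>Zero has to be lifted to zero for the support to stay finite.\<close>
  define x where "x = (\<lambda>gs. if z gs = \<zero>\<^bsub>M'\<^esub> then \<zero>\<^bsub>M\<^esub> else (SOME m. m \<in> carrier M \<and> \<psi> m = z gs))"
  have ex: "\<exists>m. m \<in> carrier M \<and> \<psi> m = z gs" for gs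
  proof -
    have "z gs \<in> \<psi> ` carrier M" using z'(1)[of gs] by (simp only: s)
    then show ?thesis by auto
  qed
  have x1: "x gs \<in> carrier M \<and> \<psi> (x gs) = z gs" for gs
    using someI_ex[OF ex[of gs]] linear_map_zero[OF R.mod R'.mod lin] by (simp add: x_def)
  have "finite {gs. x gs \<noteq> \<zero>\<^bsub>M\<^esub>}"
    by (rule finite_subset[OF _ z'(2)]) (auto simp: x_def)
  moreover have "x gs \<noteq> \<zero>\<^bsub>M\<^esub> \<Longrightarrow> gs \<in> R.deg n" for gs using z'(3)[of gs] by (cases "z gs = \<zero>\<^bsub>M'\<^esub>") (simp_all add: x_def)
  ultimately have x2: "x \<in> R.C n" using x1 by (auto simp: R.C_def in_fsupp)
  have "chmap x = z" using chmap_apply[of x] x1 x2 R.C_Ch by (intro ext) auto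
  then show ?thesis using x2 by blast
qed

end

lemma rel_exact_cong:
  assumes d: "\<And>k x. x \<in> C k \<Longrightarrow> d x = e x" and d': "\<And>k y. y \<in> C' k \<Longrightarrow> d' y = e' y"
    and f: "\<And>k x. x \<in> C k \<Longrightarrow> f x = g x"
    and z: "\<zero>\<^bsub>T\<^esub> = \<zero>\<^bsub>U\<^esub>" and p: "\<And>x y. x \<oplus>\<^bsub>T'\<^esub> y = x \<oplus>\<^bsub>U'\<^esub> y"
  shows "rel_exact T C d T' C' d' f n \<longleftrightarrow> rel_exact U C e U' C' e' g n"
  unfolding rel_exact_def z p by (simp add: d d' f cong: ball_cong bex_cong)

text \<open>
  The kernels are given by their carriers \<open>N1\<close> and \<open>N2\<close>, with the operations and the actions of the
  modules that contain them.  The chains with coefficients in the kernel are then literally a subset of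
  the chains with coefficients in the whole module.
\<close>

locale rep_ses =
  rep_square G1 K M1 a1 G2 M2 a2 \<phi> \<psi>g G1 M3 a3 G2 M4 a4 \<phi> \<psi>f "\<lambda>x. x" \<psi>\<alpha> "\<lambda>x. x" \<psi>\<beta> +
  n: rep_map G1 K "M1\<lparr>carrier := N1\<rparr>" a1 G2 "M2\<lparr>carrier := N2\<rparr>" a2 \<phi> \<psi>g
  for G1 :: "('g1, 'b1) monoid_scheme" and K :: "('k, 'r) ring_scheme" and M1 :: "('k, 'm1) module" and a1
    and G2 :: "('g2, 'b2) monoid_scheme" and M2 :: "('k, 'm2) module" and a2 and \<phi> \<psi>g
    and M3 :: "('k, 'm3) module" and a3
    and M4 :: "('k, 'm4) module" and a4 and \<psi>f \<psi>\<alpha> \<psi>\<beta> and N1 N2 +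
  assumes surj_\<alpha>: "\<psi>\<alpha> ` carrier M1 = carrier M3" and surj_\<beta>: "\<psi>\<beta> ` carrier M2 = carrier M4"
    and N1: "N1 = {m \<in> carrier M1. \<psi>\<alpha> m = \<zero>\<^bsub>M3\<^esub>}" and N2: "N2 = {m \<in> carrier M2. \<psi>\<beta> m = \<zero>\<^bsub>M4\<^esub>}"
begin

sublocale A: coeff_map G1 K M1 a1 M3 a3 \<psi>\<alpha> ..
sublocale B: coeff_map G2 K M2 a2 M4 a4 \<psi>\<beta> ..

lemma chain_ses: "chain_ses K g.R.Ch g.R.C g.R.bd g.R'.Ch g.R'.C g.R'.bd f.R.Ch f.R.C f.R.bd f.R'.Ch f.R'.C f.R'.bd
    g.chmap f.chmap \<alpha>.chmap \<beta>.chmap"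
proof (intro chain_ses.intro chain_ses_axioms.intro g.chain_map f.chain_map \<alpha>.chain_map \<beta>.chain_map chmaps_commute)
  show "\<exists>x \<in> g.R.C n. \<alpha>.chmap x = z" if "z \<in> f.R.C n" for z n by (rule A.chmap_surj[OF surj_\<alpha> that])
  show "\<exists>x \<in> g.R'.C n. \<beta>.chmap x = z" if "z \<in> f.R'.C n" for z n by (rule B.chmap_surj[OF surj_\<beta> that])
qed

sublocale S: chain_ses K g.R.Ch g.R.C g.R.bd g.R'.Ch g.R'.C g.R'.bd f.R.Ch f.R.C f.R.bd f.R'.Ch f.R'.C f.R'.bd
    g.chmap f.chmap \<alpha>.chmap \<beta>.chmap
  by (rule chain_ses)

lemma incl1: "coeff_map G1 K (M1\<lparr>carrier := N1\<rparr>) a1 M1 a1 (\<lambda>x. x)"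
proof (intro coeff_map.intro rep_map.intro rep_map_axioms.intro n.R.group_rep_axioms g.R.group_rep_axioms)
  show "linear_map K (M1\<lparr>carrier := N1\<rparr>) M1 (\<lambda>x. x)" by (auto simp: linear_map_def N1)
qed (auto simp: hom_def)

lemma incl2: "coeff_map G2 K (M2\<lparr>carrier := N2\<rparr>) a2 M2 a2 (\<lambda>x. x)"
proof (intro coeff_map.intro rep_map.intro rep_map_axioms.intro n.R'.group_rep_axioms g.R'.group_rep_axioms)
  show "linear_map K (M2\<lparr>carrier := N2\<rparr>) M2 (\<lambda>x. x)" by (auto simp: linear_map_def N2)
qed (auto simp: hom_def)

sublocale i: coeff_map G1 K "M1\<lparr>carrier := N1\<rparr>" a1 M1 a1 "\<lambda>x. x" by (rule incl1)
sublocale j: coeff_map G2 K "M2\<lparr>carrier := N2\<rparr>" a2 M2 a2 "\<lambda>x. x" by (rule incl2)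

lemma i_chmap: "c \<in> carrier n.R.Ch \<Longrightarrow> i.chmap c = c" by (rule ext) (rule i.chmap_apply)
lemma j_chmap: "c \<in> carrier n.R'.Ch \<Longrightarrow> j.chmap c = c" by (rule ext) (rule j.chmap_apply)

lemma bd_sub1: "c \<in> carrier n.R.Ch \<Longrightarrow> n.R.bd c = g.R.bd c"
  using i.chmap_bd[of c] by (simp only: i_chmap n.R.bd_closed)

lemma bd_sub2: "c \<in> carrier n.R'.Ch \<Longrightarrow> n.R'.bd c = g.R'.bd c"
  using j.chmap_bd[of c] by (simp only: j_chmap n.R'.bd_closed)

lemma chmap_sub: assumes c: "c \<in> carrier n.R.Ch" shows "n.chmap c = g.chmap c"
proof -
  interpret sq: rep_square G1 K "M1\<lparr>carrier := N1\<rparr>" a1 G2 "M2\<lparr>carrier := N2\<rparr>" a2 \<phi> \<psi>g G1 M1 a1 G2 M2 a2 \<phi> \<psi>g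
      "\<lambda>x. x" "\<lambda>x. x" "\<lambda>x. x" "\<lambda>x. x"
    by (intro rep_square.intro rep_square_axioms.intro n.rep_map_axioms g.rep_map_axioms i.rep_map_axioms j.rep_map_axioms) auto
  show ?thesis using sq.chmaps_commute[OF c] by (simp only: i_chmap[OF c] j_chmap[OF n.chmap_closed[OF c]])
qed

lemma in_N1: "m \<in> N1 \<longleftrightarrow> m \<in> carrier M1 \<and> \<psi>\<alpha> m = \<zero>\<^bsub>M3\<^esub>" by (simp add: N1)
lemma in_N2: "m \<in> N2 \<longleftrightarrow> m \<in> carrier M2 \<and> \<psi>\<beta> m = \<zero>\<^bsub>M4\<^esub>" by (simp add: N2)

lemma kernel1: "S.N k = n.R.C k"
proof -
  have "\<alpha>.chmap x = \<zero>\<^bsub>f.R.Ch\<^esub> \<longleftrightarrow> (\<forall>gs. \<psi>\<alpha> (x gs) = \<zero>\<^bsub>M3\<^esub>)" if "x \<in> g.R.C k" for x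
  proof -
    have "x \<in> carrier g.R.Ch" using that g.R.C_Ch by blast
    note A.chmap_apply[OF this]
    then show ?thesis by (simp add: f.R.Ch_def fun_eq_iff)
  qed
  then show ?thesis
    unfolding S.N_def by (auto simp: n.R.C_def g.R.C_def in_fsupp in_N1)
qed

lemma kernel2: "S.N' k = n.R'.C k"
proof -
  have "\<beta>.chmap x = \<zero>\<^bsub>f.R'.Ch\<^esub> \<longleftrightarrow> (\<forall>gs. \<psi>\<beta> (x gs) = \<zero>\<^bsub>M4\<^esub>)" if "x \<in> g.R'.C k" for x
  proof -
    have "x \<in> carrier g.R'.Ch" using that g.R'.C_Ch by blast
    note B.chmap_apply[OF this]
    then show ?thesis by (simp add: f.R'.Ch_def fun_eq_iff)
  qed
  then show ?thesis
    unfolding S.N'_def by (auto simp: n.R'.C_def g.R'.C_def in_fsupp in_N2)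
qed

lemma sub_exact_iff: "S.sub_exact k \<longleftrightarrow> n.F.exact k"
proof -
  have z: "\<zero>\<^bsub>n.R.Ch\<^esub> = \<zero>\<^bsub>g.R.Ch\<^esub>" by (simp add: n.R.Ch_def g.R.Ch_def)
  have p: "x \<oplus>\<^bsub>n.R'.Ch\<^esub> y = x \<oplus>\<^bsub>g.R'.Ch\<^esub> y" for x y by (simp add: n.R'.Ch_def g.R'.Ch_def)
  have c: "x \<in> n.R.C k \<Longrightarrow> x \<in> carrier n.R.Ch" "y \<in> n.R'.C k \<Longrightarrow> y \<in> carrier n.R'.Ch" for x y k
    using n.R.C_Ch n.R'.C_Ch by blast+
  have "rel_exact g.R.Ch n.R.C g.R.bd g.R'.Ch n.R'.C g.R'.bd g.chmap k \<longleftrightarrow> n.F.exact k"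
    by (rule rel_exact_cong) (simp_all only: bd_sub1 bd_sub2 chmap_sub c z p)
  moreover have "S.N = n.R.C" "S.N' = n.R'.C" using kernel1 kernel2 by (intro ext; simp)+
  ultimately show ?thesis by (simp only:)
qed

theorem quotient_exact_0: "g.F.exact 0 \<Longrightarrow> f.F.exact 0"
  by (rule S.quotient_exact_0)

theorem quotient_exact_Suc: "g.F.exact (Suc k) \<Longrightarrow> n.F.exact k \<Longrightarrow> f.F.exact (Suc k)"
  by (rule S.quotient_exact_Suc) (simp_all only: sub_exact_iff)

theorem extension_exact: "n.F.exact k \<Longrightarrow> f.F.exact k \<Longrightarrow> g.F.exact k"
  by (rule S.extension_exact) (simp_all only: sub_exact_iff)

end

section \<open>Modules over the category\<close>

lemma A_moduleD:
  assumes "A_module A K M"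
  shows "V \<in> Ob A \<Longrightarrow> module K (fib M V)"
    and "f \<in> Homs A U V \<Longrightarrow> linear_map K (fib M U) (fib M V) (mor M f)"
    and "V \<in> Ob A \<Longrightarrow> x \<in> carrier (fib M V) \<Longrightarrow> mor M (Id A V) x = x"
    and "f \<in> Homs A U V \<Longrightarrow> g \<in> Homs A V W \<Longrightarrow> x \<in> carrier (fib M U) \<Longrightarrow>
      mor M (g \<bullet>\<^bsub>A\<^esub> f) x = mor M g (mor M f x)"
  using assms unfolding A_module_def by (auto simp: Homs_def)

text \<open>
  The cone of the stabilization map from \<open>X\<^sup>n\<close> to \<open>X\<^sup>n\<^sup>+\<^sup>1\<close> is exact in degree \<open>q\<close>.  With the shift of
  degrees, this means that the map is surjective on \<open>H\<^sub>q\<close> and injective on homology one degree lower.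
\<close>

definition stab_exact ::
    "('o, 'a) smcat \<Rightarrow> 'o \<Rightarrow> ('o, 'a, 'k, 'm) amod \<Rightarrow> nat \<Rightarrow> nat \<Rightarrow> bool"
  where "stab_exact A X M q n =
    (let G = AutG A (xpow A X n); N = fib M (xpow A X n);
         G' = AutG A (xpow A X (Suc n)); N' = fib M (xpow A X (Suc n)) in
     rel_exact (group_rep.Ch G N) (group_rep.C G N) (group_rep.bd G N (mor M))
       (group_rep.Ch G' N') (group_rep.C G' N') (group_rep.bd G' N' (mor M))
       (rep_map.chmap N G' N' (stab_hom A X) (mor M (inl_arr A (xpow A X n) X))) q)"

definition amod_epi ::
    "('o, 'a) smcat \<Rightarrow> ('k, 'r) ring_scheme \<Rightarrow> ('o, 'a, 'k, 'm) amod \<Rightarrow> ('o, 'a, 'k, 'n) amod \<Rightarrow>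
     ('o \<Rightarrow> 'm \<Rightarrow> 'n) \<Rightarrow> bool"
  where "amod_epi A K P M \<pi> \<longleftrightarrow>
    (\<forall>V \<in> Ob A. linear_map K (fib P V) (fib M V) (\<pi> V) \<and> \<pi> V ` carrier (fib P V) = carrier (fib M V)) \<and>
    (\<forall>U V. \<forall>f \<in> Homs A U V. \<forall>x \<in> carrier (fib P U). \<pi> V (mor P f x) = mor M f (\<pi> U x))"

definition amod_kernel ::
    "('o, 'a, 'k, 'm) amod \<Rightarrow> ('o, 'a, 'k, 'n) amod \<Rightarrow> ('o \<Rightarrow> 'm \<Rightarrow> 'n) \<Rightarrow> 'o \<Rightarrow> 'm set"
  where "amod_kernel P M \<pi> V = {x \<in> carrier (fib P V). \<pi> V x = \<zero>\<^bsub>fib M V\<^esub>}"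

lemma submodule_kernel:
  assumes M: "module K M" and N: "module K N" and f: "linear_map K M N f"
  shows "submodule {x \<in> carrier M. f x = \<zero>\<^bsub>N\<^esub>} K M"
proof -
  interpret M: module K M by (rule M)
  interpret N: module K N by (rule N)
  show ?thesis
    by (rule M.submoduleI)
      (auto simp: linear_map_zero[OF M N f] linear_map_minus[OF M N f] linear_map_add[OF f]
        linear_map_smult[OF f] N.a_inv_zero)
qed

lemma submodule_image:
  assumes M: "module K M" and N: "module K N" and f: "linear_map K M N f"
  shows "submodule (f ` carrier M) K N"
proof -
  interpret M: module K M by (rule M)
  interpret N: module K N by (rule N)
  show ?thesis
  proof (rule N.submoduleI)
    show "f ` carrier M \<subseteq> carrier N" using linear_map_closed[OF f] by blast
    show "\<zero>\<^bsub>N\<^esub> \<in> f ` carrier M"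
      by (rule image_eqI[where x = "\<zero>\<^bsub>M\<^esub>"]) (simp_all add: linear_map_zero[OF M N f])
    show "\<ominus>\<^bsub>N\<^esub> a \<in> f ` carrier M" if a: "a \<in> f ` carrier M" for a
    proof -
      obtain x where "x \<in> carrier M" "a = f x" using a by blast
      then show ?thesis by (intro image_eqI[where x = "\<ominus>\<^bsub>M\<^esub> x"]) (simp_all add: linear_map_minus[OF M N f])
    qed
    show "a \<oplus>\<^bsub>N\<^esub> b \<in> f ` carrier M" if ab: "a \<in> f ` carrier M" "b \<in> f ` carrier M" for a b
    proof -
      obtain x y where "x \<in> carrier M" "a = f x" "y \<in> carrier M" "b = f y" using ab by blast
      then show ?thesis by (intro image_eqI[where x = "x \<oplus>\<^bsub>M\<^esub> y"]) (simp_all add: linear_map_add[OF f])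
    qed
    show "c \<odot>\<^bsub>N\<^esub> a \<in> f ` carrier M" if c: "c \<in> carrier K" and a: "a \<in> f ` carrier M" for c a
    proof -
      obtain x where "x \<in> carrier M" "a = f x" using a by blast
      then show ?thesis using c by (intro image_eqI[where x = "c \<odot>\<^bsub>M\<^esub> x"]) (simp_all add: linear_map_smult[OF f])
    qed
  qed
qed

lemma amod_kernel_submodule:
  assumes cat: "cat A" and P: "A_module A K P" and M: "A_module A K M" and \<pi>: "amod_epi A K P M \<pi>"
  shows "A_submodule A K P (amod_kernel P M \<pi>)"
  unfolding A_submodule_def
proof (intro conjI ballI)
  fix V assume V: "V \<in> Ob A"
  have l: "linear_map K (fib P V) (fib M V) (\<pi> V)" using \<pi> V by (auto simp: amod_epi_def)
  show "submodule (amod_kernel P M \<pi> V) K (fib P V)"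
    unfolding amod_kernel_def
    by (rule submodule_kernel[OF A_moduleD(1)[OF P V] A_moduleD(1)[OF M V] l])
next
  fix f assume "f \<in> Arr A"
  then have f: "f \<in> Homs A (Dom A f) (Cod A f)" by (simp add: Homs_def)
  have V: "Dom A f \<in> Ob A" "Cod A f \<in> Ob A" using cat.Homs_Ob[OF cat f] by auto
  note lP = A_moduleD(2)[OF P f] and lM = A_moduleD(2)[OF M f]
  show "mor P f ` amod_kernel P M \<pi> (Dom A f) \<subseteq> amod_kernel P M \<pi> (Cod A f)"
  proof
    fix y assume "y \<in> mor P f ` amod_kernel P M \<pi> (Dom A f)"
    then obtain x where x: "x \<in> carrier (fib P (Dom A f))" "\<pi> (Dom A f) x = \<zero>\<^bsub>fib M (Dom A f)\<^esub>" "y = mor P f x"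
      by (auto simp: amod_kernel_def)
    have "\<pi> (Cod A f) y = mor M f (\<pi> (Dom A f) x)" using \<pi> f x by (auto simp: amod_epi_def)
    also have "\<dots> = \<zero>\<^bsub>fib M (Cod A f)\<^esub>"
      unfolding x(2) by (rule linear_map_zero[OF A_moduleD(1)[OF M V(1)] A_moduleD(1)[OF M V(2)] lM])
    finally show "y \<in> amod_kernel P M \<pi> (Cod A f)"
      using linear_map_closed[OF lP x(1)] x(3) by (simp add: amod_kernel_def)
  qed
qed

context complemented_cat begin

lemma A_module_rep:
  assumes "A_module A K M" "V \<in> Ob A"
  shows "group_rep (AutG A V) K (fib M V) (mor M)"
  by (rule group_rep.intro)
    (use A_moduleD[OF assms(1)] assms(2) AutG_group[OF assms(2)] in
      \<open>auto simp: AutG_carrier AutG_mult AutG_one\<close>)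

lemma A_module_stab:
  assumes M: "A_module A K M"
  shows "rep_map (AutG A (xpow A X n)) K (fib M (xpow A X n)) (mor M)
    (AutG A (xpow A X (Suc n))) (fib M (xpow A X (Suc n))) (mor M)
    (stab_hom A X) (mor M (inl_arr A (xpow A X n) X))"
proof (intro rep_map.intro rep_map_axioms.intro A_module_rep[OF M] xpow_Ob)
  note i = inl_arr[OF xpow_Ob[of n] X_Ob]
  show "stab_hom A X \<in> hom (AutG A (xpow A X n)) (AutG A (xpow A X (Suc n)))"
    using stab_hom_hom[OF xpow_Ob[of n] X_Ob] by simp
  show "linear_map K (fib M (xpow A X n)) (fib M (xpow A X (Suc n))) (mor M (inl_arr A (xpow A X n) X))"
    using A_moduleD(2)[OF M i] by simp
  fix g m assume g: "g \<in> carrier (AutG A (xpow A X n))" and m: "m \<in> carrier (fib M (xpow A X n))"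
  have gH: "g \<in> Homs A (xpow A X n) (xpow A X n)" using g by (simp add: AutG_carrier)
  note sH = TArr_Homs[OF gH Id_Homs[OF X_Ob]]
  show "mor M (inl_arr A (xpow A X n) X) (mor M g m) =
      mor M (stab_hom A X g) (mor M (inl_arr A (xpow A X n) X) m)"
    using A_moduleD(4)[OF M gH i m] A_moduleD(4)[OF M i sH m] inl_natural[OF gH Id_Homs[OF X_Ob]]
    by (simp add: stab_hom_def)
qed

lemma stab_exact_module_iso:
  assumes M: "A_module A K M" and "stab_exact A X M q n" "stab_exact A X M (Suc q) n"
  shows "module_iso K (H_twisted A X M q n) (H_twisted A X M q (n + 1)) (stab_twisted A X M q n)"
proof -
  interpret s: rep_map "AutG A (xpow A X n)" K "fib M (xpow A X n)" "mor M"
      "AutG A (xpow A X (Suc n))" "fib M (xpow A X (Suc n))" "mor M"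
      "stab_hom A X" "mor M (inl_arr A (xpow A X n) X)"
    by (rule A_module_stab[OF M])
  have "s.F.exact q" "s.F.exact (Suc q)" using assms(2,3) by (simp_all only: stab_exact_def Let_def)
  then have "s.F.hsurj (Suc q) \<and> s.F.hinj (Suc q)" using s.F.exact_hsurj s.F.exact_hinj by blast
  then show ?thesis
    unfolding H_twisted_def stab_twisted_def Suc_eq_plus1[symmetric] by (simp only: s.module_iso_iff)
qed

lemma stab_rep_ses:
  assumes P: "A_module A K P" and M: "A_module A K M" and \<pi>: "amod_epi A K P M \<pi>"
  shows "rep_ses (AutG A (xpow A X n)) K (fib P (xpow A X n)) (mor P)
    (AutG A (xpow A X (Suc n))) (fib P (xpow A X (Suc n))) (mor P)
    (stab_hom A X) (mor P (inl_arr A (xpow A X n) X)) (fib M (xpow A X n)) (mor M)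
    (fib M (xpow A X (Suc n))) (mor M) (mor M (inl_arr A (xpow A X n) X))
    (\<pi> (xpow A X n)) (\<pi> (xpow A X (Suc n)))
    (amod_kernel P M \<pi> (xpow A X n)) (amod_kernel P M \<pi> (xpow A X (Suc n)))"
proof -
  have pr: "\<pi> V ` carrier (fib P V) = carrier (fib M V)" if "V \<in> Ob A" for V
    using \<pi> that by (auto simp: amod_epi_def)
  have nat: "\<pi> V (mor P f x) = mor M f (\<pi> U x)" if "f \<in> Homs A U V" "x \<in> carrier (fib P U)" for U V f x
    using \<pi> that by (auto simp: amod_epi_def)
  have rep: "rep_map (AutG A V) K (fib P V) (mor P) (AutG A V) (fib M V) (mor M) (\<lambda>x. x) (\<pi> V)"
    if V: "V \<in> Ob A" for V
  proof (intro rep_map.intro rep_map_axioms.intro A_module_rep[OF P V] A_module_rep[OF M V])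
    show "linear_map K (fib P V) (fib M V) (\<pi> V)" using \<pi> V by (auto simp: amod_epi_def)
    show "\<pi> V (mor P g m) = mor M g (\<pi> V m)" if "g \<in> carrier (AutG A V)" "m \<in> carrier (fib P V)" for g m
      using nat that by (auto simp: AutG_carrier)
  qed (simp add: hom_def)
  have NM: "A_module A K (restrict_amod P (amod_kernel P M \<pi>))"
    by (rule A_module_restrict[OF P amod_kernel_submodule[OF cat_axioms P M \<pi>] cat_axioms])
  have i: "inl_arr A (xpow A X n) X \<in> Homs A (xpow A X n) (xpow A X (Suc n))"
    using inl_arr[OF xpow_Ob[of n] X_Ob] by simp
  show ?thesis
  proof (intro rep_ses.intro rep_square.intro rep_square_axioms.intro rep_ses_axioms.intro
      A_module_stab[OF P] A_module_stab[OF M] rep xpow_Ob pr)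
    show "rep_map (AutG A (xpow A X n)) K ((fib P (xpow A X n))\<lparr>carrier := amod_kernel P M \<pi> (xpow A X n)\<rparr>) (mor P)
      (AutG A (xpow A X (Suc n))) ((fib P (xpow A X (Suc n)))\<lparr>carrier := amod_kernel P M \<pi> (xpow A X (Suc n))\<rparr>) (mor P)
      (stab_hom A X) (mor P (inl_arr A (xpow A X n) X))"
      using A_module_stab[OF NM, of n] by (simp add: restrict_amod_def)
    show "mor M (inl_arr A (xpow A X n) X) (\<pi> (xpow A X n) m) =
        \<pi> (xpow A X (Suc n)) (mor P (inl_arr A (xpow A X n) X) m)" if "m \<in> carrier (fib P (xpow A X n))" for m
      using nat[OF i that] by simp
  qed (simp_all only: amod_kernel_def)
qed

lemma stab_exact_ses:
  assumes P: "A_module A K P" and M: "A_module A K M" and \<pi>: "amod_epi A K P M \<pi>"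
  shows "stab_exact A X P 0 n \<Longrightarrow> stab_exact A X M 0 n"
    and "stab_exact A X P (Suc q) n \<Longrightarrow> stab_exact A X (restrict_amod P (amod_kernel P M \<pi>)) q n \<Longrightarrow>
      stab_exact A X M (Suc q) n"
    and "stab_exact A X (restrict_amod P (amod_kernel P M \<pi>)) q n \<Longrightarrow> stab_exact A X M q n \<Longrightarrow>
      stab_exact A X P q n"
proof -
  interpret s: rep_ses "AutG A (xpow A X n)" K "fib P (xpow A X n)" "mor P"
    "AutG A (xpow A X (Suc n))" "fib P (xpow A X (Suc n))" "mor P"
    "stab_hom A X" "mor P (inl_arr A (xpow A X n) X)" "fib M (xpow A X n)" "mor M"
    "fib M (xpow A X (Suc n))" "mor M" "mor M (inl_arr A (xpow A X n) X)"
    "\<pi> (xpow A X n)" "\<pi> (xpow A X (Suc n))"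
    "amod_kernel P M \<pi> (xpow A X n)" "amod_kernel P M \<pi> (xpow A X (Suc n))"
    by (rule stab_rep_ses[OF assms])
  have N: "stab_exact A X (restrict_amod P (amod_kernel P M \<pi>)) q n \<longleftrightarrow> s.n.F.exact q" for q
    unfolding stab_exact_def Let_def by (simp add: restrict_amod_def)
  have P': "stab_exact A X P q n \<longleftrightarrow> s.g.F.exact q" for q
    unfolding stab_exact_def Let_def ..
  have M': "stab_exact A X M q n \<longleftrightarrow> s.f.F.exact q" for q
    unfolding stab_exact_def Let_def ..
  show "stab_exact A X P 0 n \<Longrightarrow> stab_exact A X M 0 n"
    unfolding P' M' by (rule s.quotient_exact_0)
  show "stab_exact A X P (Suc q) n \<Longrightarrow> stab_exact A X (restrict_amod P (amod_kernel P M \<pi>)) q n \<Longrightarrow>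
      stab_exact A X M (Suc q) n"
    unfolding P' M' N by (rule s.quotient_exact_Suc)
  show "stab_exact A X (restrict_amod P (amod_kernel P M \<pi>)) q n \<Longrightarrow> stab_exact A X M q n \<Longrightarrow>
      stab_exact A X P q n"
    unfolding P' M' N by (rule s.extension_exact)
qed

end

section \<open>Free modules\<close>

definition free_idx :: "('o, 'a) smcat \<Rightarrow> (nat \<Rightarrow> 'o) \<Rightarrow> nat set \<Rightarrow> 'o \<Rightarrow> (nat \<times> 'a) set"
  where "free_idx A v R W = {(i, h). i \<in> R \<and> h \<in> Homs A (v i) W}"

text \<open>
  The module with one generator at \<open>v i\<close> for each \<open>i\<close> in \<open>R\<close>: its value at \<open>W\<close> is free on the pairs of a
  generator and a morphism to \<open>W\<close>.  The function \<open>mor\<close> is the same for all \<open>R\<close>, so that the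
  module on a subset of the generators is equal to a restriction of the module on all of them.
\<close>

definition free_mod ::
    "('o, 'a) smcat \<Rightarrow> ('k, 'r) ring_scheme \<Rightarrow> (nat \<Rightarrow> 'o) \<Rightarrow> nat set \<Rightarrow> ('o, 'a, 'k, nat \<times> 'a \<Rightarrow> 'k) amod"
  where "free_mod A K v R =
    \<lparr>fib = (\<lambda>W. fsupp (free_idx A v R W) (regular_module K)),
     mor = (\<lambda>f. lin_ext (regular_module K) (fsupp UNIV (regular_module K))
       (\<lambda>s. single (regular_module K) (fst s, f \<bullet>\<^bsub>A\<^esub> snd s)))\<rparr>"

text \<open>The map that sends the generator number \<open>i\<close> to \<open>x i\<close>.\<close>

definition free_map ::
    "('k, 'r) ring_scheme \<Rightarrow> ('o, 'a, 'k, 'm) amod \<Rightarrow> (nat \<Rightarrow> 'm) \<Rightarrow> 'o \<Rightarrow> (nat \<times> 'a \<Rightarrow> 'k) \<Rightarrow> 'm"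
  where "free_map K M x W = lin_ext (regular_module K) (fib M W) (\<lambda>s a. a \<odot>\<^bsub>fib M W\<^esub> mor M (snd s) (x (fst s)))"

locale free_module = complemented_cat A X for A :: "('o, 'a) smcat" (structure) and X :: 'o +
  fixes K :: "('k, 'r) ring_scheme"
  assumes cringK: "cring K"
begin

abbreviation "k1 \<equiv> regular_module K"
abbreviation "Fr \<equiv> free_mod A K"

lemma k1: "module K k1" by (rule module_regular[OF cringK])

lemma fib_free: "fib (Fr v R) W = fsupp (free_idx A v R W) k1"
  by (simp add: free_mod_def)

lemma mor_free_linear: "linear_map K (fsupp UNIV k1) (fsupp UNIV k1) (mor (Fr v R) f)"
  unfolding free_mod_def amod.simps
  by (rule linear_map_lin_ext[OF k1 fsupp_module[OF k1]]) (rule linear_map_single[OF k1 UNIV_I])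

lemma mor_free_single:
  assumes "a \<in> carrier k1"
  shows "mor (Fr v R) f (single k1 (i, h) a) = single k1 (i, f \<bullet> h) a"
  unfolding free_mod_def amod.simps
  using lin_ext_single[where \<phi> = "\<lambda>s. single k1 (fst s, f \<bullet> snd s)" and i = "(i, h)",
      OF k1 fsupp_module[OF k1] linear_map_single[OF k1 UNIV_I] assms] by simp

lemma mor_free:
  assumes f: "f \<in> Homs A U V"
  shows "linear_map K (fib (Fr v R) U) (fib (Fr v R) V) (mor (Fr v R) f)"
proof -
  have "mor (Fr v R) f c \<in> carrier (fib (Fr v R) V)" if c: "c \<in> carrier (fib (Fr v R) U)" for c
    unfolding fib_free
  proof (rule linear_map_supports[where f = "mor (Fr v R) f" and c = c,
        OF k1 k1 mor_free_linear subset_UNIV subset_UNIV])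
    fix s a assume s: "s \<in> free_idx A v R U" and a: "a \<in> carrier k1"
    obtain i h where ih: "s = (i, h)" by (cases s)
    then have "(i, f \<bullet> h) \<in> free_idx A v R V" using s Comp_Homs[OF _ f] by (auto simp: free_idx_def)
    then show "mor (Fr v R) f (single k1 s a) \<in> carrier (fsupp (free_idx A v R V) k1)"
      unfolding ih mor_free_single[OF a] by (rule single_closed[OF k1 _ a])
  qed (use c in \<open>simp add: fib_free\<close>)
  moreover have "x \<in> carrier (fsupp UNIV k1)" if "x \<in> carrier (fib (Fr v R) U)" for x
    using that fsupp_mono[OF subset_UNIV] by (auto simp: fib_free)
  ultimately show ?thesis
    using linear_map_add[OF mor_free_linear[of v R f]] linear_map_smult[OF mor_free_linear[of v R f]]
    unfolding linear_map_def by (auto simp: fib_free)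
qed

lemma free_eqI:
  assumes "module K N" "linear_map K (fib (Fr v R) W) N f" "linear_map K (fib (Fr v R) W) N g"
    and "\<And>i h a. i \<in> R \<Longrightarrow> h \<in> Homs A (v i) W \<Longrightarrow> a \<in> carrier k1 \<Longrightarrow>
      f (single k1 (i, h) a) = g (single k1 (i, h) a)"
    and "c \<in> carrier (fib (Fr v R) W)"
  shows "f c = g c"
  by (rule linear_map_eqI[where f = f and g = g and c = c, OF k1 assms(1) assms(2,3)[unfolded fib_free]])
    (use assms(4,5) in \<open>auto simp: free_idx_def fib_free\<close>)

lemma free_A_module: "A_module A K (Fr v R)"
  unfolding A_module_def
proof (intro conjI ballI allI)
  show mod: "module K (fib (Fr v R) V)" for V unfolding fib_free by (rule fsupp_module[OF k1])
  show "linear_map K (fib (Fr v R) (Dom A f)) (fib (Fr v R) (Cod A f)) (mor (Fr v R) f)" if "f \<in> Arr A" for f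
    by (rule mor_free) (use that in \<open>simp add: Homs_def\<close>)
  show "mor (Fr v R) (Id A V) x = x" if V: "V \<in> Ob A" and x: "x \<in> carrier (fib (Fr v R) V)" for V x
    by (rule free_eqI[where f = "mor (Fr v R) (Id A V)" and g = "\<lambda>x. x", OF mod mor_free[OF Id_Homs[OF V]] linear_map_id _ x])
      (use Id_Comp in \<open>simp add: mor_free_single\<close>)
  show "mor (Fr v R) (g \<bullet> f) x = mor (Fr v R) g (mor (Fr v R) f x)"
    if f: "f \<in> Homs A U V" and g: "g \<in> Homs A V W" and x: "x \<in> carrier (fib (Fr v R) U)" for U V W f g x
    by (rule free_eqI[where f = "mor (Fr v R) (g \<bullet> f)" and g = "\<lambda>x. mor (Fr v R) g (mor (Fr v R) f x)",
          OF mod mor_free[OF Comp_Homs[OF f g]] linear_map_comp[OF mor_free[OF f] mor_free[OF g]] _ x])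
      (use Comp_assoc[OF _ f g] in \<open>simp add: mor_free_single\<close>)
qed

lemma free_single: "i \<in> R \<Longrightarrow> h \<in> Homs A (v i) W \<Longrightarrow> a \<in> carrier k1 \<Longrightarrow>
    single k1 (i, h) a \<in> carrier (fib (Fr v R) W)"
  unfolding fib_free by (rule single_closed[OF k1]) (simp_all add: free_idx_def)

lemma generated_submoduleI:
  assumes M: "A_module A K M" and S: "S \<subseteq> (SIGMA V:Ob A. carrier (fib M V))"
    and gen: "\<And>N V. A_submodule A K M N \<Longrightarrow> (\<And>U x. (U, x) \<in> S \<Longrightarrow> x \<in> N U) \<Longrightarrow> V \<in> Ob A \<Longrightarrow>
      carrier (fib M V) \<subseteq> N V"
    and V: "V \<in> Ob A"
  shows "generated_submodule A K M S V = carrier (fib M V)"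
proof
  have "A_submodule A K M (\<lambda>V. carrier (fib M V))"
    unfolding A_submodule_def
  proof (intro conjI ballI)
    show "submodule (carrier (fib M V)) K (fib M V)" if "V \<in> Ob A" for V
      by (rule module.carrier_is_submodule[OF A_moduleD(1)[OF M that]])
    show "mor M f ` carrier (fib M (Dom A f)) \<subseteq> carrier (fib M (Cod A f))" if "f \<in> Arr A" for f
      using linear_map_closed[OF A_moduleD(2)[OF M, of f "Dom A f" "Cod A f"]] that by (auto simp: Homs_def)
  qed
  then show "generated_submodule A K M S V \<subseteq> carrier (fib M V)"
    using S unfolding generated_submodule_def by blast
  show "carrier (fib M V) \<subseteq> generated_submodule A K M S V"
    unfolding generated_submodule_def using gen[OF _ _ V] by blast
qed

lemma free_finitely_generated:
  assumes R: "finite R" and v: "\<And>i. i \<in> R \<Longrightarrow> v i \<in> Ob A"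
  shows "finitely_generated A K (Fr v R)"
proof -
  interpret K: cring K by (rule cringK)
  let ?S = "(\<lambda>i. (v i, single k1 (i, Id A (v i)) \<one>\<^bsub>K\<^esub>)) ` R"
  have one: "\<one>\<^bsub>K\<^esub> \<in> carrier k1" by (simp add: regular_module_def)
  have S: "?S \<subseteq> (SIGMA V:Ob A. carrier (fib (Fr v R) V))"
    using v free_single[OF _ Id_Homs one] by auto
  have "carrier (fib (Fr v R) W) \<subseteq> N W"
    if N: "A_submodule A K (Fr v R) N" and SN: "\<And>U x. (U, x) \<in> ?S \<Longrightarrow> x \<in> N U" and W: "W \<in> Ob A" for N W
  proof -
    interpret m: module K "fib (Fr v R) W" by (rule A_moduleD(1)[OF free_A_module W])
    have sub: "submodule (N W) K (fib (Fr v R) W)" using N W by (auto simp: A_submodule_def)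
    note E = m.submoduleE[OF sub]
    have cell: "single k1 s a \<in> N W" if s: "s \<in> free_idx A v R W" and a: "a \<in> carrier k1" for s a
    proof -
      obtain i h where ih: "s = (i, h)" "i \<in> R" "h \<in> Homs A (v i) W" using s by (auto simp: free_idx_def)
      have "single k1 (i, Id A (v i)) \<one>\<^bsub>K\<^esub> \<in> N (v i)" using SN ih(2) by blast
      then have "mor (Fr v R) h (single k1 (i, Id A (v i)) \<one>\<^bsub>K\<^esub>) \<in> N W"
      proof -
        have "mor (Fr v R) h ` N (Dom A h) \<subseteq> N (Cod A h)"
          using N HomsD(1)[OF ih(3)] unfolding A_submodule_def by blast
        then show ?thesis
          using \<open>single k1 (i, Id A (v i)) \<one>\<^bsub>K\<^esub> \<in> N (v i)\<close> unfolding HomsD(2,3)[OF ih(3)] by blast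
      qed
      then have "single k1 (i, h) \<one>\<^bsub>K\<^esub> \<in> N W"
        unfolding mor_free_single[OF one] Comp_Id[OF ih(3)] .
      then have "a \<odot>\<^bsub>fib (Fr v R) W\<^esub> single k1 (i, h) \<one>\<^bsub>K\<^esub> \<in> N W"
        using E(4) a by (simp add: regular_module_def)
      moreover have "a \<odot>\<^bsub>fib (Fr v R) W\<^esub> single k1 (i, h) \<one>\<^bsub>K\<^esub> = single k1 (i, h) a"
        using a by (auto simp: fib_free single_def regular_module_def)
      ultimately show ?thesis by (simp only: ih)
    qed
    show ?thesis
    proof
      fix c assume "c \<in> carrier (fib (Fr v R) W)"
      then have "c \<in> addspan (fsupp (free_idx A v R W) k1) {single k1 s a |s a. s \<in> free_idx A v R W \<and> a \<in> carrier k1}"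
        unfolding fib_free using fsupp_addspan[OF k1 carrier_addspan[OF k1] subset_refl] by metis
      then show "c \<in> N W"
      proof (induction rule: addspan.induct)
        case addspan_zero
        have "\<zero>\<^bsub>fib (Fr v R) W\<^esub> \<in> N W"
          using sub by (auto simp: submodule_def dest: subgroup.one_closed)
        then show ?case by (simp only: fib_free)
      next
        case (addspan_add x y)
        have "x \<in> N W" using addspan_add.hyps(1) cell by blast
        then show ?case using E(5) addspan_add.IH by (simp only: fib_free)
      qed
    qed
  qed
  then have "generated_submodule A K (Fr v R) ?S V = carrier (fib (Fr v R) V)" if "V \<in> Ob A" for V
    by (rule generated_submoduleI[OF free_A_module S _ that])
  moreover have "finite ?S" using R by simp
  ultimately show ?thesis using S unfolding finitely_generated_def by blast
qed

text \<open>The image is a submodule and contains the generators.\<close>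

lemma free_map_epi:
  assumes M: "A_module A K M"
    and x: "\<And>i. i \<in> R \<Longrightarrow> v i \<in> Ob A \<and> x i \<in> carrier (fib M (v i))"
    and gen: "\<And>V. V \<in> Ob A \<Longrightarrow> generated_submodule A K M ((\<lambda>i. (v i, x i)) ` R) V = carrier (fib M V)"
  shows "amod_epi A K (Fr v R) M (free_map K M x)"
proof -
  interpret K: cring K by (rule cringK)
  have one: "\<one>\<^bsub>K\<^esub> \<in> carrier k1" by (simp add: regular_module_def)
  have clin: "linear_map K k1 (fib M W) (\<lambda>a. a \<odot>\<^bsub>fib M W\<^esub> mor M (snd s) (x (fst s)))"
    if s: "s \<in> free_idx A v R W" and W: "W \<in> Ob A" for s W
  proof (rule linear_map_eval_scale[OF A_moduleD(1)[OF M W]])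
    have "snd s \<in> Homs A (v (fst s)) W" "fst s \<in> R" using s by (auto simp: free_idx_def)
    then show "mor M (snd s) (x (fst s)) \<in> carrier (fib M W)"
      using linear_map_closed[OF A_moduleD(2)[OF M]] x by blast
  qed
  have lin: "linear_map K (fib (Fr v R) W) (fib M W) (free_map K M x W)" if W: "W \<in> Ob A" for W
    unfolding free_map_def fib_free by (rule linear_map_lin_ext[OF k1 A_moduleD(1)[OF M W] clin[OF _ W]])
  have val: "free_map K M x W (single k1 (i, h) a) = a \<odot>\<^bsub>fib M W\<^esub> mor M h (x i)"
    if i: "i \<in> R" and h: "h \<in> Homs A (v i) W" and a: "a \<in> carrier k1" for W i h a
  proof -
    have "(i, h) \<in> free_idx A v R W" using i h by (simp add: free_idx_def)
    note clin[OF this Homs_Ob(2)[OF h]]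
    from lin_ext_single[where \<phi> = "\<lambda>s a. a \<odot>\<^bsub>fib M W\<^esub> mor M (snd s) (x (fst s))" and i = "(i, h)",
        OF k1 A_moduleD(1)[OF M Homs_Ob(2)[OF h]] this a]
    show ?thesis unfolding free_map_def by simp
  qed
  have nat: "free_map K M x W (mor (Fr v R) f c) = mor M f (free_map K M x U c)"
    if f: "f \<in> Homs A U W" and c: "c \<in> carrier (fib (Fr v R) U)" for U W f c
  proof (rule free_eqI[where f = "\<lambda>c. free_map K M x W (mor (Fr v R) f c)" and c = c
        and g = "\<lambda>c. mor M f (free_map K M x U c)"])
    note O = Homs_Ob[OF f]
    show "module K (fib M W)" by (rule A_moduleD(1)[OF M O(2)])
    show "linear_map K (fib (Fr v R) U) (fib M W) (\<lambda>c. free_map K M x W (mor (Fr v R) f c))"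
      by (rule linear_map_comp[OF mor_free[OF f] lin[OF O(2)]])
    show "linear_map K (fib (Fr v R) U) (fib M W) (\<lambda>c. mor M f (free_map K M x U c))"
      by (rule linear_map_comp[OF lin[OF O(1)] A_moduleD(2)[OF M f]])
    fix i h a assume i: "i \<in> R" and h: "h \<in> Homs A (v i) U" and a: "a \<in> carrier k1"
    have xi: "x i \<in> carrier (fib M (v i))" using x[OF i] by blast
    have hx: "mor M h (x i) \<in> carrier (fib M U)" by (rule linear_map_closed[OF A_moduleD(2)[OF M h] xi])
    have a': "a \<in> carrier K" using a by (simp add: regular_module_def)
    show "free_map K M x W (mor (Fr v R) f (single k1 (i, h) a)) =
        mor M f (free_map K M x U (single k1 (i, h) a))"
      unfolding mor_free_single[OF a] val[OF i h a] val[OF i Comp_Homs[OF h f] a]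
        A_moduleD(4)[OF M h f xi] linear_map_smult[OF A_moduleD(2)[OF M f] a' hx] ..
  qed (rule c)
  define N where "N = (\<lambda>V. free_map K M x V ` carrier (fib (Fr v R) V))"
  have "A_submodule A K M N"
    unfolding A_submodule_def
  proof (intro conjI ballI)
    show "submodule (N V) K (fib M V)" if V: "V \<in> Ob A" for V
      unfolding N_def
      by (rule submodule_image[OF A_moduleD(1)[OF free_A_module V] A_moduleD(1)[OF M V] lin[OF V]])
    fix f assume "f \<in> Arr A"
    then have f: "f \<in> Homs A (Dom A f) (Cod A f)" by (simp add: Homs_def)
    show "mor M f ` N (Dom A f) \<subseteq> N (Cod A f)"
    proof
      fix y assume "y \<in> mor M f ` N (Dom A f)"
      then obtain c where c: "c \<in> carrier (fib (Fr v R) (Dom A f))" "y = mor M f (free_map K M x (Dom A f) c)"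
        by (auto simp: N_def)
      then show "y \<in> N (Cod A f)"
        unfolding N_def using nat[OF f c(1)] linear_map_closed[OF mor_free[OF f] c(1)] by force
    qed
  qed
  moreover have "x i \<in> N (v i)" if i: "i \<in> R" for i
  proof -
    have vi: "v i \<in> Ob A" and xi: "x i \<in> carrier (fib M (v i))" using x[OF i] by auto
    interpret m: module K "fib M (v i)" by (rule A_moduleD(1)[OF M vi])
    have "free_map K M x (v i) (single k1 (i, Id A (v i)) \<one>\<^bsub>K\<^esub>) = x i"
      unfolding val[OF i Id_Homs[OF vi] one] A_moduleD(3)[OF M vi xi] by (rule m.smult_one[OF xi])
    then show ?thesis unfolding N_def using free_single[where v = v and R = R, OF i Id_Homs[OF vi] one] by (metis imageI)
  qed
  ultimately have "generated_submodule A K M ((\<lambda>i. (v i, x i)) ` R) V \<subseteq> N V" for V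
    unfolding generated_submodule_def by blast
  then have "carrier (fib M V) \<subseteq> N V" if "V \<in> Ob A" for V using gen[OF that] by blast
  then have "free_map K M x V ` carrier (fib (Fr v R) V) = carrier (fib M V)" if "V \<in> Ob A" for V
    using that linear_map_closed[OF lin[OF that]] unfolding N_def by blast
  then show ?thesis unfolding amod_epi_def using lin nat by blast
qed

lemma finitely_generated_epi:
  assumes M: "A_module A K M" and fg: "finitely_generated A K M"
  shows "\<exists>v x R. finite R \<and> (\<forall>i \<in> R. v i \<in> Ob A) \<and> amod_epi A K (Fr v R) M (free_map K M x)"
proof -
  obtain S where S: "finite S" "S \<subseteq> (SIGMA V:Ob A. carrier (fib M V))"
    "\<And>V. V \<in> Ob A \<Longrightarrow> generated_submodule A K M S V = carrier (fib M V)"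
    using fg unfolding finitely_generated_def by metis
  obtain g where g: "set g = S" using finite_list[OF S(1)] by blast
  let ?v = "\<lambda>i. fst (g ! i)" and ?x = "\<lambda>i. snd (g ! i)" and ?R = "{..<length g}"
  have x: "?v i \<in> Ob A \<and> ?x i \<in> carrier (fib M (?v i))" if "i \<in> ?R" for i
    using subsetD[OF S(2), of "g ! i"] g nth_mem[of i g] that by (cases "g ! i") auto
  have im: "(\<lambda>i. (?v i, ?x i)) ` ?R = S" using g by (auto simp: set_conv_nth)
  have "amod_epi A K (Fr ?v ?R) M (free_map K M ?x)"
    by (rule free_map_epi[OF M x]) (simp_all only: im S(3))
  moreover have "\<forall>i \<in> ?R. ?v i \<in> Ob A" using x by blast
  ultimately show ?thesis by (intro exI[of _ ?v] exI[of _ ?x] exI[of _ ?R] conjI finite_lessThan)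
qed

subsection \<open>Stability for free modules\<close>

lemma const_stab: "rep_map (AutG A (xpow A X n)) K k1 (\<lambda>_ x. x) (AutG A (xpow A X (Suc n))) k1 (\<lambda>_ x. x)
    (stab_hom A X) (\<lambda>x. x)"
proof (intro rep_map.intro rep_map_axioms.intro group_rep.intro AutG_group xpow_Ob k1)
  show "stab_hom A X \<in> hom (AutG A (xpow A X n)) (AutG A (xpow A X (Suc n)))"
    using stab_hom_hom[OF xpow_Ob[of n] X_Ob] by simp
qed (simp_all add: linear_map_id)

text \<open>
  The single generator sits at an object isomorphic to \<open>X\<^sup>m\<close>, and the basis of the module at \<open>X\<^sup>m\<^sup>+\<^sup>l\<close> is
  \<open>Hom(X\<^sup>m, X\<^sup>m\<^sup>+\<^sup>l)\<close> up to composition with that isomorphism.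
\<close>

lemma principal_action:
  assumes u: "u \<in> Homs A (v i) (xpow A X m)" "iso_arr A u"
  shows "transitive_action (AutG A (xpow A X (m + l))) (AutG A (xpow A X l)) K
    (free_idx A v {i} (xpow A X (m + l))) (\<lambda>g s. (fst s, g \<bullet> snd s)) (mor (Fr v {i}))
    (i, base_arr m l \<bullet> u) (conj_arr m l)"
proof (rule transitive_action.intro)
  let ?n = "m + l"
  note b = base_arr[of m l]
  note bu = Comp_Homs[OF u(1) b]
  show "group (AutG A (xpow A X ?n))" "group (AutG A (xpow A X l))" by (rule AutG_group[OF xpow_Ob])+
  show "cring K" by (rule cringK)
  show "(fst s, g \<bullet> snd s) \<in> free_idx A v {i} (xpow A X ?n)"
    if "g \<in> carrier (AutG A (xpow A X ?n))" "s \<in> free_idx A v {i} (xpow A X ?n)" for g s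
    using that Comp_Homs by (auto simp: AutG_carrier free_idx_def)
  show "(fst s, \<one>\<^bsub>AutG A (xpow A X ?n)\<^esub> \<bullet> snd s) = s" if "s \<in> free_idx A v {i} (xpow A X ?n)" for s
    using that Id_Comp by (auto simp: AutG_one free_idx_def)
  show "(fst s, (g \<otimes>\<^bsub>AutG A (xpow A X ?n)\<^esub> h) \<bullet> snd s) =
      (fst (fst s, h \<bullet> snd s), g \<bullet> snd (fst s, h \<bullet> snd s))"
    if "g \<in> carrier (AutG A (xpow A X ?n))" "h \<in> carrier (AutG A (xpow A X ?n))"
      "s \<in> free_idx A v {i} (xpow A X ?n)" for g h s
    using that Comp_assoc by (auto simp: AutG_carrier AutG_mult free_idx_def)
  show "linear_map K (fsupp (free_idx A v {i} (xpow A X ?n)) k1) (fsupp (free_idx A v {i} (xpow A X ?n)) k1)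
      (mor (Fr v {i}) g)" if "g \<in> carrier (AutG A (xpow A X ?n))" for g
    using mor_free[of g "xpow A X ?n" "xpow A X ?n" v "{i}"] that by (simp add: AutG_carrier fib_free)
  show "mor (Fr v {i}) g (single k1 s a) = single k1 (fst s, g \<bullet> snd s) a" if "a \<in> carrier k1" for g s a
    using mor_free_single[OF that, of v "{i}" g "fst s" "snd s"] by simp
  show "(i, base_arr m l \<bullet> u) \<in> free_idx A v {i} (xpow A X ?n)" using bu by (simp add: free_idx_def)
  show "\<exists>g \<in> carrier (AutG A (xpow A X ?n)). (fst (i, base_arr m l \<bullet> u), g \<bullet> snd (i, base_arr m l \<bullet> u)) = s"
    if s: "s \<in> free_idx A v {i} (xpow A X ?n)" for s
  proof -
    have s: "fst s = i" "snd s \<in> Homs A (v i) (xpow A X ?n)" using s by (auto simp: free_idx_def)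
    have "isomorphic_obs A (v i) (xpow A X m)" using u unfolding isomorphic_obs_def by blast
    from transitive_Homs[OF this bu s(2)] show ?thesis using s(1) by (auto simp: prod_eq_iff)
  qed
  show "conj_arr m l \<in> hom (AutG A (xpow A X l)) (AutG A (xpow A X ?n))" by (rule conj_arr_hom)
  show "inj_on (conj_arr m l) (carrier (AutG A (xpow A X l)))" by (rule conj_arr_inj)
  have "g \<bullet> base_arr m l = base_arr m l \<longleftrightarrow> g \<bullet> (base_arr m l \<bullet> u) = base_arr m l \<bullet> u"
    if "g \<in> carrier (AutG A (xpow A X ?n))" for g
  proof -
    have g: "g \<in> Homs A (xpow A X ?n) (xpow A X ?n)" using that by (simp add: AutG_carrier)
    have e: "g \<bullet> (base_arr m l \<bullet> u) = (g \<bullet> base_arr m l) \<bullet> u" using Comp_assoc[OF u(1) b g] by simp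
    show ?thesis unfolding e using iso_right_cancel[OF u Comp_Homs[OF b g] b] by metis
  qed
  then show "conj_arr m l ` carrier (AutG A (xpow A X l)) =
      {g \<in> carrier (AutG A (xpow A X ?n)).
        (fst (i, base_arr m l \<bullet> u), g \<bullet> snd (i, base_arr m l \<bullet> u)) = (i, base_arr m l \<bullet> u)}"
    unfolding conj_arr_image by auto
qed

text \<open>
  The homology isomorphisms of Shapiro's lemma for \<open>l\<close> and \<open>l + 1\<close> are the sides of a commutative
  square, whose top is the stabilization map for constant coefficients and whose bottom is the one for
  the principal module.  Exactness in degree \<open>q\<close> involves the homology in degrees \<open>q\<close> and \<open>q - 1\<close>.
\<close>

lemma principal_stable:
  assumes u: "u \<in> Homs A (v i) (xpow A X m)" "iso_arr A u"
    and l: "module_iso K (H_const A X K q l) (H_const A X K q (l + 1)) (stab_const A X K q l)"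
    and l': "q = 0 \<or> module_iso K (H_const A X K (q - 1) l) (H_const A X K (q - 1) (l + 1)) (stab_const A X K (q - 1) l)"
  shows "stab_exact A X (Fr v {i}) q (m + l)"
proof -
  interpret s: transitive_action "AutG A (xpow A X (m + l))" "AutG A (xpow A X l)" K
    "free_idx A v {i} (xpow A X (m + l))" "\<lambda>g s. (fst s, g \<bullet> snd s)" "mor (Fr v {i})"
    "(i, base_arr m l \<bullet> u)" "conj_arr m l"
    by (rule principal_action[where u = u and v = v and i = i and m = m, OF u])
  interpret s': transitive_action "AutG A (xpow A X (Suc (m + l)))" "AutG A (xpow A X (Suc l))" K
    "free_idx A v {i} (xpow A X (Suc (m + l)))" "\<lambda>g s. (fst s, g \<bullet> snd s)" "mor (Fr v {i})"
    "(i, base_arr m (Suc l) \<bullet> u)" "conj_arr m (Suc l)"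
    by (rule principal_action[where u = u and v = v and i = i and m = m and l = "Suc l", OF u, unfolded add_Suc_right])
  have f: "rep_map (AutG A (xpow A X (m + l))) K (fsupp (free_idx A v {i} (xpow A X (m + l))) k1) (mor (Fr v {i}))
    (AutG A (xpow A X (Suc (m + l)))) (fsupp (free_idx A v {i} (xpow A X (Suc (m + l)))) k1) (mor (Fr v {i}))
    (stab_hom A X) (mor (Fr v {i}) (inl_arr A (xpow A X (m + l)) X))"
    using A_module_stab[OF free_A_module[of v "{i}"], where n = "m + l"] unfolding fib_free .
  interpret q: rep_square "AutG A (xpow A X l)" K k1 "\<lambda>_ x. x" "AutG A (xpow A X (Suc l))" k1 "\<lambda>_ x. x"
    "stab_hom A X" "\<lambda>x. x"
    "AutG A (xpow A X (m + l))" "fsupp (free_idx A v {i} (xpow A X (m + l))) k1" "mor (Fr v {i})"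
    "AutG A (xpow A X (Suc (m + l)))" "fsupp (free_idx A v {i} (xpow A X (Suc (m + l)))) k1" "mor (Fr v {i})"
    "stab_hom A X" "mor (Fr v {i}) (inl_arr A (xpow A X (m + l)) X)"
    "conj_arr m l" "single k1 (i, base_arr m l \<bullet> u)" "conj_arr m (Suc l)" "single k1 (i, base_arr m (Suc l) \<bullet> u)"
  proof (intro rep_square.intro rep_square_axioms.intro const_stab f s.rep_map s'.rep_map)
    show "stab_hom A X (conj_arr m l x) = conj_arr m (Suc l) (stab_hom A X x)"
      if "x \<in> carrier (AutG A (xpow A X l))" for x
      by (rule conj_arr_stab[OF that, symmetric])
    have "inl_arr A (xpow A X (m + l)) X \<bullet> (base_arr m l \<bullet> u) = base_arr m (Suc l) \<bullet> u"
      using Comp_assoc[OF u(1) base_arr inl_arr[OF xpow_Ob X_Ob]] base_arr_Suc by simp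
    then show "mor (Fr v {i}) (inl_arr A (xpow A X (m + l)) X) (single k1 (i, base_arr m l \<bullet> u) a) =
        single k1 (i, base_arr m (Suc l) \<bullet> u) a" if "a \<in> carrier k1" for a
      using mor_free_single[OF that] by simp
  qed
  have c: "q.g.F.hsurj (Suc q) \<and> q.g.F.hinj (Suc q)"
    if "module_iso K (H_const A X K q l) (H_const A X K q (l + 1)) (stab_const A X K q l)" for q
    using that unfolding H_const_def stab_const_def Suc_eq_plus1[symmetric] by (simp only: q.g.module_iso_iff)
  have c': "q.g.F.hinj q"
  proof (cases q)
    case 0
    then show ?thesis using q.g.F.hinj_0 by simp
  next
    case (Suc p)
    then show ?thesis using l' c[of p] by simp
  qed
  have "q.f.F.hsurj (Suc q)"
    by (rule q.Q.hsurj_transport[OF s'.shapiro(1)]) (use c[OF l] in blast)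
  moreover have "q.f.F.hinj q"
    by (rule q.Q.hinj_transport[OF s.shapiro(1) s'.shapiro(2) c'])
  ultimately have "q.f.F.exact q" by (rule q.f.F.exactI)
  then show ?thesis unfolding stab_exact_def Let_def fib_free .
qed

lemma zero_stable: "stab_exact A X (Fr v {}) q n"
proof -
  interpret s: rep_map "AutG A (xpow A X n)" K "fib (Fr v {}) (xpow A X n)" "mor (Fr v {})"
      "AutG A (xpow A X (Suc n))" "fib (Fr v {}) (xpow A X (Suc n))" "mor (Fr v {})"
      "stab_hom A X" "mor (Fr v {}) (inl_arr A (xpow A X n) X)"
    by (rule A_module_stab[OF free_A_module])
  have z: "carrier (fib (Fr v {}) V) = {\<zero>\<^bsub>fib (Fr v {}) V\<^esub>}" if "V \<in> Ob A" for V
  proof -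
    interpret m: module K "fib (Fr v {}) V" by (rule A_moduleD(1)[OF free_A_module that])
    have "c = \<zero>\<^bsub>fib (Fr v {}) V\<^esub>" if "c \<in> carrier (fib (Fr v {}) V)" for c
      using that by (auto simp: fib_free free_idx_def in_fsupp)
    then show ?thesis by auto
  qed
  have "x = \<zero>\<^bsub>s.R.Ch\<^esub>" if "x \<in> s.R.C k" for x k
  proof -
    have "x gs \<in> {\<zero>\<^bsub>fib (Fr v {}) (xpow A X n)\<^esub>}" for gs
      using that unfolding z[OF xpow_Ob, symmetric] by (simp add: s.R.C_def in_fsupp)
    then show ?thesis by (auto simp: s.R.Ch_def fun_eq_iff)
  qed
  moreover have "y = \<zero>\<^bsub>s.R'.Ch\<^esub>" if "y \<in> s.R'.C k" for y k
  proof -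
    have "y gs \<in> {\<zero>\<^bsub>fib (Fr v {}) (xpow A X (Suc n))\<^esub>}" for gs
      using that unfolding z[OF xpow_Ob, symmetric] by (simp add: s.R'.C_def in_fsupp del: xpow.simps)
    then show ?thesis by (auto simp: s.R'.Ch_def fun_eq_iff simp del: xpow.simps)
  qed
  moreover have "s.chmap \<zero>\<^bsub>s.R.Ch\<^esub> \<oplus>\<^bsub>s.R'.Ch\<^esub> s.R'.bd \<zero>\<^bsub>s.R'.Ch\<^esub> = \<zero>\<^bsub>s.R'.Ch\<^esub>"
    by (simp only: s.chmap_zero s.R'.bd_zero s.R'.Ch.r_zero[OF s.R'.Ch.zero_closed])
  ultimately have "s.F.exact q"
    unfolding rel_exact_def using s.R.zero_C s.R'.zero_C s.R.bd_zero by metis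
  then show ?thesis unfolding stab_exact_def Let_def .
qed

lemma free_restriction_epi:
  "amod_epi A K (Fr v (insert i R)) (Fr v {i}) (\<lambda>V c s. if fst s = i then c s else \<zero>\<^bsub>k1\<^esub>)"
proof -
  interpret k1: module K k1 by (rule k1)
  let ?\<pi> = "\<lambda>c s. if fst s = i then c s else \<zero>\<^bsub>k1\<^esub>"
  have lin: "linear_map K (fib (Fr v (insert i R)) V) (fib (Fr v {i}) V) ?\<pi>" for V
  proof -
    have "?\<pi> c \<in> carrier (fib (Fr v {i}) V)" if c: "c \<in> carrier (fib (Fr v (insert i R)) V)" for c
    proof -
      have "finite {s. ?\<pi> c s \<noteq> \<zero>\<^bsub>k1\<^esub>}"
        by (rule finite_subset[of _ "{s. c s \<noteq> \<zero>\<^bsub>k1\<^esub>}"]) (use c in \<open>auto simp: fib_free in_fsupp split: if_splits\<close>)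
      then show ?thesis using c by (auto simp: fib_free in_fsupp free_idx_def)
    qed
    then show ?thesis unfolding linear_map_def by (auto simp: fib_free fun_eq_iff)
  qed
  have val: "?\<pi> (single k1 (j, h) a) = (if j = i then single k1 (j, h) a else (\<lambda>s. \<zero>\<^bsub>k1\<^esub>))" for j and h :: 'a and a
    by (auto simp: single_def fun_eq_iff)
  have surj: "?\<pi> ` carrier (fib (Fr v (insert i R)) V) = carrier (fib (Fr v {i}) V)" for V
  proof
    show "?\<pi> ` carrier (fib (Fr v (insert i R)) V) \<subseteq> carrier (fib (Fr v {i}) V)"
      using linear_map_closed[OF lin] by blast
    show "carrier (fib (Fr v {i}) V) \<subseteq> ?\<pi> ` carrier (fib (Fr v (insert i R)) V)"
    proof
      fix c assume c: "c \<in> carrier (fib (Fr v {i}) V)"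
      have "c s = \<zero>\<^bsub>k1\<^esub>" if "fst s \<noteq> i" for s
        by (rule ccontr) (use c that in \<open>cases s; auto simp: fib_free in_fsupp free_idx_def\<close>)
      then have "?\<pi> c = c" by (intro ext) simp
      moreover have "c \<in> carrier (fib (Fr v (insert i R)) V)"
        using c fsupp_mono[of "free_idx A v {i} V" "free_idx A v (insert i R) V" k1]
        by (auto simp: fib_free free_idx_def)
      ultimately show "c \<in> ?\<pi> ` carrier (fib (Fr v (insert i R)) V)"
        by (intro image_eqI[where x = c]) simp_all
    qed
  qed
  have nat: "?\<pi> (mor (Fr v (insert i R)) f c) = mor (Fr v {i}) f (?\<pi> c)"
    if f: "f \<in> Homs A U V" and c: "c \<in> carrier (fib (Fr v (insert i R)) U)" for U V f c
  proof (rule free_eqI[where f = "\<lambda>c. ?\<pi> (mor (Fr v (insert i R)) f c)" and c = c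
        and g = "\<lambda>c. mor (Fr v {i}) f (?\<pi> c)"])
    note O = Homs_Ob[OF f]
    show "module K (fib (Fr v {i}) V)" by (rule A_moduleD(1)[OF free_A_module O(2)])
    show "linear_map K (fib (Fr v (insert i R)) U) (fib (Fr v {i}) V) (\<lambda>c. ?\<pi> (mor (Fr v (insert i R)) f c))"
      by (rule linear_map_comp[OF mor_free[OF f] lin])
    show "linear_map K (fib (Fr v (insert i R)) U) (fib (Fr v {i}) V) (\<lambda>c. mor (Fr v {i}) f (?\<pi> c))"
      by (rule linear_map_comp[OF lin mor_free[OF f]])
    fix j h a assume a: "a \<in> carrier k1"
    have z: "mor (Fr v {i}) f (\<lambda>s. \<zero>\<^bsub>k1\<^esub>) = (\<lambda>s. \<zero>\<^bsub>k1\<^esub>)"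
      using linear_map_zero[OF fsupp_module[OF k1] fsupp_module[OF k1] mor_free_linear[of v "{i}" f]] by simp
    show "?\<pi> (mor (Fr v (insert i R)) f (single k1 (j, h) a)) = mor (Fr v {i}) f (?\<pi> (single k1 (j, h) a))"
      unfolding mor_free_single[OF a] val using z mor_free_single[OF a] by simp
  qed (rule c)
  show ?thesis unfolding amod_epi_def using lin surj nat by blast
qed

lemma free_restriction_kernel:
  assumes "i \<notin> R"
  shows "restrict_amod (Fr v (insert i R))
    (amod_kernel (Fr v (insert i R)) (Fr v {i}) (\<lambda>V c s. if fst s = i then c s else \<zero>\<^bsub>k1\<^esub>)) = Fr v R"
proof -
  have "amod_kernel (Fr v (insert i R)) (Fr v {i}) (\<lambda>V c s. if fst s = i then c s else \<zero>\<^bsub>k1\<^esub>) V =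
      carrier (fsupp (free_idx A v R V) k1)" for V
  proof -
    have "(\<lambda>s. if fst s = i then c s else \<zero>\<^bsub>k1\<^esub>) = \<zero>\<^bsub>fib (Fr v {i}) V\<^esub> \<longleftrightarrow> (\<forall>h. c (i, h) = \<zero>\<^bsub>k1\<^esub>)"
      for c :: "nat \<times> 'a \<Rightarrow> 'k" by (auto simp: fib_free fun_eq_iff)
    moreover have "(c \<in> carrier (fsupp (free_idx A v (insert i R) V) k1) \<and> (\<forall>h. c (i, h) = \<zero>\<^bsub>k1\<^esub>)) \<longleftrightarrow>
        c \<in> carrier (fsupp (free_idx A v R V) k1)" (is "?l \<longleftrightarrow> ?r") for c :: "nat \<times> 'a \<Rightarrow> 'k"
    proof
      assume r: ?r
      have "c (i, h) = \<zero>\<^bsub>k1\<^esub>" for h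
        by (rule ccontr) (use r assms in \<open>auto simp: in_fsupp free_idx_def\<close>)
      then show ?l using r by (auto simp: in_fsupp free_idx_def)
    next
      assume ?l
      then show ?r by (auto simp: in_fsupp free_idx_def) metis
    qed
    ultimately show ?thesis unfolding amod_kernel_def by (auto simp: fib_free)
  qed
  then show ?thesis by (simp add: restrict_amod_def free_mod_def fsupp_def)
qed

text \<open>The module on \<open>insert i R\<close> maps onto the principal module of \<open>i\<close>, with kernel the module on \<open>R\<close>.\<close>

lemma free_stable:
  assumes h: "\<forall>q. \<forall>\<^sub>F n in sequentially.
      module_iso K (H_const A X K q n) (H_const A X K q (n + 1)) (stab_const A X K q n)"
    and R: "finite R" and v: "\<And>i. i \<in> R \<Longrightarrow> v i \<in> Ob A"
  shows "\<forall>\<^sub>F n in sequentially. stab_exact A X (Fr v R) q n"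
  using R v
proof (induction R rule: finite_induct)
  case empty
  show ?case using zero_stable by simp
next
  case (insert i R)
  have "v i \<in> Ob A" using insert by simp
  then obtain m where "isomorphic_obs A (v i) (xpow A X m)" using ex1_implies_ex[OF generator] by blast
  then obtain u where u: "u \<in> Homs A (v i) (xpow A X m)" "iso_arr A u" unfolding isomorphic_obs_def by blast
  have "\<forall>\<^sub>F l in sequentially. stab_exact A X (Fr v {i}) q (m + l)"
    using spec[OF h, of q] spec[OF h, of "q - 1"]
  proof eventually_elim
    case (elim l)
    then show ?case by (intro principal_stable[where u = u and v = v and i = i and m = m, OF u]) auto
  qed
  then have "\<forall>\<^sub>F n in sequentially. stab_exact A X (Fr v {i}) q n"
    by (subst (asm) add.commute) (rule eventually_sequentially_seg[THEN iffD1])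
  moreover have "\<forall>\<^sub>F n in sequentially. stab_exact A X (Fr v R) q n" using insert by simp
  ultimately show ?case
  proof eventually_elim
    case (elim n)
    show ?case
      by (rule stab_exact_ses(3)[OF free_A_module free_A_module free_restriction_epi])
        (use elim free_restriction_kernel[OF insert(2)] in simp_all)
  qed
qed

text \<open>
  A cover by a free module reduces degree \<open>q\<close> for \<open>M\<close> to degree \<open>q - 1\<close> for the kernel.  The elements of
  the kernel have the type of the elements of a free module, whatever the type of the elements of \<open>M\<close>
  is.  Hence the induction hypothesis is needed for this one type only, and the induction on the degree
  can be carried out there.
\<close>

lemma stable_step:
  fixes M :: "('o, 'a, 'k, 'm) amod"
  assumes noeth: "locally_noetherian A K"
    and h: "\<forall>q. \<forall>\<^sub>F n in sequentially.
      module_iso K (H_const A X K q n) (H_const A X K q (n + 1)) (stab_const A X K q n)"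
    and M: "A_module A K M" and fg: "finitely_generated A K M"
    and IH: "\<And>p (N :: ('o, 'a, 'k, nat \<times> 'a \<Rightarrow> 'k) amod). q = Suc p \<Longrightarrow> A_module A K N \<Longrightarrow>
      finitely_generated A K N \<Longrightarrow> \<forall>\<^sub>F n in sequentially. stab_exact A X N p n"
  shows "\<forall>\<^sub>F n in sequentially. stab_exact A X M q n"
proof -
  obtain v x R where R: "finite R" "\<And>i. i \<in> R \<Longrightarrow> v i \<in> Ob A"
    and \<pi>: "amod_epi A K (Fr v R) M (free_map K M x)"
    using finitely_generated_epi[OF M fg] by blast
  note P = free_A_module[of v R]
  have P': "\<forall>\<^sub>F n in sequentially. stab_exact A X (Fr v R) q n" by (rule free_stable[OF h R])
  show ?thesis
  proof (cases q)
    case 0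
    show ?thesis using P' unfolding 0 by eventually_elim (rule stab_exact_ses(1)[OF P M \<pi>])
  next
    case (Suc p)
    let ?N = "amod_kernel (Fr v R) M (free_map K M x)"
    note sub = amod_kernel_submodule[OF cat_axioms P M \<pi>]
    have "finitely_generated A K (restrict_amod (Fr v R) ?N)"
      by (rule locally_noetherianD[OF cat_axioms noeth P free_finitely_generated[OF R] sub])
    then have "\<forall>\<^sub>F n in sequentially. stab_exact A X (restrict_amod (Fr v R) ?N) p n"
      by (rule IH[OF Suc A_module_restrict[OF P sub cat_axioms]])
    then show ?thesis using P' unfolding Suc
      by eventually_elim (rule stab_exact_ses(2)[OF P M \<pi>])
  qed
qed

lemma stable_free_type:
  fixes M :: "('o, 'a, 'k, nat \<times> 'a \<Rightarrow> 'k) amod"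
  assumes noeth: "locally_noetherian A K"
    and h: "\<forall>q. \<forall>\<^sub>F n in sequentially.
      module_iso K (H_const A X K q n) (H_const A X K q (n + 1)) (stab_const A X K q n)"
    and "A_module A K M" "finitely_generated A K M"
  shows "\<forall>\<^sub>F n in sequentially. stab_exact A X M q n"
  using assms(3,4)
proof (induction q arbitrary: M)
  case 0
  show ?case by (rule stable_step[OF noeth h 0]) simp
next
  case (Suc q)
  show ?case by (rule stable_step[OF noeth h Suc(2,3)]) (use Suc.IH in simp)
qed

end

theorem theorem4p2:
  fixes A :: "('o, 'a) smcat" and X :: 'o
    and K :: "('k, 'r) ring_scheme" and M :: "('o, 'a, 'k, 'm) amod"
  assumes "complemented_cat A X"
    and "cring K"
    and "A_module A K M"
    and "finitely_generated A K M"
    and "locally_noetherian A K"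
    and "\<forall>q. \<forall>\<^sub>F n in sequentially.
      module_iso K (H_const A X K q n) (H_const A X K q (n + 1)) (stab_const A X K q n)"
  shows "\<forall>q. \<forall>\<^sub>F n in sequentially.
      module_iso K (H_twisted A X M q n) (H_twisted A X M q (n + 1)) (stab_twisted A X M q n)"
proof
  fix q
  interpret free_module A X K
    by (intro free_module.intro free_module_axioms.intro assms(1,2))
  have "\<forall>\<^sub>F n in sequentially. stab_exact A X M q n" for q
    by (rule stable_step[OF assms(5,6,3,4)]) (rule stable_free_type[OF assms(5,6)])
  from this[of q] this[of "Suc q"]
  show "\<forall>\<^sub>F n in sequentially.
      module_iso K (H_twisted A X M q n) (H_twisted A X M q (n + 1)) (stab_twisted A X M q n)"
    by eventually_elim (rule stab_exact_module_iso[OF assms(3)])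
qed

end
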